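(* Let $f\colon X\to Y$ be a finite stable holomorphic map between complex manifolds. Then $\mathscr I^2(f)=\mathscr H^2(f)$.
   Context: $n=\dim X$, $p=\dim Y$. For a manifold $Z$, $\mathscr I_{\Delta(Z)}$ is the ideal sheaf of the diagonal in $Z\times Z$. Stability. A multigerm $f\colon(\mathbb C^n,A)\to(\mathbb C^p,0)$ ($A$ finite) is stable if each of its unfoldings $F(s,x)=(s,f_s(x))$, $s\in(\mathbb C^r,0)$, $f_0=f$, is trivial, i.e. $\Psi\circ F\circ\Phi^{-1}=\mathrm{id}\times f$ for some biholomorphic unfoldings $\Phi,\Psi$ of the identities in source and target. A finite map $f\colon X\to Y$ is stable if for every $y\in f(X)$ the multigerm of $f$ at $f^{-1}(y)$ is stable. $\mathscr H^2(f)=(f\times f)^*\mathscr I_{\Delta(Y)}:\mathscr I_{\Delta(X)}$ is the ideal quotient sheaf on $X\times X$, where $(f\times f)^*\mathscr I_{\Delta(Y)}$ is the ideal sheaf generated by pullbacks, and $I:J=\{h\mid hJ\subseteq I\}$. The sheaf $\mathscr I^2(f)$. For a germ $g\colon(\mathbb C^n,0)\to(\mathbb C^p,0)$ there is a $p\times n$ matrix $\alpha(x,x')$ with entries in $\mathcal O_{2n}$ such that $g(x)-g(x')=\alpha(x,x')\,(x-x')$. Set $I^2(g)=\langle g_j(x)-g_j(x')\mid 1\le j\le p\rangle+\langle n\times n\text{ minors of }\alpha\rangle\subseteq\mathcal O_{2n}$; it does not depend on $\alpha$ and is compatible with coordinate changes. $\mathscr I^2(f)$ is the coherent ideal sheaf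 on $X\times X$ which coincides with $(f\times f)^*\mathscr I_{\Delta(Y)}$ off the diagonal and, near a diagonal point $(x,x)$, is generated by representatives of $I^2(f_x)$, where $f_x$ is the germ of $f$ at $x$ in local coordinates. *)

theory Defs
  imports
    "HOL-Analysis.Analysis"
    "HOL-Algebra.Ideal"
    "Jordan_Normal_Form.Determinant"
    "Jordan_Normal_Form.DL_Submatrix"
begin

section \<open>Holomorphic functions on open subsets of complex n-space\<close>

text \<open>
  As for the real \<open>Euclidean_space\<close> of the library, complex n-space consists of the
  sequences that vanish from index n on. Unlike \<open>complex ^ 'n\<close>, this permits the
  dimension to be a bound variable (needed for the parameter spaces of unfoldings)
  and to be 0.
\<close>

definition cvec :: "nat \<Rightarrow> (nat \<Rightarrow> complex) set" where
  "cvec n = {u. \<forall>i\<ge>n. u i = 0}"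

text \<open>Complex (Frechet) differentiability at every point of U; used for U open in \<open>cvec n\<close>.\<close>

definition holo_on :: "nat \<Rightarrow> (nat \<Rightarrow> complex) set \<Rightarrow> ((nat \<Rightarrow> complex) \<Rightarrow> complex) \<Rightarrow> bool" where
  "holo_on n U h \<longleftrightarrow>
     (\<forall>a\<in>U. \<exists>c :: nat \<Rightarrow> complex.
        ((\<lambda>u. norm (h u - h a - (\<Sum>i<n. c i * (u i - a i)))
               / L2_set (\<lambda>i. norm (u i - a i)) {..<n}) \<longlongrightarrow> 0) (at a within U))"

section \<open>Complex manifolds\<close>

record 'a charted =
  mtop :: "'a topology"
  mdim :: nat
  matlas :: "('a set \<times> ('a \<Rightarrow> nat \<Rightarrow> complex)) set"

text \<open>
  All charts have image in \<open>cvec (mdim M)\<close>, so manifolds are pure-dimensional;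
  the atlas need not be maximal.
\<close>

definition complex_manifold :: "'a charted \<Rightarrow> bool" where
  "complex_manifold M \<longleftrightarrow>
     Hausdorff_space (mtop M) \<and> second_countable (mtop M) \<and>
     (\<Union>(U, \<phi>)\<in>matlas M. U) = topspace (mtop M) \<and>
     (\<forall>(U, \<phi>)\<in>matlas M.
        openin (mtop M) U \<and> openin (top_of_set (cvec (mdim M))) (\<phi> ` U) \<and>
        homeomorphic_map (subtopology (mtop M) U) (top_of_set (\<phi> ` U)) \<phi>) \<and>
     (\<forall>(U, \<phi>)\<in>matlas M. \<forall>(V, \<psi>)\<in>matlas M. \<forall>i<mdim M.
        holo_on (mdim M) (\<phi> ` (U \<inter> V)) (\<lambda>u. \<psi> (inv_into U \<phi> u) i))"

definition cspace :: "nat \<Rightarrow> (nat \<Rightarrow> complex) charted" where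
  "cspace n = \<lparr>mtop = top_of_set (cvec n), mdim = n, matlas = {(cvec n, id)}\<rparr>"

definition cconcat :: "nat \<Rightarrow> (nat \<Rightarrow> complex) \<Rightarrow> (nat \<Rightarrow> complex) \<Rightarrow> nat \<Rightarrow> complex" where
  "cconcat m u v = (\<lambda>i. if i < m then u i else v (i - m))"

definition prod_mfd :: "'a charted \<Rightarrow> 'b charted \<Rightarrow> ('a \<times> 'b) charted" (infixr "\<times>\<^sub>M\<^sub>f" 80) where
  "M \<times>\<^sub>M\<^sub>f N =
     \<lparr>mtop = prod_topology (mtop M) (mtop N),
      mdim = mdim M + mdim N,
      matlas = {(U \<times> V, \<lambda>(x, y). cconcat (mdim M) (\<phi> x) (\<psi> y)) | U \<phi> V \<psi>.
                  (U, \<phi>) \<in> matlas M \<and> (V, \<psi>) \<in> matlas N}\<rparr>"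

text \<open>In the following definitions W is an open set; values outside W are irrelevant.\<close>

definition holo_fun :: "'a charted \<Rightarrow> 'a set \<Rightarrow> ('a \<Rightarrow> complex) \<Rightarrow> bool" where
  "holo_fun M W h \<longleftrightarrow>
     (\<forall>(U, \<phi>)\<in>matlas M. holo_on (mdim M) (\<phi> ` (U \<inter> W)) (\<lambda>u. h (inv_into U \<phi> u)))"

definition holo_map :: "'a charted \<Rightarrow> 'b charted \<Rightarrow> 'a set \<Rightarrow> ('a \<Rightarrow> 'b) \<Rightarrow> bool" where
  "holo_map M N W F \<longleftrightarrow>
     continuous_map (subtopology (mtop M) W) (mtop N) F \<and>
     (\<forall>(U, \<phi>)\<in>matlas M. \<forall>(V, \<psi>)\<in>matlas N. \<forall>j<mdim N.
        holo_on (mdim M) (\<phi> ` (U \<inter> W \<inter> F -` V)) (\<lambda>u. \<psi> (F (inv_into U \<phi> u)) j))"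

definition biholo :: "'a charted \<Rightarrow> 'b charted \<Rightarrow> 'a set \<Rightarrow> 'b set \<Rightarrow> ('a \<Rightarrow> 'b) \<Rightarrow> bool" where
  "biholo M N W W' F \<longleftrightarrow>
     openin (mtop M) W \<and> openin (mtop N) W' \<and> bij_betw F W W' \<and>
     holo_map M N W F \<and> holo_map N M W' (inv_into W F)"

definition local_coords :: "'a charted \<Rightarrow> 'a \<Rightarrow> 'a set \<Rightarrow> ('a \<Rightarrow> nat \<Rightarrow> complex) \<Rightarrow> bool" where
  "local_coords M x U \<phi> \<longleftrightarrow>
     x \<in> U \<and> \<phi> x = (\<lambda>_. 0) \<and> biholo M (cspace (mdim M)) U (\<phi> ` U) \<phi>"

definition finite_map :: "'a charted \<Rightarrow> 'b charted \<Rightarrow> ('a \<Rightarrow> 'b) \<Rightarrow> bool" where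
  "finite_map X Y f \<longleftrightarrow>
     proper_map (mtop X) (mtop Y) f \<and>
     (\<forall>y\<in>topspace (mtop Y). finite {x \<in> topspace (mtop X). f x = y})"

section \<open>Stability\<close>

text \<open>
  Multigerms are taken directly on manifolds, at a finite set S of source points with
  common image y; for \<open>X = cspace n\<close>, \<open>Y = cspace p\<close>, y = 0 this is the notion for
  multigerms between complex number spaces. Germs are given by representatives on an
  open neighbourhood W of \<open>{0} \<times> S\<close>.
\<close>

definition unfolding_of ::
  "'a charted \<Rightarrow> 'b charted \<Rightarrow> ('a \<Rightarrow> 'b) \<Rightarrow> 'a set \<Rightarrow> nat \<Rightarrow>
   ((nat \<Rightarrow> complex) \<times> 'a) set \<Rightarrow> ((nat \<Rightarrow> complex) \<times> 'a \<Rightarrow> (nat \<Rightarrow> complex) \<times> 'b) \<Rightarrow> bool" where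
  "unfolding_of X Y f S r W F \<longleftrightarrow>
     openin (mtop (cspace r \<times>\<^sub>M\<^sub>f X)) W \<and> {\<lambda>_. 0} \<times> S \<subseteq> W \<and>
     holo_map (cspace r \<times>\<^sub>M\<^sub>f X) (cspace r \<times>\<^sub>M\<^sub>f Y) W F \<and>
     (\<forall>(s, x)\<in>W. fst (F (s, x)) = s) \<and>
     (\<forall>x. (\<lambda>_. 0, x) \<in> W \<longrightarrow> F (\<lambda>_. 0, x) = (\<lambda>_. 0, f x))"

definition trivial_unfolding ::
  "'a charted \<Rightarrow> 'b charted \<Rightarrow> ('a \<Rightarrow> 'b) \<Rightarrow> 'a set \<Rightarrow> 'b \<Rightarrow> nat \<Rightarrow>
   ((nat \<Rightarrow> complex) \<times> 'a) set \<Rightarrow> ((nat \<Rightarrow> complex) \<times> 'a \<Rightarrow> (nat \<Rightarrow> complex) \<times> 'b) \<Rightarrow> bool" where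
  "trivial_unfolding X Y f S y r W\<^sub>0 F \<longleftrightarrow>
     (\<exists>W W' \<Phi> Q Q' \<Psi>.
        W \<subseteq> W\<^sub>0 \<and> F ` W \<subseteq> Q \<and>
        unfolding_of X X id S r W \<Phi> \<and>
        biholo (cspace r \<times>\<^sub>M\<^sub>f X) (cspace r \<times>\<^sub>M\<^sub>f X) W W' \<Phi> \<and>
        unfolding_of Y Y id {y} r Q \<Psi> \<and>
        biholo (cspace r \<times>\<^sub>M\<^sub>f Y) (cspace r \<times>\<^sub>M\<^sub>f Y) Q Q' \<Psi> \<and>
        (\<forall>z\<in>W'. \<Psi> (F (inv_into W \<Phi> z)) = map_prod id f z))"

definition stable_multigerm ::
  "'a charted \<Rightarrow> 'b charted \<Rightarrow> ('a \<Rightarrow> 'b) \<Rightarrow> 'a set \<Rightarrow> 'b \<Rightarrow> bool" where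
  "stable_multigerm X Y f S y \<longleftrightarrow>
     (\<forall>r W F. unfolding_of X Y f S r W F \<longrightarrow> trivial_unfolding X Y f S y r W F)"

definition stable_map :: "'a charted \<Rightarrow> 'b charted \<Rightarrow> ('a \<Rightarrow> 'b) \<Rightarrow> bool" where
  "stable_map X Y f \<longleftrightarrow>
     (\<forall>y \<in> f ` topspace (mtop X).
        stable_multigerm X Y f {x \<in> topspace (mtop X). f x = y} y)"

section \<open>Ideal sheaves\<close>

text \<open>The ring of sections of the structure sheaf over the open set W.\<close>

definition holo_ring :: "'a charted \<Rightarrow> 'a set \<Rightarrow> ('a \<Rightarrow> complex) ring" where
  "holo_ring M W =
     \<lparr>carrier = {h \<in> extensional W. holo_fun M W h},
      monoid.mult = (\<lambda>g h. \<lambda>z\<in>W. g z * h z),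
      one = (\<lambda>z\<in>W. 1),
      zero = (\<lambda>z\<in>W. 0),
      add = (\<lambda>g h. \<lambda>z\<in>W. g z + h z)\<rparr>"

text \<open>An ideal sheaf is represented by its sections over each open set.\<close>

type_synonym 'a sheaf = "'a set \<Rightarrow> ('a \<Rightarrow> complex) set"

definition generated_sheaf :: "'a charted \<Rightarrow> 'a sheaf \<Rightarrow> 'a sheaf" where
  "generated_sheaf M G W =
     {h \<in> carrier (holo_ring M W).
        \<forall>z\<in>W. \<exists>V. openin (mtop M) V \<and> z \<in> V \<and> V \<subseteq> W \<and>
          restrict h V \<in> Idl\<^bsub>holo_ring M V\<^esub> (G V)}"

definition diagonal_ideal :: "'a charted \<Rightarrow> ('a \<times> 'a) sheaf" where
  "diagonal_ideal Z W =
     {h \<in> carrier (holo_ring (Z \<times>\<^sub>M\<^sub>f Z) W). \<forall>z. (z, z) \<in> W \<longrightarrow> h (z, z) = 0}"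

definition pullback_ideal ::
  "'a charted \<Rightarrow> 'b charted \<Rightarrow> ('a \<Rightarrow> 'b) \<Rightarrow> 'b sheaf \<Rightarrow> 'a sheaf" where
  "pullback_ideal M N F J =
     generated_sheaf M
       (\<lambda>V. {restrict (g \<circ> F) V | g Q. openin (mtop N) Q \<and> F ` V \<subseteq> Q \<and> g \<in> J Q})"

definition ideal_quotient :: "'a charted \<Rightarrow> 'a sheaf \<Rightarrow> 'a sheaf \<Rightarrow> 'a sheaf" where
  "ideal_quotient M I J W =
     {h \<in> carrier (holo_ring M W).
        \<forall>V. openin (mtop M) V \<and> V \<subseteq> W \<longrightarrow> (\<forall>g \<in> J V. (\<lambda>z\<in>V. h z * g z) \<in> I V)}"

definition double_ideal :: "'a charted \<Rightarrow> 'b charted \<Rightarrow> ('a \<Rightarrow> 'b) \<Rightarrow> ('a \<times> 'a) sheaf" where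
  "double_ideal X Y f =
     pullback_ideal (X \<times>\<^sub>M\<^sub>f X) (Y \<times>\<^sub>M\<^sub>f Y) (map_prod f f) (diagonal_ideal Y)"

definition H2_sheaf :: "'a charted \<Rightarrow> 'b charted \<Rightarrow> ('a \<Rightarrow> 'b) \<Rightarrow> ('a \<times> 'a) sheaf" where
  "H2_sheaf X Y f = ideal_quotient (X \<times>\<^sub>M\<^sub>f X) (double_ideal X Y f) (diagonal_ideal X)"

text \<open>
  \<open>difference_matrix n p g D \<alpha>\<close>: on D, an open neighbourhood of (0,0) in
  \<open>cspace n \<times>\<^sub>M\<^sub>f cspace n\<close>, \<open>\<alpha>\<close> is a holomorphic p by n matrix with
  \<open>g x - g x' = \<alpha> (x, x') (x - x')\<close>.
\<close>

definition difference_matrix ::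
  "nat \<Rightarrow> nat \<Rightarrow> ((nat \<Rightarrow> complex) \<Rightarrow> nat \<Rightarrow> complex) \<Rightarrow>
   ((nat \<Rightarrow> complex) \<times> (nat \<Rightarrow> complex)) set \<Rightarrow>
   ((nat \<Rightarrow> complex) \<times> (nat \<Rightarrow> complex) \<Rightarrow> complex mat) \<Rightarrow> bool" where
  "difference_matrix n p g D \<alpha> \<longleftrightarrow>
     openin (mtop (cspace n \<times>\<^sub>M\<^sub>f cspace n)) D \<and> (\<lambda>_. 0, \<lambda>_. 0) \<in> D \<and>
     (\<forall>z\<in>D. \<alpha> z \<in> carrier_mat p n) \<and>
     (\<forall>j<p. \<forall>i<n. holo_fun (cspace n \<times>\<^sub>M\<^sub>f cspace n) D (\<lambda>z. \<alpha> z $$ (j, i))) \<and>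
     (\<forall>(x, x')\<in>D.
        vec p (\<lambda>j. g x j - g x' j) = \<alpha> (x, x') *\<^sub>v vec n (\<lambda>i. x i - x' i))"

text \<open>
  The functions whose germ at (0,0) lies in \<open>I\<^sup>2(g)\<close>, for a germ g at 0. The maximal
  minors are indexed by the sets R of n rows. The neighbourhood D may be arbitrarily
  small, so only the germ of g at 0 matters.
\<close>

definition I2_germ ::
  "nat \<Rightarrow> nat \<Rightarrow> ((nat \<Rightarrow> complex) \<Rightarrow> nat \<Rightarrow> complex) \<Rightarrow>
   ((nat \<Rightarrow> complex) \<times> (nat \<Rightarrow> complex) \<Rightarrow> complex) set" where
  "I2_germ n p g =
     {h. \<exists>D \<alpha>. difference_matrix n p g D \<alpha> \<and>
           restrict h D \<in> Idl\<^bsub>holo_ring (cspace n \<times>\<^sub>M\<^sub>f cspace n) D\<^esub>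
             ({(\<lambda>(x, x')\<in>D. g x j - g x' j) | j. j < p} \<union>
              {(\<lambda>z\<in>D. Determinant.det (submatrix (\<alpha> z) R UNIV)) | R.
                 R \<subseteq> {..<p} \<and> card R = n})}"

text \<open>
  The sheaf \<open>I\<^sup>2(f)\<close> is described by its stalks: a section belongs to it iff its germ lies
  in the stalk of \<open>double_ideal X Y f\<close> at every off-diagonal point, and in \<open>I\<^sup>2(f\<^sub>x)\<close> at
  every diagonal point (x,x), \<open>f\<^sub>x\<close> being the germ of f at x in centred local coordinates.
\<close>

definition I2_sheaf :: "'a charted \<Rightarrow> 'b charted \<Rightarrow> ('a \<Rightarrow> 'b) \<Rightarrow> ('a \<times> 'a) sheaf" where
  "I2_sheaf X Y f W =
     {h \<in> carrier (holo_ring (X \<times>\<^sub>M\<^sub>f X) W).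
        (\<forall>(x, x')\<in>W. x \<noteq> x' \<longrightarrow>
           (\<exists>V. openin (mtop (X \<times>\<^sub>M\<^sub>f X)) V \<and> (x, x') \<in> V \<and> V \<subseteq> W \<and>
              restrict h V \<in> double_ideal X Y f V)) \<and>
        (\<forall>x. (x, x) \<in> W \<longrightarrow>
           (\<exists>U \<phi> V \<psi>. local_coords X x U \<phi> \<and> local_coords Y (f x) V \<psi> \<and>
              h \<circ> map_prod (inv_into U \<phi>) (inv_into U \<phi>)
                \<in> I2_germ (mdim X) (mdim Y) (\<psi> \<circ> f \<circ> inv_into U \<phi>)))}"

end

theory Submission
 imports
  Defs
  "HOL-Complex_Analysis.Complex_Analysis"
begin

text \<open>The parameters run through all p by n matrices, so the entries of T = s + \<alpha>
  become free variables, but the base point moves to T = \<alpha>(0,0), the Jacobian matrix, whose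
  rank is arbitrary. This is why the residual statement is needed at every T and is proved by
  eliminating pivots down to T = 0. There the contracting homotopy divides by the degree in one
  column and the homogeneous pieces are added up; convergence of that sum is not controlled, so it
  is formed among formal series and only the membership of h is brought back to germs. The descent
  rests on a weight of monomials that is multiplicative and injective: a nonzero series has exactly
  one leading exponent of least weight, Dickson's lemma leaves finitely many divisors, and powers of
  the same weight serve as norms for the quotients. Stability concerns the whole fibre while the
  argument looks at one of its points; the unfolding is therefore deformed near that point and
  constant in the parameters near the other ones.\<close>

type_synonym cseq = "nat => complex"
type_synonym ser = "(nat => nat) => complex"

abbreviation (input) opn where "opn M \<equiv> openin (mtop M)"
abbreviation (input) pts where "pts M \<equiv> topspace (mtop M)"
abbreviation (input) nhd where "nhd M \<equiv> nhdsin (mtop M)"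
abbreviation (input) sq where "sq M \<equiv> M \<times>\<^sub>M\<^sub>f M"
abbreviation (input) hid where "hid M V S \<equiv> Idl\<^bsub>holo_ring M V\<^esub> S"
abbreviation (input) hfn where "hfn M V \<equiv> carrier (holo_ring M V)"

text \<open>
 Off the diagonal both sides agree because 1 is a section of the ideal of the diagonal, and
 \<open>I\<^sup>2 \<subseteq> H\<^sup>2\<close> is Cramer's rule. For the converse at a diagonal point, stability is used
 only for the unfolding \<open>F(s, x) = (s, f(x) + s x)\<close> with s an arbitrary p by n matrix. Since F is
 trivial, a germ h of \<open>H\<^sup>2(f)\<close> extends to a germ \<open>H(s, x, x')\<close> with
 \<open>H (x - x')\<close> in the ideal generated by the entries of \<open>(s + \<alpha>(x, x')) (x - x')\<close>. With
 \<open>T = s + \<alpha>\<close> and \<open>v = x - x'\<close> as independent coordinates, this is the colon ideal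
 \<open>\<langle>T v\<rangle> : \<langle>v\<rangle>\<close> of a generic matrix, which is \<open>\<langle>T v\<rangle>\<close> plus the maximal minors of T: at a
 point where T is not 0 one eliminates a pivot; where T = 0 one argues on formal power series by the
 exactness of a Buchsbaum--Rim complex and descends to convergent series by Krull's theorem.
\<close>

section \<open>Neighbourhood filters and germs of holomorphic functions\<close>

text \<open>The neighbourhood filter of a in complex m-space, and (hg below) the germs at a that are
 Frechet holomorphic near a.\<close>

definition nb :: "nat => cseq => cseq filter" where
 "nb m a = inf (nhds a) (principal (cvec m))"

definition pd :: "nat => cseq => real => cseq set" where
 "pd m a r = {z:cvec m. ALL i<m. norm (z i - a i) < r}"

lemma pd_center: "a:cvec m ==> r > 0 ==> a:pd m a r"
 by (simp add: pd_def)

lemma pd_mono: "r <= s ==> pd m a r <= pd m a s"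
 by (auto simp: pd_def)

lemma eventually_nb_open:
 "eventually P (nb m a) \<longleftrightarrow> (EX S. open S & a:S & (ALL z:S \<inter> cvec m. P z))"
 unfolding nb_def eventually_inf_principal eventually_nhds by auto

lemma open_pd_aux: "open {z :: nat => complex. ALL i<m. norm (z i - a i) < r}"
proof -
 have "{z :: nat => complex. ALL i<m. norm (z i - a i) < r} = (\<Inter>i\<in>{..<m}. {z. norm (z i - a i) < r})"
  by auto
 moreover have "open {z :: nat => complex. norm (z i - a i) < r}" for i
  by (intro open_Collect_less continuous_intros continuous_on_product_coordinates)
 ultimately show ?thesis by auto
qed

text \<open>A basic open set of the product topology may restrict coordinates beyond the first m,
  but there both a and the members of \<open>cvec m\<close> vanish, so only the first m radii
  matter.\<close>

lemma eventually_nb: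
 assumes a: "a:cvec m"
 shows "eventually P (nb m a) \<longleftrightarrow> (EX r>0. ALL z:pd m a r. P z)"
proof
 assume "eventually P (nb m a)"
 then obtain S where S: "open S" "a:S" "!!z. z:S ==> z:cvec m ==> P z"
  unfolding eventually_nb_open by blast
 from S(1) have "openin (product_topology (%i::nat. euclidean :: complex topology) UNIV) S"
  by (simp add: open_fun_def)
 from product_topology_open_contains_basis[OF this S(2)] obtain V where
  V: "a:(\<Pi>\<^sub>E i\<in>UNIV. V i)" "!!i. open (V i)" "(\<Pi>\<^sub>E i\<in>UNIV. V i) <= S" by auto
 have "EX e>0. ALL w. norm (w - a i) < e --> w:V i" for i
 proof -
  have "a i:V i" using V(1) by auto
  then show ?thesis using V(2)[of i] by (metis open_dist dist_norm)
 qed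
 then obtain e where e: "!!i. e i > 0" "!!i w. norm (w - a i) < e i ==> w:V i" by metis
 \<comment> \<open>The element 1 keeps the minimum meaningful when m = 0.\<close>
 define r where "r = Min (insert 1 (e ` {..<m}))"
 have r: "r > 0" "!!i. i < m ==> r <= e i"
  unfolding r_def using e(1) by auto
 have "P z" if "z:pd m a r" for z
 proof -
  have "z i:V i" for i
  proof (cases "i < m")
   case True
   then have "norm (z i - a i) < e i" using that r(2)[OF True] by (auto simp: pd_def)
   then show ?thesis by (rule e(2))
  next
   case False
   then have "z i = a i" using a that by (auto simp: pd_def cvec_def)
   then show ?thesis using V(1) by auto
  qed
  then have "z:S" using V(3) by auto
  moreover have "z:cvec m" using that by (simp add: pd_def)
  ultimately show ?thesis by (rule S(3))
 qed
 then show "EX r>0. ALL z:pd m a r. P z" using r(1) by blast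
next
 assume "EX r>0. ALL z:pd m a r. P z"
 then obtain r where "r > 0" "ALL z:pd m a r. P z" by blast
 then show "eventually P (nb m a)"
  unfolding eventually_nb_open
  by (intro exI[of _ "{z. ALL i<m. norm (z i - a i) < r}"]) (auto simp: open_pd_aux pd_def)
qed

lemma openin_pd: "openin (top_of_set (cvec m)) (pd m a r)"
 unfolding openin_open
 by (intro exI[of _ "{z. ALL i<m. norm (z i - a i) < r}"]) (auto simp: open_pd_aux pd_def)

lemma eventually_nb_nb:
 "eventually P (nb m a) ==> eventually (%w. eventually P (nb m w)) (nb m a)"
 unfolding eventually_nb_open by blast

lemma eventually_nb_self:
 "eventually P (nb m a) ==> a:cvec m ==> P a"
 unfolding eventually_nb_open by blast

lemma eventually_nb_cvec: "eventually (%z. z:cvec m) (nb m a)"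
 unfolding eventually_nb_open by blast

lemma eventually_nb_openin:
 assumes "openin (top_of_set (cvec m)) U" "a:U"
 shows "eventually (%z. z:U) (nb m a)"
 using assms unfolding eventually_nb_open openin_open by blast

lemma tendsto_nb_coord: "((%z. z i) \<longlongrightarrow> a i) (nb m a)"
proof -
 have "((%z :: nat => complex. z i) \<longlongrightarrow> a i) (nhds a)"
  using continuous_on_product_coordinates[of i] unfolding continuous_on_def
  by (metis UNIV_I tendsto_at_iff_tendsto_nhds)
 then show ?thesis unfolding nb_def by (rule tendsto_mono[rotated]) simp
qed

lemma filterlim_nb:
 assumes "!!i. i < k ==> ((%z. G z i) \<longlongrightarrow> b i) F" "b:cvec k" "eventually (%z. G z:cvec k) F"
 shows "filterlim G (nb k b) F"
 unfolding filterlim_iff eventually_nb[OF assms(2)]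
proof (intro allI impI, elim exE conjE)
 fix P r assume r: "(0::real) < r" "ALL z:pd k b r. P z"
 have "eventually (%z. ALL i:{..<k}. norm (G z i - b i) < r) F"
  using assms(1) r(1) by (intro eventually_ball_finite) (auto simp: tendsto_iff dist_norm)
 with assms(3) show "eventually (%z. P (G z)) F"
  by eventually_elim (use r in \<open>auto simp: pd_def\<close>)
qed

text \<open>Frechet differentiability at a with gradient c. The sum norm and a product in place of a
  quotient make the chain rule a matter of multiplying estimates, and the point u = a needs no
  exception.\<close>

definition fdc :: "nat => (cseq => complex) => cseq => cseq => bool" where
 "fdc m h a c \<longleftrightarrow> (ALL e>0. eventually (%u. norm (h u - h a - (\<Sum>i<m. c i * (u i - a i)))
   <= e * (\<Sum>i<m. norm (u i - a i))) (nb m a))"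

lemma fdcD: "fdc m h a c ==> e > 0 ==> eventually (%u. norm (h u - h a - (\<Sum>i<m. c i * (u i - a i)))
   <= e * (\<Sum>i<m. norm (u i - a i))) (nb m a)"
 by (simp add: fdc_def)

lemma eventually_within_openin:
 assumes U: "openin (top_of_set (cvec m)) U" "a:U"
 shows "eventually P (at a within U) \<longleftrightarrow> eventually (%z. z ~= a --> P z) (nb m a)"
proof -
 obtain S where S: "open S" "U = cvec m \<inter> S" using U(1) by (auto simp: openin_open)
 show ?thesis unfolding eventually_at_topological eventually_nb_open
 proof safe
  fix T assume T: "open T" "a:T" "ALL x:T. x ~= a --> x:U --> P x"
  then show "EX S. open S & a:S & (ALL z:S \<inter> cvec m. z ~= a --> P z)"
   using S U by (intro exI[of _ "S \<inter> T"]) auto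
 qed (use S in auto)
qed

text \<open>The euclidean norm L and the sum norm S satisfy \<open>L u <= S u <= m * L u\<close>, so
  they define the same notion of small error; positivity of L away from a uses that both points lie
  in \<open>cvec m\<close>.\<close>

lemma holo_on_iff:
 assumes U: "openin (top_of_set (cvec m)) U"
 shows "holo_on m U h \<longleftrightarrow> (ALL a:U. EX c. fdc m h a c)"
proof -
 have "((%u. norm (h u - h a - (\<Sum>i<m. c i * (u i - a i)))
       / L2_set (%i. norm (u i - a i)) {..<m}) \<longlongrightarrow> 0) (at a within U) \<longleftrightarrow> fdc m h a c"
  if a: "a:U" for a c
 proof -
  have acv: "a:cvec m" using a openin_imp_subset[OF U] by blast
  define E where "E u = norm (h u - h a - (\<Sum>i<m. c i * (u i - a i)))" for u
  define L where "L u = L2_set (%i. norm (u i - a i)) {..<m}" for u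
  define S where "S u = (\<Sum>i<m. norm (u i - a i))" for u
  have Lpos: "L u > 0" if ua: "u ~= a" "u:cvec m" for u
  proof -
   obtain i where i: "u i ~= a i" using ua(1) by (auto simp: fun_eq_iff)
   have "i < m"
   proof (rule ccontr)
    assume "~ i < m"
    then have "u i = 0" "a i = 0" using ua(2) acv by (auto simp: cvec_def)
    then show False using i by simp
   qed
   then have "norm (u i - a i) <= L u" unfolding L_def
    by (intro member_le_L2_set) auto
   moreover have "norm (u i - a i) > 0" using i by simp
   ultimately show ?thesis by linarith
  qed
  have LS: "L u <= S u" for u unfolding L_def S_def by (rule L2_set_le_sum) auto
  have SL: "S u <= m * L u" for u
  proof -
   have "S u <= (\<Sum>i<m. L u)" unfolding S_def L_def
    by (intro sum_mono member_le_L2_set) auto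
   then show ?thesis by simp
  qed
  have S0: "S a = 0" "E a = 0" by (auto simp: S_def E_def)
  show ?thesis unfolding fdc_def E_def[symmetric] L_def[symmetric] S_def[symmetric]
  proof (intro iffI allI impI)
   fix e :: real assume lim: "((%u. E u / L u) \<longlongrightarrow> 0) (at a within U)" and e: "e > 0"
   have "eventually (%u. dist (E u / L u) 0 < e) (at a within U)"
    using lim e by (rule tendstoD)
   then have "eventually (%u. u ~= a --> dist (E u / L u) 0 < e) (nb m a)"
    unfolding eventually_within_openin[OF U a] .
   then show "eventually (%u. E u <= e * S u) (nb m a)"
    using eventually_nb_cvec[of m a]
   proof eventually_elim
    case (elim u)
    show ?case
    proof (cases "u = a")
     case False
     then have "L u > 0" using Lpos elim by auto
     moreover have "\<bar>E u / L u\<bar> < e" using elim False by auto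
     ultimately have "E u <= e * L u" by (simp add: field_simps abs_if split: if_splits)
     also have "\<dots> <= e * S u" using e LS by auto
     finally show ?thesis .
    qed (use S0 in auto)
   qed
  next
   assume R: "ALL e>0. eventually (%u. E u <= e * S u) (nb m a)"
   show "((%u. E u / L u) \<longlongrightarrow> 0) (at a within U)"
   proof (rule tendstoI)
    fix e :: real assume e: "e > 0"
    \<comment> \<open>Passing from S to L costs a factor m; the added 1 makes the inequality strict
      and covers m = 0.\<close>
    define d where "d = e / (real m + 1)"
    have d: "d > 0" "d * m < e" unfolding d_def using e by (auto simp: field_simps)
    show "eventually (%u. dist (E u / L u) 0 < e) (at a within U)"
     unfolding eventually_within_openin[OF U a]
     using R[rule_format, OF d(1)] eventually_nb_cvec[of m a]
    proof eventually_elim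
     case (elim u)
     show ?case
     proof
      assume "u ~= a"
      then have L: "L u > 0" using Lpos elim by auto
      have "E u <= d * (m * L u)" using elim SL[of u] d(1)
       by (meson mult_left_mono order.trans less_imp_le)
      then have "E u / L u <= d * m" using L by (simp add: field_simps)
      moreover have "E u >= 0" by (simp add: E_def)
      ultimately show "dist (E u / L u) 0 < e" using d(2) L by simp
     qed
    qed
   qed
  qed
 qed
 then show ?thesis unfolding holo_on_def by blast
qed

lemma fdc_lipschitz:
 assumes "fdc m h a c"
 shows "EX C>0. eventually (%u. norm (h u - h a) <= C * (\<Sum>i<m. norm (u i - a i))) (nb m a)"
proof (intro exI conjI)
 show "1 + (\<Sum>i<m. norm (c i)) > 0" by (intro add_pos_nonneg sum_nonneg) auto
 show "eventually (%u. norm (h u - h a) <= (1 + (\<Sum>i<m. norm (c i))) * (\<Sum>i<m. norm (u i - a i))) (nb m a)"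
  using fdcD[OF assms, of 1, simplified]
 proof eventually_elim
  case (elim u)
  have "norm (\<Sum>i<m. c i * (u i - a i)) <= (\<Sum>i<m. norm (c i) * norm (u i - a i))"
   by (rule order.trans[OF norm_sum]) (auto simp: norm_mult)
  also have "\<dots> <= (\<Sum>i<m. norm (c i) * (\<Sum>i<m. norm (u i - a i)))"
   by (intro sum_mono mult_left_mono member_le_sum) auto
  finally have 1: "norm (\<Sum>i<m. c i * (u i - a i)) <= (\<Sum>i<m. norm (c i)) * (\<Sum>i<m. norm (u i - a i))"
   by (simp add: sum_distrib_right)
  have "norm (h u - h a) <= norm (h u - h a - (\<Sum>i<m. c i * (u i - a i))) + norm (\<Sum>i<m. c i * (u i - a i))"
   by (metis diff_add_cancel norm_triangle_ineq)
  then show ?case using elim 1 by (simp add: algebra_simps)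
 qed
qed

lemma fdc_tendsto:
 assumes "fdc m h a c"
 shows "(h \<longlongrightarrow> h a) (nb m a)"
proof -
 obtain C where C: "eventually (%u. norm (h u - h a) <= C * (\<Sum>i<m. norm (u i - a i))) (nb m a)"
  using fdc_lipschitz[OF assms] by blast
 have "((%u. C * (\<Sum>i<m. norm (u i - a i))) \<longlongrightarrow> C * (\<Sum>i<m. norm (a i - a i))) (nb m a)"
  by (intro tendsto_intros tendsto_nb_coord)
 then have "((%u. h u - h a) \<longlongrightarrow> 0) (nb m a)"
  by (intro Lim_null_comparison[OF C]) simp
 then show ?thesis using Lim_null by blast
qed

lemma fdc_compose:
 assumes h: "fdc k h (G a) c" and G: "!!i. i < k ==> fdc m (%z. G z i) a (d i)"
  and Ga: "G a:cvec k" "eventually (%z. G z:cvec k) (nb m a)"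
 shows "fdc m (%z. h (G z)) a (%j. \<Sum>i<k. c i * d i j)"
 unfolding fdc_def
proof (intro allI impI)
 fix e :: real assume e: "e > 0"
 define S where "S u = (\<Sum>i<m. norm (u i - a i))" for u
 have S0: "S u >= 0" for u unfolding S_def by (intro sum_nonneg) auto
 have "ALL i:{..<k}. EX C>0. eventually (%u. norm (G u i - G a i) <= C * S u) (nb m a)"
  unfolding S_def using G fdc_lipschitz by blast
 then obtain C where C: "!!i. i < k ==> C i > 0"
  "!!i. i < k ==> eventually (%u. norm (G u i - G a i) <= C i * S u) (nb m a)"
  unfolding bchoice_iff by (metis lessThan_iff)
 \<comment> \<open>The added 1 keeps the constant positive when k = 0; the same holds for N below.
   The error e is split evenly between the outer function and the inner map.\<close>
 define CC where "CC = 1 + (\<Sum>i<k. C i)"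
 have CC: "CC > 0" unfolding CC_def using C(1) by (intro add_pos_nonneg sum_nonneg) (auto intro: less_imp_le)
 define N where "N = 1 + (\<Sum>i<k. norm (c i))"
 have N: "N > 0" unfolding N_def by (intro add_pos_nonneg sum_nonneg) auto
 have lim: "filterlim G (nb k (G a)) (nb m a)"
  using G by (intro filterlim_nb fdc_tendsto Ga) auto
 have e1: "eventually (%u. norm (h (G u) - h (G a) - (\<Sum>i<k. c i * (G u i - G a i)))
   <= e / (2 * CC) * (\<Sum>i<k. norm (G u i - G a i))) (nb m a)"
  using fdcD[OF h, of "e / (2 * CC)"] e CC lim by (auto simp: filterlim_iff)
 have e2: "eventually (%u. ALL i:{..<k}. norm (G u i - G a i) <= C i * S u) (nb m a)"
  using C(2) by (intro eventually_ball_finite) auto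
 have e3: "eventually (%u. ALL i:{..<k}. norm (G u i - G a i - (\<Sum>j<m. d i j * (u j - a j))) <= e / (2 * N) * S u) (nb m a)"
  unfolding S_def using fdcD[OF G, of _ "e / (2 * N)"] e N by (intro eventually_ball_finite) auto
 show "eventually (%u. norm (h (G u) - h (G a) - (\<Sum>j<m. (\<Sum>i<k. c i * d i j) * (u j - a j)))
   <= e * (\<Sum>i<m. norm (u i - a i))) (nb m a)"
  using e1 e2 e3 unfolding S_def[symmetric]
 proof eventually_elim
  case (elim u)
  have "(\<Sum>i<k. norm (G u i - G a i)) <= (\<Sum>i<k. C i * S u)" using elim by (intro sum_mono) auto
  also have "\<dots> = (\<Sum>i<k. C i) * S u" by (simp add: sum_distrib_right)
  also have "\<dots> <= CC * S u" using S0 unfolding CC_def by (intro mult_right_mono) auto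
  finally have "norm (h (G u) - h (G a) - (\<Sum>i<k. c i * (G u i - G a i))) <= e / (2 * CC) * (CC * S u)"
   using elim(1) e CC by (meson divide_nonneg_pos less_imp_le mult_left_mono mult_pos_pos order.trans zero_less_numeral)
  then have 1: "norm (h (G u) - h (G a) - (\<Sum>i<k. c i * (G u i - G a i))) <= e / 2 * S u"
   using CC by simp
  have "norm (\<Sum>i<k. c i * (G u i - G a i - (\<Sum>j<m. d i j * (u j - a j))))
    <= (\<Sum>i<k. norm (c i) * (e / (2 * N) * S u))"
  proof (rule order.trans[OF norm_sum], rule sum_mono)
   fix i assume "i:{..<k}"
   then show "norm (c i * (G u i - G a i - (\<Sum>j<m. d i j * (u j - a j)))) <= norm (c i) * (e / (2 * N) * S u)"
    unfolding norm_mult using elim by (intro mult_left_mono) auto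
  qed
  also have "\<dots> <= N * (e / (2 * N) * S u)" unfolding N_def sum_distrib_right[symmetric]
   using e N S0[of u] by (intro mult_right_mono) (auto simp: N_def)
  finally have 2: "norm (\<Sum>i<k. c i * (G u i - G a i - (\<Sum>j<m. d i j * (u j - a j)))) <= e / 2 * S u"
   using N by simp
  have "(\<Sum>j<m. (\<Sum>i<k. c i * d i j) * (u j - a j)) = (\<Sum>i<k. c i * (\<Sum>j<m. d i j * (u j - a j)))"
   unfolding sum_distrib_left sum_distrib_right by (subst sum.swap) (simp add: mult.assoc)
  then have "h (G u) - h (G a) - (\<Sum>j<m. (\<Sum>i<k. c i * d i j) * (u j - a j))
   = (h (G u) - h (G a) - (\<Sum>i<k. c i * (G u i - G a i))) + (\<Sum>i<k. c i * (G u i - G a i - (\<Sum>j<m. d i j * (u j - a j))))"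
   by (simp add: right_diff_distrib sum_subtractf)
  moreover have "e / 2 * S u + e / 2 * S u = e * S u" by simp
  ultimately show ?case using norm_triangle_mono[OF 1 2] by metis
 qed
qed

lemma fdc_exact:
 assumes "!!u. u:cvec m ==> h u - h a = (\<Sum>i<m. c i * (u i - a i))"
 shows "fdc m h a c"
 unfolding fdc_def
proof (intro allI impI)
 fix e :: real assume "e > 0"
 show "eventually (%u. norm (h u - h a - (\<Sum>i<m. c i * (u i - a i))) <= e * (\<Sum>i<m. norm (u i - a i))) (nb m a)"
  using eventually_nb_cvec[of m a]
  by eventually_elim (use \<open>e > 0\<close> assms in \<open>auto intro!: mult_nonneg_nonneg sum_nonneg\<close>)
qed

lemma fdc_const: "fdc m (%_. k) a (%_. 0)"
 by (rule fdc_exact) simp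

lemma fdc_coord: "i < m ==> fdc m (%z. z i) a (%j. if j = i then 1 else 0)"
 by (rule fdc_exact) (simp add: if_distrib[of "%x. x * _"] sum.delta cong: if_cong)

lemma fdc_plus2: "fdc 2 (%z. z 0 + z 1) a (%_. 1)"
 by (rule fdc_exact) (simp add: numeral_2_eq_2)

lemma fdc_times2: "fdc 2 (%z. z 0 * z 1) a (%i. if i = 0 then a 1 else a 0)"
 unfolding fdc_def
proof (intro allI impI)
 fix e :: real assume "e > 0"
 then have "eventually (%u. norm (u 0 - a 0) < e) (nb 2 a)"
  using tendstoD[OF tendsto_nb_coord[of 0 a 2]] by (simp add: dist_norm)
 then show "eventually (%u. norm (u 0 * u 1 - a 0 * a 1 - (\<Sum>i<2. (if i = 0 then a 1 else a 0) * (u i - a i)))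
   <= e * (\<Sum>i<2. norm (u i - a i))) (nb 2 a)"
 proof eventually_elim
  case (elim u)
  have "u 0 * u 1 - a 0 * a 1 - (\<Sum>i<2. (if i = 0 then a 1 else a 0) * (u i - a i)) = (u 0 - a 0) * (u 1 - a 1)"
   by (simp add: numeral_2_eq_2 algebra_simps)
  then have "norm (u 0 * u 1 - a 0 * a 1 - (\<Sum>i<2. (if i = 0 then a 1 else a 0) * (u i - a i))) = norm (u 0 - a 0) * norm (u 1 - a 1)"
   by (simp add: norm_mult)
  also have "\<dots> <= e * norm (u 1 - a 1)" using elim by (intro mult_right_mono) auto
  also have "\<dots> <= e * (\<Sum>i<2. norm (u i - a i))" using \<open>e > 0\<close>
   by (intro mult_left_mono) (auto simp: numeral_2_eq_2)
  finally show ?case .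
 qed
qed

lemma fdc_field:
 assumes "(f has_field_derivative d) (at (a 0))"
 shows "fdc 1 (%z. f (z 0)) a (%_. d)"
 unfolding fdc_def
proof (intro allI impI)
 fix e :: real assume e: "e > 0"
 have "(f has_derivative (*) d) (at (a 0))" using assms by (simp add: has_field_derivative_def)
 then obtain r where r: "r > 0" "!!y. norm (y - a 0) < r ==> norm (f y - f (a 0) - d * (y - a 0)) <= e * norm (y - a 0)"
  unfolding has_derivative_at_alt using e by blast
 have "eventually (%u. norm (u 0 - a 0) < r) (nb 1 a)"
  using tendstoD[OF tendsto_nb_coord[of 0 a 1] r(1)] by (simp add: dist_norm)
 then show "eventually (%u. norm (f (u 0) - f (a 0) - (\<Sum>i<1. d * (u i - a i))) <= e * (\<Sum>i<1. norm (u i - a i))) (nb 1 a)"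
  by eventually_elim (use r in auto)
qed

text \<open>Algebraic operations are treated as compositions with a map to the plane, so that only
  addition and multiplication of two coordinates have to be differentiated by hand.\<close>

lemma fdc_compose2:
 assumes h: "!!b. EX c. fdc 2 (%z. h (z 0) (z 1)) b c" and "fdc m f a c" "fdc m g a d"
 shows "EX e. fdc m (%z. h (f z) (g z)) a e"
proof -
 define G where "G z = (%i::nat. if i = 0 then f z else if i = 1 then g z else 0)" for z
 have G: "G z 0 = f z" "G z 1 = g z" for z by (simp_all add: G_def)
 have cv: "G z:cvec 2" for z by (simp add: G_def cvec_def)
 obtain e where e: "fdc 2 (%z. h (z 0) (z 1)) (G a) e" using h by blast
 have "fdc m (%z. G z i) a ((%i. if i = 0 then c else d) i)" if "i < 2" for i
 proof (cases "i = 0")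
  case True
  then show ?thesis using assms(2) G(1) by simp
 next
  case False
  then have "i = 1" using that by simp
  then show ?thesis using assms(3) G(2) by simp
 qed
 from fdc_compose[where h = "%z. h (z 0) (z 1)" and G = G, OF e this cv always_eventually] show ?thesis
  unfolding G using cv by blast
qed

lemma fdc_add: "fdc m f a c ==> fdc m g a d ==> EX e. fdc m (%z. f z + g z) a e"
 by (rule fdc_compose2[where h = "(+)"]) (rule exI, rule fdc_plus2)

lemma fdc_mult: "fdc m f a c ==> fdc m g a d ==> EX e. fdc m (%z. f z * g z) a e"
 by (rule fdc_compose2[where h = "(*)"]) (rule exI, rule fdc_times2)

lemma fdc_field_compose:
 assumes "fdc m g a c" "(f has_field_derivative d) (at (g a))"
 shows "EX e. fdc m (%z. f (g z)) a e"
proof -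
 define G where "G z = (%i::nat. if i = 0 then g z else 0)" for z
 have G: "G z 0 = g z" for z by (simp add: G_def)
 have cv: "G z:cvec 1" for z by (simp add: G_def cvec_def)
 have e: "fdc 1 (%z. f (z 0)) (G a) (%_. d)" using assms(2) G by (intro fdc_field) simp
 have "fdc m (%z. G z i) a ((%i. c) i)" if "i < 1" for i
  using that assms(1) G by simp
 from fdc_compose[where h = "%z. f (z 0)" and G = G, OF e this cv always_eventually] show ?thesis
  unfolding G using cv by blast
qed

definition hg :: "nat => cseq => (cseq => complex) => bool" where
 "hg m a h \<longleftrightarrow> eventually (%w. EX c. fdc m h w c) (nb m a)"

lemma fdc_cong:
 assumes "eventually (%z. f z = g z) (nb m a)" "f a = g a"
 shows "fdc m f a c \<longleftrightarrow> fdc m g a c"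
 unfolding fdc_def
 by (intro all_cong1 imp_cong refl eventually_cong assms(1)[THEN eventually_mono]) (use assms in auto)

lemma hg_cong:
 assumes "eventually (%z. f z = g z) (nb m a)" "hg m a f"
 shows "hg m a g"
 unfolding hg_def
 using eventually_nb_nb[OF assms(1)] assms(1) assms(2)[unfolded hg_def]
 by eventually_elim (use fdc_cong in blast)

lemma hg_self: "hg m a h ==> a:cvec m ==> EX c. fdc m h a c"
 unfolding hg_def by (drule eventually_nb_self) auto

lemma hg_tendsto: "hg m a h ==> a:cvec m ==> (h \<longlongrightarrow> h a) (nb m a)"
 using hg_self fdc_tendsto by blast

lemma hg_eventually: "hg m a h ==> eventually (%w. hg m w h) (nb m a)"
 unfolding hg_def by (rule eventually_nb_nb)

lemma hg_const: "hg m a (%_. k)"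
 unfolding hg_def by (rule always_eventually) (blast intro: fdc_const)

lemma hg_coord: "i < m ==> hg m a (%z. z i)"
 unfolding hg_def by (rule always_eventually) (blast intro: fdc_coord)

lemma hg_add: "hg m a f ==> hg m a g ==> hg m a (%z. f z + g z)"
 unfolding hg_def by (erule (1) eventually_elim2) (elim exE, erule (1) fdc_add)

lemma hg_mult: "hg m a f ==> hg m a g ==> hg m a (%z. f z * g z)"
 unfolding hg_def by (erule (1) eventually_elim2) (elim exE, erule (1) fdc_mult)

lemma hg_uminus: "hg m a f ==> hg m a (%z. - f z)"
 using hg_mult[OF hg_const[of m a "-1"], of f] by simp

lemma hg_diff: "hg m a f ==> hg m a g ==> hg m a (%z. f z - g z)"
 using hg_add[of m a f "%z. - g z"] hg_uminus[of m a g] by simp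

lemma hg_sum: "(!!i. i:I ==> hg m a (f i)) ==> hg m a (%z. \<Sum>i\<in>I. f i z)"
 by (induction I rule: infinite_finite_induct) (simp_all add: hg_const hg_add)

lemma hg_prod: "(!!i. i:I ==> hg m a (f i)) ==> hg m a (%z. \<Prod>i\<in>I. f i z)"
 by (induction I rule: infinite_finite_induct) (simp_all add: hg_const hg_mult)

lemma hg_inverse:
 assumes "hg m a f" "f a ~= 0" "a:cvec m"
 shows "hg m a (%z. inverse (f z))"
proof -
 have "eventually (%z. f z ~= 0) (nb m a)"
  using hg_tendsto[OF assms(1,3)] assms(2) by (rule tendsto_imp_eventually_ne)
 then show ?thesis using assms(1) unfolding hg_def
  by eventually_elim (elim exE, rule fdc_field_compose, assumption, erule DERIV_inverse)
qed

lemma hg_divide: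
 "hg m a f ==> hg m a g ==> g a ~= 0 ==> a:cvec m ==> hg m a (%z. f z / g z)"
 unfolding divide_inverse by (intro hg_mult hg_inverse)

lemma hg_filterlim:
 assumes "!!i. i < k ==> hg m a (%z. G z i)"
  and "eventually (%z. G z:cvec k) (nb m a)" and a: "a:cvec m"
 shows "filterlim G (nb k (G a)) (nb m a)"
 using assms eventually_nb_self[OF assms(2) a]
 by (intro filterlim_nb hg_tendsto) auto

lemma hg_compose:
 assumes h: "hg k (G a) h" and G: "!!i. i < k ==> hg m a (%z. G z i)"
  and Ga: "eventually (%z. G z:cvec k) (nb m a)" and a: "a:cvec m"
 shows "hg m a (%z. h (G z))"
proof -
 have lim: "filterlim G (nb k (G a)) (nb m a)"
  by (rule hg_filterlim[OF G Ga a])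
 have "eventually (%w. EX c. fdc k h (G w) c) (nb m a)"
  using h lim unfolding hg_def filterlim_iff by blast
 moreover have "eventually (%w. ALL i:{..<k}. EX c. fdc m (%z. G z i) w c) (nb m a)"
  using G unfolding hg_def by (intro eventually_ball_finite) auto
 ultimately show ?thesis unfolding hg_def using Ga eventually_nb_nb[OF Ga]
 proof eventually_elim
  case (elim w)
  then obtain c d where "fdc k h (G w) c" "!!i. i < k ==> fdc m (%z. G z i) w (d i)"
   unfolding bchoice_iff by auto
  then show ?case using fdc_compose elim by blast
 qed
qed

lemma hg_compose_eventually:
 assumes "eventually P (nb k (G a))" and G: "!!i. i < k ==> hg m a (%z. G z i)"
  and Ga: "eventually (%z. G z:cvec k) (nb m a)" and a: "a:cvec m"
 shows "eventually (%z. P (G z)) (nb m a)"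
 using hg_filterlim[OF G Ga a] assms(1) unfolding filterlim_iff by blast

lemma hg_holo_on:
 assumes "a:cvec m"
 shows "hg m a h \<longleftrightarrow> (EX U. openin (top_of_set (cvec m)) U & a:U & holo_on m U h)"
proof
 assume "hg m a h"
 then obtain r where "r > 0" "ALL z:pd m a r. EX c. fdc m h z c"
  unfolding hg_def eventually_nb[OF assms] by blast
 then show "EX U. openin (top_of_set (cvec m)) U & a:U & holo_on m U h"
  by (intro exI[of _ "pd m a r"] conjI openin_pd pd_center assms)
   (auto simp: holo_on_iff[OF openin_pd[of m a r]])
next
 assume "EX U. openin (top_of_set (cvec m)) U & a:U & holo_on m U h"
 then obtain U where U: "openin (top_of_set (cvec m)) U" "a:U" "holo_on m U h" by blast
 have "ALL w:U. EX c. fdc m h w c" using U holo_on_iff by blast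
 then show "hg m a h" unfolding hg_def
  using eventually_nb_openin[OF U(1,2)] by (auto elim: eventually_mono)
qed

lemma holo_on_iff_hg:
 assumes "openin (top_of_set (cvec m)) U"
 shows "holo_on m U h \<longleftrightarrow> (ALL a:U. hg m a h)"
proof -
 have sub: "U <= cvec m" by (rule openin_imp_subset[OF assms])
 show ?thesis
 proof
  assume "holo_on m U h"
  then show "ALL a:U. hg m a h" using hg_holo_on assms sub by blast
 next
  assume "ALL a:U. hg m a h"
  then show "holo_on m U h" using hg_self holo_on_iff[OF assms] sub by blast
 qed
qed

section \<open>Taylor expansion in several variables\<close>

definition mis :: "nat => (nat => nat) set" where
 "mis m = {mu. ALL i>=m. mu i = 0}"

definition tdeg :: "nat => (nat => nat) => nat" where
 "tdeg m mu = (\<Sum>i<m. mu i)"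

definition mon :: "nat => cseq => (nat => nat) => complex" where
 "mon m z mu = (\<Prod>i<m. z i ^ mu i)"

text \<open>Continuous and separately holomorphic on a polydisc: the form in which Taylor expansion is
 proved by induction on the number of variables.\<close>

definition cs :: "nat => cseq => real => (cseq => complex) => bool" where
 "cs m a r h \<longleftrightarrow> continuous_on (pd m a r) h &
  (ALL z:pd m a r. ALL i<m. (%ze. h (z(i := ze))) holomorphic_on ball (a i) r)"

lemma pd_upd: "z:pd m a r ==> i < m ==> ze:ball (a i) r ==> z(i := ze):pd m a r"
 by (auto simp: pd_def cvec_def dist_norm norm_minus_commute)

lemma pd_coord: "z:pd m a r ==> i < m ==> z i:ball (a i) r"
 by (auto simp: pd_def dist_norm norm_minus_commute)

lemma continuous_on_upd:
 fixes z :: "'b :: topological_space => nat => complex"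
 assumes "continuous_on S z" "continuous_on S w"
 shows "continuous_on S (%x. (z x)(i := w x))"
proof (rule continuous_on_coordinatewise_then_product)
 fix j
 have "continuous_on S (%x. z x j)"
  by (rule continuous_on_product_then_coordinatewise[OF assms(1)])
 then show "continuous_on S (%x. ((z x)(i := w x)) j)"
  using assms(2) by (cases "j = i") auto
qed

text \<open>Compactness of C turns joint continuity into uniformity along a slice. It lets
  one-variable tools, Cauchy's inequality and uniform limits, be used while the other variables
  move.\<close>

lemma cs_slice_uniform:
 assumes h: "continuous_on (pd m a r) h" and z0: "z0:pd m a r" and k: "k < m"
  and C: "compact C" "C <= ball (a k) r" and e: "e > 0"
 shows "EX X. open X & z0:X & (ALL z:X \<inter> pd m a r. ALL ze:C. norm (h (z(k := ze)) - h (z0(k := ze))) <= e)"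
proof -
 have "continuous_on (pd m a r \<times> C) (%x. (fst x)(k := snd x))"
  by (intro continuous_on_upd continuous_intros)
 then have "continuous_on (pd m a r \<times> C) (%x. h ((fst x)(k := snd x)))"
  by (rule continuous_on_compose2[OF h]) (use pd_upd k C in auto)
 from continuous_on_prod_compactE[OF this C(1) z0 e] show ?thesis
  unfolding dist_norm by (metis fst_conv snd_conv)
qed

definition pderiv_at :: "nat => (cseq => complex) => cseq => complex" where
 "pderiv_at k h z = deriv (%ze. h (z(k := ze))) (z k)"

text \<open>Cauchy's inequality for the difference of the two functions: uniformly close functions
  have close derivatives.\<close>

lemma deriv_close:
 assumes "f holomorphic_on S" "g holomorphic_on S" "open S" "cball w d <= S" "d > 0"
  and "!!ze. ze:cball w d ==> norm (f ze - g ze) <= e"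
 shows "norm (deriv f w - deriv g w) <= e / d"
proof -
 have hol: "(%ze. f ze - g ze) holomorphic_on S" using assms by (intro holomorphic_intros)
 have wS: "w:S" using assms(4,5) by auto
 have "deriv (%ze. f ze - g ze) w = deriv f w - deriv g w"
  by (rule deriv_diff) (use assms wS holomorphic_on_imp_differentiable_at in blast)+
 moreover have "norm ((deriv ^^ 1) (%ze. f ze - g ze) w) <= fact 1 * e / d ^ 1"
 proof (rule Cauchy_inequality)
  show "(%ze. f ze - g ze) holomorphic_on ball w d"
   using hol assms(4) ball_subset_cball by (metis holomorphic_on_subset order.trans)
  show "continuous_on (cball w d) (%ze. f ze - g ze)"
   using hol assms(4) holomorphic_on_imp_continuous_on continuous_on_subset by blast
  show "norm (f x - g x) <= e" if "norm (w - x) = d" for x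
   using that by (intro assms(6)) (auto simp: dist_norm)
 qed (use assms in auto)
 ultimately show ?thesis by simp
qed

text \<open>Continuity follows from Cauchy's inequality on a disc of fixed radius around the moving
  point. Holomorphy in another variable follows because the derivative is a uniform limit, on
  compact discs, of difference quotients that are holomorphic in that variable.\<close>

lemma cs_pderiv:
 assumes h: "cs m a r h" and k: "k < m"
 shows "cs m a r (pderiv_at k h)"
proof -
 have cont: "continuous_on (pd m a r) h" using h by (simp add: cs_def)
 have hol: "(%ze. h (z(i := ze))) holomorphic_on ball (a i) r" if "z:pd m a r" "i < m" for z i
  using h that by (simp add: cs_def)
 have C: "continuous_on (pd m a r) (pderiv_at k h)"
  unfolding continuous_on_def
 proof
  fix z0 assume z0: "z0:pd m a r"
  define g where "g z = (%ze. h (z(k := ze)))" for z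
  have g: "g z holomorphic_on ball (a k) r" if "z:pd m a r" for z
   unfolding g_def by (rule hol[OF that k])
  \<comment> \<open>Twice the radius: if the k-th coordinate moves by less than d, the disc of
    radius d around it stays in the larger disc.\<close>
  obtain d where d: "d > 0" "cball (z0 k) (2 * d) <= ball (a k) r"
  proof -
   have "z0 k:ball (a k) r" using pd_coord[OF z0 k] .
   then obtain e where "e > 0" "cball (z0 k) e <= ball (a k) r"
    using open_contains_cball by (metis open_ball)
   then show ?thesis using that[of "e/2"] by simp
  qed
  have sub: "cball w d <= cball (z0 k) (2 * d)" if "norm (w - z0 k) < d" for w
  proof
   fix x assume "x:cball w d"
   then have "dist (z0 k) x <= dist (z0 k) w + dist w x" "dist w x <= d" by (auto simp: dist_triangle)
   then show "x:cball (z0 k) (2 * d)" using that by (auto simp: dist_norm norm_minus_commute)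
  qed
  show "(pderiv_at k h \<longlongrightarrow> pderiv_at k h z0) (at z0 within pd m a r)"
  proof (rule tendstoI)
   fix e :: real assume e: "e > 0"
   obtain X where X: "open X" "z0:X"
    "!!z ze. z:X \<inter> pd m a r ==> ze:cball (z0 k) (2 * d) ==> norm (g z ze - g z0 ze) <= e / 2 * d"
    using cs_slice_uniform[OF cont z0 k compact_cball d(2), of "e / 2 * d"] e d(1) unfolding g_def by auto
   have "continuous_on (ball (a k) r) (deriv (g z0))"
    using g[OF z0] holomorphic_deriv holomorphic_on_imp_continuous_on by blast
   then have "isCont (deriv (g z0)) (z0 k)"
    using pd_coord[OF z0 k] by (simp add: continuous_on_eq_continuous_at)
   moreover have zk: "((%z. z k) \<longlongrightarrow> z0 k) (at z0 within pd m a r)"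
    using continuous_on_subset[OF continuous_on_product_coordinates subset_UNIV, of "pd m a r" k] z0
    unfolding continuous_on_def by (rule bspec)
   ultimately have lim: "((%z. deriv (g z0) (z k)) \<longlongrightarrow> deriv (g z0) (z0 k)) (at z0 within pd m a r)"
    by (rule isCont_tendsto_compose)
   have e1: "eventually (%z. norm (deriv (g z0) (z k) - deriv (g z0) (z0 k)) < e / 2) (at z0 within pd m a r)"
    using tendstoD[OF lim, of "e / 2"] e by (simp add: dist_norm)
   have e2: "eventually (%z. norm (z k - z0 k) < d) (at z0 within pd m a r)"
    using tendstoD[OF zk d(1)] by (simp add: dist_norm)
   have e3: "eventually (%z. z:X \<inter> pd m a r) (at z0 within pd m a r)"
    using X(1,2) by (auto simp: eventually_at_topological)
   show "eventually (%z. dist (pderiv_at k h z) (pderiv_at k h z0) < e) (at z0 within pd m a r)"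
    using e1 e2 e3
   proof eventually_elim
    case (elim z)
    have "norm (deriv (g z) (z k) - deriv (g z0) (z k)) <= (e / 2 * d) / d"
    proof (rule deriv_close[OF g g open_ball])
     show "cball (z k) d <= ball (a k) r" using sub[of "z k"] elim d(2) by blast
     show "norm (g z ze - g z0 ze) <= e / 2 * d" if "ze:cball (z k) d" for ze
      using sub[of "z k"] elim X(3) that by blast
    qed (use elim z0 d in auto)
    then have "norm (deriv (g z) (z k) - deriv (g z0) (z k)) <= e / 2" using d(1) by simp
    moreover have "norm (deriv (g z) (z k) - deriv (g z0) (z0 k)) \<le>
      norm (deriv (g z) (z k) - deriv (g z0) (z k)) + norm (deriv (g z0) (z k) - deriv (g z0) (z0 k))"
     by (rule norm_diff_triangle_le[OF order.refl order.refl])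
    ultimately have "norm (deriv (g z) (z k) - deriv (g z0) (z0 k)) < e"
     using elim(1) by linarith
    then show ?case by (simp add: pderiv_at_def g_def dist_norm)
   qed
  qed
 qed
 have H: "(%ze. pderiv_at k h (z(i := ze))) holomorphic_on ball (a i) r" if z: "z:pd m a r" and i: "i < m" for z i
 proof (cases "i = k")
  case True
  have "(%ze. pderiv_at k h (z(i := ze))) = deriv (%ze. h (z(i := ze)))"
   unfolding pderiv_at_def True by simp
  then show ?thesis using holomorphic_deriv[OF hol[OF z i]] by simp
 next
  case ik: False
  have "(%ze. pderiv_at k h (z(i := ze))) field_differentiable at ze0" if z0: "ze0:ball (a i) r" for ze0
  proof -
   obtain d where d: "d > 0" "cball ze0 d <= ball (a i) r"
    using open_contains_cball z0 by (metis open_ball)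
   define w where "w = z k"
   have w: "w:ball (a k) r" unfolding w_def using pd_coord[OF z k] .
   obtain d' where d': "d' > 0" "ball w d' <= ball (a k) r"
    using open_contains_ball w by (metis open_ball)
   define H where "H xi ze = h (z(i := ze, k := xi))" for xi ze
   have mem: "z(i := ze):pd m a r" if "ze:ball (a i) r" for ze using pd_upd[OF z i that] .
   have memk: "z(k := xi):pd m a r" if "xi:ball (a k) r" for xi using pd_upd[OF z k that] .
   define D where "D xi ze = pderiv_at k h (z(k := xi, i := ze))" for xi ze
   have Dd: "((%xi. H xi ze) has_field_derivative D xi ze) (at xi)"
    if "ze:ball (a i) r" "xi:ball (a k) r" for ze xi
   proof -
    have "(%xi. H xi ze) holomorphic_on ball (a k) r"
     unfolding H_def using hol[OF mem[OF that(1)] k] .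
    then have "(%xi. H xi ze) field_differentiable at xi"
     using that(2) holomorphic_on_imp_differentiable_at by blast
    moreover have "deriv (%xi. H xi ze) xi = D xi ze"
     unfolding D_def pderiv_at_def H_def using ik by (simp add: fun_upd_twist)
    ultimately show ?thesis using DERIV_deriv_iff_field_differentiable by metis
   qed
   \<comment> \<open>The mean value inequality for \<open>H xi ze - D w ze * xi\<close> bounds the
     error of the quotient by the oscillation of the derivative, which is small uniformly in ze by
     the continuity C just proved.\<close>
   have ulim: "uniform_limit (cball ze0 d) (%xi ze. (H xi ze - H w ze) / (xi - w)) (D w) (at w)"
   proof (rule uniform_limitI)
    fix e :: real assume e: "e > 0"
    obtain X where X: "open X" "z:X"
     "!!y ze. y:X \<inter> pd m a r ==> ze:cball ze0 d ==>
      norm (pderiv_at k h (y(i := ze)) - pderiv_at k h (z(i := ze))) <= e / 2"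
     using cs_slice_uniform[OF C z i compact_cball d(2), of "e / 2"] e by auto
    have "continuous_on UNIV (%xi. z(k := xi))" by (intro continuous_on_upd continuous_intros)
    then have "open ((%xi. z(k := xi)) -` X)" using X(1) by (simp add: open_vimage)
    moreover have "w:(%xi. z(k := xi)) -` X" using X(2) by (simp add: w_def)
    ultimately obtain d2 where d2: "d2 > 0" "ball w d2 <= (%xi. z(k := xi)) -` X"
     using open_contains_ball by blast
    define d3 where "d3 = min d' d2"
    have d3: "d3 > 0" "ball w d3 <= ball (a k) r" "!!xi. xi:ball w d3 ==> z(k := xi):X"
     unfolding d3_def using d' d2 by (auto simp: subset_eq)
    have main: "dist ((H xi ze - H w ze) / (xi - w)) (D w ze) < e"
     if xi: "xi:ball w d3" "xi ~= w" and ze: "ze:cball ze0 d" for xi ze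
    proof -
     have "norm ((H xi ze - D w ze * xi) - (H w ze - D w ze * w)) <= e / 2 * norm (xi - w)"
     proof (rule field_differentiable_bound[where S = "ball w d3" and f' = "%xi. D xi ze - D w ze"])
      fix x assume x: "x:ball w d3"
      have xa: "x:ball (a k) r" using d3(2) x by blast
      have "ze:ball (a i) r" using d(2) ze by blast
      then have "((%xi. H xi ze - D w ze * xi) has_field_derivative D x ze - D w ze * 1) (at x)"
       using xa by (intro DERIV_diff Dd DERIV_cmult DERIV_ident)
      then show "((%xi. H xi ze - D w ze * xi) has_field_derivative D x ze - D w ze) (at x within ball w d3)"
       by (simp add: has_field_derivative_at_within)
      have "z(k := x):X \<inter> pd m a r" using d3(3)[OF x] memk[OF xa] by blast
      from X(3)[OF this ze] show "norm (D x ze - D w ze) <= e / 2"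
       unfolding D_def w_def by simp
     qed (use xi d3(1) in auto)
     then have "norm ((H xi ze - H w ze) - D w ze * (xi - w)) <= e / 2 * norm (xi - w)"
      by (simp add: algebra_simps)
     moreover have "(H xi ze - H w ze) / (xi - w) - D w ze = ((H xi ze - H w ze) - D w ze * (xi - w)) / (xi - w)"
      using xi(2) by (simp add: field_simps)
     ultimately have "norm ((H xi ze - H w ze) / (xi - w) - D w ze) <= e / 2"
      using xi(2) by (simp add: norm_divide divide_le_eq)
     then show ?thesis using e by (simp add: dist_norm)
    qed
    show "eventually (%xi. ALL ze:cball ze0 d. dist ((H xi ze - H w ze) / (xi - w)) (D w ze) < e) (at w)"
     unfolding eventually_at using d3(1) main by (auto intro!: exI[of _ d3] simp: dist_commute)
   qed
   have Hhol: "H xi holomorphic_on ball (a i) r" if "xi:ball (a k) r" for xi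
   proof -
    have "H xi = (%ze. h ((z(k := xi))(i := ze)))" unfolding H_def using ik by (simp add: fun_upd_twist)
    then show ?thesis using hol[OF memk[OF that] i] by simp
   qed
   have "eventually (%xi. xi:ball (a k) r & xi ~= w) (at w)"
    using w by (auto simp: eventually_at_topological intro!: exI[of _ "ball (a k) r"])
   then have ev: "eventually (%xi. continuous_on (cball ze0 d) (%ze. (H xi ze - H w ze) / (xi - w)) &
     (%ze. (H xi ze - H w ze) / (xi - w)) holomorphic_on ball ze0 d) (at w)"
   proof eventually_elim
    case (elim xi)
    have "(%ze. (H xi ze - H w ze) / (xi - w)) holomorphic_on ball (a i) r"
     using elim Hhol w by (intro holomorphic_intros) auto
    then show ?case using d(2) ball_subset_cball holomorphic_on_imp_continuous_on
     by (meson continuous_on_subset holomorphic_on_subset order.trans)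
   qed
   have "D w holomorphic_on ball ze0 d"
    using holomorphic_uniform_limit[OF ev ulim] by (metis trivial_limit_at)
   then have "D w field_differentiable at ze0" using d(1) holomorphic_on_imp_differentiable_at
    by (metis centre_in_ball open_ball)
   then show ?thesis unfolding D_def w_def by simp
  qed
  then show ?thesis by (simp add: holomorphic_on_open field_differentiable_def)
 qed
 show ?thesis unfolding cs_def using C H by blast
qed

lemma mis_0: "mis 0 = {%_. 0}"
 by (auto simp: mis_def)

lemma mis_Suc: "bij_betw (%(mu, l). mu(m := l)) (mis m \<times> UNIV) (mis (Suc m))"
 by (rule bij_betwI[where g = "%mu. (mu(m := 0), mu m)"]) (auto simp: mis_def fun_eq_iff)

lemma tdeg_Suc: "tdeg (Suc m) (mu(m := l)) = tdeg m mu + l"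
 by (simp add: tdeg_def)

lemma mon_Suc: "mon (Suc m) z (mu(m := l)) = mon m z mu * z m ^ l"
 by (simp add: mon_def)

lemma has_sum_geometric:
 fixes q :: real
 assumes "0 <= q" "q < 1"
 shows "((%l. q ^ l) has_sum (1 / (1 - q))) UNIV"
 using assms by (intro norm_summable_imp_has_sum geometric_sums) (auto simp: summable_geometric norm_power)

lemma has_sum_tdeg:
 fixes q :: real
 assumes "0 <= q" "q < 1"
 shows "((%mu. q ^ tdeg m mu) has_sum (1 / (1 - q)) ^ m) (mis m)"
proof (induction m)
 case 0
 show ?case unfolding mis_0 by (rule has_sum_finiteI) (auto simp: tdeg_def)
next
 case (Suc m)
 have in1: "((%l. q ^ tdeg m mu * q ^ l) has_sum (q ^ tdeg m mu * (1 / (1 - q)))) UNIV" for mu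
  by (intro has_sum_cmult_right has_sum_geometric assms)
 have out: "((%mu. q ^ tdeg m mu * (1 / (1 - q))) has_sum ((1 / (1 - q)) ^ m * (1 / (1 - q)))) (mis m)"
  by (intro has_sum_cmult_left Suc.IH)
 have "((%(mu, l). q ^ tdeg m mu * q ^ l) has_sum ((1 / (1 - q)) ^ m * (1 / (1 - q)))) (mis m \<times> UNIV)"
 proof (rule has_sum_SigmaI[where g = "%mu. q ^ tdeg m mu * (1 / (1 - q))"])
  show "(%(mu, l). q ^ tdeg m mu * q ^ l) summable_on mis m \<times> UNIV"
   by (rule summable_on_SigmaI[where g = "%mu. q ^ tdeg m mu * (1 / (1 - q))"])
    (use in1 out assms summable_on_def in auto)
 qed (use in1 out in auto)
 then have "((%x. q ^ tdeg (Suc m) (case x of (mu, l) => mu(m := l))) has_sum ((1 / (1 - q)) ^ Suc m)) (mis m \<times> UNIV)"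
  by (simp add: tdeg_Suc power_add case_prod_unfold mult.commute)
 then show ?case using has_sum_reindex_bij_betw[OF mis_Suc, where f = "%mu. q ^ tdeg (Suc m) mu"] by blast
qed

lemma mon_bound:
 assumes "!!i. i < m ==> norm (z i) <= s"
 shows "norm (mon m z mu) <= s ^ tdeg m mu"
proof -
 have "norm (mon m z mu) = (\<Prod>i<m. norm (z i) ^ mu i)" by (simp add: mon_def prod_norm[symmetric] norm_power)
 also have "\<dots> <= (\<Prod>i<m. s ^ mu i)" using assms by (intro prod_mono) (auto intro!: power_mono)
 finally show ?thesis by (simp add: tdeg_def power_sum)
qed

lemma cvec_0: "cvec 0 = {%_. 0}"
 by (auto simp: cvec_def)

abbreviation zc :: "nat => complex" where "zc \<equiv> %_. 0"

lemma zc_in_cvec [simp]: "zc:cvec m"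
 by (auto simp: cvec_def)

lemma cs_funpow_pderiv: "cs m a r h ==> k < m ==> cs m a r ((pderiv_at k ^^ l) h)"
 by (induction l) (auto intro: cs_pderiv)

lemma funpow_pderiv_at: "((pderiv_at k ^^ l) h) z = (deriv ^^ l) (%ze. h (z(k := ze))) (z k)"
proof (induction l arbitrary: z)
 case (Suc l)
 have "((pderiv_at k ^^ Suc l) h) z = deriv (%ze. ((pderiv_at k ^^ l) h) (z(k := ze))) (z k)"
  by (simp add: pderiv_at_def)
 also have "(%ze. ((pderiv_at k ^^ l) h) (z(k := ze))) = (deriv ^^ l) (%ze. h (z(k := ze)))"
  by (simp only: Suc fun_upd_upd fun_upd_same)
 finally show ?case by (simp only: funpow.simps(2) o_apply)
qed simp

lemma cs_restrict:
 assumes "cs (Suc m) zc r h" "r > 0"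
 shows "cs m zc r h"
proof -
 have "pd m zc r <= pd (Suc m) zc r" using assms(2) by (auto simp: pd_def cvec_def less_Suc_eq)
 then show ?thesis using assms(1) continuous_on_subset unfolding cs_def
  by (metis less_Suc_eq subsetD)
qed

lemma cs_scale: "cs m a r h ==> cs m a r (%z. h z / c)"
 unfolding cs_def divide_inverse by (auto intro!: continuous_intros holomorphic_intros)

text \<open>Induction on the number of variables: expand in the last variable, then expand its
  coefficients, which are functions of the other variables. Cauchy's bounds are carried through the
  induction because they give the absolute summability that permits the double series to be summed
  in either order.\<close>

lemma cs_taylor:
 assumes "cs m zc r h" "0 < rho" "rho < r" "!!z. z:cvec m ==> (!!i. i < m ==> norm (z i) <= rho) ==> norm (h z) <= M"
 shows "EX c. (ALL mu:mis m. norm (c mu) <= M / rho ^ tdeg m mu) &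
   (ALL z:pd m zc rho. ((%mu. c mu * mon m z mu) has_sum h z) (mis m))"
 using assms
proof (induction m arbitrary: h M)
 case 0
 have "norm (h zc) <= M" by (rule 0(4)) simp_all
 moreover have "pd 0 zc rho = {zc}" by (auto simp: pd_def cvec_0)
 moreover have "((%mu. h zc * mon 0 zc mu) has_sum h zc) (mis 0)"
  unfolding mis_0 by (rule has_sum_finiteI) (auto simp: mon_def)
 ultimately show ?case by (intro exI[of _ "%_. h zc"]) (auto simp: mis_0 tdeg_def)
next
 case (Suc m)
 have r: "r > 0" using Suc.prems by simp
 \<comment> \<open>The Taylor coefficients in the last variable; on \<open>cvec m\<close> they are
   taken at \<open>z m = 0\<close>.\<close>
 define C where "C l z = ((pderiv_at m ^^ l) h) z / fact l" for l z
 have csC: "cs m zc r (C l)" for l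
  unfolding C_def by (rule cs_scale, rule cs_restrict, rule cs_funpow_pderiv) (use Suc.prems(1) r in auto)
 have slice: "(%ze. h (z(m := ze))) holomorphic_on ball 0 r" if "z:pd (Suc m) zc r" for z
  using Suc.prems(1) that unfolding cs_def by blast
 have memS: "z:pd (Suc m) zc r" if "z:cvec m" "!!i. i < m ==> norm (z i) <= rho" for z
  using that Suc.prems(3) r by (auto simp: pd_def cvec_def less_Suc_eq intro: le_less_trans)
 have bdC: "norm (C l z) <= M / rho ^ l" if z: "z:cvec m" "!!i. i < m ==> norm (z i) <= rho" for l z
 proof -
  have zm: "z m = 0" using z(1) by (simp add: cvec_def)
  have "norm ((deriv ^^ l) (%ze. h (z(m := ze))) 0) <= fact l * M / rho ^ l"
  proof (rule Cauchy_inequality)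
   have hol: "(%ze. h (z(m := ze))) holomorphic_on ball 0 r" using slice memS z by blast
   show "(%ze. h (z(m := ze))) holomorphic_on ball 0 rho"
    by (rule holomorphic_on_subset[OF hol]) (use Suc.prems in auto)
   show "continuous_on (cball 0 rho) (%ze. h (z(m := ze)))"
    by (rule continuous_on_subset[OF holomorphic_on_imp_continuous_on[OF hol]]) (use Suc.prems in auto)
   show "norm (h (z(m := x))) <= M" if "norm (0 - x) = rho" for x
    by (rule Suc.prems(4)) (use z that in \<open>auto simp: cvec_def less_Suc_eq\<close>)
  qed (use Suc.prems in auto)
  then show ?thesis unfolding C_def funpow_pderiv_at zm by (simp add: norm_divide divide_le_eq field_simps)
 qed
 have "EX c. (ALL mu:mis m. norm (c mu) <= (M / rho ^ l) / rho ^ tdeg m mu) &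
   (ALL z:pd m zc rho. ((%mu. c mu * mon m z mu) has_sum C l z) (mis m))" for l
  by (rule Suc.IH[OF csC Suc.prems(2,3)]) (rule bdC)
 then obtain c where c: "!!l mu. mu:mis m ==> norm (c l mu) <= (M / rho ^ l) / rho ^ tdeg m mu"
  "!!l z. z:pd m zc rho ==> ((%mu. c l mu * mon m z mu) has_sum C l z) (mis m)"
  by metis
 have "norm (h zc) <= M" by (rule Suc.prems(4)) (use Suc.prems in auto)
 then have M0: "M >= 0" using norm_ge_zero order.trans by blast
 define d where "d mu = c (mu m) (mu(m := 0))" for mu
 have d: "d (mu(m := l)) = c l mu" if "mu:mis m" for mu l
 proof -
  have "mu(m := 0) = mu" using that by (auto simp: mis_def)
  then show ?thesis by (simp add: d_def)
 qed
 have b1: "norm (d mu) <= M / rho ^ tdeg (Suc m) mu" if "mu:mis (Suc m)" for mu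
 proof -
  have m': "mu(m := 0):mis m" using that by (auto simp: mis_def)
  have "tdeg (Suc m) mu = tdeg m (mu(m := 0)) + mu m" by (simp add: tdeg_def)
  then show ?thesis using c(1)[OF m', of "mu m"] unfolding d_def by (simp add: power_add mult.commute)
 qed
 have hs: "((%mu. d mu * mon (Suc m) z mu) has_sum h z) (mis (Suc m))" if z: "z:pd (Suc m) zc rho" for z
 proof -
  define z' where "z' = z(m := 0)"
  have z': "z':pd m zc rho" using z by (auto simp: z'_def pd_def cvec_def)
  have z'S: "z':pd (Suc m) zc r" using z' Suc.prems(2,3)
   by (auto simp: pd_def cvec_def less_Suc_eq)
  have zz: "z = z'(m := z m)" by (simp add: z'_def)
  have monz: "mon m z mu = mon m z' mu" for mu by (auto simp: mon_def z'_def intro!: prod.cong)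
  \<comment> \<open>The largest coordinate is still below rho, and \<open>t / rho\<close> is the
    ratio of a dominating geometric series.\<close>
  define t where "t = Max (insert 0 ((%i. norm (z i)) ` {..<Suc m}))"
  have t: "0 <= t" "t < rho" "!!i. i < Suc m ==> norm (z i) <= t"
   unfolding t_def using z Suc.prems(2) by (auto simp: pd_def intro!: Max_ge simp del: image_insert)
  have q: "0 <= t / rho" "t / rho < 1" using t Suc.prems(2) by auto
  have "norm (c l mu * mon m z mu * z m ^ l) <= M * (t / rho) ^ tdeg (Suc m) (mu(m := l))" if "mu:mis m" for l mu
  proof -
   have "norm (c l mu * mon m z mu * z m ^ l) <= (M / rho ^ l / rho ^ tdeg m mu) * t ^ tdeg m mu * t ^ l"
    unfolding norm_mult norm_power
    using t M0 Suc.prems(2) by (intro mult_mono c(1)[OF that] mon_bound power_mono) auto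
   also have "\<dots> = M * (t / rho) ^ tdeg (Suc m) (mu(m := l))"
    unfolding tdeg_Suc by (simp add: power_add power_divide mult_ac)
   finally show ?thesis .
  qed
  moreover have "(%x. M * (t / rho) ^ tdeg (Suc m) ((%(mu, l). mu(m := l)) x)) summable_on (mis m \<times> UNIV)"
   using summable_on_cmult_right[OF has_sum_imp_summable[OF has_sum_tdeg[OF q]], of M "Suc m"]
   unfolding summable_on_reindex_bij_betw[OF mis_Suc, where f = "%mu. M * (t / rho) ^ tdeg (Suc m) mu"] .
  ultimately have "(%x. norm ((%(mu, l). c l mu * mon m z mu * z m ^ l) x)) summable_on (mis m \<times> UNIV)"
   by (elim Infinite_Sum.abs_summable_on_comparison_test') auto
  then have sm: "(%(mu, l). c l mu * mon m z mu * z m ^ l) summable_on (mis m \<times> UNIV)"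
   by (rule abs_summable_summable)
  then obtain S where S: "((%(mu, l). c l mu * mon m z mu * z m ^ l) has_sum S) (mis m \<times> UNIV)"
   unfolding summable_on_def by blast
  then have S': "((%(l, mu). c l mu * mon m z mu * z m ^ l) has_sum S) (UNIV \<times> mis m)"
   by (subst has_sum_swap) simp
  have "((%l. C l z' * z m ^ l) has_sum S) UNIV"
  proof (rule has_sum_SigmaD[OF S'])
   fix l
   have "((%mu. c l mu * mon m z' mu * z m ^ l) has_sum (C l z' * z m ^ l)) (mis m)"
    by (rule has_sum_cmult_left[OF c(2)[OF z']])
   then show "((%mu. case (l, mu) of (l, mu) => c l mu * mon m z mu * z m ^ l) has_sum (C l z' * z m ^ l)) (mis m)"
    by (simp add: monz)
  qed
  then have "(%l. C l z' * z m ^ l) sums S" by (rule has_sum_imp_sums)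
  moreover have "(%l. C l z' * z m ^ l) sums h z"
  proof -
   have hol: "(%ze. h (z'(m := ze))) holomorphic_on ball 0 r" using slice z'S by blast
   have "z m:ball 0 r" using z Suc.prems(3) by (auto simp: pd_def)
   from holomorphic_power_series[OF hol this]
   show ?thesis unfolding C_def funpow_pderiv_at using zz by (simp add: z'_def)
  qed
  ultimately have "S = h z" by (rule sums_unique2)
  with S have "((%x. d ((%(mu, l). mu(m := l)) x) * mon (Suc m) z ((%(mu, l). mu(m := l)) x)) has_sum h z) (mis m \<times> UNIV)"
   by (subst has_sum_cong[where g = "%(mu, l). c l mu * mon m z mu * z m ^ l"]) (auto simp: d mon_Suc)
  then show ?thesis
   using has_sum_reindex_bij_betw[OF mis_Suc, where f = "%mu. d mu * mon (Suc m) z mu"] by blast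
 qed
 show ?case using b1 hs by blast
qed

section \<open>Convergent power series and germs\<close>

definition ps :: "nat => real => ser => bool" where
 "ps m s c \<longleftrightarrow> (%mu. norm (c mu) * s ^ tdeg m mu) summable_on mis m"

definition ev :: "nat => ser => cseq => complex" where
 "ev m c z = (\<Sum>\<^sub>\<infinity>mu\<in>mis m. c mu * mon m z mu)"

lemma ps_term_bound:
 assumes "!!i. i < m ==> norm (z i) <= s"
 shows "norm (c mu * mon m z mu) <= norm (c mu) * s ^ tdeg m mu"
 unfolding norm_mult by (intro mult_left_mono mon_bound assms) auto

lemma ps_abs_summable:
 assumes "ps m s c" "!!i. i < m ==> norm (z i) <= s"
 shows "(%mu. norm (c mu * mon m z mu)) summable_on mis m"
 by (rule Infinite_Sum.abs_summable_on_comparison_test'[OF assms(1)[unfolded ps_def]])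
  (rule ps_term_bound[OF assms(2)])

lemma ps_has_sum:
 assumes "ps m s c" "!!i. i < m ==> norm (z i) <= s"
 shows "((%mu. c mu * mon m z mu) has_sum ev m c z) (mis m)"
 unfolding ev_def by (rule has_sum_infsum[OF abs_summable_summable[OF ps_abs_summable]]) (use assms in auto)

lemma ps_mono:
 assumes "ps m s c" "0 <= t" "t <= s"
 shows "ps m t c"
 unfolding ps_def
proof (rule summable_on_comparison_test)
 show "(%mu. norm (c mu) * s ^ tdeg m mu) summable_on mis m" using assms by (simp add: ps_def)
qed (use assms in \<open>auto intro!: mult_left_mono power_mono\<close>)

lemma ps_geometric_bound:
 assumes "!!mu. mu:mis m ==> norm (c mu) <= M / rho ^ tdeg m mu" "0 <= s" "s < rho"
 shows "ps m s c"
 unfolding ps_def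
proof (rule summable_on_comparison_test)
 have "(%mu. (s / rho) ^ tdeg m mu) summable_on mis m"
  by (rule has_sum_imp_summable[OF has_sum_tdeg]) (use assms in auto)
 then show "(%mu. M * (s / rho) ^ tdeg m mu) summable_on mis m" by (rule summable_on_cmult_right)
 show "norm (c mu) * s ^ tdeg m mu <= M * (s / rho) ^ tdeg m mu" if "mu:mis m" for mu
  using mult_right_mono[OF assms(1)[OF that], of "s ^ tdeg m mu"] assms(2) by (simp add: power_divide)
qed (use assms in auto)

lemma continuous_on_mon: "continuous_on S (%z. mon m z mu)"
 unfolding mon_def
 by (intro continuous_intros continuous_on_subset[OF continuous_on_product_coordinates subset_UNIV])

lemma holomorphic_on_mon: "(%ze. mon m (z(i := ze)) mu) holomorphic_on S"
proof -
 have "(%ze. (z(i := ze)) j ^ mu j) holomorphic_on S" for j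
  by (cases "j = i") (auto intro!: holomorphic_intros)
 then show ?thesis unfolding mon_def by (intro holomorphic_on_prod)
qed

text \<open>By the Weierstrass test the partial sums converge uniformly on the polydisc; continuity
  and holomorphy along coordinate discs pass to the limit.\<close>

lemma cs_ev:
 assumes ps: "ps m s c" and s: "s > 0"
 shows "cs m zc s (ev m c)"
 unfolding cs_def
proof (intro conjI ballI allI impI)
 have ulim: "uniform_limit (pd m zc s) (%X z. \<Sum>mu\<in>X. c mu * mon m z mu) (ev m c) (finite_subsets_at_top (mis m))"
  unfolding ev_def
 proof (rule Weierstrass_m_test_general)
  show "(%mu. norm (c mu) * s ^ tdeg m mu) summable_on mis m" using ps by (simp add: ps_def)
  show "norm (c mu * mon m z mu) <= norm (c mu) * s ^ tdeg m mu" if "z:pd m zc s" for mu z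
   by (rule ps_term_bound) (use that in \<open>auto simp: pd_def intro: less_imp_le\<close>)
 qed
 show "continuous_on (pd m zc s) (ev m c)"
  by (rule uniform_limit_theorem[OF always_eventually ulim])
   (auto intro!: continuous_intros continuous_on_mon)
 fix z i assume z: "z:pd m zc s" and i: "i < m"
 have "(%ze. ev m c (z(i := ze))) field_differentiable at w" if w: "w:ball (zc i) s" for w
 proof -
  obtain d where d: "d > 0" "cball w d <= ball (zc i) s"
   using open_contains_cball w by (metis open_ball)
  have sub: "(%ze. z(i := ze)) ` cball w d <= pd m zc s" using pd_upd[OF z i] d by blast
  have ul: "uniform_limit (cball w d) (%X ze. \<Sum>mu\<in>X. c mu * mon m (z(i := ze)) mu) (%ze. ev m c (z(i := ze))) (finite_subsets_at_top (mis m))"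
  proof (rule uniform_limitI)
   fix e :: real assume "e > 0"
   from uniform_limitD[OF ulim this]
   show "eventually (%X. ALL ze:cball w d. dist (\<Sum>mu\<in>X. c mu * mon m (z(i := ze)) mu) (ev m c (z(i := ze))) < e)
     (finite_subsets_at_top (mis m))"
    by (rule eventually_mono) (use sub in blast)
  qed
  have ev: "eventually (%X. continuous_on (cball w d) (%ze. \<Sum>mu\<in>X. c mu * mon m (z(i := ze)) mu) &
   (%ze. \<Sum>mu\<in>X. c mu * mon m (z(i := ze)) mu) holomorphic_on ball w d) (finite_subsets_at_top (mis m))"
   by (rule always_eventually)
    (auto intro!: holomorphic_intros holomorphic_on_mon holomorphic_on_imp_continuous_on)
  have "(%ze. ev m c (z(i := ze))) holomorphic_on ball w d"
   using holomorphic_uniform_limit[OF ev ul] by (metis finite_subsets_at_top_neq_bot)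
  then show ?thesis using d(1) holomorphic_on_imp_differentiable_at by (metis centre_in_ball open_ball)
 qed
 then show "(%ze. ev m c (z(i := ze))) holomorphic_on ball (zc i) s"
  by (simp add: holomorphic_on_open field_differentiable_def)
qed

lemma cs_shift:
 assumes "cs m a r h" "a:cvec m"
 shows "cs m zc r (%z. h (%i. z i + a i))"
 unfolding cs_def
proof (intro conjI ballI allI impI)
 have mem: "(%i. z i + a i):pd m a r" if "z:pd m zc r" for z
  using that assms(2) by (auto simp: pd_def cvec_def)
 have c1: "continuous_on (pd m zc r) (%z i. z i + a i)"
  by (intro continuous_on_coordinatewise_then_product continuous_intros
     continuous_on_subset[OF continuous_on_product_coordinates subset_UNIV])
 have "continuous_on (pd m a r) h" using assms(1) by (simp add: cs_def)
 then show "continuous_on (pd m zc r) (%z. h (%i. z i + a i))"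
  by (rule continuous_on_compose2[OF _ c1]) (use mem in blast)
 fix z i assume z: "z:pd m zc r" and i: "i < m"
 have "(%ze. h ((%i. z i + a i)(i := ze))) holomorphic_on ball (a i) r"
  using assms(1) mem[OF z] i unfolding cs_def by blast
 moreover have "(%ze. ze + a i) ` ball (zc i) r <= ball (a i) r" by (auto simp: dist_norm)
 ultimately have "((%ze. h ((%i. z i + a i)(i := ze))) \<circ> (%ze. ze + a i)) holomorphic_on ball (zc i) r"
  by (intro holomorphic_on_compose_gen[where t = "ball (a i) r"] holomorphic_intros)
 moreover have "(%i. z i + a i)(i := ze + a i) = (%j. (z(i := ze)) j + a j)" for ze by auto
 ultimately show "(%ze. h (%j. (z(i := ze)) j + a j)) holomorphic_on ball (zc i) r" by (simp add: o_def)
qed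

lemma fdc_slice:
 assumes f: "fdc m h (z(i := w)) c" and z: "z:cvec m" and i: "i < m"
 shows "((%ze. h (z(i := ze))) has_field_derivative c i) (at w)"
proof -
 have lim: "filterlim (%ze. z(i := ze)) (nb m (z(i := w))) (at w)"
 proof (rule filterlim_nb)
  show "((%ze. (z(i := ze)) j) \<longlongrightarrow> (z(i := w)) j) (at w)" for j
   by (cases "j = i") auto
  show "z(i := w):cvec m" using z i by (auto simp: cvec_def)
  show "eventually (%ze. z(i := ze):cvec m) (at w)"
   using z i by (auto simp: cvec_def)
 qed
 have sum1: "(\<Sum>j<m. c j * ((z(i := ze)) j - (z(i := w)) j)) = c i * (ze - w)" for ze
 proof -
  have "(\<Sum>j<m. c j * ((z(i := ze)) j - (z(i := w)) j)) = (\<Sum>j<m. if j = i then c i * (ze - w) else 0)"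
   by (intro sum.cong) auto
  then show ?thesis using i by simp
 qed
 have sum2: "(\<Sum>j<m. norm ((z(i := ze)) j - (z(i := w)) j)) = norm (ze - w)" for ze
 proof -
  have "(\<Sum>j<m. norm ((z(i := ze)) j - (z(i := w)) j)) = (\<Sum>j<m. if j = i then norm (ze - w) else 0)"
   by (intro sum.cong) auto
  then show ?thesis using i by simp
 qed
 show ?thesis unfolding has_field_derivative_iff
 proof (rule tendstoI)
  fix e :: real assume e: "e > 0"
  have "eventually (%ze. norm (h (z(i := ze)) - h (z(i := w)) - c i * (ze - w)) <= e / 2 * norm (ze - w)) (at w)"
   using fdcD[OF f, of "e / 2"] e lim unfolding filterlim_iff sum1[symmetric] sum2[symmetric] by auto
  moreover have "eventually (%ze. ze ~= w) (at w)" by (simp add: eventually_neq_at_within)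
  ultimately show "eventually (%ze. dist ((h (z(i := ze)) - h (z(i := w))) / (ze - w)) (c i) < e) (at w)"
  proof eventually_elim
   case (elim ze)
   have "(h (z(i := ze)) - h (z(i := w))) / (ze - w) - c i
     = (h (z(i := ze)) - h (z(i := w)) - c i * (ze - w)) / (ze - w)"
    using elim by (simp add: field_simps)
   then have "norm ((h (z(i := ze)) - h (z(i := w))) / (ze - w) - c i) <= e / 2"
    using elim by (simp add: norm_divide divide_le_eq)
   then show ?case using e by (simp add: dist_norm)
  qed
 qed
qed

lemma fdc_cs:
 assumes "!!z. z:pd m a r ==> EX c. fdc m h z c"
 shows "cs m a r h"
 unfolding cs_def
proof (intro conjI ballI allI impI)
 show "continuous_on (pd m a r) h" unfolding continuous_on_def
 proof
  fix z assume z: "z:pd m a r"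
  then obtain c where "fdc m h z c" using assms by blast
  then have "(h \<longlongrightarrow> h z) (nb m z)" by (rule fdc_tendsto)
  moreover have "at z within pd m a r <= nb m z"
   unfolding nb_def at_within_def by (intro inf_mono) (auto simp: pd_def)
  ultimately show "(h \<longlongrightarrow> h z) (at z within pd m a r)" by (rule tendsto_mono[rotated])
 qed
 fix z i assume z: "z:pd m a r" and i: "i < m"
 have zc: "z:cvec m" using z by (simp add: pd_def)
 have "EX D. ((%ze. h (z(i := ze))) has_field_derivative D) (at w)" if w: "w:ball (a i) r" for w
 proof -
  obtain c where "fdc m h (z(i := w)) c" using assms pd_upd[OF z i w] by blast
  from fdc_slice[OF this zc i] show ?thesis by blast
 qed
 then show "(%ze. h (z(i := ze))) holomorphic_on ball (a i) r"
  by (simp add: holomorphic_on_open)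
qed

lemma tdeg_eq_0: "mu:mis m ==> tdeg m mu = 0 ==> mu = (%_. 0)"
proof
 fix i assume "mu:mis m" "tdeg m mu = 0"
 then show "mu i = 0" by (cases "i < m") (auto simp: tdeg_def mis_def)
qed

lemma tdeg_eq_1:
 assumes "mu:mis m" "tdeg m mu = 1"
 shows "EX i<m. mu = (%_. 0)(i := 1)"
proof -
 obtain i where i: "i < m" "mu i = 1" "!!j. j < m ==> j ~= i ==> mu j = 0"
  using assms(2) unfolding tdeg_def by (subst (asm) sum_eq_1_iff) auto
 have "mu j = ((%_. 0)(i := 1)) j" for j
  using i assms(1) by (cases "j < m") (auto simp: mis_def)
 then show ?thesis using i(1) by blast
qed

text \<open>Remove the terms of degree 0 and 1. Each remaining term has degree at least 2, so
  shrinking the radius from s to the sum norm t of the point gains the factor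
  \<open>(t / s)^2\<close>, and the remainder is quadratic in t.\<close>

lemma power_series_fdc:
 assumes ps: "ps m s c" and s: "s > 0"
  and h: "!!z. z:pd m zc s ==> ((%mu. c mu * mon m z mu) has_sum h z) (mis m)"
 shows "fdc m h zc (%i. c ((%_. 0)(i := 1)))"
proof -
 define E :: "nat => nat => nat" where "E i = (%_. 0)(i := 1)" for i
 define A where "A = insert (%_. 0) (E ` {..<m})"
 have A: "finite A" "A <= mis m" by (auto simp: A_def mis_def E_def)
 have inj: "inj_on E {..<m}" by (auto simp: inj_on_def E_def fun_eq_iff split: if_splits)
 have "(%_. 0) ~= E i" for i
 proof
  assume "(%_. 0) = E i"
  moreover have "E i i = 1" by (simp add: E_def)
  ultimately show False by (metis zero_neq_one)
 qed
 then have E0: "(%_. 0) \<notin> E ` {..<m}" by blast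
 have monE: "mon m z (E i) = z i" if "i < m" for z i
 proof -
  have "mon m z (E i) = (\<Prod>j<m. if j = i then z i else 1)"
   unfolding mon_def E_def by (intro prod.cong) auto
  then show ?thesis using that by simp
 qed
 have mon0: "mon m z (%_. 0) = 1" for z by (simp add: mon_def)
 have sumA: "(\<Sum>mu\<in>A. c mu * mon m z mu) = c (%_. 0) + (\<Sum>i<m. c (E i) * z i)" for z
  unfolding A_def using E0 by (simp add: sum.reindex[OF inj] monE mon0)
 define K where "K = (\<Sum>\<^sub>\<infinity>mu\<in>mis m. norm (c mu) * s ^ tdeg m mu)"
 have K: "((%mu. norm (c mu) * s ^ tdeg m mu) has_sum K) (mis m)"
  unfolding K_def using ps by (simp add: ps_def)
 have K0: "K >= 0" unfolding K_def by (intro infsum_nonneg) (use s in auto)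
 have est: "norm (h z - (c (%_. 0) + (\<Sum>i<m. c (E i) * z i))) <= K / s\<^sup>2 * (\<Sum>i<m. norm (z i)) ^ 2"
  if z: "z:pd m zc s" "(\<Sum>i<m. norm (z i)) < s" for z
 proof -
  define t where "t = (\<Sum>i<m. norm (z i))"
  have t: "0 <= t" "t < s" unfolding t_def using z by (auto intro: sum_nonneg)
  have zt: "norm (z i) <= t" if "i < m" for i unfolding t_def using that by (intro member_le_sum) auto
  have d: "((%mu. c mu * mon m z mu) has_sum (h z - (c (%_. 0) + (\<Sum>i<m. c (E i) * z i)))) (mis m - A)"
   unfolding sumA[symmetric] by (intro has_sum_Diff h z has_sum_finite A)
  have "((%mu. norm (c mu) * s ^ tdeg m mu) has_sum (K - (\<Sum>mu\<in>A. norm (c mu) * s ^ tdeg m mu))) (mis m - A)"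
   by (intro has_sum_Diff K has_sum_finite A)
  then have k: "((%mu. (t / s)\<^sup>2 * (norm (c mu) * s ^ tdeg m mu)) has_sum ((t / s)\<^sup>2 * (K - (\<Sum>mu\<in>A. norm (c mu) * s ^ tdeg m mu)))) (mis m - A)"
   by (rule has_sum_cmult_right)
  have le: "norm (c mu * mon m z mu) <= (t / s)\<^sup>2 * (norm (c mu) * s ^ tdeg m mu)" if mu: "mu:mis m - A" for mu
  proof -
   have "tdeg m mu ~= 0" using mu tdeg_eq_0 by (auto simp: A_def)
   moreover have "tdeg m mu ~= 1" using mu tdeg_eq_1 by (fastforce simp: A_def E_def)
   ultimately obtain k where k: "tdeg m mu = 2 + k"
    by (metis One_nat_def add_2_eq_Suc less_2_cases_iff not_less le_add_diff_inverse)
   have "t ^ tdeg m mu = (t / s)\<^sup>2 * (s\<^sup>2 * t ^ k)" unfolding k using s by (simp add: power_add power_divide power2_eq_square)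
   also have "\<dots> <= (t / s)\<^sup>2 * (s\<^sup>2 * s ^ k)"
    using t s by (intro mult_left_mono power_mono) auto
   also have "\<dots> = (t / s)\<^sup>2 * s ^ tdeg m mu" unfolding k by (simp add: power_add power2_eq_square)
   finally have "norm (c mu) * t ^ tdeg m mu <= norm (c mu) * ((t / s)\<^sup>2 * s ^ tdeg m mu)"
    by (intro mult_left_mono) auto
   with ps_term_bound[of m z t c mu] zt show ?thesis by (simp add: mult_ac)
  qed
  have sm: "(%mu. norm (c mu * mon m z mu)) summable_on (mis m - A)"
   by (rule Infinite_Sum.abs_summable_on_comparison_test'[OF has_sum_imp_summable[OF k] le])
  have "norm (h z - (c (%_. 0) + (\<Sum>i<m. c (E i) * z i))) <= (\<Sum>\<^sub>\<infinity>mu\<in>mis m - A. norm (c mu * mon m z mu))"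
   by (rule norm_has_sum_bound[OF has_sum_infsum[OF sm] d])
  also have "\<dots> <= (t / s)\<^sup>2 * (K - (\<Sum>mu\<in>A. norm (c mu) * s ^ tdeg m mu))"
   by (rule has_sum_mono[OF has_sum_infsum[OF sm] k le])
  also have "\<dots> <= (t / s)\<^sup>2 * K"
   by (intro mult_left_mono) (use s in \<open>auto intro!: sum_nonneg\<close>)
  finally show ?thesis unfolding t_def by (simp add: power_divide mult.commute)
 qed
 have hz: "h zc = c (%_. 0)"
  using est[of zc] s by (simp add: pd_def)
 show ?thesis unfolding fdc_def E_def[symmetric]
 proof (intro allI impI)
  fix e :: real assume e: "e > 0"
  have lim: "((%z. \<Sum>i<m. norm (z i)) \<longlongrightarrow> (\<Sum>i<m. norm (zc i))) (nb m zc)"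
   by (intro tendsto_intros tendsto_nb_coord)
  \<comment> \<open>Chosen such that t < d gives \<open>K / s^2 * t <= e\<close>; the denominator K
    + 1 is positive even when K = 0.\<close>
  define d where "d = min s (e * s\<^sup>2 / (K + 1))"
  have d: "d > 0" unfolding d_def using s e K0 by simp
  have e1: "eventually (%z. (\<Sum>i<m. norm (z i)) < d) (nb m zc)"
   using order_tendstoD(2)[OF lim, of d] d by simp
  have e2: "eventually (%z. z:pd m zc s) (nb m zc)"
   using eventually_nb[OF zc_in_cvec] s by blast
  show "eventually (%u. norm (h u - h zc - (\<Sum>i<m. c (E i) * (u i - zc i))) <= e * (\<Sum>i<m. norm (u i - zc i))) (nb m zc)"
   using e1 e2
  proof eventually_elim
   case (elim z)
   define t where "t = (\<Sum>i<m. norm (z i))"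
   have t0: "t >= 0" unfolding t_def by (intro sum_nonneg) auto
   have t: "t < s" "t < e * s\<^sup>2 / (K + 1)" using elim unfolding t_def d_def by auto
   have "norm (h z - (c (%_. 0) + (\<Sum>i<m. c (E i) * z i))) <= K / s\<^sup>2 * t * t"
    using est[OF elim(2)] t unfolding t_def by (simp add: power2_eq_square mult_ac)
   also have "K / s\<^sup>2 * t <= e"
   proof -
    have "t * (K + 1) <= e * s\<^sup>2" using t(2) K0 by (simp add: field_simps)
    moreover have "K * t <= t * (K + 1)" using t0 by (simp add: algebra_simps)
    ultimately show ?thesis using s by (simp add: field_simps)
   qed
   then have "K / s\<^sup>2 * t * t <= e * t" using t0 by (rule mult_right_mono)
   finally show ?case unfolding hz t_def by (simp add: algebra_simps)
  qed
 qed
qed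

lemma pd_sub: 
 assumes "b:pd m a r"
 shows "EX r'>0. pd m b r' <= pd m a r"
proof -
 define r' where "r' = Min (insert 1 ((%i. r - norm (b i - a i)) ` {..<m}))"
 have r': "r' > 0" "!!i. i < m ==> r' <= r - norm (b i - a i)"
  unfolding r'_def using assms by (auto simp: pd_def)
 have "norm (z i - a i) < r" if "norm (z i - b i) < r'" "i < m" for z i
  using norm_triangle_ineq[of "z i - b i" "b i - a i"] that r'(2)[OF that(2)] by simp
 then have "pd m b r' <= pd m a r" by (auto simp: pd_def)
 then show ?thesis using r'(1) by blast
qed

lemma cs_mono:
 assumes "cs m a r h" "pd m b r' <= pd m a r" "b:cvec m"
 shows "cs m b r' h"
 unfolding cs_def
proof (intro conjI ballI allI impI)
 show "continuous_on (pd m b r') h" using assms continuous_on_subset unfolding cs_def by blast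
 fix z i assume z: "z:pd m b r'" and i: "i < m"
 show "(%ze. h (z(i := ze))) holomorphic_on ball (b i) r'"
 proof (rule holomorphic_on_subset)
  show "(%ze. h (z(i := ze))) holomorphic_on ball (a i) r"
   using assms z i unfolding cs_def by blast
  show "ball (b i) r' <= ball (a i) r"
  proof
   fix w assume "w:ball (b i) r'"
   then have "z(i := w):pd m a r" using pd_upd[OF z i] assms(2) by blast
   then show "w:ball (a i) r" using pd_coord[of "z(i := w)" m a r i] i by simp
  qed
 qed
qed

lemma cs_series:
 assumes "cs m a r h" "r > 0" "a:cvec m"
 shows "EX c s. s > 0 & ps m s c & (ALL z:pd m zc s. ((%mu. c mu * mon m z mu) has_sum h (%i. z i + a i)) (mis m))"
proof -
 define g where "g z = h (%i. z i + a i)" for z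
 have cs: "cs m zc r g" unfolding g_def using cs_shift[OF assms(1,3)] .
 have "continuous_on (pd m zc r) g" using cs by (simp add: cs_def)
 then have "(g \<longlongrightarrow> g zc) (at zc within pd m zc r)"
  using pd_center[OF zc_in_cvec assms(2)] by (simp add: continuous_on_def)
 then have "eventually (%z. dist (g z) (g zc) < 1) (at zc within pd m zc r)" by (rule tendstoD) simp
 then have "eventually (%z. z ~= zc --> dist (g z) (g zc) < 1) (nb m zc)"
  unfolding eventually_within_openin[OF openin_pd pd_center[OF zc_in_cvec assms(2)]] .
 then obtain r1 where r1: "r1 > 0" "ALL z:pd m zc r1. z ~= zc --> dist (g z) (g zc) < 1"
  unfolding eventually_nb[OF zc_in_cvec] by blast
 define r2 where "r2 = min r r1"
 have r2: "r2 > 0" "r2 <= r" "r2 <= r1" using assms(2) r1 by (auto simp: r2_def)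
 have cs2: "cs m zc r2 g" by (rule cs_mono[OF cs pd_mono[OF r2(2)]]) simp
 have bd: "norm (g z) <= norm (g zc) + 1" if "z:cvec m" "!!i. i < m ==> norm (z i) <= r2 / 2" for z
 proof -
  have "norm (z i) < r1" if "i < m" for i
   using \<open>!!i. i < m ==> norm (z i) <= r2 / 2\<close>[OF that] r2 by linarith
  then have "z:pd m zc r1" using that by (auto simp: pd_def)
  then have "dist (g z) (g zc) <= 1" using r1(2) by (cases "z = zc") auto
  then show ?thesis using norm_triangle_sub[of "g z" "g zc"] by (simp add: dist_norm)
 qed
 obtain c where c: "!!mu. mu:mis m ==> norm (c mu) <= (norm (g zc) + 1) / (r2 / 2) ^ tdeg m mu"
  "!!z. z:pd m zc (r2 / 2) ==> ((%mu. c mu * mon m z mu) has_sum g z) (mis m)"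
  using cs_taylor[OF cs2, of "r2 / 2" "norm (g zc) + 1"] r2 bd by auto
 \<comment> \<open>The coefficients are bounded by powers of \<open>r2 / 2\<close>; absolute
   summability needs a strictly smaller radius.\<close>
 have "ps m (r2 / 4) c" by (rule ps_geometric_bound[OF c(1)]) (use r2 in auto)
 moreover have "pd m zc (r2 / 4) <= pd m zc (r2 / 2)" using r2 by (intro pd_mono) auto
 ultimately show ?thesis using c(2) r2 unfolding g_def
  by (intro exI[of _ c] exI[of _ "r2 / 4"]) auto
qed

lemma nb_shift:
 assumes "a:cvec m"
 shows "eventually P (nb m a) \<longleftrightarrow> eventually (%z. P (%i. z i + a i)) (nb m zc)"
proof -
 have "(ALL z:pd m a r. P z) \<longleftrightarrow> (ALL z:pd m zc r. P (%i. z i + a i))" for r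
 proof safe
  fix z assume "ALL z:pd m a r. P z" "z:pd m zc r"
  then show "P (%i. z i + a i)" using assms by (auto simp: pd_def cvec_def)
 next
  fix z assume *: "ALL z:pd m zc r. P (%i. z i + a i)" "z:pd m a r"
  then have "(%i. z i - a i):pd m zc r" using assms by (auto simp: pd_def cvec_def)
  then show "P z" using *(1) by force
 qed
 then show ?thesis unfolding eventually_nb[OF assms] eventually_nb[OF zc_in_cvec] by simp
qed

text \<open>Every nearby point is again the centre of a power series, so differentiability of a
  series at its centre gives differentiability near a.\<close>

lemma cs_hg:
 assumes "cs m a r h" "r > 0" "a:cvec m"
 shows "hg m a h"
proof -
 have "EX c. fdc m h b c" if b: "b:pd m a r" for b
 proof -
  have bc: "b:cvec m" using b by (simp add: pd_def)
  obtain r' where "r' > 0" "pd m b r' <= pd m a r" using pd_sub[OF b] by blast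
  from cs_series[OF cs_mono[OF assms(1) this(2) bc] this(1) bc]
  obtain c s where "s > 0" "ps m s c"
   "!!z. z:pd m zc s ==> ((%mu. c mu * mon m z mu) has_sum h (%i. z i + b i)) (mis m)" by blast
  from power_series_fdc[OF this(2,1,3)] obtain c where c: "fdc m (%z. h (%i. z i + b i)) zc c" by blast
  have "fdc m h b c" unfolding fdc_def nb_shift[OF bc] using c by (simp add: fdc_def)
  then show ?thesis by blast
 qed
 then show ?thesis unfolding hg_def eventually_nb[OF assms(3)] using assms(2) by blast
qed

definition hs :: "nat => cseq => (cseq => complex) => ser => bool" where
 "hs m a h c \<longleftrightarrow> (EX s>0. ps m s c) & eventually (%z. h (%i. z i + a i) = ev m c z) (nb m zc)"

lemma hs_ex:
 assumes "hg m a h" "a:cvec m"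
 shows "EX c. hs m a h c"
proof -
 obtain r where r: "r > 0" "!!z. z:pd m a r ==> EX c. fdc m h z c"
  using assms(1) unfolding hg_def eventually_nb[OF assms(2)] by blast
 from cs_series[OF fdc_cs[OF r(2)] r(1) assms(2)]
 obtain c s where c: "s > 0" "ps m s c"
  "!!z. z:pd m zc s ==> ((%mu. c mu * mon m z mu) has_sum h (%i. z i + a i)) (mis m)" by blast
 have "h (%i. z i + a i) = ev m c z" if "z:pd m zc s" for z
  using infsumI[OF c(3)[OF that]] by (simp add: ev_def)
 then show ?thesis unfolding hs_def eventually_nb[OF zc_in_cvec] using c(1,2) by blast
qed

lemma hs_hg:
 assumes "hs m a h c" "a:cvec m"
 shows "hg m a h"
proof -
 obtain s where s: "s > 0" "ps m s c" using assms by (auto simp: hs_def)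
 have 1: "hg m zc (ev m c)" by (rule cs_hg[OF cs_ev[OF s(2,1)] s(1)]) simp
 define G where "G z = (%i. if i < m then z i - a i else 0)" for z :: "nat => complex"
 have Ga: "G a = zc" by (auto simp: G_def)
 have "hg m a (%z. ev m c (G z))"
 proof (rule hg_compose[where h = "ev m c" and G = G and k = m])
  show "hg m (G a) (ev m c)" using 1 Ga by simp
  show "hg m a (%z. G z i)" if "i < m" for i
   using that by (simp add: G_def) (intro hg_diff hg_coord hg_const)
 qed (use assms in \<open>auto simp: G_def cvec_def\<close>)
 moreover have "eventually (%z. ev m c (G z) = h z) (nb m a)"
  unfolding nb_shift[OF assms(2)]
  using assms(1)[unfolded hs_def, THEN conjunct2] eventually_nb_cvec[of m zc]
 proof eventually_elim
  case (elim z)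
  have "G (%i. z i + a i) = z" using elim(2) assms(2) by (auto simp: G_def cvec_def)
  then show ?case using elim by simp
 qed
 ultimately show ?thesis by (rule hg_cong[rotated])
qed

text \<open>Split the Taylor series by whether the k-th variable occurs. The terms without it give
  the restriction to \<open>z k = a k\<close>; in the others one power is removed, an injective
  shift J of exponents that preserves summability.\<close>

lemma hg_hadamard:
 assumes h: "hg m a h" and a: "a:cvec m" and k: "k < m"
 shows "EX q. hg m a q & eventually (%z. h z - h (z(k := a k)) = (z k - a k) * q z) (nb m a)"
proof -
 obtain c where c: "hs m a h c" using hs_ex[OF h a] by blast
 obtain s where s: "s > 0" "ps m s c" using c by (auto simp: hs_def)
 define d where "d mu = c (mu(k := mu k + 1))" for mu
 define J where "J mu = mu(k := mu k + (1::nat))" for mu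
 have inj: "inj J"
 proof (rule injI)
  fix x y :: "nat => nat" assume J: "J x = J y"
  have "x i = y i" for i using fun_cong[OF J, of i] by (cases "i = k") (auto simp: J_def)
  then show "x = y" by blast
 qed
 have Jmis: "J ` mis m = {mu:mis m. mu k ~= 0}"
 proof (intro equalityI subsetI)
  fix mu :: "nat => nat" assume "mu:{mu:mis m. mu k ~= 0}"
  then have "mu = J (mu(k := mu k - 1))" "mu(k := mu k - 1):mis m" by (auto simp: J_def mis_def)
  then show "mu:J ` mis m" by blast
 qed (use k in \<open>auto simp: J_def mis_def\<close>)
 have tJ: "tdeg m (J mu) = Suc (tdeg m mu)" for mu
 proof -
  have "tdeg m (J mu) = (\<Sum>i<m. mu i + (if i = k then 1 else 0))" unfolding tdeg_def J_def by (intro sum.cong) auto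
  then show ?thesis using k by (simp add: sum.distrib tdeg_def)
 qed
 have mJ: "mon m z (J mu) = z k * mon m z mu" for z mu
 proof -
  have "mon m z (J mu) = (\<Prod>i<m. z i ^ mu i * (if i = k then z k else 1))" unfolding mon_def J_def by (intro prod.cong) auto
  then show ?thesis using k by (simp add: prod.distrib mon_def mult.commute)
 qed
 have psd: "ps m s d"
 proof -
  have "(%mu. norm (c mu) * s ^ tdeg m mu) summable_on (J ` mis m)"
   by (rule summable_on_subset_banach[OF s(2)[unfolded ps_def]]) (auto simp: Jmis)
  then have "((%mu. norm (c mu) * s ^ tdeg m mu) \<circ> J) summable_on mis m"
   by (subst (asm) summable_on_reindex) (use inj in \<open>auto intro: inj_on_subset\<close>)
  then have "(%mu. (norm (d mu) * s ^ tdeg m mu) * s) summable_on mis m"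
   by (simp add: o_def tJ d_def[symmetric] J_def[symmetric] mult_ac) (simp add: d_def J_def)
  then show ?thesis unfolding ps_def using s(1) by (simp add: summable_on_cmult_left')
 qed
 define q where "q z = ev m d (%i. z i - a i)" for z
 have hsq: "hs m a q d" unfolding hs_def q_def using psd s(1) by (auto intro!: always_eventually)
 have main: "ev m c z - ev m c (z(k := 0)) = z k * ev m d z" if z: "z:pd m zc s" for z
 proof -
  have zs: "!!i. i < m ==> norm (z i) <= s" "!!i. i < m ==> norm ((z(k := 0)) i) <= s"
   using z s(1) by (auto simp: pd_def intro: less_imp_le)
  have "((%mu. z k * (d mu * mon m z mu)) has_sum (z k * ev m d z)) (mis m)"
   by (intro has_sum_cmult_right ps_has_sum[OF psd]) (use zs in auto)
  then have "(((%mu. c mu * mon m z mu) \<circ> J) has_sum (z k * ev m d z)) (mis m)"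
   by (simp add: o_def mJ) (simp add: d_def J_def mult_ac)
  then have 1: "((%mu. c mu * mon m z mu) has_sum (z k * ev m d z)) {mu:mis m. mu k ~= 0}"
   unfolding Jmis[symmetric] by (subst has_sum_reindex) (use inj in \<open>auto intro: inj_on_subset\<close>)
  have z0: "mon m (z(k := 0)) mu = (if mu k = 0 then mon m z mu else 0)" for mu
  proof (cases "mu k = 0")
   case True
   then show ?thesis unfolding mon_def by (auto intro!: prod.cong)
  next
   case False
   then show ?thesis unfolding mon_def using k by (auto intro!: prod_zero bexI[of _ k])
  qed
  have "((%mu. c mu * mon m (z(k := 0)) mu) has_sum ev m c (z(k := 0))) (mis m)"
   by (rule ps_has_sum[OF s(2) zs(2)])
  then have 2: "((%mu. c mu * mon m z mu) has_sum ev m c (z(k := 0))) {mu:mis m. mu k = 0}"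
   by (subst (asm) has_sum_cong_neutral[where T = "{mu:mis m. mu k = 0}" and g = "%mu. c mu * mon m z mu"])
    (auto simp: z0)
  have "((%mu. c mu * mon m z mu) has_sum (z k * ev m d z + ev m c (z(k := 0)))) ({mu:mis m. mu k ~= 0} \<union> {mu:mis m. mu k = 0})"
   by (rule has_sum_Un_disjoint[OF 1 2]) auto
  moreover have "{mu:mis m. mu k ~= 0} \<union> {mu:mis m. mu k = 0} = mis m" by auto
  ultimately have "((%mu. c mu * mon m z mu) has_sum (z k * ev m d z + ev m c (z(k := 0)))) (mis m)"
   by simp
  from has_sum_unique[OF ps_has_sum[OF s(2) zs(1)] this] show ?thesis by simp
 qed
 obtain s1 where s1: "s1 > 0" "!!z. z:pd m zc s1 ==> h (%i. z i + a i) = ev m c z"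
  using c unfolding hs_def eventually_nb[OF zc_in_cvec] by blast
 have "eventually (%z. h z - h (z(k := a k)) = (z k - a k) * q z) (nb m a)"
  unfolding nb_shift[OF a] eventually_nb[OF zc_in_cvec]
 proof (intro exI conjI ballI)
  show "min s s1 > 0" using s s1 by simp
  fix z assume "z:pd m zc (min s s1)"
  then have z: "z:pd m zc s" "z:pd m zc s1" "z(k := 0):pd m zc s1"
   using s1(1) by (auto simp: pd_def cvec_def)
  have "(%i. z i + a i)(k := a k) = (%i. (z(k := 0)) i + a i)" by auto
  then show "h (%i. z i + a i) - h ((%i. z i + a i)(k := a k)) = ((%i. z i + a i) k - a k) * q (%i. z i + a i)"
   using main[OF z(1)] s1(2)[OF z(2)] s1(2)[OF z(3)] by (simp add: q_def)
 qed
 then show ?thesis using hs_hg[OF hsq a] by blast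
qed

section \<open>Contraction and exterior multiplication with operators as coefficients\<close>

type_synonym 'x form = "nat set => 'x => complex"

text \<open>The sign of moving the j-th basis vector past the smaller elements of S, as it occurs in
  interior and exterior products.\<close>

definition sg :: "nat => nat set => complex" where
 "sg j S = (-1) ^ card {k:S. k < j}"

lemma sg_sq [simp]: "sg j S * sg j S = 1"
 by (simp add: sg_def power_mult_distrib[symmetric])

lemma fin_below [simp]: "finite {k:S. k < (j::nat)}"
 by (rule finite_subset[of _ "{..<j}"]) auto

lemma sg_insert:
 assumes "k \<notin> S"
 shows "sg j (insert k S) = (if k < j then - sg j S else sg j S)"
proof (cases "k < j")
 case True
 then have "{l:insert k S. l < j} = insert k {l:S. l < j}" by auto
 then show ?thesis using True assms by (simp add: sg_def)
next
 case False
 then have "{l:insert k S. l < j} = {l:S. l < j}" by auto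
 then show ?thesis using False by (simp add: sg_def)
qed

lemma sg_swap:
 assumes "j \<notin> S" "k \<notin> S" "j ~= k"
 shows "sg j S * sg k (insert j S) = - (sg k S * sg j (insert k S))"
 using assms by (cases "j < k") (auto simp: sg_insert)

lemma sg_self_insert: "sg j (insert j S) = sg j S"
proof -
 have "{l:insert j S. l < j} = {l:S. l < j}" by auto
 then show ?thesis by (simp add: sg_def)
qed

text \<open>Forms in symbols indexed by J: a form assigns a coefficient to each subset S of J. ct is the
 contraction with a vector of operators, kt the exterior multiplication by one.\<close>

definition ct :: "nat set => (nat => ('x => complex) => ('x => complex)) => 'x form => 'x form" where
 "ct J T om = (%S x. \<Sum>j\<in>J - S. sg j S * T j (om (insert j S)) x)"

definition kt :: "nat set => (nat => ('x => complex) => ('x => complex)) => 'x form => 'x form" where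
 "kt J T om = (%S x. \<Sum>j\<in>S \<inter> J. sg j S * T j (om (S - {j})) x)"

definition lin :: "(('x => complex) => ('x => complex)) => bool" where
 "lin T \<longleftrightarrow> (ALL a b f g. T (%x. a * f x + b * g x) = (%x. a * T f x + b * T g x))"

lemma linD: "lin T ==> T (%x. a * f x + b * g x) = (%x. a * T f x + b * T g x)"
 by (simp add: lin_def)

lemma lin_0: "lin T ==> T (%x. 0) = (%x. 0)"
 using linD[of T 0 "%_. 0" 0 "%_. 0"] by simp

lemma lin_sum:
 assumes "lin T"
 shows "T (%x. \<Sum>k\<in>A. a k * f k x) = (%x. \<Sum>k\<in>A. a k * T (f k) x)"
proof (induction A rule: infinite_finite_induct)
 case (insert k A)
 have "T (%x. \<Sum>k\<in>insert k A. a k * f k x) = T (%x. a k * f k x + 1 * (\<Sum>k\<in>A. a k * f k x))"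
  using insert by simp
 then show ?case using insert by (simp add: linD[OF assms, of _ _ 1, simplified])
qed (simp_all add: lin_0[OF assms])

lemma lin_sum1:
 assumes "lin T"
 shows "T (%x. \<Sum>k\<in>A. f k x) = (%x. \<Sum>k\<in>A. T (f k) x)"
 using lin_sum[OF assms, where A = A and a = "%_. 1" and f = f] by simp

definition lc :: "complex => 'x form => complex => 'x form => 'x form" where
 "lc a om b et = (%S x. a * om S x + b * et S x)"

lemma ct_lc:
 assumes "!!j. j:J ==> lin (T j)"
 shows "ct J T (lc a om b et) = lc a (ct J T om) b (ct J T et)"
 unfolding ct_def lc_def using assms
 by (intro ext) (simp add: linD sum_distrib_left sum.distrib algebra_simps)

lemma kt_lc:
 assumes "!!j. j:J ==> lin (T j)"
 shows "kt J T (lc a om b et) = lc a (kt J T om) b (kt J T et)"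
 unfolding kt_def lc_def using assms
 by (intro ext) (simp add: linD sum_distrib_left sum.distrib algebra_simps)

lemma sum_pairs_swap_neg:
 fixes f g :: "nat => nat => complex"
 assumes "finite A" "!!j k. j:A ==> k:A ==> j ~= k ==> f j k = - g k j"
 shows "(\<Sum>j\<in>A. \<Sum>k\<in>A - {j}. f j k) = - (\<Sum>j\<in>A. \<Sum>k\<in>A - {j}. g j k)"
proof -
 have "(\<Sum>j\<in>A. \<Sum>k\<in>A - {j}. f j k) = (\<Sum>j\<in>A. \<Sum>k\<in>{k:A. j ~= k}. f j k)"
  by (intro sum.cong) auto
 also have "\<dots> = (\<Sum>k\<in>A. \<Sum>j\<in>{j:A. j ~= k}. f j k)"
  by (rule sum.swap_restrict) (use assms in auto)
 also have "\<dots> = (\<Sum>k\<in>A. \<Sum>j\<in>A - {k}. - g k j)"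
  using assms by (intro sum.cong) auto
 finally show ?thesis by (simp add: sum_negf)
qed

text \<open>Two indices can be removed in either order, with opposite signs by
  \<open>sg_swap\<close>. The pair j = k does not occur, hence commutation is asked for distinct
  indices only.\<close>

lemma ct_anticomm:
 assumes J: "finite J" and T: "!!j. j:J ==> lin (T j)" and U: "!!j. j:J ==> lin (U j)"
  and comm: "!!j k f. j:J ==> k:J ==> j ~= k ==> T j (U k f) = U k (T j f)"
 shows "ct J T (ct J U om) = (%S x. - ct J U (ct J T om) S x)"
proof (intro ext)
 fix S x
 have exp: "ct J T (ct J U om) S x = (\<Sum>j\<in>J - S. \<Sum>k\<in>(J - S) - {j}. sg j S * sg k (insert j S) * T j (U k (om (insert k (insert j S)))) x)"
  if "!!j. j:J ==> lin (T j)" for T U :: "nat => ('a => complex) => ('a => complex)"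
 proof -
  have "T j (ct J U om (insert j S)) x = (\<Sum>k\<in>J - insert j S. sg k (insert j S) * T j (U k (om (insert k (insert j S)))) x)"
   if "j:J" for j
   unfolding ct_def by (subst lin_sum[OF \<open>!!j. j:J ==> lin (T j)\<close>[OF that]]) simp
  moreover have "J - insert j S = (J - S) - {j}" for j by auto
  ultimately show ?thesis
   unfolding ct_def[of J T] by (intro sum.cong refl) (simp add: sum_distrib_left mult.assoc)
 qed
 show "ct J T (ct J U om) S x = - ct J U (ct J T om) S x"
  unfolding exp[of T U, simplified T, simplified] exp[of U T, simplified U, simplified]
 proof (rule sum_pairs_swap_neg)
  fix j k assume jk: "j:J - S" "k:J - S" "j ~= k"
  then have "sg j S * sg k (insert j S) = - (sg k S * sg j (insert k S))" by (intro sg_swap) auto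
  moreover have "T j (U k (om (insert k (insert j S)))) = U k (T j (om (insert j (insert k S))))"
   using comm jk by (simp add: insert_commute)
  ultimately show "sg j S * sg k (insert j S) * T j (U k (om (insert k (insert j S)))) x =
   - (sg k S * sg j (insert k S) * U k (T j (om (insert j (insert k S)))) x)" by simp
 qed (use J in auto)
qed

text \<open>The general form of Cartan's formula: terms in which one index is added and another
  removed cancel in sign. There remain, for each j, the two operators in the order dictated by
  whether j lies in S.\<close>

lemma ct_kt:
 assumes J: "finite J" and T: "!!j. j:J ==> lin (T j)" and P: "!!j. j:J ==> lin (P j)"
  and comm: "!!j k f. j:J ==> k:J ==> j ~= k ==> T j (P k f) = P k (T j f)"
 shows "ct J T (kt J P om) S x + kt J P (ct J T om) S x
   = (\<Sum>j\<in>J - S. T j (P j (om S)) x) + (\<Sum>j\<in>S \<inter> J. P j (T j (om S)) x)"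
proof -
 define R where "R j l = sg j S * sg l (insert j S) * T j (P l (om (insert j S - {l}))) x" for j l
 define R' where "R' l j = sg l S * sg j (S - {l}) * P l (T j (om (insert j (S - {l})))) x" for j l
 have "ct J T (kt J P om) S x = (\<Sum>j\<in>J - S. T j (P j (om S)) x + (\<Sum>l\<in>S \<inter> J. R j l))"
  unfolding ct_def
 proof (rule sum.cong[OF refl])
  fix j assume j: "j:J - S"
  have "T j (kt J P om (insert j S)) x = (\<Sum>l\<in>insert j S \<inter> J. sg l (insert j S) * T j (P l (om (insert j S - {l}))) x)"
   unfolding kt_def by (subst lin_sum[OF T]) (use j in auto)
  also have "insert j S \<inter> J = insert j (S \<inter> J)" using j by auto
  also have "(\<Sum>l\<in>insert j (S \<inter> J). sg l (insert j S) * T j (P l (om (insert j S - {l}))) x)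
   = sg j S * T j (P j (om S)) x + (\<Sum>l\<in>S \<inter> J. sg l (insert j S) * T j (P l (om (insert j S - {l}))) x)"
   using J j by (simp add: sg_self_insert)
  finally show "sg j S * T j (kt J P om (insert j S)) x = T j (P j (om S)) x + (\<Sum>l\<in>S \<inter> J. R j l)"
   unfolding R_def by (simp add: distrib_left sum_distrib_left mult.assoc[symmetric])
 qed
 moreover have "kt J P (ct J T om) S x = (\<Sum>l\<in>S \<inter> J. P l (T l (om S)) x + (\<Sum>j\<in>J - S. R' l j))"
  unfolding kt_def
 proof (rule sum.cong[OF refl])
  fix l assume l: "l:S \<inter> J"
  have "P l (ct J T om (S - {l})) x = (\<Sum>j\<in>J - (S - {l}). sg j (S - {l}) * P l (T j (om (insert j (S - {l})))) x)"
   unfolding ct_def by (subst lin_sum[OF P]) (use l in auto)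
  also have "J - (S - {l}) = insert l (J - S)" using l by auto
  also have "(\<Sum>j\<in>insert l (J - S). sg j (S - {l}) * P l (T j (om (insert j (S - {l})))) x)
   = sg l S * P l (T l (om S)) x + (\<Sum>j\<in>J - S. sg j (S - {l}) * P l (T j (om (insert j (S - {l})))) x)"
   using J l sg_self_insert[of l "S - {l}"] by (simp add: insert_absorb)
  finally show "sg l S * P l (ct J T om (S - {l})) x = P l (T l (om S)) x + (\<Sum>j\<in>J - S. R' l j)"
   unfolding R'_def by (simp add: distrib_left sum_distrib_left mult.assoc[symmetric])
 qed
 moreover have "R j l = - R' l j" if jl: "j:J - S" "l:S \<inter> J" for j l
 proof -
  have "insert j S - {l} = insert j (S - {l})" "insert l (S - {l}) = S" using jl by auto
  moreover have "T j (P l f) = P l (T j f)" for f using jl by (intro comm) auto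
  moreover have "sg j S * sg l (insert j S) = - (sg l S * sg j (S - {l}))"
  proof -
   have "sg j (insert l (S - {l})) = (if l < j then - sg j (S - {l}) else sg j (S - {l}))"
    by (rule sg_insert) simp
   moreover have "sg l (insert j S) = (if j < l then - sg l S else sg l S)"
    by (rule sg_insert) (use jl in auto)
   moreover have "insert l (S - {l}) = S" "j ~= l" using jl by auto
   ultimately show ?thesis by (auto simp: mult.commute)
  qed
  ultimately show ?thesis unfolding R_def R'_def by simp
 qed
 then have "(\<Sum>j\<in>J - S. \<Sum>l\<in>S \<inter> J. R j l) = - (\<Sum>j\<in>J - S. \<Sum>l\<in>S \<inter> J. R' l j)"
  by (simp add: sum_negf[symmetric])
 moreover have "(\<Sum>j\<in>J - S. \<Sum>l\<in>S \<inter> J. R' l j) = (\<Sum>l\<in>S \<inter> J. \<Sum>j\<in>J - S. R' l j)" by (rule sum.swap)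
 ultimately show ?thesis by (simp add: sum.distrib)
qed

section \<open>Formal power series\<close>

text \<open>On coefficient functions \<open>Xs\<close> is multiplication by the variable a,
  \<open>Ps\<close> the partial derivative, \<open>Zs\<close> the substitution of 0 for the
  variable, and \<open>Qs\<close> the quotient by the variable of what \<open>Zs\<close>
  drops.\<close>

definition Xs :: "nat => ser => ser" where
 "Xs a c = (%mu. if mu a = 0 then 0 else c (mu(a := mu a - 1)))"

definition Ps :: "nat => ser => ser" where
 "Ps a c = (%mu. of_nat (mu a + 1) * c (mu(a := mu a + 1)))"

definition Qs :: "nat => ser => ser" where
 "Qs a c = (%mu. c (mu(a := mu a + 1)))"

definition Zs :: "nat => ser => ser" where
 "Zs a c = (%mu. if mu a = 0 then c mu else 0)"

lemma lin_Xs: "lin (Xs a)" by (auto simp: lin_def Xs_def)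
lemma lin_Ps: "lin (Ps a)" by (auto simp: lin_def Ps_def algebra_simps)
lemma lin_Zs: "lin (Zs a)" by (auto simp: lin_def Zs_def)
lemma lin_Qs: "lin (Qs a)" by (auto simp: lin_def Qs_def)

lemma Xs_comm: "Xs a (Xs b c) = Xs b (Xs a c)"
proof (cases "a = b")
 case False
 then show ?thesis by (auto simp: Xs_def fun_eq_iff fun_upd_twist)
qed simp

lemma Xs_Ps_comm: "a ~= b ==> Xs a (Ps b c) = Ps b (Xs a c)"
 by (auto simp: Xs_def Ps_def fun_eq_iff fun_upd_twist)

lemma Xs_Ps: "Xs a (Ps a c) = (%mu. of_nat (mu a) * c mu)"
 by (auto simp: Xs_def Ps_def fun_eq_iff)

lemma Ps_Xs: "Ps a (Xs a c) = (%mu. of_nat (mu a + 1) * c mu)"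
 by (auto simp: Xs_def Ps_def fun_eq_iff)

lemma Zs_Xs_same: "Zs a (Xs a c) = (%_. 0)" by (auto simp: Zs_def Xs_def)

lemma Zs_Xs: "a ~= b ==> Zs a (Xs b c) = Xs b (Zs a c)" by (auto simp: Zs_def Xs_def)

lemma Zs_Qs: "c mu = Zs a c mu + Xs a (Qs a c) mu"
 by (simp add: Zs_def Qs_def Xs_def)

lemma Xs_inj: "Xs a c = Xs a d ==> c = d"
proof
 fix mu assume "Xs a c = Xs a d"
 then have "Xs a c (mu(a := mu a + 1)) = Xs a d (mu(a := mu a + 1))" by simp
 then show "c mu = d mu" by (simp add: Xs_def)
qed

abbreviation zf :: "'x form" where "zf \<equiv> %S x. 0"

definition neg :: "'x form => 'x form" where "neg om = (%S x. - om S x)"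

lemma neg_neg [simp]: "neg (neg om) = om" by (simp add: neg_def)
lemma neg_zf [simp]: "neg zf = zf" by (simp add: neg_def)
lemma neg_eq_zf [simp]: "neg om = zf \<longleftrightarrow> om = zf"
 by (metis neg_neg neg_zf)
lemma neg_lc: "neg om = lc (-1) om 0 zf" by (simp add: neg_def lc_def)

lemma ct_map:
 assumes A: "lin A" and comm: "!!j c. j:J ==> A (T j c) = T j (A c)"
 shows "ct J T (%S. A (om S)) = (%S. A (ct J T om S))"
 unfolding ct_def
 by (intro ext, subst lin_sum[OF A]) (auto simp: comm)

text \<open>The homogeneous component of degree d for a grading g of the exponents.\<close>

definition comp :: "((nat => nat) => nat) => nat => (nat => nat) form => (nat => nat) form" where
 "comp g d om = (%S mu. if g mu = d then om S mu else 0)"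

lemma comp_zf [simp]: "comp g d zf = zf" by (simp add: comp_def)
lemma comp_comp: "comp g d (comp g d om) = comp g d om" by (auto simp: comp_def fun_eq_iff)

lemma comp_ext: "(!!d. comp g d om = comp g d et) ==> om = et"
proof (intro ext)
 fix S mu assume "!!d. comp g d om = comp g d et"
 then have "comp g (g mu) om S mu = comp g (g mu) et S mu" by simp
 then show "om S mu = et S mu" by (simp add: comp_def)
qed

lemma comp_ct_Xs:
 assumes "!!j mu. j:J ==> mu (a j) ~= 0 ==> g mu = g (mu(a j := mu (a j) - 1)) + de"
 shows "comp g d (ct J (%j. Xs (a j)) om) = (if d < de then zf else ct J (%j. Xs (a j)) (comp g (d - de) om))"
proof (intro ext)
 fix S mu
 have "(if g mu = d then Xs (a j) (om S') mu else 0) = (if d < de then 0 else Xs (a j) (comp g (d - de) om S') mu)"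
  if "j:J" for j S'
  using assms[OF that, of mu] by (auto simp: Xs_def comp_def)
 then have "(\<Sum>j\<in>J - S. sg j S * (if g mu = d then Xs (a j) (om (insert j S)) mu else 0))
  = (\<Sum>j\<in>J - S. sg j S * (if d < de then 0 else Xs (a j) (comp g (d - de) om (insert j S)) mu))"
  by (intro sum.cong) auto
 then show "comp g d (ct J (%j. Xs (a j)) om) S mu =
  (if d < de then zf else ct J (%j. Xs (a j)) (comp g (d - de) om)) S mu"
  by (cases "g mu = d"; cases "d < de") (simp_all add: comp_def[of g d] ct_def)
qed

section \<open>Exactness for a generic matrix\<close>

text \<open>The coordinate t j i is the (j,i) entry of the generic matrix, y i the i-th entry of the generic
 vector. D i contracts with the i-th column; dl is the composite of all of these, whose values are the
 combinations of maximal minors; dY is the contraction with matrix times vector.\<close>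

locale gvars =
 fixes J I :: "nat set" and t :: "nat => nat => nat" and y :: "nat => nat"
 assumes J: "finite J"
  and t_inj: "!!j i j' i'. j:J ==> i:I ==> j':J ==> i':I ==> t j i = t j' i' ==> j = j' & i = i'"
  and y_inj: "inj_on y I"
  and ty: "!!j i k. j:J ==> i:I ==> k:I ==> t j i ~= y k"
begin

definition D :: "nat => (nat => nat) form => (nat => nat) form" where
 "D i om = ct J (%j. Xs (t j i)) om"

text \<open>The exterior derivative in the variables of column i. Since \<open>D i\<close> is the
  contraction with the Euler field of that column, the two together satisfy Cartan's
  formula.\<close>

definition K :: "nat => (nat => nat) form => (nat => nat) form" where
 "K i om = kt J (%j. Ps (t j i)) om"

text \<open>The polarization that replaces a variable of column i by the one of column k in the same
  row. It lowers the degree in column i by one, which is what the induction in \<open>BR\<close>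
  lives on.\<close>

definition Ls :: "nat => nat => ser => ser" where
 "Ls k i c = (%mu. \<Sum>j\<in>J. Xs (t j k) (Ps (t j i) c) mu)"

definition Lf :: "nat => nat => (nat => nat) form => (nat => nat) form" where
 "Lf k i om = (%S. Ls k i (om S))"

definition cdeg :: "nat => (nat => nat) => nat" where
 "cdeg i mu = (\<Sum>j\<in>J. mu (t j i))"

definition vdeg :: "nat list => (nat => nat) => nat" where
 "vdeg M mu = (\<Sum>i\<in>set M. mu (y i))"

definition fdeg :: "nat => (nat => nat) form => bool" where
 "fdeg r om \<longleftrightarrow> (ALL S. ~ (S <= J & card S = r) --> om S = (%_. 0))"

definition dl :: "nat list => (nat => nat) form => (nat => nat) form" where
 "dl M om = foldr D M om"

definition Y :: "nat => (nat => nat) form => (nat => nat) form" where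
 "Y i om = (%S. Xs (y i) (om S))"

primrec dY :: "nat list => (nat => nat) form => (nat => nat) form" where
 "dY [] om = zf"
| "dY (i # M) om = lc 1 (dY M om) 1 (Y i (D i om))"

lemma dl_simps [simp]: "dl [] om = om" "dl (i # M) om = D i (dl M om)"
 by (simp_all add: dl_def)

lemma dl_append: "dl (M @ N) om = dl M (dl N om)" by (simp add: dl_def)

lemma D_lc: "D i (lc a om b et) = lc a (D i om) b (D i et)"
 unfolding D_def by (rule ct_lc) (rule lin_Xs)

lemma K_lc: "K i (lc a om b et) = lc a (K i om) b (K i et)"
 unfolding K_def by (rule kt_lc) (rule lin_Ps)

lemma D_zf [simp]: "D i zf = zf"
 using D_lc[of i 0 zf 0 zf] by (simp add: lc_def)

lemma K_zf [simp]: "K i zf = zf"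
 using K_lc[of i 0 zf 0 zf] by (simp add: lc_def)

lemma D_neg: "D i (neg om) = neg (D i om)"
 unfolding neg_lc D_lc by simp

lemma dl_lc: "dl M (lc a om b et) = lc a (dl M om) b (dl M et)"
 by (induction M) (simp_all add: D_lc)

lemma dl_zf [simp]: "dl M zf = zf"
 by (induction M) auto

lemma D_anti: "D i (D k om) = neg (D k (D i om))"
 unfolding D_def neg_def
 by (rule ct_anticomm) (auto simp: J lin_Xs intro: Xs_comm)

lemma D_D [simp]: "D i (D i om) = zf"
proof (intro ext)
 fix S mu
 have "D i (D i om) S mu = - D i (D i om) S mu" using D_anti[of i i om] by (metis neg_def)
 then show "D i (D i om) S mu = 0" by simp
qed

lemma D_dl: "D k (dl M om) = (if even (length M) then dl M (D k om) else neg (dl M (D k om)))"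
 by (induction M) (auto simp: D_anti[of k] D_neg)

lemma D_dl_mem: "k:set M ==> D k (dl M om) = zf"
proof (induction M)
 case (Cons i M)
 show ?case
 proof (cases "k = i")
  case False
  then have "D k (dl M om) = zf" using Cons by simp
  then show ?thesis by (simp add: D_anti[of k i])
 qed simp
qed simp

lemma dl_remove1: "i:set M ==> dl M om = D i (dl (remove1 i M) om) \<or> dl M om = neg (D i (dl (remove1 i M) om))"
proof (induction M)
 case (Cons k M)
 show ?case
 proof (cases "k = i")
  case False
  then have "dl M om = D i (dl (remove1 i M) om) \<or> dl M om = neg (D i (dl (remove1 i M) om))"
   using Cons by simp
  then show ?thesis using False by (auto simp: D_anti[of k i] D_neg)
 qed simp
qed simp

lemma fdeg_zf [simp]: "fdeg r zf" by (simp add: fdeg_def)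

lemma fdeg_lc: "fdeg r om ==> fdeg r et ==> fdeg r (lc a om b et)"
 unfolding fdeg_def lc_def by (metis (no_types) mult_zero_right add_0)

lemma fdeg_comp: "fdeg r om ==> fdeg r (comp g d om)"
 unfolding fdeg_def comp_def by (auto simp: fun_eq_iff)

lemma fdeg_map: "lin A ==> fdeg r om ==> fdeg r (%S. A (om S))"
 unfolding fdeg_def by (simp add: lin_0)

lemma fdeg_D:
 assumes "fdeg (Suc r) om"
 shows "fdeg r (D i om)"
 unfolding fdeg_def
proof (intro allI impI)
 fix S assume S: "~ (S <= J & card S = r)"
 have "om (insert j S) = (%_. 0)" if "j:J - S" for j
 proof -
  have "~ (insert j S <= J & card (insert j S) = Suc r)"
  proof
   assume "insert j S <= J & card (insert j S) = Suc r"
   then have "S <= J" "card S = r" using that J finite_subset[of S J] by auto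
   then show False using S by simp
  qed
  then show ?thesis using assms by (simp add: fdeg_def)
 qed
 then show "D i om S = (%_. 0)"
  unfolding D_def ct_def by (simp add: lin_0[OF lin_Xs])
qed

lemma fdeg_dl: "fdeg (r + length M) om ==> fdeg r (dl M om)"
 by (induction M arbitrary: r) (auto intro: fdeg_D)

lemma fdeg_K:
 assumes "fdeg r om"
 shows "fdeg (Suc r) (K i om)"
 unfolding fdeg_def
proof (intro allI impI)
 fix S assume S: "~ (S <= J & card S = Suc r)"
 have "om (S - {j}) = (%_. 0)" if "j:S \<inter> J" for j
 proof -
  have "~ (S - {j} <= J & card (S - {j}) = r)"
  proof
   assume *: "S - {j} <= J & card (S - {j}) = r"
   then have "S <= J" using that by auto
   moreover have "card S = Suc (card (S - {j}))"
    using that \<open>S <= J\<close> J finite_subset[of S J] card_Suc_Diff1[of S j] by auto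
   ultimately show False using S * by simp
  qed
  then show ?thesis using assms by (simp add: fdeg_def)
 qed
 then show "K i om S = (%_. 0)"
  unfolding K_def kt_def by (simp add: lin_0[OF lin_Ps])
qed

lemma lin_Ls: "lin (Ls k i)"
 unfolding lin_def Ls_def
 by (simp add: linD[OF lin_Xs] linD[OF lin_Ps] sum.distrib sum_distrib_left)

text \<open>For distinct columns, multiplication and derivative commute, so the diagonal terms of
  \<open>ct_kt\<close> have the same form inside and outside S and sum to the polarization.\<close>

lemma D_K_neq:
 assumes "i:I" "k:I" "i ~= k"
 shows "K i (D k om) = lc 1 (Lf k i om) (-1) (D k (K i om))"
proof (intro ext)
 fix S mu
 have ne: "t j k ~= t l i" if "j:J" "l:J" for j l
  using t_inj[of j k l i] assms that by auto
 have "D k (K i om) S mu + K i (D k om) S mu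
  = (\<Sum>j\<in>J - S. Xs (t j k) (Ps (t j i) (om S)) mu) + (\<Sum>j\<in>S \<inter> J. Ps (t j i) (Xs (t j k) (om S)) mu)"
  unfolding D_def K_def
  by (rule ct_kt) (auto simp: J lin_Xs lin_Ps ne intro: Xs_Ps_comm)
 also have "(\<Sum>j\<in>S \<inter> J. Ps (t j i) (Xs (t j k) (om S)) mu) = (\<Sum>j\<in>S \<inter> J. Xs (t j k) (Ps (t j i) (om S)) mu)"
  by (intro sum.cong refl) (simp add: Xs_Ps_comm[OF ne])
 also have "(\<Sum>j\<in>J - S. Xs (t j k) (Ps (t j i) (om S)) mu) + \<dots> = Lf k i om S mu"
  unfolding Lf_def Ls_def by (subst sum.union_disjoint[symmetric]) (auto simp: J intro: sum.cong)
 finally show "K i (D k om) S mu = lc 1 (Lf k i om) (-1) (D k (K i om)) S mu"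
  by (simp add: lc_def algebra_simps)
qed

text \<open>Within one column the derivative of a product yields an extra 1 for each j in S. The
  resulting number is the degree in the column plus the degree of the form.\<close>

lemma D_K_eq:
 assumes "i:I"
 shows "D i (K i om) S mu + K i (D i om) S mu = of_nat (cdeg i mu + card (S \<inter> J)) * om S mu"
proof -
 have ne: "t j i ~= t l i" if "j:J" "l:J" "j ~= l" for j l
  using t_inj[of j i l i] assms that by auto
 have "D i (K i om) S mu + K i (D i om) S mu
  = (\<Sum>j\<in>J - S. Xs (t j i) (Ps (t j i) (om S)) mu) + (\<Sum>j\<in>S \<inter> J. Ps (t j i) (Xs (t j i) (om S)) mu)"
  unfolding D_def K_def
  by (rule ct_kt) (auto simp: J lin_Xs lin_Ps ne intro: Xs_Ps_comm)
 also have "\<dots> = (\<Sum>j\<in>J - S. of_nat (mu (t j i)) * om S mu) + (\<Sum>j\<in>S \<inter> J. of_nat (mu (t j i)) * om S mu + om S mu)"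
  by (simp add: Xs_Ps Ps_Xs distrib_right add.commute)
 also have "\<dots> = ((\<Sum>j\<in>J - S. of_nat (mu (t j i)) * om S mu) + (\<Sum>j\<in>S \<inter> J. of_nat (mu (t j i)) * om S mu)) + of_nat (card (S \<inter> J)) * om S mu"
  by (simp add: sum.distrib)
 also have "(\<Sum>j\<in>J - S. of_nat (mu (t j i)) * om S mu) + (\<Sum>j\<in>S \<inter> J. of_nat (mu (t j i)) * om S mu) = of_nat (cdeg i mu) * om S mu"
  unfolding cdeg_def of_nat_sum sum_distrib_right
  by (subst sum.union_disjoint[symmetric]) (auto simp: J intro: sum.cong)
 finally show ?thesis by (simp add: distrib_right)
qed

lemma Lf_D_neq:
 assumes "i:I" "k:I" "l:I" "l ~= i"
 shows "Lf k i (D l om) = D l (Lf k i om)"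
 unfolding Lf_def D_def
proof (rule ct_map[symmetric, OF lin_Ls])
 fix j c assume j: "j:J"
 have ne: "t j l ~= t j' i" if "j':J" for j' using t_inj[of j l j' i] assms that j by auto
 show "Ls k i (Xs (t j l) c) = Xs (t j l) (Ls k i c)"
  unfolding Ls_def lin_sum1[OF lin_Xs]
  by (intro ext sum.cong refl) (simp add: Xs_Ps_comm[OF ne, symmetric] Xs_comm)
qed

text \<open>The extra term arises when the derivative in column i hits the variable used by the
  contraction; it turns that variable into the one of column k.\<close>

lemma Lf_D_eq:
 assumes "i:I" "k:I"
 shows "Lf k i (D i om) = lc 1 (D i (Lf k i om)) 1 (D k om)"
proof -
 have *: "Ls k i (Xs (t j i) c) = (%mu. Xs (t j i) (Ls k i c) mu + Xs (t j k) c mu)" if j: "j:J" for j c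
 proof
  fix mu
  have ne: "t j i ~= t j' i" if "j':J - {j}" for j' using t_inj[of j i j' i] assms that j by auto
  have 1: "Ps (t j i) (Xs (t j i) c) = (%mu. 1 * Xs (t j i) (Ps (t j i) c) mu + 1 * c mu)"
   by (simp add: Xs_Ps Ps_Xs distrib_right add.commute)
  have "Ls k i (Xs (t j i) c) mu = Xs (t j k) (Ps (t j i) (Xs (t j i) c)) mu + (\<Sum>j'\<in>J - {j}. Xs (t j' k) (Ps (t j' i) (Xs (t j i) c)) mu)"
   unfolding Ls_def using J j by (simp add: sum.remove)
  also have "(\<Sum>j'\<in>J - {j}. Xs (t j' k) (Ps (t j' i) (Xs (t j i) c)) mu) = (\<Sum>j'\<in>J - {j}. Xs (t j i) (Xs (t j' k) (Ps (t j' i) c)) mu)"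
   by (intro sum.cong refl) (simp add: Xs_Ps_comm[OF ne, symmetric] Xs_comm)
  also have "Xs (t j k) (Ps (t j i) (Xs (t j i) c)) mu = Xs (t j i) (Xs (t j k) (Ps (t j i) c)) mu + Xs (t j k) c mu"
   unfolding 1 linD[OF lin_Xs] by (simp add: Xs_comm)
  finally have "Ls k i (Xs (t j i) c) mu = (\<Sum>j'\<in>J. Xs (t j i) (Xs (t j' k) (Ps (t j' i) c)) mu) + Xs (t j k) c mu"
   using J j by (simp add: sum.remove)
  then show "Ls k i (Xs (t j i) c) mu = Xs (t j i) (Ls k i c) mu + Xs (t j k) c mu"
   unfolding Ls_def lin_sum1[OF lin_Xs] .
 qed
 show ?thesis
 proof (intro ext)
  fix S mu
  have "Lf k i (D i om) S mu = (\<Sum>j\<in>J - S. sg j S * Ls k i (Xs (t j i) (om (insert j S))) mu)"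
   unfolding Lf_def D_def ct_def by (subst lin_sum[OF lin_Ls]) simp
  also have "\<dots> = (\<Sum>j\<in>J - S. sg j S * Xs (t j i) (Ls k i (om (insert j S))) mu + sg j S * Xs (t j k) (om (insert j S)) mu)"
   by (intro sum.cong refl) (simp add: * distrib_left)
  finally show "Lf k i (D i om) S mu = lc 1 (D i (Lf k i om)) 1 (D k om) S mu"
   by (simp add: lc_def D_def ct_def Lf_def sum.distrib)
 qed
qed

lemma comp_D_cdeg:
 assumes "i:I" "k:I"
 shows "comp (cdeg k) d (D i om) = (if i = k then (if d = 0 then zf else D i (comp (cdeg k) (d - 1) om)) else D i (comp (cdeg k) d om))"
proof -
 have "cdeg k mu = cdeg k (mu(t j i := mu (t j i) - 1)) + (if i = k then 1 else 0)"
  if j: "j:J" "mu (t j i) ~= 0" for j mu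
 proof (cases "i = k")
  case True
  have "cdeg k mu = (\<Sum>l\<in>J. (mu(t j i := mu (t j i) - 1)) (t l k) + (if l = j then 1 else 0))"
   unfolding cdeg_def using t_inj[of _ i j i] True assms j by (intro sum.cong refl) auto
  then show ?thesis using True J j by (simp add: cdeg_def sum.distrib)
 next
  case False
  have "t l k ~= t j i" if "l:J" for l using t_inj[of l k j i] assms j that False by auto
  then show ?thesis unfolding cdeg_def using False by (auto intro!: sum.cong)
 qed
 from comp_ct_Xs[of J "%j. t j i" "cdeg k" "if i = k then 1 else 0" d om, OF this]
 show ?thesis unfolding D_def by auto
qed

lemma comp_dl_cdeg:
 assumes "set M <= I" "k:I" "k \<notin> set M"
 shows "comp (cdeg k) d (dl M om) = dl M (comp (cdeg k) d om)"
 using assms by (induction M) (auto simp: comp_D_cdeg)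

text \<open>Formal series carry no convergence condition, so solutions for all homogeneous
  components can be glued coefficient by coefficient. As A raises the degree by one, the component
  of degree d of the solution is taken from the equation in degree d + 1.\<close>

lemma assemble:
 assumes A: "!!d om. comp g d (A om) = (if d = 0 then zf else A (comp g (d - 1) om))"
  and ex: "!!d. EX e. fdeg r e & comp g d b = A e"
 shows "EX e. fdeg r e & b = A e"
proof -
 obtain e where e: "!!d. fdeg r (e d)" "!!d. comp g d b = A (e d)" using ex by metis
 define E where "E = (%S mu. e (g mu + 1) S mu)"
 have E: "fdeg r E" using e(1) unfolding fdeg_def E_def by (metis (mono_tags, lifting))
 have cE: "comp g d E = comp g d (e (d + 1))" for d by (auto simp: comp_def E_def fun_eq_iff)
 have "b = A E"
 proof (rule comp_ext[of g])
  fix d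
  have "comp g d b = comp g d (A (e d))" using e(2)[of d] comp_comp[of g d b] by simp
  then show "comp g d b = comp g d (A E)" using cE[of "d - 1"] by (auto simp: A)
 qed
 then show ?thesis using E by blast
qed

definition Im :: "nat list => nat => (nat => nat) form set" where
 "Im M r = {om. EX e. fdeg (r + length M) e & om = dl M e}"

lemma Im_lc: "om:Im M r ==> et:Im M r ==> lc a om b et:Im M r"
proof -
 assume "om:Im M r" "et:Im M r"
 then obtain e e' where "fdeg (r + length M) e" "om = dl M e" "fdeg (r + length M) e'" "et = dl M e'"
  by (auto simp: Im_def)
 then show ?thesis unfolding Im_def using fdeg_lc dl_lc by (metis (mono_tags, lifting) mem_Collect_eq)
qed

lemma Im_zf: "zf:Im M r" unfolding Im_def using dl_zf fdeg_zf by (metis (mono_tags, lifting) mem_Collect_eq)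

text \<open>A part of the Buchsbaum--Rim complex is exact; the contracting homotopy is that of
 Cartan's formula for the Euler field of one column, and the error terms have smaller degree
 in that column.\<close>

theorem BR:
 assumes "distinct M" "set M <= I" "r >= 1" "fdeg r b" "!!i. i:set M ==> D i b = zf"
 shows "b:Im M r"
 using assms
proof (induction M arbitrary: r b)
 case Nil
 then show ?case by (auto simp: Im_def)
next
 case (Cons k M)
 have kI: "k:I" and MI: "set M <= I" and kM: "k \<notin> set M" and dM: "distinct M" using Cons.prems by auto
 have MIk: "l:I" "l ~= k" if "l:set M" for l using MI kM that by auto
 \<comment> \<open>Inside the induction over the columns, a second one over the degree d in the new
   column k.\<close>
 have hom: "b:Im (k # M) r"
  if "comp (cdeg k) d b = b" "fdeg r b" "!!i. i:set (k # M) ==> D i b = zf" for d b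
  using that
 proof (induction d arbitrary: b rule: less_induct)
  case (less d b)
  have "b:Im M r" by (rule Cons.IH) (use dM MI Cons.prems less.prems in auto)
  then obtain c where c: "fdeg (r + length M) c" "b = dl M c" by (auto simp: Im_def)
  \<comment> \<open>The polarized form \<open>Lf i k b\<close> is again killed by all columns and
    has degree d - 1 in column k, hence equals \<open>dl (k # M) e\<close>. Since
    \<open>b = dl M c\<close>, the combination w of \<open>Lf i k c\<close> and \<open>D k e\<close>
    is killed by \<open>dl M\<close>. Contracting w with the columns of M other than i gives a form
    of degree r + 1 killed by all of M, to which the outer induction applies; the part with
    \<open>D k e\<close> disappears after a second contraction with column k.\<close>
  have DL: "D k (dl (remove1 i M) (Lf i k c)):Im (k # M) r" if i: "i:set M" for i
  proof -
   have iI: "i:I" and ik: "i ~= k" using i MI kM by auto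
   have Lb: "Lf i k b = dl M (Lf i k c)"
   proof -
    have "Lf i k (dl N c) = dl N (Lf i k c)" if "set N <= set M" for N
     using that by (induction N) (simp_all add: Lf_D_neq[OF kI iI] MIk)
    then show ?thesis using c(2) by simp
   qed
   have fdL: "fdeg r (Lf i k b)" unfolding Lf_def by (rule fdeg_map[OF lin_Ls less.prems(2)])
   have "Lf i k b:Im (k # M) r"
   proof (cases "d = 0")
    case True
    \<comment> \<open>In degree 0 the variables of column k do not occur, and their derivatives
      vanish.\<close>
    have "Lf i k b = zf"
    proof (intro ext)
     fix S mu
     have "b S nu = 0" if "cdeg k nu ~= 0" for nu
      using less.prems(1) that True unfolding comp_def by (metis (no_types, lifting))
     moreover have "cdeg k (mu(t j k := mu (t j k) + 1)) ~= 0" if "j:J" for j mu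
      unfolding cdeg_def using J that by (auto intro!: bexI[of _ j])
     ultimately have "Ps (t j k) (b S) = (%_. 0)" if "j:J" for j
      using that by (auto simp: Ps_def)
     then show "Lf i k b S mu = 0" unfolding Lf_def Ls_def by (simp add: lin_0[OF lin_Xs])
    qed
    then show ?thesis using Im_zf by simp
   next
    case False
    show ?thesis
    proof (rule less.IH[of "d - 1"])
     show "comp (cdeg k) (d - 1) (Lf i k b) = Lf i k b"
     proof (intro ext)
      fix S mu
      have b0: "b S nu = 0" if "cdeg k nu ~= d" for nu
       using less.prems(1) that unfolding comp_def by (metis (no_types, lifting))
      have "Lf i k b S mu = 0" if "cdeg k mu ~= d - 1"
      proof -
       have "Xs (t j i) (Ps (t j k) (b S)) mu = 0" if j: "j:J" for j
       proof (cases "mu (t j i) = 0")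
        case nz: False
        define nu where "nu = mu(t j i := mu (t j i) - 1)"
        have "t l k ~= t j i" if "l:J" for l using t_inj[of l k j i] kI iI ik j that by auto
        then have "cdeg k nu = cdeg k mu" unfolding cdeg_def nu_def
         by (auto intro!: sum.cong)
        moreover have "cdeg k (nu(t j k := nu (t j k) + 1)) = cdeg k nu + 1"
        proof -
         have "cdeg k (nu(t j k := nu (t j k) + 1)) = (\<Sum>l\<in>J. nu (t l k) + (if l = j then 1 else 0))"
          unfolding cdeg_def using t_inj[of _ k j k] kI j by (intro sum.cong refl) auto
         then show ?thesis using J j by (simp add: cdeg_def sum.distrib)
        qed
        ultimately have "b S (nu(t j k := nu (t j k) + 1)) = 0"
         using \<open>cdeg k mu ~= d - 1\<close> False by (intro b0) auto
        then show ?thesis using nz by (simp add: Xs_def Ps_def nu_def)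
       qed (simp add: Xs_def)
       then show ?thesis by (simp add: Lf_def Ls_def)
      qed
      then show "comp (cdeg k) (d - 1) (Lf i k b) S mu = Lf i k b S mu" by (auto simp: comp_def)
     qed
     show "D l (Lf i k b) = zf" if l: "l:set (k # M)" for l
     proof (cases "l = k")
      case True
      have "Lf i k (D k b) = lc 1 (D k (Lf i k b)) 1 (D i b)" by (rule Lf_D_eq[OF kI iI])
      moreover have "Lf i k (D k b) = zf" using less.prems(3)[of k]
       by (simp add: Lf_def lin_0[OF lin_Ls])
      moreover have "D i b = zf" using less.prems(3) i by simp
      ultimately show ?thesis using True by (simp add: lc_def)
     next
      case False
      then have lI: "l:I" using l MI by auto
      have "D l (Lf i k b) = Lf i k (D l b)" using Lf_D_neq[OF kI iI lI False] by simp
      then show ?thesis using less.prems(3)[OF l] by (simp add: Lf_def lin_0[OF lin_Ls])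
     qed
    qed (use False fdL in auto)
   qed
   then obtain e where e: "fdeg (r + length (k # M)) e" "Lf i k b = dl (k # M) e" by (auto simp: Im_def)
   define s :: complex where "s = (if even (length M) then 1 else -1)"
   define w where "w = lc 1 (Lf i k c) (- s) (D k e)"
   have "fdeg (r + length M) (D k e)" using e(1) by (intro fdeg_D) simp
   then have fw: "fdeg (r + length M) w" unfolding w_def
    by (intro fdeg_lc) (simp_all add: Lf_def fdeg_map[OF lin_Ls c(1)])
   have "dl M w = zf"
   proof -
    have "dl M (Lf i k c) = D k (dl M e)" using Lb e(2) by simp
    also have "\<dots> = lc s (dl M (D k e)) 0 zf" unfolding D_dl s_def by (simp add: lc_def neg_def)
    finally show ?thesis unfolding w_def dl_lc by (simp add: lc_def)
   qed
   define N where "N = remove1 i M"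
   define x where "x = dl N w"
   have lenM: "length M = Suc (length N)" unfolding N_def using i
    using length_pos_if_in_set[OF i] by (simp add: length_remove1)
   have "x:Im M (r + 1)"
   proof (rule Cons.IH[OF dM MI])
    show "fdeg (r + 1) x" unfolding x_def using fw lenM by (intro fdeg_dl) simp
    show "D l x = zf" if l: "l:set M" for l
    proof (cases "l = i")
     case True
     have "dl M w = D i x \<or> dl M w = neg (D i x)" unfolding x_def N_def by (rule dl_remove1[OF i])
     then have "D i x = zf" using \<open>dl M w = zf\<close> neg_eq_zf[of "D i x"] by argo
     then show ?thesis using True by simp
    next
     case False
     then show ?thesis unfolding x_def N_def using l by (intro D_dl_mem) simp
    qed
   qed simp
   then obtain y where y: "fdeg (r + 1 + length M) y" "x = dl M y" by (auto simp: Im_def)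
   have "D k (dl N (D k e)) = zf"
    unfolding D_dl by auto
   then have "D k (dl N (Lf i k c)) = D k x"
    unfolding x_def w_def dl_lc D_lc by (simp add: lc_def)
   also have "\<dots> = dl (k # M) y" using y(2) by simp
   finally show ?thesis unfolding Im_def N_def using y(1) by auto
  qed
  \<comment> \<open>\<open>K k\<close> is pushed inwards through the contractions until it reaches
    c. Each exchange with a column i leaves a polarization term, which \<open>DL\<close> puts into
    the image.\<close>
  have step: "D k (dl A (K k (dl B c))):Im (k # M) r" if "A @ B = M" for A B
   using that
  proof (induction B arbitrary: A)
   case Nil
   have "fdeg (r + length (k # M)) (K k c)" using fdeg_K[OF c(1)] by simp
   then show ?case using Nil by (auto simp: Im_def)
  next
   case (Cons i B)
   have i: "i:set M" "i ~= k" "i:I" using Cons.prems kM MI by auto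
   have BM: "set B <= set M" using Cons.prems by auto
   have rem: "remove1 i M = A @ B"
   proof -
    have "i \<notin> set A" using Cons.prems[symmetric] dM by auto
    then show ?thesis using Cons.prems[symmetric] by (simp add: remove1_append)
   qed
   have LB: "Lf i k (dl N c) = dl N (Lf i k c)" if "set N <= set B" for N
    using that by (induction N) (simp_all add: Lf_D_neq[OF kI i(3)] MIk subsetD[OF BM])
   have "D k (dl A (K k (dl (i # B) c))) = D k (dl A (lc 1 (Lf i k (dl B c)) (-1) (D i (K k (dl B c)))))"
    using D_K_neq[OF kI i(3) i(2)[symmetric]] by simp
   also have "\<dots> = lc 1 (D k (dl (A @ B) (Lf i k c))) (-1) (D k (dl (A @ [i]) (K k (dl B c))))"
    by (simp add: dl_lc D_lc dl_append LB)
   also have "\<dots>:Im (k # M) r"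
    by (intro Im_lc) (use DL[OF i(1)] rem Cons.IH[of "A @ [i]"] Cons.prems in auto)
   finally show ?case .
  qed
  have DK: "D k (K k b):Im (k # M) r" using step[of "[]" M] c(2) by simp
  \<comment> \<open>Cartan's formula on a cycle: multiplication by d + r, which is invertible
    because r is at least 1.\<close>
  have "D k (K k b) = (%S mu. of_nat (d + r) * b S mu)"
  proof (intro ext)
   fix S mu
   have "D k (K k b) S mu + K k (D k b) S mu = of_nat (cdeg k mu + card (S \<inter> J)) * b S mu"
    by (rule D_K_eq[OF kI])
   moreover have "K k (D k b) = zf" using less.prems(3)[of k] by simp
   moreover have "of_nat (cdeg k mu + card (S \<inter> J)) * b S mu = of_nat (d + r) * b S mu"
   proof (cases "b S mu = 0")
    case False
    then have "S <= J & card S = r" using less.prems(2) unfolding fdeg_def by metis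
    moreover have "cdeg k mu = d" using less.prems(1) False unfolding comp_def by (metis (no_types, lifting))
    ultimately show ?thesis by (simp add: Int_absorb2)
   qed simp
   ultimately show "D k (K k b) S mu = of_nat (d + r) * b S mu" by simp
  qed
  then have "b = lc (1 / of_nat (d + r)) (D k (K k b)) 0 zf"
   using Cons.prems(3) by (simp add: lc_def del: of_nat_add)
  then show ?case using Im_lc[OF DK Im_zf] by metis
 qed
 have "EX e. fdeg (r + length (k # M)) e & b = dl (k # M) e"
 proof (rule assemble[where g = "cdeg k"])
  show "comp (cdeg k) d (dl (k # M) om) = (if d = 0 then zf else dl (k # M) (comp (cdeg k) (d - 1) om))" for d om
   using comp_D_cdeg[OF kI kI] comp_dl_cdeg[OF MI kI kM] by simp
  show "EX e. fdeg (r + length (k # M)) e & comp (cdeg k) d b = dl (k # M) e" for d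
  proof -
   have "comp (cdeg k) d b:Im (k # M) r"
   proof (rule hom[of d])
    show "D i (comp (cdeg k) d b) = zf" if i: "i:set (k # M)" for i
    proof -
     have iI: "i:I" and Di: "D i b = zf" using i MI kI Cons.prems(5) by auto
     show ?thesis using comp_D_cdeg[OF iI kI, of d b] comp_D_cdeg[OF iI kI, of "d + 1" b] Di
      by (auto split: if_splits)
    qed
   qed (simp_all add: comp_comp fdeg_comp Cons.prems)
   then show ?thesis by (auto simp: Im_def)
  qed
 qed
 then show ?case by (auto simp: Im_def)
qed

end

section \<open>Adjoining the generic vector\<close>

context gvars
begin

definition Zf :: "nat => (nat => nat) form => (nat => nat) form" where
 "Zf n om = (%S. Zs (y n) (om S))"

definition Qf :: "nat => (nat => nat) form => (nat => nat) form" where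
 "Qf n om = (%S. Qs (y n) (om S))"

lemma Y_lc: "Y k (lc a om b et) = lc a (Y k om) b (Y k et)"
 unfolding Y_def lc_def by (simp add: linD[OF lin_Xs])

lemma Y_zf [simp]: "Y k zf = zf" unfolding Y_def by (simp add: lin_0[OF lin_Xs])

lemma D_Y: "D i (Y k om) = Y k (D i om)"
 unfolding D_def Y_def by (rule ct_map[where A = "Xs (y k)"]) (rule lin_Xs Xs_comm)+

lemma Y_Y: "Y i (Y k om) = Y k (Y i om)"
 unfolding Y_def by (simp add: Xs_comm)

lemma dY_lc: "dY M (lc a om b et) = lc a (dY M om) b (dY M et)"
 by (induction M) (auto simp: D_lc Y_lc, auto simp: lc_def algebra_simps fun_eq_iff)

lemma dY_zf [simp]: "dY M zf = zf"
 by (induction M) (auto simp: lc_def)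

lemma D_dY: "D i (dY M om) = neg (dY M (D i om))"
proof (induction M)
 case (Cons k M)
 have "D i (Y k (D k om)) = neg (Y k (D k (D i om)))"
  unfolding D_Y D_anti[of i k] by (simp add: neg_lc Y_lc)
 then show ?case using Cons by (simp add: D_lc, simp add: lc_def neg_def)
qed simp

lemma Y_dY: "Y k (dY M om) = dY M (Y k om)"
 by (induction M) (auto simp: Y_lc D_Y Y_Y)

lemma dY_anti: "dY M (dY N om) = neg (dY N (dY M om))"
proof (induction M)
 case (Cons k M)
 have "Y k (D k (dY N om)) = neg (dY N (Y k (D k om)))"
  unfolding D_dY Y_dY[symmetric] by (simp add: neg_lc Y_lc)
 then show ?case using Cons by (simp add: dY_lc, simp add: lc_def neg_def)
qed simp

lemma dY_dY [simp]: "dY M (dY M om) = zf"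
proof (intro ext)
 fix S mu
 have "dY M (dY M om) S mu = - dY M (dY M om) S mu" using dY_anti[of M M om] by (metis neg_def)
 then show "dY M (dY M om) S mu = 0" by simp
qed

lemma fdeg_Y: "fdeg r om ==> fdeg r (Y k om)"
 unfolding Y_def by (rule fdeg_map[OF lin_Xs])

lemma fdeg_dY: "fdeg (Suc r) om ==> fdeg r (dY M om)"
 by (induction M) (auto intro: fdeg_lc fdeg_Y fdeg_D)

lemma Y_inj: "Y k om = Y k et ==> om = et"
 unfolding Y_def fun_eq_iff[of om] using Xs_inj by (metis (no_types))

lemma Zf_Qf: "om = lc 1 (Zf n om) 1 (Y n (Qf n om))"
 unfolding lc_def Zf_def Y_def Qf_def using Zs_Qs by (auto simp: fun_eq_iff)

lemma Zf_D: "n:I ==> i:I ==> Zf n (D i om) = D i (Zf n om)"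
 unfolding D_def Zf_def
 by (rule ct_map[symmetric, OF lin_Zs]) (metis Zs_Xs ty)

lemma Zf_lc: "Zf n (lc a om b et) = lc a (Zf n om) b (Zf n et)"
 unfolding Zf_def lc_def by (simp add: linD[OF lin_Zs])

lemma Zf_Y_same: "Zf n (Y n om) = zf"
 unfolding Zf_def Y_def by (simp add: Zs_Xs_same)

lemma Zf_zf [simp]: "Zf n zf = zf" unfolding Zf_def by (simp add: lin_0[OF lin_Zs])

lemma Zf_Y: "n:I ==> k:I ==> n ~= k ==> Zf n (Y k om) = Y k (Zf n om)"
 unfolding Zf_def Y_def using Zs_Xs y_inj by (metis inj_on_def)

lemma Zf_dY:
 assumes "n:I" "set M <= I" "n \<notin> set M"
 shows "Zf n (dY M om) = dY M (Zf n om)"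
 using assms by (induction M) (auto simp: Zf_lc Zf_Y Zf_D)

lemma vdeg_upd_t: "j:J ==> i:I ==> set M <= I ==> vdeg M (mu(t j i := x)) = vdeg M mu"
 unfolding vdeg_def using ty by (intro sum.cong) fastforce+

lemma vdeg_upd_y:
 assumes "k:I" "set M <= I"
 shows "vdeg M (mu(y k := mu (y k) + 1)) = vdeg M mu + (if k:set M then 1 else 0)"
proof -
 have "vdeg M (mu(y k := mu (y k) + 1)) = (\<Sum>i\<in>set M. mu (y i) + (if i = k then 1 else 0))"
  unfolding vdeg_def using y_inj assms by (intro sum.cong) (auto dest: inj_onD)
 then show ?thesis by (simp add: sum.distrib vdeg_def)
qed

lemma comp_D_vdeg: "i:I ==> set M <= I ==> comp (vdeg M) d (D i om) = D i (comp (vdeg M) d om)"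
 unfolding D_def using comp_ct_Xs[of J "%j. t j i" "vdeg M" 0 d om] by (simp add: vdeg_upd_t)

lemma comp_Y_vdeg:
 assumes "k:set M" "set M <= I"
 shows "comp (vdeg M) d (Y k om) = (if d = 0 then zf else Y k (comp (vdeg M) (d - 1) om))"
proof (intro ext)
 fix S mu
 show "comp (vdeg M) d (Y k om) S mu = (if d = 0 then zf else Y k (comp (vdeg M) (d - 1) om)) S mu"
 proof (cases "mu (y k) = 0")
  case False
  define nu where "nu = mu(y k := mu (y k) - 1)"
  have "mu = nu(y k := nu (y k) + 1)" using False by (auto simp: nu_def)
  then have "vdeg M mu = vdeg M nu + 1" using vdeg_upd_y[of k M nu] assms by auto
  then show ?thesis using False by (auto simp: comp_def Y_def Xs_def nu_def)
 qed (auto simp: comp_def Y_def Xs_def)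
qed

lemma comp_lc: "comp g d (lc a om b et) = lc a (comp g d om) b (comp g d et)"
 by (auto simp: comp_def lc_def fun_eq_iff)

lemma comp_dY_vdeg:
 assumes "set N <= set M" "set M <= I"
 shows "comp (vdeg M) d (dY N om) = (if d = 0 then zf else dY N (comp (vdeg M) (d - 1) om))"
 using assms
proof (induction N)
 case (Cons k N)
 have "comp (vdeg M) d (D k om) = D k (comp (vdeg M) d om)" for d
  using Cons.prems by (intro comp_D_vdeg) auto
 then show ?case using Cons by (auto simp: comp_lc comp_Y_vdeg, auto simp: lc_def)
qed simp

lemma comp_Qf:
 assumes "n:set M" "set M <= I"
 shows "comp (vdeg M) d (Qf n om) = Qf n (comp (vdeg M) (d + 1) om)"
 using vdeg_upd_y[of n M] assms by (auto simp: comp_def Qf_def Qs_def fun_eq_iff)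

lemma comp_Zf: "comp g d (Zf n om) = Zf n (comp g d om)"
 by (auto simp: comp_def Zf_def Zs_def fun_eq_iff)

text \<open>The variables y are independent over series in which they do not occur: the coefficient
  of the equation at an exponent with y i raised once sees only the contraction with column
  i.\<close>

lemma dY_degree_0:
 assumes "distinct M" "set M <= I" "comp (vdeg M) 0 b = b" "dY M b = zf" "i:set M"
 shows "D i b = zf"
proof (intro ext)
 fix S mu
 have hom: "comp (vdeg M) 0 (D k b) = D k b" if "k:set M" for k
  using comp_D_vdeg[of k M 0 b] assms that by auto
 show "D i b S mu = 0"
 proof (cases "vdeg M mu = 0")
  case False
  then show ?thesis using fun_cong[OF fun_cong[OF hom[OF assms(5)]], of S mu] by (simp add: comp_def)
 next
  case True
  then have 0: "mu (y k) = 0" if "k:set M" for k using that by (simp add: vdeg_def)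
  define nu where "nu = mu(y i := mu (y i) + 1)"
  have other: "Y k (D k b) S nu = 0" if k: "k:set M" "k ~= i" for k
  proof -
   have "y k ~= y i" using y_inj k assms(2,5) by (auto dest: inj_onD)
   then show ?thesis using 0[OF k(1)] by (simp add: Y_def Xs_def nu_def)
  qed
  have same: "Y i (D i b) S nu = D i b S mu" by (simp add: Y_def Xs_def nu_def)
  have "dY N b S nu = (if i:set N then D i b S mu else 0)" if "set N <= set M" "distinct N" for N
   using that by (induction N) (auto simp: lc_def same other intro!: other)
  from this[of M] show ?thesis using assms by simp
 qed
qed

text \<open>Exactness in positive degree e of the vector variables. Putting y n = 0 leaves the
  complex of the other columns, settled by induction; what remains is divisible by y n, and the
  quotient is a cycle of degree e - 1. The quotient of degree 0 is not a boundary in general, but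
  \<open>BR\<close> writes it as a full contraction, and its product with y n is a boundary.\<close>

theorem dY_exact:
 assumes "distinct M" "set M <= I" "r >= 1" "e >= 1" "fdeg r b" "comp (vdeg M) e b = b" "dY M b = zf"
 shows "EX c. fdeg (Suc r) c & b = dY M c"
 using assms
proof (induction M arbitrary: b e)
 case Nil
 have "b S mu = 0" for S mu
  using fun_cong[OF fun_cong[OF Nil.prems(6)], of S mu] Nil.prems(4) by (simp add: comp_def vdeg_def)
 then have "b = dY [] zf" by (simp add: fun_eq_iff)
 then show ?case using fdeg_zf by blast
next
 case (Cons n M)
 have nI: "n:I" and MI: "set M <= I" and nM: "n \<notin> set M" and dM: "distinct M" using Cons.prems by auto
 have setI: "set (n # M) <= I" using Cons.prems by simp
 show ?case using Cons.prems(4-)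
 proof (induction e arbitrary: b rule: less_induct)
  case (less e b)
  have "Zf n (dY (n # M) b) = dY M (Zf n b)"
   by (simp add: Zf_lc Zf_dY[OF nI MI nM] Zf_Y_same) (simp add: lc_def)
  then have z1: "dY M (Zf n b) = zf" using less.prems(4) by simp
  have z2: "comp (vdeg M) e (Zf n b) = Zf n b"
  proof (intro ext)
   fix S mu
   have "vdeg (n # M) mu = mu (y n) + vdeg M mu" unfolding vdeg_def using nM by simp
   then show "comp (vdeg M) e (Zf n b) S mu = Zf n b S mu"
    using fun_cong[OF fun_cong[OF less.prems(3)], of S mu] by (auto simp: comp_def Zf_def Zs_def)
  qed
  have "fdeg r (Zf n b)" unfolding Zf_def by (rule fdeg_map[OF lin_Zs less.prems(2)])
  from Cons.IH[OF dM MI Cons.prems(3) less.prems(1) this z2 z1]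
  obtain c0 where c0: "fdeg (Suc r) c0" "Zf n b = dY M c0" by blast
  \<comment> \<open>c0 comes from the columns M and may involve y n in any degree; its component of
    degree e - 1 still solves the equation and makes the quotient b' homogeneous.\<close>
  define c where "c = comp (vdeg (n # M)) (e - 1) c0"
  have fc: "fdeg (Suc r) c" unfolding c_def by (rule fdeg_comp[OF c0(1)])
  have cz: "Zf n b = dY M c"
  proof -
   have "Zf n b = comp (vdeg (n # M)) e (Zf n b)" by (simp add: comp_Zf less.prems(3))
   also have "\<dots> = dY M c" unfolding c0(2) c_def
    using comp_dY_vdeg[of M "n # M" e c0] setI less.prems(1) by (auto simp: set_subset_Cons)
   finally show ?thesis .
  qed
  define b' where "b' = lc 1 (Qf n b) (-1) (D n c)"
  have bb: "b = lc 1 (dY (n # M) c) 1 (Y n b')"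
  proof -
   have "b = lc 1 (dY M c) 1 (Y n (Qf n b))" using Zf_Qf[of b n] cz by simp
   then show ?thesis unfolding b'_def by (simp add: Y_lc, simp add: lc_def fun_eq_iff)
  qed
  have fb': "fdeg r b'" unfolding b'_def
   by (intro fdeg_lc fdeg_D fc) (simp add: Qf_def fdeg_map[OF lin_Qs less.prems(2)])
  have "Y n (dY (n # M) b') = dY (n # M) (Y n b')" by (rule Y_dY)
  also have "\<dots> = dY (n # M) (lc 1 b (-1) (dY (n # M) c))"
  proof -
   have "Y n b' = lc 1 b (-1) (dY (n # M) c)" using bb by (simp add: lc_def fun_eq_iff)
   then show ?thesis by simp
  qed
  also have "\<dots> = zf" unfolding dY_lc less.prems(4) dY_dY by (simp add: lc_def)
  finally have d0: "dY (n # M) b' = zf" using Y_inj[of n "dY (n # M) b'" zf] by simp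
  have cb': "comp (vdeg (n # M)) (e - 1) b' = b'"
  proof -
   have "comp (vdeg (n # M)) (e - 1) (Qf n b) = Qf n b"
    using comp_Qf[of n "n # M" "e - 1" b] setI less.prems(1,3) by simp
   moreover have "comp (vdeg (n # M)) (e - 1) (D n c) = D n c"
    unfolding c_def using comp_D_vdeg[OF nI setI] comp_comp by metis
   ultimately show ?thesis unfolding b'_def comp_lc by simp
  qed
  have "EX c'. fdeg (Suc r) c' & Y n b' = dY (n # M) c'"
  proof (cases "e = 1")
   case False
   then have e2: "e - 1 < e" "e - 1 >= 1" using less.prems(1) by auto
   from less.IH[OF e2 fb' cb' d0] obtain c' where "fdeg (Suc r) c'" "b' = dY (n # M) c'" by blast
   then show ?thesis using fdeg_Y[of "Suc r" c' n] Y_dY[of n "n # M" c'] by blast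
  next
   case True
   have Di: "D i b' = zf" if "i:set (n # M)" for i
    by (rule dY_degree_0[OF Cons.prems(1) setI _ d0 that]) (use cb' True in simp)
   obtain z where z: "fdeg (r + length (n # M)) z" "b' = dl (n # M) z"
    using BR[OF Cons.prems(1) setI Cons.prems(3) fb' Di] by (auto simp: Im_def)
   have "D k (dl M z) = zf" if "k:set M" for k using that by (rule D_dl_mem)
   then have "dY N (dl M z) = zf" if "set N <= set M" for N
    using that by (induction N) (auto simp: lc_def)
   \<comment> \<open>The contraction \<open>dl M z\<close> is killed by every column of M, so that
     \<open>dY\<close> retains the term of column n only.\<close>
   then have "Y n b' = dY (n # M) (dl M z)" unfolding z(2) by (simp add: lc_def)
   moreover have "fdeg (Suc r) (dl M z)" using z(1) by (intro fdeg_dl) simp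
   ultimately show ?thesis by blast
  qed
  then obtain c' where "fdeg (Suc r) c'" "Y n b' = dY (n # M) c'" by blast
  then have "b = dY (n # M) (lc 1 c 1 c')" "fdeg (Suc r) (lc 1 c 1 c')"
   using bb fc by (simp_all only: dY_lc fdeg_lc)
  then show ?case by blast
 qed
qed

text \<open>The product of h with a single variable y n suffices. Modulo y n the coefficients b form
  a cycle b0 for the other columns, and h equals \<open>D n b0\<close> up to the row ideal. By
  \<open>dY_exact\<close> the part of b0 of positive degree in y is a boundary and contributes rows;
  by \<open>BR\<close> the part of degree 0 is a contraction, and one more contraction with column n
  produces maximal minors.\<close>

theorem generic_residual_formal:
 assumes L: "distinct L" "set L <= I" "n:set L" and b: "fdeg 1 b" and h: "Y n h = dY L b"
 shows "EX c E. fdeg 1 c & fdeg (length L) E & h = lc 1 (dY L c) 1 (dl L E)"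
proof -
 define M where "M = remove1 n L"
 have M: "distinct M" "set M <= I" "n \<notin> set M" "n:I" "length L = Suc (length M)"
  unfolding M_def using L length_pos_if_in_set[OF L(3)] by (auto simp: length_remove1 notin_set_remove1 dest: set_remove1_subset[THEN subsetD])
 have dYL: "dY N om = lc 1 (dY (remove1 n N) om) 1 (Y n (D n om))" if "n:set N" for N om
  using that by (induction N) (auto simp: lc_def fun_eq_iff)
 have "Zf n (Y n h) = dY M (Zf n b)"
  unfolding h dYL[OF L(3)] M_def[symmetric] by (simp add: Zf_lc Zf_dY[OF M(4,2,3)] Zf_Y_same) (simp add: lc_def)
 then have z: "dY M (Zf n b) = zf" by (simp add: Zf_Y_same)
 define b0 where "b0 = Zf n b"
 define q where "q = Qf n b"
 have fb0: "fdeg 1 b0" unfolding b0_def Zf_def by (rule fdeg_map[OF lin_Zs b])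
 have fq: "fdeg 1 q" unfolding q_def Qf_def by (rule fdeg_map[OF lin_Qs b])
 have "Y n h = Y n (lc 1 (dY M q) 1 (D n b))"
 proof -
  have "dY M b = lc 1 (dY M b0) 1 (Y n (dY M q))"
   using arg_cong[OF Zf_Qf[of b n], of "dY M"] unfolding b0_def q_def by (simp add: dY_lc Y_dY)
  then show ?thesis unfolding h dYL[OF L(3)] M_def[symmetric] Y_lc using z b0_def by (simp add: lc_def)
 qed
 then have h1: "h = lc 1 (dY M q) 1 (D n b)" by (rule Y_inj)
 have "D n b = lc 1 (D n b0) 1 (Y n (D n q))"
  using arg_cong[OF Zf_Qf[of b n], of "D n"] unfolding b0_def q_def by (simp add: D_lc D_Y)
 then have h2: "h = lc 1 (dY L q) 1 (D n b0)"
  unfolding h1 dYL[OF L(3)] M_def[symmetric] by (simp add: lc_def fun_eq_iff)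
 define b1 where "b1 = comp (vdeg M) 0 b0"
 define b2 where "b2 = lc 1 b0 (-1) b1"
 have cz: "comp (vdeg M) d (dY M b0) = zf" for d using z b0_def by simp
 have "dY M (comp (vdeg M) d b0) = zf" for d
  using comp_dY_vdeg[of M M "Suc d" b0] cz[of "Suc d"] M(2) by simp
 note dz = this
 have "EX c. fdeg 2 c & b2 = dY M c"
 proof (rule assemble[where g = "vdeg M"])
  show "comp (vdeg M) d (dY M om) = (if d = 0 then zf else dY M (comp (vdeg M) (d - 1) om))" for d om
   using M(2) by (intro comp_dY_vdeg) auto
  show "EX c. fdeg 2 c & comp (vdeg M) d b2 = dY M c" for d
  proof (cases "d = 0")
   case True
   then have "comp (vdeg M) d b2 = dY M zf"
    unfolding b2_def comp_lc b1_def by (simp add: comp_comp lc_def)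
   then show ?thesis using fdeg_zf by blast
  next
   case False
   have "comp (vdeg M) d b1 = zf" unfolding b1_def comp_def using False by (auto simp: fun_eq_iff)
   then have "comp (vdeg M) d b2 = comp (vdeg M) d b0" unfolding b2_def comp_lc by (simp add: lc_def)
   then show ?thesis
    using dY_exact[OF M(1,2) _ _ fdeg_comp[OF fb0] comp_comp dz, of d] False by (simp add: numeral_2_eq_2)
  qed
 qed
 then obtain c where c: "fdeg 2 c" "b2 = dY M c" by blast
 have "D i b1 = zf" if "i:set M" for i
  by (rule dY_degree_0[OF M(1,2) _ _ that]) (simp_all add: b1_def comp_comp dz)
 then obtain E where E: "fdeg (1 + length M) E" "b1 = dl M E"
  using BR[OF M(1,2) order.refl, of b1] fdeg_comp[OF fb0] unfolding b1_def by (auto simp: Im_def)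
 have "b0 = lc 1 b1 1 (dY M c)"
 proof (intro ext)
  fix S x
  show "b0 S x = lc 1 b1 1 (dY M c) S x"
   using fun_cong[OF fun_cong[OF c(2)[unfolded b2_def]], of S x] by (simp add: lc_def diff_eq_eq add.commute)
 qed
 then have "D n b0 = lc 1 (D n (dl M E)) (-1) (dY M (D n c))"
  using E(2) by (simp add: D_lc D_dY, simp add: lc_def neg_def)
 also have "dY M (D n c) = dY L (D n c)"
  unfolding dYL[OF L(3)] M_def[symmetric] by (simp add: lc_def)
 finally have h3: "h = lc 1 (dY L (lc 1 q (-1) (D n c))) 1 (D n (dl M E))"
  unfolding h2 dY_lc by (simp add: lc_def fun_eq_iff)
 obtain s where s: "D n (dl M E) = dl L (lc s E 0 zf)"
 proof -
  have "dl L E = D n (dl M E) \<or> dl L E = neg (D n (dl M E))" unfolding M_def by (rule dl_remove1[OF L(3)])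
  then show ?thesis
  proof
   assume "dl L E = D n (dl M E)"
   then show ?thesis using that[of 1] by (simp add: lc_def)
  next
   assume "dl L E = neg (D n (dl M E))"
   then have "D n (dl M E) = dl L (lc (-1) E 0 zf)" unfolding dl_lc by (simp add: lc_def neg_def)
   then show ?thesis by (rule that)
  qed
 qed
 have "fdeg 1 (lc 1 q (-1) (D n c))" using c(1) by (intro fdeg_lc fq fdeg_D) (simp add: numeral_2_eq_2)
 moreover have "fdeg (length L) (lc s E 0 zf)" using E(1) M(5) by (intro fdeg_lc) simp_all
 ultimately show ?thesis using h3[unfolded s] by (intro exI conjI)
qed

end

section \<open>Weights of monomials and weighted norms\<close>

text \<open>Giving the i-th variable the i-th prime as weight separates monomials.\<close>

definition pr :: "nat => nat" where "pr i = enumerate {p. prime p} i"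

lemma prime_pr: "prime (pr i)"
 using enumerate_in_set[OF primes_infinite] unfolding pr_def by blast

lemma inj_pr: "inj pr"
 unfolding pr_def using strict_mono_enumerate[OF primes_infinite] strict_mono_imp_inj_on by blast

lemma pr_ge_2: "pr i >= 2"
 using prime_pr prime_ge_2_nat by blast

definition wt :: "nat => (nat => nat) => nat" where
 "wt m mu = (\<Prod>i<m. pr i ^ mu i)"

lemma multiplicity_wt: "i < m ==> multiplicity (pr i) (wt m mu) = mu i"
proof -
 assume i: "i < m"
 have inj: "inj_on pr {..<m}" using inj_pr by (rule inj_on_subset) simp
 have "wt m mu = (\<Prod>p\<in>pr ` {..<m}. p ^ mu (inv_into UNIV pr p))"
  unfolding wt_def by (subst prod.reindex[OF inj]) (simp add: inv_f_f[OF inj_pr])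
 also have "multiplicity (pr i) \<dots> = (if pr i:pr ` {..<m} then mu (inv_into UNIV pr (pr i)) else 0)"
  by (rule multiplicity_prod_prime_powers) (auto simp: prime_pr)
 finally show ?thesis using i by (simp add: inv_f_f[OF inj_pr])
qed

lemma wt_inj: "inj_on (wt m) (mis m)"
proof (rule inj_onI)
 fix mu nu assume *: "mu:mis m" "nu:mis m" "wt m mu = wt m nu"
 have "mu i = nu i" for i
 proof (cases "i < m")
  case True
  then show ?thesis using multiplicity_wt *(3) by metis
 next
  case False
  then show ?thesis using * by (simp add: mis_def)
 qed
 then show "mu = nu" by blast
qed

lemma wt_pos: "wt m mu > 0"
 unfolding wt_def using pr_ge_2 by (intro prod_pos) (metis gr0I not_numeral_le_zero zero_less_power)

lemma wt_add: "wt m (%i. mu i + nu i) = wt m mu * wt m nu"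
 by (simp add: wt_def power_add prod.distrib)

lemma wt_ge: "2 ^ tdeg m mu <= wt m mu"
proof -
 have "(\<Prod>i<m. 2 ^ mu i) <= (\<Prod>i<m. pr i ^ mu i)" by (intro prod_mono) (auto intro!: power_mono pr_ge_2)
 then show ?thesis by (simp add: wt_def tdeg_def power_sum)
qed

text \<open>A base for bounding the weight from above by a power whose exponent is the total degree,
  as 2 does from below. The two bounds compare the weighted norms with those on polydiscs; the added
  1 keeps the base positive when m = 0.\<close>

definition prb :: "nat => nat" where "prb m = 1 + (\<Sum>i<m. pr i)"

lemma wt_le: "wt m mu <= prb m ^ tdeg m mu"
proof -
 have "pr i <= prb m" if "i < m" for i
  using member_le_sum[of i "{..<m}" pr] that by (simp add: prb_def)
 then have "(\<Prod>i<m. pr i ^ mu i) <= (\<Prod>i<m. prb m ^ mu i)" by (intro prod_mono) (auto intro!: power_mono)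
 then show ?thesis by (simp add: wt_def tdeg_def power_sum)
qed

lemma finite_wt_le: "finite {mu:mis m. wt m mu <= N}"
 by (rule finite_imageD[of "wt m"]) (auto intro: inj_on_subset[OF wt_inj] finite_subset[of _ "{..N}"])

lemma wt_mono: "(!!i. ka i <= ga i) ==> wt m ka <= wt m ga"
 unfolding wt_def by (intro prod_mono) (auto intro!: power_increasing simp: Suc_leI prime_gt_0_nat prime_pr)

text \<open>The terms of the norm on the polydisc whose i-th radius is \<open>pr i\<close> to the
  power -si. Larger si means smaller polydiscs, and since \<open>wt\<close> is multiplicative, a
  shift of exponents changes the norm by a known factor.\<close>

definition wn :: "nat => nat => ser => (nat => nat) => real" where
 "wn m si c mu = norm (c mu) / real (wt m mu) ^ si"

lemma wn_nonneg [simp]: "wn m si c mu >= 0" by (simp add: wn_def)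

lemma ps_imp_wn:
 assumes "ps m s c" "s > 0"
 shows "EX si. wn m si c summable_on mis m"
proof -
 obtain si where si: "(1/2::real) ^ si < s" using assms(2) real_arch_pow_inv[of s "1/2"] by auto
 have "wn m si c mu <= norm (c mu) * s ^ tdeg m mu" for mu
 proof -
  have "real (2 ^ tdeg m mu) <= real (wt m mu)" using wt_ge by (rule of_nat_mono)
  then have "(2 ^ tdeg m mu) ^ si <= real (wt m mu) ^ si" by (intro power_mono) simp_all
  then have "1 / real (wt m mu) ^ si <= 1 / (2 ^ tdeg m mu) ^ si"
   by (intro divide_left_mono) (auto simp: wt_pos)
  also have "\<dots> = ((1/2) ^ si) ^ tdeg m mu"
   by (simp add: power_divide power_mult[symmetric] mult.commute)
  also have "\<dots> <= s ^ tdeg m mu" using si by (intro power_mono) auto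
  finally have "norm (c mu) * (1 / real (wt m mu) ^ si) <= norm (c mu) * s ^ tdeg m mu"
   by (intro mult_left_mono) auto
  then show ?thesis by (simp add: wn_def)
 qed
 then have "wn m si c summable_on mis m"
  by (intro summable_on_comparison_test[OF assms(1)[unfolded ps_def]]) auto
 then show ?thesis by blast
qed

lemma wn_imp_ps':
 assumes "wn m si c summable_on mis m"
 shows "ps m (1 / real (prb m) ^ si) c"
proof -
 define s where "s = 1 / real (prb m) ^ si"
 have pb: "real (prb m) > 0" by (simp add: prb_def add_pos_nonneg sum_nonneg)
 have "norm (c mu) * s ^ tdeg m mu <= wn m si c mu" for mu
 proof -
  have "real (wt m mu) <= real (prb m) ^ tdeg m mu"
   using of_nat_mono[OF wt_le[of m mu], where 'a = real] by simp
  then have "real (wt m mu) ^ si <= (real (prb m) ^ tdeg m mu) ^ si" by (intro power_mono) auto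
  then have "1 / (real (prb m) ^ tdeg m mu) ^ si <= 1 / real (wt m mu) ^ si"
   using pb by (intro divide_left_mono) (auto simp: wt_pos)
  moreover have "s ^ tdeg m mu = 1 / (real (prb m) ^ tdeg m mu) ^ si"
   by (simp add: s_def power_divide power_mult[symmetric] mult.commute)
  ultimately have "norm (c mu) * s ^ tdeg m mu <= norm (c mu) * (1 / real (wt m mu) ^ si)"
   by (intro mult_left_mono) auto
  then show ?thesis by (simp add: wn_def)
 qed
 moreover have "s > 0" using pb by (simp add: s_def)
 ultimately show ?thesis unfolding ps_def s_def[symmetric]
  by (intro summable_on_comparison_test[OF assms]) auto
qed

lemma wn_mono:
 assumes "wn m si c summable_on mis m" "si <= ta"
 shows "wn m ta c summable_on mis m"
proof (rule summable_on_comparison_test[OF assms(1)])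
 show "wn m ta c mu <= wn m si c mu" for mu
  unfolding wn_def using assms(2) wt_pos[of m mu]
  by (intro divide_left_mono power_increasing) (auto simp: Suc_leI)
qed simp

text \<open>Weights are integers, so a series without terms of weight up to N starts at N + 1 or
  later, and its norm multiplied by \<open>N ^ si\<close> decays like the si-th power of N / (N +
  1).\<close>

lemma tail_small:
 assumes sm: "wn m si0 c summable_on mis m" and N: "N >= 1"
  and c0: "!!mu. mu:mis m ==> wt m mu <= N ==> c mu = 0" and e: "e > 0"
 shows "EX ta>=si0. ALL si>=ta. real N ^ si * (\<Sum>\<^sub>\<infinity>mu\<in>mis m. wn m si c mu) <= e"
proof -
 define C where "C = (\<Sum>\<^sub>\<infinity>mu\<in>mis m. wn m si0 c mu)"
 have C0: "C >= 0" unfolding C_def by (intro infsum_nonneg) simp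
 define q where "q = real N / (real N + 1)"
 have q: "0 < q" "q < 1" using N by (auto simp: q_def)
 have bd: "real N ^ (si0 + k) * (\<Sum>\<^sub>\<infinity>mu\<in>mis m. wn m (si0 + k) c mu) <= real N ^ si0 * C * q ^ k" for k
 proof -
  have "wn m (si0 + k) c mu <= (1 / (real N + 1) ^ k) * wn m si0 c mu" if "mu:mis m" for mu
  proof (cases "wt m mu <= N")
   case True
   then show ?thesis using c0 that by (simp add: wn_def)
  next
   case False
   then have "real N + 1 <= real (wt m mu)" by linarith
   then have "(real N + 1) ^ k <= real (wt m mu) ^ k" by (intro power_mono) auto
   then have "1 / real (wt m mu) ^ k <= 1 / (real N + 1) ^ k"
    by (intro divide_left_mono) (auto simp: wt_pos)
   then have "wn m si0 c mu * (1 / real (wt m mu) ^ k) <= wn m si0 c mu * (1 / (real N + 1) ^ k)"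
    by (intro mult_left_mono) auto
   then show ?thesis by (simp add: wn_def power_add mult.commute)
  qed
  then have "(\<Sum>\<^sub>\<infinity>mu\<in>mis m. wn m (si0 + k) c mu) <= (\<Sum>\<^sub>\<infinity>mu\<in>mis m. (1 / (real N + 1) ^ k) * wn m si0 c mu)"
   using sm by (intro infsum_mono wn_mono[OF sm] summable_on_cmult_right) auto
  also have "\<dots> = (1 / (real N + 1) ^ k) * C"
   unfolding C_def by (rule infsum_cmult_right) (use sm in simp)
  finally have "real N ^ (si0 + k) * (\<Sum>\<^sub>\<infinity>mu\<in>mis m. wn m (si0 + k) c mu) <= real N ^ (si0 + k) * ((1 / (real N + 1) ^ k) * C)"
   by (intro mult_left_mono) auto
  also have "\<dots> = real N ^ si0 * C * q ^ k" by (simp add: q_def power_add power_divide)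
  finally show ?thesis .
 qed
 define B where "B = real N ^ si0 * C + 1"
 have B: "B > 0" unfolding B_def using C0 by (simp add: add_nonneg_pos)
 obtain K where K: "q ^ K < e / B" using q e B real_arch_pow_inv[of "e / B" q] by auto
 have "real N ^ si * (\<Sum>\<^sub>\<infinity>mu\<in>mis m. wn m si c mu) <= e" if "si >= si0 + K" for si
 proof -
  define k where "k = si - si0"
  have k: "si = si0 + k" "k >= K" using that by (auto simp: k_def)
  have "q ^ k <= q ^ K" using k q by (intro power_decreasing) auto
  then have qk: "q ^ k <= e / B" using K by simp
  have "real N ^ si0 * C * q ^ k <= B * q ^ k" using q by (intro mult_right_mono) (auto simp: B_def)
  also have "\<dots> <= B * (e / B)" using qk B by (intro mult_left_mono) auto
  also have "\<dots> = e" using B by simp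
  finally show ?thesis using bd[of k] k(1) by simp
 qed
 then show ?thesis by (intro exI[of _ "si0 + K"]) auto
qed

text \<open>A sequence of points tending to 0 at which each monomial takes as value a power of its
  weight; along it the term of least weight dominates.\<close>

lemma mon_wt: "mon m (%i. if i < m then 1 / of_nat (pr i) ^ si else 0) mu = 1 / of_nat (wt m mu) ^ si"
proof -
 have "mon m (%i. if i < m then 1 / of_nat (pr i) ^ si else 0) mu = (\<Prod>i<m. 1 / (of_nat (pr i) ^ mu i) ^ si :: complex)"
  unfolding mon_def by (intro prod.cong refl) (simp add: power_divide power_mult[symmetric] mult.commute)
 also have "\<dots> = 1 / (\<Prod>i<m. of_nat (pr i) ^ mu i) ^ si" by (simp add: prod_dividef prod_power_distrib)
 finally show ?thesis by (simp add: wt_def)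
qed

text \<open>Evaluate at the points of \<open>mon_wt\<close> for large si: by
  \<open>tail_small\<close> the other terms together amount to at most half of the term of least
  weight, which therefore cannot be cancelled.\<close>

theorem ps_unique:
 assumes ps: "ps m s c" "s > 0" and z: "eventually (%z. ev m c z = 0) (nb m zc)" and mu: "mu:mis m"
 shows "c mu = 0"
proof (rule ccontr)
 assume "c mu ~= 0"
 then obtain mu0 where mu0: "mu0:mis m" "c mu0 ~= 0" "!!nu. nu:mis m ==> c nu ~= 0 ==> wt m mu0 <= wt m nu"
  using ex_has_least_nat[of "%nu. nu:mis m & c nu ~= 0" mu "wt m"] mu by blast
 define N where "N = wt m mu0"
 have N: "N >= 1" using wt_pos[of m mu0] by (simp add: N_def)
 define d where "d = c(mu0 := 0)"
 obtain si0 where si0: "wn m si0 c summable_on mis m" using ps_imp_wn[OF ps] by blast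
 have dsm: "wn m si0 d summable_on mis m"
  by (rule summable_on_comparison_test[OF si0]) (auto simp: d_def wn_def)
 have d0: "d nu = 0" if "nu:mis m" "wt m nu <= N" for nu
 proof (rule ccontr)
  assume "d nu ~= 0"
  then have "nu ~= mu0" "c nu ~= 0" by (auto simp: d_def split: if_splits)
  then have "wt m nu = wt m mu0" using mu0(3)[OF that(1)] that(2) N_def by simp
  then show False using wt_inj \<open>nu ~= mu0\<close> that(1) mu0(1) by (metis inj_onD)
 qed
 obtain ta where ta: "ta >= si0" "!!si. si >= ta ==> real N ^ si * (\<Sum>\<^sub>\<infinity>mu\<in>mis m. wn m si d mu) <= norm (c mu0) / 2"
  using tail_small[OF dsm N d0, of "norm (c mu0) / 2"] mu0(2) by auto
 obtain r where r: "r > 0" "!!z. z:pd m zc r ==> ev m c z = 0"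
  using z unfolding eventually_nb[OF zc_in_cvec] by blast
 obtain k where k: "(1/2::real) ^ k < min r s" using r(1) ps(2) real_arch_pow_inv[of "min r s" "1/2"] by auto
 define si where "si = max ta k"
 have si: "si >= ta" "si >= k" "si >= si0" using ta(1) by (auto simp: si_def)
 define p :: "nat => complex" where "p = (%i. if i < m then 1 / of_nat (pr i) ^ si else 0)"
 have pn: "norm (p i) < min r s" if "i < m" for i
 proof -
  have "(2::real) ^ si <= real (pr i) ^ si" using pr_ge_2[of i] by (intro power_mono) auto
  then have "norm (p i) <= 1 / 2 ^ si" using that unfolding p_def
   by (simp add: norm_divide norm_power) (intro divide_left_mono, auto intro!: mult_pos_pos simp: prime_gt_0_nat prime_pr)
  also have "\<dots> = (1/2) ^ si" by (simp add: power_divide)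
  also have "\<dots> <= (1/2) ^ k" using si by (intro power_decreasing) auto
  finally show ?thesis using k by simp
 qed
 have "p:cvec m" by (auto simp: p_def cvec_def)
 then have ev0: "ev m c p = 0" using pn by (intro r(2)) (auto simp: pd_def)
 have monp: "mon m p nu = 1 / of_nat (wt m nu) ^ si" for nu unfolding p_def by (rule mon_wt)
 have "((%mu. c mu * mon m p mu) has_sum 0) (mis m)"
  using ps_has_sum[OF ps(1), of p] pn ev0 by (simp add: less_imp_le)
 moreover have "((%mu. c mu * mon m p mu) has_sum (\<Sum>mu\<in>{mu0}. c mu * mon m p mu)) {mu0}" by (rule has_sum_finite) simp
 ultimately have "((%mu. c mu * mon m p mu) has_sum (0 - c mu0 * mon m p mu0)) (mis m - {mu0})"
  using mu0(1) by (intro has_sum_Diff) auto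
 then have hsd: "((%mu. d mu * mon m p mu) has_sum (- c mu0 * mon m p mu0)) (mis m)"
  by (subst (asm) has_sum_cong_neutral[where T = "mis m" and g = "%mu. d mu * mon m p mu"]) (auto simp: d_def)
 have "(%mu. norm (d mu * mon m p mu)) = wn m si d"
  by (auto simp: monp wn_def norm_mult norm_divide norm_power)
 then have "((%mu. norm (d mu * mon m p mu)) has_sum (\<Sum>\<^sub>\<infinity>mu\<in>mis m. wn m si d mu)) (mis m)"
  using has_sum_infsum[OF wn_mono[OF dsm si(3)]] by simp
 from norm_has_sum_bound[OF this hsd]
 have "norm (- c mu0 * mon m p mu0) <= (\<Sum>\<^sub>\<infinity>mu\<in>mis m. wn m si d mu)" .
 then have "norm (c mu0) / real N ^ si <= (\<Sum>\<^sub>\<infinity>mu\<in>mis m. wn m si d mu)"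
  by (simp add: monp norm_mult norm_divide norm_power N_def)
 then have "norm (c mu0) <= real N ^ si * (\<Sum>\<^sub>\<infinity>mu\<in>mis m. wn m si d mu)"
  using N by (simp add: field_simps)
 also have "\<dots> <= norm (c mu0) / 2" by (rule ta(2)[OF si(1)])
 finally show False using mu0(2) by simp
qed

section \<open>Dickson's lemma, division with remainder and closedness of ideals\<close>

lemma dickson_aux:
 assumes IH: "!!A. A <= mis m ==> \<exists>B\<subseteq>A. finite B & (ALL a:A. EX b:B. ALL i. b i <= a i)"
  and C: "C <= mis (Suc m)"
 shows "\<exists>B\<subseteq>C. finite B & (ALL a:C. EX b:B. ALL i. i ~= m --> b i <= a i)"
proof -
 define P where "P = (%mu :: nat => nat. mu(m := 0))"
 have "P ` C <= mis m" using C by (auto simp: P_def mis_def)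
 from IH[OF this] obtain B' where B': "B' <= P ` C" "finite B'" "!!a. a:P ` C ==> EX b:B'. ALL i. b i <= a i" by blast
 obtain B where B: "B <= C" "finite B" "B' = P ` B"
  using finite_subset_image[OF B'(2,1)] by blast
 have "EX b:B. ALL i. i ~= m --> b i <= a i" if "a:C" for a
 proof -
  have "P a:P ` C" using that by blast
  from B'(3)[OF this] obtain b where b: "b:B" "ALL i. P b i <= P a i" unfolding B(3) by blast
  have "b i <= a i" if "i ~= m" for i using b(2)[rule_format, of i] that by (simp add: P_def)
  then show ?thesis using b(1) by blast
 qed
 then show ?thesis using B by blast
qed

text \<open>Finitely many members B0 of A dominate in all coordinates but the last. Where the last
  coordinate is at least N, their largest one, they dominate completely; below N there are finitely
  many slices, and in a slice the last coordinates agree.\<close>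

lemma dickson:
 "A <= mis m ==> \<exists>B\<subseteq>A. finite B & (ALL a:A. EX b:B. ALL i. b i <= a i)"
proof (induction m arbitrary: A)
 case 0
 then have "finite A" by (simp add: mis_0 finite_subset)
 then show ?case by blast
next
 case (Suc m)
 obtain B0 where B0: "B0 <= A" "finite B0" "!!a. a:A ==> EX b:B0. ALL i. i ~= m --> b i <= a i"
  using dickson_aux[OF Suc.IH Suc.prems] by blast
 define N where "N = Max (insert 0 ((%b. b m) ` B0))"
 have N: "b m <= N" if "b:B0" for b unfolding N_def using B0(2) that by (intro Max_ge) auto
 have "\<exists>B\<subseteq>{a:A. a m = k}. finite B & (ALL a:{a:A. a m = k}. EX b:B. ALL i. i ~= m --> b i <= a i)" for k
  by (rule dickson_aux[OF Suc.IH]) (use Suc.prems in auto)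
 then have "ALL k. EX B. B <= {a:A. a m = k} & finite B & (ALL a:{a:A. a m = k}. EX b:B. ALL i. i ~= m --> b i <= a i)" by blast
 from choice[OF this] obtain Bk where Bk': "ALL k. Bk k <= {a:A. a m = k} & finite (Bk k) &
  (ALL a:{a:A. a m = k}. EX b:Bk k. ALL i. i ~= m --> b i <= a i)" by blast
 then have Bk: "!!k. Bk k <= {a:A. a m = k}" "!!k. finite (Bk k)"
  "!!k a. a:A ==> a m = k ==> EX b:Bk k. ALL i. i ~= m --> b i <= a i" by blast+
 define B where "B = B0 \<union> (\<Union>k<N. Bk k)"
 have "B <= A" unfolding B_def using B0(1) Bk(1) by blast
 moreover have "finite B" unfolding B_def using B0(2) Bk(2) by blast
 moreover have "EX b:B. ALL i. b i <= a i" if a: "a:A" for a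
 proof (cases "a m < N")
  case True
  obtain b where b: "b:Bk (a m)" "!!i. i ~= m ==> b i <= a i" using Bk(3)[OF a refl] by blast
  have "b m = a m" using Bk(1) b(1) by blast
  then have "ALL i. b i <= a i" using b(2) by (metis order.refl)
  moreover have "b:B" using b(1) True by (auto simp: B_def)
  ultimately show ?thesis by blast
 next
  case False
  obtain b where b: "b:B0" "!!i. i ~= m ==> b i <= a i" using B0(3)[OF a] by blast
  have "b m <= a m" using N[OF b(1)] False by simp
  then have "ALL i. b i <= a i" using b(2) by metis
  then show ?thesis using b(1) by (auto simp: B_def)
 qed
 ultimately show ?case by blast
qed

definition conv :: "ser => ser => ser" where
 "conv F q ga = (\<Sum>ka | ALL i. ka i <= ga i. F ka * q (%i. ga i - ka i))"

lemma below_mis: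
 assumes "ga:mis m" "ALL i. ka i <= ga i"
 shows "ka:mis m"
proof -
 have "ka i = 0" if "i >= m" for i
 proof -
  have "ga i = 0" using assms(1) that by (simp add: mis_def)
  then show ?thesis using assms(2)[rule_format, of i] by simp
 qed
 then show ?thesis by (simp add: mis_def)
qed

lemma finite_below:
 assumes "ga:mis m"
 shows "finite {ka. ALL i. ka i <= ga i}"
proof (rule finite_subset[OF _ finite_wt_le[of m "wt m ga"]])
 show "{ka. ALL i. ka i <= ga i} <= {mu:mis m. wt m mu <= wt m ga}"
 proof
  fix ka assume "ka:{ka. ALL i. ka i <= ga i}"
  then have k: "ALL i. ka i <= ga i" by simp
  then show "ka:{mu:mis m. wt m mu <= wt m ga}"
   using below_mis[OF assms k] wt_mono[of ka ga m] by simp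
 qed
qed

lemma mon_add: "mon m z (%i. mu i + nu i) = mon m z mu * mon m z nu"
 by (simp add: mon_def power_add prod.distrib)

lemma bij_conv: "bij_betw (%(ka, de). (%i. ka i + de i, ka)) (mis m \<times> mis m) (SIGMA ga:mis m. {ka. ALL i. ka i <= ga i})"
proof (rule bij_betwI[where g = "%(ga, ka). (ka, %i. ga i - ka i)"])
 show "(%(ga, ka). (ka, %i. ga i - ka i)):(SIGMA ga:mis m. {ka. ALL i. ka i <= ga i}) \<rightarrow> mis m \<times> mis m"
 proof (intro funcsetI)
  fix x assume "x:(SIGMA ga:mis m. {ka. ALL i. ka i <= ga i})"
  then obtain ga ka where x: "x = (ga, ka)" and g: "ga:mis m" and k: "ALL i. ka i <= ga i" by auto
  have "(%i. ga i - ka i):mis m" using g by (simp add: mis_def)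
  then show "(case x of (ga, ka) => (ka, %i. ga i - ka i)):mis m \<times> mis m"
   using below_mis[OF g k] x by simp
 qed
qed (auto simp: mis_def)

text \<open>Cauchy's product: the double series converges absolutely, and \<open>bij_conv\<close>
  groups its terms by the sum of the exponents.\<close>

lemma has_sum_conv:
 assumes F: "ps m s F" and q: "ps m s q" and z: "!!i. i < m ==> norm (z i) <= s"
 shows "((%ga. conv F q ga * mon m z ga) has_sum (ev m F z * ev m q z)) (mis m)"
proof -
 define f where "f = (%(ka, de). (F ka * mon m z ka) * (q de * mon m z de))"
 have in1: "((%de. f (ka, de)) has_sum (F ka * mon m z ka * ev m q z)) (mis m)" for ka
  unfolding f_def prod.case by (intro has_sum_cmult_right ps_has_sum[OF q z])
 have out: "((%ka. F ka * mon m z ka * ev m q z) has_sum (ev m F z * ev m q z)) (mis m)"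
  by (intro has_sum_cmult_left ps_has_sum[OF F z])
 have "(%x. norm (f x)) summable_on (mis m \<times> mis m)"
 proof (rule summable_on_SigmaI[where g = "%ka. norm (F ka * mon m z ka) * (\<Sum>\<^sub>\<infinity>de\<in>mis m. norm (q de * mon m z de))"])
  show "((%de. norm (f (ka, de))) has_sum (norm (F ka * mon m z ka) * (\<Sum>\<^sub>\<infinity>de\<in>mis m. norm (q de * mon m z de)))) (mis m)" for ka
   unfolding f_def prod.case norm_mult[of "F ka * mon m z ka"]
   by (intro has_sum_cmult_right has_sum_infsum ps_abs_summable[OF q z])
  show "(%ka. norm (F ka * mon m z ka) * (\<Sum>\<^sub>\<infinity>de\<in>mis m. norm (q de * mon m z de))) summable_on mis m"
   by (intro summable_on_cmult_left ps_abs_summable[OF F z])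
 qed simp
 then have "f summable_on (mis m \<times> mis m)" by (rule abs_summable_summable)
 then have "(f has_sum (ev m F z * ev m q z)) (mis m \<times> mis m)"
  by (rule has_sum_SigmaI[OF in1 out])
 moreover define f' where "f' = (%(ga, ka). F ka * q (%i. ga i - ka i) * mon m z ga)"
 have "f = (%x. f' ((%(ka, de). (%i. ka i + de i, ka)) x))"
  by (rule ext) (simp add: f_def f'_def mon_add split: prod.splits)
 ultimately have hs: "(f' has_sum (ev m F z * ev m q z)) (SIGMA ga:mis m. {ka. ALL i. ka i <= ga i})"
  using has_sum_reindex_bij_betw[OF bij_conv, of f' m "ev m F z * ev m q z"] by simp
 show ?thesis
 proof (rule has_sum_SigmaD[OF hs])
  fix ga assume "ga:mis m"
  then show "((%ka. f' (ga, ka)) has_sum (conv F q ga * mon m z ga)) {ka. ALL i. ka i <= ga i}"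
   by (intro has_sum_finiteI finite_below) (auto simp: f'_def conv_def sum_distrib_right)
 qed
qed

lemma wt_diff: "ALL i. ka i <= ga i ==> wt m (%i. ga i - ka i) * wt m ka = wt m ga"
 unfolding wt_add[symmetric] by simp

text \<open>The quotients are found by recursion on the weight; summability follows by absorbing the tails of the divisors,
 which are small in the norms with large exponent.\<close>

theorem division:
 assumes B: "finite B" "B <= mis m"
  and F: "!!be. be:B ==> wn m si1 (F be) summable_on mis m" "!!be. be:B ==> F be be = 1"
   "!!be ka. be:B ==> ka:mis m ==> wt m ka < wt m be ==> F be ka = 0"
  and h: "wn m si1 h summable_on mis m"
 shows "EX si q r. (ALL be:B. wn m si (q be) summable_on mis m) & wn m si r summable_on mis m &
  (ALL ga:mis m. h ga = (\<Sum>be\<in>B. conv (F be) (q be) ga) + r ga) &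
  (ALL ga:mis m. (EX be:B. ALL i. be i <= ga i) --> r ga = 0)"
proof -
 \<comment> \<open>One divisor is fixed for every exponent that has any, so that each coefficient
   goes into exactly one quotient.\<close>
 define ch where "ch ga be \<longleftrightarrow> be:B & (ALL i. be i <= ga i) & (SOME be. be:B & (ALL i. be i <= ga i)) = be"
  for ga be :: "nat => nat"
 have ch_unique: "be = be'" if "ch ga be" "ch ga be'" for ga be be' using that by (simp add: ch_def)
 have ch_ex: "EX be. ch ga be" if "EX be:B. ALL i. be i <= ga i" for ga
 proof -
  have "EX be. be:B & (ALL i. be i <= ga i)" using that by blast
  from someI_ex[OF this] show ?thesis unfolding ch_def by blast
 qed
 define Kset where "Kset ga be = {ka. (ALL i. ka i <= ga i) & wt m be < wt m ka}" for ga be :: "nat => nat"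
 \<comment> \<open>A term of F be at ka contributes to ga through the quotient at ga - ka;
   \<open>sh ga ka be\<close> is the exponent at which the same term of the quotient meets the
   leading monomial of F be. It has smaller weight than ga, since ka is heavier than be.\<close>
 define sh where "sh ga ka be = (%i. ga i - ka i + be i)" for ga ka be :: "nat => nat"
 define H where "H g ga = h ga - (\<Sum>be\<in>B. \<Sum>ka\<in>Kset ga be. F be ka * (if ch (sh ga ka be) be then g (sh ga ka be) else 0))"
  for g ga
 \<comment> \<open>G ga is what remains of h ga after the contributions of quotient terms found at
   smaller weights. It is the coefficient of the chosen quotient if ga has a divisor, and of the
   remainder otherwise.\<close>
 define G where "G = wfrec (Wellfounded.measure (wt m)) H"
 have wt_sh: "wt m (sh ga ka be) * wt m ka = wt m ga * wt m be" if "ka:Kset ga be" for ga ka be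
 proof -
  have "wt m (sh ga ka be) = wt m (%i. ga i - ka i) * wt m be" unfolding sh_def by (rule wt_add)
  then show ?thesis using wt_diff[of ka ga m] that by (simp add: Kset_def mult_ac)
 qed
 have sh_less: "wt m (sh ga ka be) < wt m ga" if "ka:Kset ga be" for ga ka be
 proof (rule ccontr)
  assume "~ wt m (sh ga ka be) < wt m ga"
  then have "wt m ga * wt m be < wt m (sh ga ka be) * wt m ka"
   using that wt_pos[of m] unfolding Kset_def
   by (intro mult_le_less_imp_less) (auto simp: not_less)
  then show False using wt_sh[OF that] by simp
 qed
 have G: "G ga = h ga - (\<Sum>be\<in>B. \<Sum>ka\<in>Kset ga be. F be ka * (if ch (sh ga ka be) be then G (sh ga ka be) else 0))" for ga
 proof -
  have "G ga = H (cut G (Wellfounded.measure (wt m)) ga) ga"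
   unfolding G_def by (rule wfrec[OF wf_measure])
  also have "\<dots> = H G ga"
   unfolding H_def
   by (intro arg_cong2[where f = "(-)"] refl sum.cong) (simp add: cut_apply sh_less)
  finally show ?thesis by (simp add: H_def)
 qed
 define F' where "F' be ka = (if wt m ka <= wt m be then 0 else F be ka)" for be ka
 have F'sm: "wn m si1 (F' be) summable_on mis m" if "be:B" for be
  by (rule summable_on_comparison_test[OF F(1)[OF that]]) (auto simp: F'_def wn_def)
 \<comment> \<open>F' is the divisor without its leading term. The bound 1/2 is enough for all
   divisors together, because each exponent is assigned to only one of them.\<close>
 have "ALL be:B. EX ta>=si1. ALL si>=ta. real (wt m be) ^ si * (\<Sum>\<^sub>\<infinity>mu\<in>mis m. wn m si (F' be) mu) <= 1/2"
 proof
  fix be assume "be:B"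
  then show "EX ta>=si1. ALL si>=ta. real (wt m be) ^ si * (\<Sum>\<^sub>\<infinity>mu\<in>mis m. wn m si (F' be) mu) <= 1/2"
   using wt_pos[of m be] by (intro tail_small F'sm) (auto simp: F'_def Suc_leI)
 qed
 from bchoice[OF this] obtain ta where ta: "!!be si. be:B ==> si >= ta be ==> real (wt m be) ^ si * (\<Sum>\<^sub>\<infinity>mu\<in>mis m. wn m si (F' be) mu) <= 1/2"
  by blast
 define si where "si = Max (insert si1 (ta ` B))"
 have si: "si >= si1" "!!be. be:B ==> si >= ta be" unfolding si_def using B(1) by auto
 have hsm: "wn m si h summable_on mis m" by (rule wn_mono[OF h si(1)])
 define hn where "hn = (\<Sum>\<^sub>\<infinity>mu\<in>mis m. wn m si h mu)"
 \<comment> \<open>An a priori estimate: the sum over A is at most hn plus half of itself. The sets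
   A contain all exponents up to a given weight, so the recursion never leaves them, and being
   finite they allow the half to be subtracted.\<close>
 have bound: "(\<Sum>ga\<in>A. wn m si G ga) <= 2 * hn" if A: "A = {ga:mis m. wt m ga <= N}" for A N
 proof -
  have finA: "finite A" unfolding A by (rule finite_wt_le)
  have subA: "A <= mis m" unfolding A by auto
  define g where "g be nu = (if ch nu be then wn m si G nu else 0)" for be nu
  have g0: "g be nu >= 0" for be nu by (simp add: g_def)
  have gsum: "(\<Sum>be\<in>B. g be nu) <= wn m si G nu" for nu
  proof (cases "EX be. ch nu be")
   case True
   then obtain be0 where b0: "ch nu be0" by blast
   have "(\<Sum>be\<in>B. g be nu) = (\<Sum>be\<in>B. if be = be0 then wn m si G nu else 0)"
    by (intro sum.cong refl) (use b0 ch_unique in \<open>auto simp: g_def\<close>)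
   then show ?thesis using B(1) by simp
  qed (simp add: g_def)
  \<comment> \<open>The pairs (ga, ka) are reindexed injectively by (ka,
    \<open>sh ga ka be\<close>); this majorizes the double sum by a product of two sums over
    A.\<close>
  have one: "(\<Sum>ga\<in>A. \<Sum>ka\<in>Kset ga be. (real (wt m be) ^ si * wn m si (F' be) ka) * g be (sh ga ka be))
    <= 1/2 * (\<Sum>nu\<in>A. g be nu)" if be: "be:B" for be
  proof -
   define U where "U = (%(ka, nu). (real (wt m be) ^ si * wn m si (F' be) ka) * g be nu)"
   define phi where "phi = (%(ga, ka). (ka, sh ga ka be))"
   have finK: "finite (Kset ga be)" if "ga:A" for ga
    using finite_below[of ga m] that subA unfolding Kset_def by (auto intro: finite_subset[rotated])
   have inj: "inj_on phi (Sigma A (%ga. Kset ga be))"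
   proof (rule inj_onI)
    fix x x' assume xx: "x:Sigma A (%ga. Kset ga be)" "x':Sigma A (%ga. Kset ga be)" "phi x = phi x'"
    obtain ga ka ga' ka' where x: "x = (ga, ka)" "x' = (ga', ka')" by fastforce
    have k: "ka:Kset ga be" "ka':Kset ga' be" and eq: "phi (ga, ka) = phi (ga', ka')"
     using xx x by auto
    have kk: "ka = ka'" "sh ga ka be = sh ga' ka' be" using eq by (auto simp: phi_def)
    have "ga i = ga' i" for i
    proof -
     have "ga i - ka i = ga' i - ka i" using fun_cong[OF kk(2), of i] kk(1) by (simp add: sh_def)
     moreover have "ka i <= ga i" "ka i <= ga' i" using k kk(1) by (auto simp: Kset_def)
     ultimately show ?thesis by linarith
    qed
    then have "ga = ga'" by (rule ext)
    then show "x = x'" using kk(1) x by simp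
   qed
   have img: "phi ` Sigma A (%ga. Kset ga be) <= A \<times> A"
   proof (rule image_subsetI)
    fix x assume xx: "x:Sigma A (%ga. Kset ga be)"
    obtain ga ka where x: "x = (ga, ka)" by fastforce
    have g: "ga:A" "ka:Kset ga be" using xx x by auto
    have "ka:mis m" using below_mis[of ga m ka] g subA by (auto simp: Kset_def)
    moreover have "wt m ka <= wt m ga" using g by (auto simp: Kset_def intro: wt_mono)
    moreover have "sh ga ka be:mis m" using g(1) be B(2) subA by (auto simp: sh_def mis_def)
    moreover have "wt m (sh ga ka be) < wt m ga" using sh_less[OF g(2)] .
    ultimately show "phi x:A \<times> A" using g(1) x by (auto simp: phi_def A)
   qed
   have U0: "U x >= 0" for x unfolding U_def by (auto simp: g0 split: prod.splits)
   have "(\<Sum>ga\<in>A. \<Sum>ka\<in>Kset ga be. (real (wt m be) ^ si * wn m si (F' be) ka) * g be (sh ga ka be))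
    = (\<Sum>x\<in>Sigma A (%ga. Kset ga be). U (phi x))"
    by (subst sum.Sigma) (use finA finK in \<open>auto simp: U_def phi_def intro!: sum.cong\<close>)
   also have "\<dots> = sum U (phi ` Sigma A (%ga. Kset ga be))" by (simp add: sum.reindex[OF inj])
   also have "\<dots> <= sum U (A \<times> A)" using img finA U0 by (intro sum_mono2) auto
   also have "\<dots> = (real (wt m be) ^ si * (\<Sum>ka\<in>A. wn m si (F' be) ka)) * (\<Sum>nu\<in>A. g be nu)"
    unfolding U_def by (subst sum.cartesian_product[symmetric]) (simp add: sum_distrib_left sum_distrib_right mult_ac)
   also have "\<dots> <= (1/2) * (\<Sum>nu\<in>A. g be nu)"
   proof (rule mult_right_mono)
    have "(\<Sum>ka\<in>A. wn m si (F' be) ka) <= (\<Sum>\<^sub>\<infinity>mu\<in>mis m. wn m si (F' be) mu)"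
     by (rule finite_sum_le_infsum[OF wn_mono[OF F'sm[OF be] si(1)] finA subA]) simp
    then have "real (wt m be) ^ si * (\<Sum>ka\<in>A. wn m si (F' be) ka) <= real (wt m be) ^ si * (\<Sum>\<^sub>\<infinity>mu\<in>mis m. wn m si (F' be) mu)"
     by (intro mult_left_mono) auto
    also have "\<dots> <= 1/2" using ta[OF be si(2)[OF be]] .
    finally show "real (wt m be) ^ si * (\<Sum>ka\<in>A. wn m si (F' be) ka) <= 1/2" .
   qed (simp add: sum_nonneg g0)
   finally show ?thesis .
  qed
  have pt: "wn m si G ga <= wn m si h ga + (\<Sum>be\<in>B. \<Sum>ka\<in>Kset ga be. (real (wt m be) ^ si * wn m si (F' be) ka) * g be (sh ga ka be))" for ga
  proof -
   have trm: "norm (F be ka * (if ch (sh ga ka be) be then G (sh ga ka be) else 0)) / real (wt m ga) ^ si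
    = (real (wt m be) ^ si * wn m si (F' be) ka) * g be (sh ga ka be)" if k: "ka:Kset ga be" for be ka
   proof -
    have "real (wt m (sh ga ka be)) * real (wt m ka) = real (wt m ga) * real (wt m be)"
     using wt_sh[OF k] by (metis of_nat_mult)
    then have "real (wt m (sh ga ka be)) ^ si * real (wt m ka) ^ si = real (wt m ga) ^ si * real (wt m be) ^ si"
     by (metis power_mult_distrib)
    then have w: "1 / real (wt m ga) ^ si = real (wt m be) ^ si / (real (wt m ka) ^ si * real (wt m (sh ga ka be)) ^ si)"
     using wt_pos[of m] by (simp add: field_simps)
    have F'k: "F' be ka = F be ka" using k by (simp add: F'_def Kset_def)
    show ?thesis
    proof (cases "ch (sh ga ka be) be")
     case True
     have "norm (F be ka * G (sh ga ka be)) / real (wt m ga) ^ si = norm (F be ka) * norm (G (sh ga ka be)) * (1 / real (wt m ga) ^ si)"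
      by (simp add: norm_mult)
     then show ?thesis using True unfolding w by (simp add: g_def wn_def F'k mult_ac)
    qed (simp add: g_def)
   qed
   have "norm (G ga) <= norm (h ga) + (\<Sum>be\<in>B. \<Sum>ka\<in>Kset ga be. norm (F be ka * (if ch (sh ga ka be) be then G (sh ga ka be) else 0)))"
    unfolding G[of ga]
    by (rule order.trans[OF norm_triangle_ineq4]) (intro add_left_mono order.trans[OF norm_sum] sum_mono norm_sum)
   then have "norm (G ga) / real (wt m ga) ^ si <= (norm (h ga) + (\<Sum>be\<in>B. \<Sum>ka\<in>Kset ga be. norm (F be ka * (if ch (sh ga ka be) be then G (sh ga ka be) else 0)))) / real (wt m ga) ^ si"
    by (rule divide_right_mono) simp
   then show ?thesis unfolding add_divide_distrib sum_divide_distrib wn_def[symmetric] by (simp add: trm cong: sum.cong)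
  qed
  have "(\<Sum>ga\<in>A. wn m si G ga) <= (\<Sum>ga\<in>A. wn m si h ga) + (\<Sum>ga\<in>A. \<Sum>be\<in>B. \<Sum>ka\<in>Kset ga be. (real (wt m be) ^ si * wn m si (F' be) ka) * g be (sh ga ka be))"
   unfolding sum.distrib[symmetric] by (intro sum_mono pt)
  also have "(\<Sum>ga\<in>A. \<Sum>be\<in>B. \<Sum>ka\<in>Kset ga be. (real (wt m be) ^ si * wn m si (F' be) ka) * g be (sh ga ka be))
   = (\<Sum>be\<in>B. \<Sum>ga\<in>A. \<Sum>ka\<in>Kset ga be. (real (wt m be) ^ si * wn m si (F' be) ka) * g be (sh ga ka be))" by (rule sum.swap)
  also have "\<dots> <= (\<Sum>be\<in>B. 1/2 * (\<Sum>nu\<in>A. g be nu))" by (intro sum_mono one)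
  also have "\<dots> = 1/2 * (\<Sum>nu\<in>A. \<Sum>be\<in>B. g be nu)" unfolding sum_distrib_left[symmetric] by (subst sum.swap) simp
  also have "\<dots> <= 1/2 * (\<Sum>nu\<in>A. wn m si G nu)" by (intro mult_left_mono sum_mono gsum) simp
  also have "(\<Sum>ga\<in>A. wn m si h ga) <= hn" unfolding hn_def
   by (rule finite_sum_le_infsum[OF hsm finA subA]) simp
  finally show ?thesis by simp
 qed
 have Gsm: "wn m si G summable_on mis m"
 proof (rule nonneg_bdd_above_summable_on)
  show "bdd_above (sum (wn m si G) ` {F. F <= mis m & finite F})"
  proof (rule bdd_aboveI2)
   fix S assume S: "S:{F. F <= mis m & finite F}"
   define N where "N = Max (insert 0 (wt m ` S))"
   have "S <= {ga:mis m. wt m ga <= N}" using S by (auto simp: N_def)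
   then have "sum (wn m si G) S <= sum (wn m si G) {ga:mis m. wt m ga <= N}"
    by (intro sum_mono2 finite_wt_le) auto
   then show "sum (wn m si G) S <= 2 * hn" using bound[OF refl, of N] by linarith
  qed
 qed simp
 define q where "q be de = (if ch (%i. de i + be i) be then G (%i. de i + be i) else 0)" for be de
 define r where "r ga = (if EX be:B. ALL i. be i <= ga i then 0 else G ga)" for ga
 have qsm: "wn m si (q be) summable_on mis m" if be: "be:B" for be
 proof -
  define T where "T = (%de :: nat => nat. %i. de i + be i)"
  have inj: "inj_on T (mis m)" by (auto simp: inj_on_def T_def fun_eq_iff)
  have "T ` mis m <= mis m" using be B(2) by (auto simp: T_def mis_def)
  then have "wn m si G summable_on T ` mis m" by (rule summable_on_subset_banach[OF Gsm])
  then have "(wn m si G \<circ> T) summable_on mis m" by (simp add: summable_on_reindex[OF inj])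
  then have "(%de. real (wt m be) ^ si * (wn m si G \<circ> T) de) summable_on mis m" by (rule summable_on_cmult_right)
  then show ?thesis
  proof (rule summable_on_comparison_test)
   fix de
   have "wt m (T de) = wt m de * wt m be" unfolding T_def by (rule wt_add)
   then have "real (wt m be) ^ si * (wn m si G \<circ> T) de = norm (G (T de)) / real (wt m de) ^ si"
    using wt_pos[of m be] by (simp add: wn_def power_mult_distrib)
   then show "wn m si (q be) de <= real (wt m be) ^ si * (wn m si G \<circ> T) de"
    by (simp add: wn_def q_def T_def)
  qed simp
 qed
 have rsm: "wn m si r summable_on mis m"
  by (rule summable_on_comparison_test[OF Gsm]) (auto simp: r_def wn_def)
 have id: "h ga = (\<Sum>be\<in>B. conv (F be) (q be) ga) + r ga" if ga: "ga:mis m" for ga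
 proof -
  have cv: "conv (F be) (q be) ga = (if ch ga be then G ga else 0) +
    (\<Sum>ka\<in>Kset ga be. F be ka * (if ch (sh ga ka be) be then G (sh ga ka be) else 0))" if be: "be:B" for be
  proof -
   define f where "f ka = F be ka * q be (%i. ga i - ka i)" for ka
   define Z where "Z = {ka. ALL i. ka i <= ga i}"
   have finZ: "finite Z" unfolding Z_def by (rule finite_below[OF ga])
   have K: "Kset ga be <= Z" "be \<notin> Kset ga be" by (auto simp: Kset_def Z_def)
   have "f ka = 0" if "ka:Z - (Kset ga be \<union> {be})" for ka
   proof -
    have km: "ka:mis m" using below_mis[OF ga] that by (auto simp: Z_def)
    have "wt m ka ~= wt m be" using inj_onD[OF wt_inj _ km, of be] that be B(2) by auto
    then have "wt m ka < wt m be" using that by (auto simp: Kset_def Z_def)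
    then show ?thesis using F(3)[OF be km] by (simp add: f_def)
   qed
   then have "sum f Z = sum f (Z \<inter> (Kset ga be \<union> {be}))"
    by (intro sum.mono_neutral_right) (use finZ in auto)
   also have "Z \<inter> (Kset ga be \<union> {be}) = Kset ga be \<union> (Z \<inter> {be})" using K by auto
   also have "sum f \<dots> = sum f (Kset ga be) + sum f (Z \<inter> {be})"
    by (rule sum.union_disjoint) (use K finZ in \<open>auto intro: finite_subset\<close>)
   also have "sum f (Z \<inter> {be}) = (if ch ga be then G ga else 0)"
   proof (cases "be:Z")
    case True
    then have "(%i. ga i - be i + be i) = ga" by (auto simp: Z_def)
    then show ?thesis using True F(2)[OF be] by (simp add: f_def q_def)
   next
    case False
    then have "~ ch ga be" by (auto simp: Z_def ch_def)
    then show ?thesis using False by simp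
   qed
   finally show ?thesis unfolding conv_def Z_def[symmetric] f_def q_def sh_def by (simp add: add.commute)
  qed
  have "(\<Sum>be\<in>B. if ch ga be then G ga else 0) + r ga = G ga"
  proof (cases "EX be:B. ALL i. be i <= ga i")
   case True
   then obtain be0 where b0: "ch ga be0" using ch_ex by blast
   have "(\<Sum>be\<in>B. if ch ga be then G ga else 0) = (\<Sum>be\<in>B. if be = be0 then G ga else 0)"
    by (intro sum.cong refl) (use b0 ch_unique in auto)
   then show ?thesis using True B(1) b0 by (simp add: r_def ch_def)
  next
   case False
   then have "~ ch ga be" if "be:B" for be using that by (auto simp: ch_def)
   then have "(\<Sum>be\<in>B. if ch ga be then G ga else 0) = 0" by (intro sum.neutral) auto
   moreover have "r ga = G ga" unfolding r_def using False by (rule if_not_P)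
   ultimately show ?thesis by simp
  qed
  then show ?thesis using G[of ga] by (simp add: cv sum.distrib algebra_simps)
 qed
 have "r ga = 0" if "EX be:B. ALL i. be i <= ga i" for ga using that by (simp add: r_def)
 then show ?thesis using qsm rsm id by blast
qed

lemma ps_lin:
 assumes "ps m s c" "ps m s d" "s >= 0"
 shows "ps m s (%mu. x * c mu + y * d mu)"
 unfolding ps_def
proof (rule summable_on_comparison_test)
 show "(%mu. norm x * (norm (c mu) * s ^ tdeg m mu) + norm y * (norm (d mu) * s ^ tdeg m mu)) summable_on mis m"
  by (intro summable_on_add summable_on_cmult_right assms(1,2)[unfolded ps_def])
 show "norm (x * c mu + y * d mu) * s ^ tdeg m mu <= norm x * (norm (c mu) * s ^ tdeg m mu) + norm y * (norm (d mu) * s ^ tdeg m mu)" for mu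
  using mult_right_mono[OF norm_triangle_ineq[of "x * c mu" "y * d mu"], of "s ^ tdeg m mu"] assms(3)
  by (simp add: norm_mult algebra_simps)
qed (use assms in auto)

lemma ev_lin:
 assumes "ps m s c" "ps m s d" "!!i. i < m ==> norm (z i) <= s"
 shows "ev m (%mu. x * c mu + y * d mu) z = x * ev m c z + y * ev m d z"
proof -
 have "((%mu. x * (c mu * mon m z mu) + y * (d mu * mon m z mu)) has_sum (x * ev m c z + y * ev m d z)) (mis m)"
  by (intro has_sum_add has_sum_cmult_right ps_has_sum[OF assms(1)] ps_has_sum[OF assms(2)] assms(3))
 then have "((%mu. (x * c mu + y * d mu) * mon m z mu) has_sum (x * ev m c z + y * ev m d z)) (mis m)"
  by (simp add: algebra_simps)
 then show ?thesis unfolding ev_def[of m "%mu. x * c mu + y * d mu"] by (rule infsumI)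
qed

lemma eventually_small: "s > 0 ==> eventually (%z. ALL i<m. norm (z i) <= s) (nb m zc)"
 unfolding eventually_nb[OF zc_in_cvec] by (auto intro!: exI[of _ s] simp: pd_def less_imp_le)

lemma hs_lin:
 assumes "hs m a f c" "hs m a g d"
 shows "hs m a (%z. x * f z + y * g z) (%mu. x * c mu + y * d mu)"
proof -
 obtain s1 s2 where s: "s1 > 0" "ps m s1 c" "s2 > 0" "ps m s2 d" using assms by (auto simp: hs_def)
 define s where "s = min s1 s2"
 have s': "s > 0" "ps m s c" "ps m s d"
  unfolding s_def using s ps_mono[OF s(2), of "min s1 s2"] ps_mono[OF s(4), of "min s1 s2"] by auto
 have "eventually (%z. x * f (%i. z i + a i) + y * g (%i. z i + a i) = ev m (%mu. x * c mu + y * d mu) z) (nb m zc)"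
  using assms(1)[unfolded hs_def, THEN conjunct2] assms(2)[unfolded hs_def, THEN conjunct2] eventually_small[OF s'(1)]
  by eventually_elim (use ev_lin[OF s'(2,3)] in auto)
 then show ?thesis unfolding hs_def using ps_lin[OF s'(2,3)] s'(1) by auto
qed

lemma has_sum_finsum:
 fixes f :: "'b => 'a => complex"
 assumes "!!b. b:B ==> (f b has_sum s b) A"
 shows "((%x. \<Sum>b\<in>B. f b x) has_sum (\<Sum>b\<in>B. s b)) A"
 using assms by (induction B rule: infinite_finite_induct) (auto intro: has_sum_add)

lemma hs_ev:
 assumes "s > 0" "ps m s c"
 shows "hs m a (%z. ev m c (%i. z i - a i)) c"
 unfolding hs_def using assms by auto

text \<open>A form of Krull's intersection theorem.\<close>

theorem krull_closed:
 fixes Id :: "(cseq => complex) set"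
 assumes a: "a:cvec m"
  and germ: "!!f. f:Id ==> hg m a f"
  and add: "!!f g. f:Id ==> g:Id ==> (%z. f z + g z):Id"
  and mult: "!!q f. hg m a q ==> f:Id ==> (%z. q z * f z):Id"
  and cong: "!!f g. f:Id ==> eventually (%z. f z = g z) (nb m a) ==> g:Id"
  and zero: "(%_. 0):Id"
  and h: "hg m a h"
  and approx: "!!N. EX i:Id. EX c. hs m a (%z. h z - i z) c & (ALL mu:mis m. wt m mu <= N --> c mu = 0)"
 shows "h:Id"
proof -
 \<comment> \<open>The leading exponents of the members. As \<open>wt\<close> is injective on
   \<open>mis m\<close>, no two exponents of a series compete for the least weight.\<close>
 define lead where "lead = {mu:mis m. EX f:Id. EX c. hs m a f c & c mu ~= 0 & (ALL ka:mis m. wt m ka < wt m mu --> c ka = 0)}"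
 have "lead <= mis m" by (auto simp: lead_def)
 from dickson[OF this] obtain B where B: "B <= lead" "finite B" "!!mu. mu:lead ==> EX be:B. ALL i. be i <= mu i" by blast
 have Bm: "B <= mis m" using B(1) by (auto simp: lead_def)
 have "EX f c. f:Id & hs m a f c & c be = 1 & (ALL ka:mis m. wt m ka < wt m be --> c ka = 0)" if bB: "be:B" for be
 proof -
  have "be:lead" using bB B(1) by blast
  then obtain f c where f: "f:Id" "hs m a f c" "c be ~= 0" "!!ka. ka:mis m ==> wt m ka < wt m be ==> c ka = 0"
   unfolding lead_def by blast
  have "(%z. (1 / c be) * f z):Id" by (rule mult[OF hg_const f(1)])
  moreover have "hs m a (%z. (1 / c be) * f z) (%mu. (1 / c be) * c mu)"
   using hs_lin[OF f(2,2), of "1 / c be" 0] by simp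
  ultimately show ?thesis using f(3,4)
   by (intro exI[of _ "%z. (1 / c be) * f z"] exI[of _ "%mu. (1 / c be) * c mu"]) auto
 qed
 then have "ALL be. EX x. be:B --> fst x:Id & hs m a (fst x) (snd x) & snd x be = 1 &
   (ALL ka:mis m. wt m ka < wt m be --> snd x ka = 0)" by auto
 from choice[OF this] obtain X where X: "!!be. be:B ==> fst (X be):Id & hs m a (fst (X be)) (snd (X be)) & snd (X be) be = 1 &
   (ALL ka:mis m. wt m ka < wt m be --> snd (X be) ka = 0)" by blast
 define f where "f be = fst (X be)" for be
 define F where "F be = snd (X be)" for be
 have f: "f be:Id" "hs m a (f be) (F be)" "F be be = 1" if "be:B" for be
  using X[OF that] by (auto simp: f_def F_def)
 have F0: "F be ka = 0" if "be:B" "ka:mis m" "wt m ka < wt m be" for be ka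
  using X[OF that(1)] that by (auto simp: F_def)
 obtain hc where hc: "hs m a h hc" using hs_ex[OF h a] by blast
 have wnF: "EX si. wn m si c summable_on mis m" if "hs m a g c" for g c
  using that ps_imp_wn unfolding hs_def by blast
 have "ALL be:B. EX si. wn m si (F be) summable_on mis m" using f(2) wnF by blast
 from bchoice[OF this] obtain siF where siF: "!!be. be:B ==> wn m (siF be) (F be) summable_on mis m" by blast
 obtain sih where sih: "wn m sih hc summable_on mis m" using wnF[OF hc] by blast
 define si1 where "si1 = Max (insert sih (siF ` B))"
 have si1: "sih <= si1" "!!be. be:B ==> siF be <= si1" unfolding si1_def using B(2) by auto
 obtain si q r where q: "!!be. be:B ==> wn m si (q be) summable_on mis m" and r: "wn m si r summable_on mis m"
  and id: "!!ga. ga:mis m ==> hc ga = (\<Sum>be\<in>B. conv (F be) (q be) ga) + r ga"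
  and r0: "!!ga. ga:mis m ==> EX be:B. ALL i. be i <= ga i ==> r ga = 0"
  using division[OF B(2) Bm, of si1 F hc] wn_mono[OF siF si1(2)] f(3) F0 wn_mono[OF sih si1(1)] by blast
 define si2 where "si2 = max si1 si"
 have sm: "wn m si2 hc summable_on mis m" "wn m si2 r summable_on mis m"
  "!!be. be:B ==> wn m si2 (F be) summable_on mis m" "!!be. be:B ==> wn m si2 (q be) summable_on mis m"
  using wn_mono[OF sih, of si2] wn_mono[OF r, of si2] wn_mono[OF siF, of _ si2] wn_mono[OF q, of _ si2] si1
  unfolding si2_def by (auto intro: le_max_iff_disj[THEN iffD2])
 define s where "s = 1 / real (prb m) ^ si2"
 have ps: "ps m s c" if "wn m si2 c summable_on mis m" for c
  using wn_imp_ps'[OF that] by (simp add: s_def)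
 have s: "s > 0" by (simp add: s_def prb_def add_pos_nonneg sum_nonneg)
 define Q where "Q be z = ev m (q be) (%i. z i - a i)" for be z
 define R where "R z = ev m r (%i. z i - a i)" for z
 have Q: "hg m a (Q be)" if "be:B" for be
  using hs_hg[OF hs_ev[OF s ps[OF sm(4)[OF that]]] a] unfolding Q_def .
 have hsR: "hs m a R r" unfolding R_def by (rule hs_ev[OF s ps[OF sm(2)]])
 have sumId: "(%z. \<Sum>be\<in>A. Q be z * f be z):Id" if "finite A" "A <= B" for A
  using that
 proof (induction A rule: finite_induct)
  case empty
  then show ?case using zero by simp
 next
  case (insert be A)
  have "(%z. Q be z * f be z + (\<Sum>be\<in>A. Q be z * f be z)):Id"
   using insert by (intro add mult Q f) auto
  then show ?case using insert(1,2) by simp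
 qed
 have fs: "eventually (%z. ALL be:B. f be (%i. z i + a i) = ev m (F be) z) (nb m zc)"
  using B(2) f(2) by (intro eventually_ball_finite) (auto simp: hs_def)
 have eq: "eventually (%z. (\<Sum>be\<in>B. Q be z * f be z) + R z = h z) (nb m a)"
  unfolding nb_shift[OF a]
  using fs hc[unfolded hs_def, THEN conjunct2] eventually_small[OF s]
 proof eventually_elim
  case (elim z)
  have zs: "norm (z i) <= s" if "i < m" for i using elim(3) that by blast
  have ee: "((%mu. conv (F be) (q be) mu * mon m z mu) has_sum (ev m (F be) z * ev m (q be) z)) (mis m)" if "be:B" for be
   by (rule has_sum_conv[OF ps[OF sm(3)[OF that]] ps[OF sm(4)[OF that]] zs])
  have "((%mu. (\<Sum>be\<in>B. conv (F be) (q be) mu * mon m z mu) + r mu * mon m z mu) has_sum ((\<Sum>be\<in>B. ev m (F be) z * ev m (q be) z) + ev m r z)) (mis m)"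
   by (intro has_sum_add has_sum_finsum ee ps_has_sum[OF ps[OF sm(2)] zs])
  then have "((%mu. hc mu * mon m z mu) has_sum ((\<Sum>be\<in>B. ev m (F be) z * ev m (q be) z) + ev m r z)) (mis m)"
   by (subst has_sum_cong[where g = "%mu. (\<Sum>be\<in>B. conv (F be) (q be) mu * mon m z mu) + r mu * mon m z mu"])
    (simp_all add: id sum_distrib_right distrib_right)
  from has_sum_unique[OF this ps_has_sum[OF ps[OF sm(1)] zs]]
  have "(\<Sum>be\<in>B. ev m (F be) z * ev m (q be) z) + ev m r z = ev m hc z" .
  then show ?case using elim(1,2) by (simp add: Q_def R_def mult.commute)
 qed
 \<comment> \<open>Suppose r had a leading exponent mu0. With a member i that approximates h beyond
   the weight of mu0, \<open>R - (h - i)\<close> is near a a combination of members, and its leading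
   exponent is again mu0. So mu0 is a multiple of some be in B, and at such exponents r
   vanishes.\<close>
 have rz: "r mu = 0" if mu: "mu:mis m" for mu
 proof (rule ccontr)
  assume "r mu ~= 0"
  then obtain mu0 where mu0: "mu0:mis m" "r mu0 ~= 0" "!!nu. nu:mis m ==> r nu ~= 0 ==> wt m mu0 <= wt m nu"
   using ex_has_least_nat[of "%nu. nu:mis m & r nu ~= 0" mu "wt m"] mu by blast
  obtain i c where i: "i:Id" "hs m a (%z. h z - i z) c" "!!mu. mu:mis m ==> wt m mu <= wt m mu0 ==> c mu = 0"
   using approx[of "wt m mu0"] by blast
  have "hs m a (%z. 1 * R z + (-1) * (h z - i z)) (%mu. 1 * r mu + (-1) * c mu)" by (rule hs_lin[OF hsR i(2)])
  moreover have "(%z. 1 * R z + (-1) * (h z - i z)):Id"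
  proof (rule cong)
   show "(%z. i z + (-1) * (\<Sum>be\<in>B. Q be z * f be z)):Id"
    by (intro add i(1) mult hg_const sumId B(2) order.refl)
   show "eventually (%z. i z + (-1) * (\<Sum>be\<in>B. Q be z * f be z) = 1 * R z + (-1) * (h z - i z)) (nb m a)"
    using eq by eventually_elim (simp add: algebra_simps)
  qed
  moreover have "1 * r mu0 + (-1) * c mu0 ~= 0" using mu0(2) i(3)[OF mu0(1)] by simp
  moreover have "1 * r ka + (-1) * c ka = 0" if "ka:mis m" "wt m ka < wt m mu0" for ka
   using mu0(3)[OF that(1)] i(3)[OF that(1)] that(2) by (cases "r ka = 0") auto
  ultimately have "mu0:lead" using mu0(1) unfolding lead_def by blast
  from B(3)[OF this] have "r mu0 = 0" by (rule r0[OF mu0(1)])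
  then show False using mu0(2) by simp
 qed
 have "R z = 0" for z unfolding R_def ev_def by (rule infsum_0) (simp add: rz)
 then have "eventually (%z. (\<Sum>be\<in>B. Q be z * f be z) = h z) (nb m a)" using eq by simp
 then show ?thesis using cong[OF sumId[OF B(2) order.refl]] by blast
qed

section \<open>Contractions with vectors of numbers\<close>

definition cv :: "nat set => cseq => (nat set => complex) => nat set => complex" where
 "cv J v om = (%S. \<Sum>j\<in>J - S. sg j S * (v j * om (insert j S)))"

text \<open>Successive contraction with the columns listed in L. At the empty set this is a
  combination of maximal minors with coefficients taken from om, as \<open>dv_det\<close> shows; in
  this guise minors can be transformed without determinants.\<close>

definition dv :: "nat set => (nat => nat => complex) => nat list => (nat set => complex) => nat set => complex" where
 "dv J T L om = foldr (%i. cv J (%j. T j i)) L om"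

lemma dv_simps [simp]: "dv J T [] om = om" "dv J T (i # L) om = cv J (%j. T j i) (dv J T L om)"
 by (simp_all add: dv_def)

lemma cv_lin: "cv J v (%S. a * om S + b * et S) = (%S. a * cv J v om S + b * cv J v et S)"
 by (auto simp: cv_def sum_distrib_left sum.distrib[symmetric] algebra_simps intro!: sum.cong)

lemma cv_scale: "cv J v (%S. a * om S) = (%S. a * cv J v om S)"
 using cv_lin[of J v a om 0 om] by simp

lemma cv_zero [simp]: "cv J v (%S. 0) = (%S. 0)"
 by (simp add: cv_def)

lemma cv_vec: "cv J (%j. v j + c * w j) om = (%S. cv J v om S + c * cv J w om S)"
 by (auto simp: cv_def sum_distrib_left sum.distrib[symmetric] algebra_simps intro!: sum.cong)

lemma dv_lin: "dv J T L (%S. a * om S + b * et S) = (%S. a * dv J T L om S + b * dv J T L et S)"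
 by (induction L) (simp_all add: cv_lin)

lemma cv_anti:
 assumes "finite J"
 shows "cv J v (cv J w om) = (%S. - cv J w (cv J v om) S)"
proof
 fix S
 have lin: "lin (%f x. v * f x)" for v :: complex by (simp add: lin_def algebra_simps)
 have "ct J (%j f x. v j * f x) (ct J (%j f x. w j * f x) (%S (_::nat). om S))
  = (%S x. - ct J (%j f x. w j * f x) (ct J (%j f x. v j * f x) (%S _. om S)) S x)"
  by (rule ct_anticomm[OF assms]) (auto intro: lin)
 from fun_cong[OF fun_cong[OF this], of S 0]
 show "cv J v (cv J w om) S = - cv J w (cv J v om) S" by (simp add: cv_def ct_def)
qed

lemma cv_cv: "finite J ==> cv J v (cv J v om) = (%S. 0)"
proof
 fix S assume "finite J"
 from fun_cong[OF cv_anti[OF this, of v v om], of S] show "cv J v (cv J v om) S = 0" by simp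
qed

text \<open>The sign depends on L and i only, so it can be absorbed into coefficients uniformly in
  the matrix.\<close>

lemma dv_remove1:
 assumes "finite J" "i:set L"
 shows "EX s:{1, -1}. ALL T om. dv J T L om = (%S. s * dv J T (i # remove1 i L) om S)"
 using assms(2)
proof (induction L)
 case (Cons k L)
 show ?case
 proof (cases "k = i")
  case True
  then show ?thesis by (intro bexI[of _ 1]) auto
 next
  case False
  then have "i:set L" using Cons.prems by simp
  from Cons.IH[OF this] obtain s
   where s: "s:{1, -1}" "!!T om. dv J T L om = (%S. s * dv J T (i # remove1 i L) om S)" by blast
  have "dv J T (k # L) om = (%S. (- s) * dv J T (i # remove1 i (k # L)) om S)" for T om
   using False cv_anti[OF assms(1), of "%j. T j k" "%j. T j i"] by (simp add: s(2)[of T om] cv_scale)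
  then show ?thesis using s(1) by (intro bexI[of _ "- s"]) auto
 qed
qed simp

text \<open>Exterior multiplication by the basis vector j0.\<close>

definition eps :: "nat => (nat set => complex) => nat set => complex" where
 "eps j0 om = (%S. if j0:S then sg j0 (S - {j0}) * om (S - {j0}) else 0)"

lemma cv_eps:
 assumes "v j0 = 0" "j0:J" "finite J"
 shows "cv J v (eps j0 om) = (%S. - eps j0 (cv (J - {j0}) v om) S)"
proof
 fix S
 show "cv J v (eps j0 om) S = - eps j0 (cv (J - {j0}) v om) S"
 proof (cases "j0:S")
  case False
  have vz: "v j * eps j0 om (insert j S) = 0" for j
   using False assms(1) by (cases "j = j0") (auto simp: eps_def)
  have "cv J v (eps j0 om) S = 0" by (simp only: cv_def vz mult_zero_right sum.neutral_const)
  then show ?thesis using False by (simp add: eps_def)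
 next
  case True
  define S' where "S' = S - {j0}"
  have S: "S = insert j0 S'" "j0 \<notin> S'" using True by (auto simp: S'_def)
  have JS: "J - {j0} - S' = J - S" using assms(2) S by auto
  have "sg j S * (v j * eps j0 om (insert j S)) = - (sg j0 S' * (sg j S' * (v j * om (insert j S'))))" if j: "j:J - S" for j
  proof -
   have jj: "j ~= j0" "j \<notin> S'" using j S by auto
   have "insert j S - {j0} = insert j S'" using jj S by auto
   then have "eps j0 om (insert j S) = sg j0 (insert j S') * om (insert j S')" using S by (simp add: eps_def)
   moreover have "sg j S' * sg j0 (insert j S') = - (sg j0 S' * sg j (insert j0 S'))"
    by (rule sg_swap) (use jj S in auto)
   then have "sg j S * sg j0 (insert j S') = - (sg j0 S' * sg j S')"
    unfolding S(1) using jj by (auto simp: sg_insert[OF S(2)] sg_insert[OF jj(2)])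
   ultimately have "sg j S * (v j * eps j0 om (insert j S)) = - (sg j0 S' * sg j S') * (v j * om (insert j S'))"
    by (metis mult.assoc mult.left_commute)
   then show ?thesis by (simp only: mult_minus_left mult.assoc)
  qed
  then have "cv J v (eps j0 om) S = (\<Sum>j\<in>J - S. - (sg j0 S' * (sg j S' * (v j * om (insert j S')))))"
   unfolding cv_def by (intro sum.cong) auto
  then show ?thesis using True by (simp add: eps_def cv_def S'_def[symmetric] JS sum_distrib_left sum_negf)
 qed
qed

text \<open>Elimination with the pivot in row j0 and column i0. Once column i0 is contracted,
  multiples of it may be subtracted from the other columns, because contracting twice with the same
  vector gives 0. The reduced columns have no entry in row j0 and pass through \<open>eps j0\<close>
  with a sign, and column i0 then meets it in the pivot alone.\<close>

lemma dv_pivot: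
 assumes J: "finite J" "j0:J" and p: "T j0 i0 ~= 0" and i0: "i0 \<notin> set M"
 shows "dv J T (i0 # M) (eps j0 om) {} =
  (-1) ^ length M * T j0 i0 * dv (J - {j0}) (%j i. T j i - T j i0 * T j0 i / T j0 i0) M om {}"
proof -
 define E where "E j i = T j i - T j i0 * T j0 i / T j0 i0" for j i
 have E0: "E j0 i = 0" for i using p by (simp add: E_def)
 define c0 where "c0 = cv J (%j. T j i0)"
 have c0c0: "c0 (c0 et) = (%S. 0)" for et unfolding c0_def by (rule cv_cv[OF J(1)])
 have anti: "c0 (cv J v et) = (%S. - cv J v (c0 et) S)" for v et
  unfolding c0_def by (rule cv_anti[OF J(1)])
 have vec: "cv J (%j. T j i) et = (%S. cv J (%j. E j i) et S + (T j0 i / T j0 i0) * c0 et S)" for i et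
  unfolding c0_def using cv_vec[of J "%j. E j i" "T j0 i / T j0 i0" "%j. T j i0" et]
  by (simp add: E_def mult.commute)
 have c0_lin: "c0 (%S. et S + b * et' S) = (%S. c0 et S + b * c0 et' S)" for et et' b
  unfolding c0_def using cv_lin[of J _ 1 et b et'] by simp
 have 1: "c0 (dv J T N et) = c0 (dv J E N et)" for N et
 proof (induction N)
  case (Cons i N)
  have "c0 (dv J T (i # N) et) = c0 (cv J (%j. E j i) (dv J T N et))"
   unfolding dv_simps vec[of i "dv J T N et"] c0_lin c0c0 by simp
  also have "\<dots> = (%S. - cv J (%j. E j i) (c0 (dv J T N et)) S)" by (rule anti)
  also have "\<dots> = (%S. - cv J (%j. E j i) (c0 (dv J E N et)) S)" by (simp add: Cons)
  also have "\<dots> = c0 (dv J E (i # N) et)" by (simp add: anti)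
  finally show ?case .
 qed simp
 have 2: "dv J E N (eps j0 om) = (%S. (-1) ^ length N * eps j0 (dv (J - {j0}) E N om) S)" for N
 proof (induction N)
  case (Cons i N)
  have "dv J E (i # N) (eps j0 om) = (%S. (-1) ^ length N * cv J (%j. E j i) (eps j0 (dv (J - {j0}) E N om)) S)"
   by (simp add: Cons cv_scale)
  moreover have "cv J (%j. E j i) (eps j0 et) = (%S. - eps j0 (cv (J - {j0}) (%j. E j i) et) S)" for et
   by (rule cv_eps) (use E0 J in auto)
  ultimately show ?case by simp
 qed simp
 have 3: "c0 (eps j0 et) {} = T j0 i0 * et {}" for et
 proof -
  have "c0 (eps j0 et) {} = (\<Sum>j\<in>J. if j = j0 then T j0 i0 * et {} else 0)"
   unfolding c0_def cv_def by (rule sum.cong) (auto simp: eps_def sg_def)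
  then show ?thesis using J by simp
 qed
 have "dv J T (i0 # M) (eps j0 om) {} = c0 (dv J E M (eps j0 om)) {}" using 1[of M] by (simp add: c0_def)
 also have "\<dots> = (-1) ^ length M * c0 (eps j0 (dv (J - {j0}) E M om)) {}"
  unfolding 2 c0_def cv_scale ..
 finally show ?thesis unfolding 3 E_def by (simp add: mult.assoc)
qed

lemma hg_cv:
 assumes "!!j. j:J ==> hg m a (%z. v z j)" "!!S. hg m a (%z. om z S)"
 shows "hg m a (%z. cv J (v z) (om z) S)"
 unfolding cv_def by (intro hg_sum hg_mult hg_const assms) auto

lemma hg_dv:
 assumes "!!j i. j:J ==> i:set L ==> hg m a (%z. T z j i)" "!!S. hg m a (%z. om z S)"
 shows "hg m a (%z. dv J (T z) L (om z) S)"
 using assms(1)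
proof (induction L arbitrary: S)
 case Nil
 then show ?case using assms(2) by simp
next
 case (Cons i L)
 then show ?case unfolding dv_simps by (intro hg_cv) auto
qed

section \<open>Generic residual intersections of germs\<close>

text \<open>The entries of matrix and vector occupy distinct coordinates among m; the coordinates
  left over are parameters. Such parameters arise in the elimination and from the second point of
  the pair.\<close>

definition gindex :: "nat => nat set => nat list => (nat => nat => nat) => (nat => nat) => bool" where
 "gindex m J L t y \<longleftrightarrow> finite J & distinct L & (ALL j:J. ALL i:set L. t j i < m) & (ALL i:set L. y i < m) &
  (ALL j:J. ALL i:set L. ALL j':J. ALL i':set L. t j i = t j' i' --> j = j' & i = i') & inj_on y (set L) &
  (ALL j:J. ALL i:set L. ALL k:set L. t j i ~= y k)"

definition row :: "nat list => (nat => nat => nat) => (nat => nat) => nat => cseq => complex" where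
 "row L t y j z = (\<Sum>i\<in>set L. z (t j i) * z (y i))"

text \<open>The ideal of the rows of matrix times vector and of the maximal minors.\<close>

definition resid :: "nat => cseq => nat set => nat list => (nat => nat => nat) => (nat => nat) => (cseq => complex) set" where
 "resid m a J L t y = {f. EX c E. (ALL j:J. hg m a (c j)) & (ALL S. hg m a (%z. E z S)) &
  eventually (%z. f z = (\<Sum>j\<in>J. c j z * row L t y j z) + dv J (%j i. z (t j i)) L (E z) {}) (nb m a)}"

lemma residI:
 assumes "!!j. j:J ==> hg m a (c j)" "!!S. hg m a (%z. E z S)"
  "eventually (%z. f z = (\<Sum>j\<in>J. c j z * row L t y j z) + dv J (%j i. z (t j i)) L (E z) {}) (nb m a)"
 shows "f:resid m a J L t y"
 unfolding resid_def using assms by blast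

lemma residE:
 assumes "f:resid m a J L t y"
 obtains c E where "!!j. j:J ==> hg m a (c j)" "!!S. hg m a (%z. E z S)"
  "eventually (%z. f z = (\<Sum>j\<in>J. c j z * row L t y j z) + dv J (%j i. z (t j i)) L (E z) {}) (nb m a)"
 using assms unfolding resid_def by blast

lemma hg_row: "gindex m J L t y ==> j:J ==> hg m a (row L t y j)"
 unfolding row_def gindex_def by (intro hg_sum hg_mult hg_coord) auto

lemma resid_lin:
 assumes "f:resid m a J L t y" "g:resid m a J L t y" "hg m a p" "hg m a q"
 shows "(%z. p z * f z + q z * g z):resid m a J L t y"
proof -
 obtain c E where f: "!!j. j:J ==> hg m a (c j)" "!!S. hg m a (%z. E z S)"
  "eventually (%z. f z = (\<Sum>j\<in>J. c j z * row L t y j z) + dv J (%j i. z (t j i)) L (E z) {}) (nb m a)"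
  using residE[OF assms(1)] by blast
 obtain c' E' where g: "!!j. j:J ==> hg m a (c' j)" "!!S. hg m a (%z. E' z S)"
  "eventually (%z. g z = (\<Sum>j\<in>J. c' j z * row L t y j z) + dv J (%j i. z (t j i)) L (E' z) {}) (nb m a)"
  using residE[OF assms(2)] by blast
 show ?thesis
 proof (rule residI)
  show "hg m a (%z. p z * c j z + q z * c' j z)" if "j:J" for j
   using that by (intro hg_add hg_mult f g assms)
  show "hg m a (%z. (%S. p z * E z S + q z * E' z S) S)" for S
   by (intro hg_add hg_mult f g assms)
  show "eventually (%z. p z * f z + q z * g z = (\<Sum>j\<in>J. (p z * c j z + q z * c' j z) * row L t y j z) +
    dv J (%j i. z (t j i)) L (%S. p z * E z S + q z * E' z S) {}) (nb m a)"
   using f(3) g(3) by eventually_elim (simp add: dv_lin algebra_simps sum.distrib sum_distrib_left)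
 qed
qed

lemma resid_cong:
 assumes "f:resid m a J L t y" "eventually (%z. f z = g z) (nb m a)"
 shows "g:resid m a J L t y"
proof -
 obtain c E where f: "!!j. j:J ==> hg m a (c j)" "!!S. hg m a (%z. E z S)"
  "eventually (%z. f z = (\<Sum>j\<in>J. c j z * row L t y j z) + dv J (%j i. z (t j i)) L (E z) {}) (nb m a)"
  using residE[OF assms(1)] by blast
 show ?thesis
  by (rule residI[OF f(1,2)], assumption) (use f(3) assms(2) in eventually_elim, simp)
qed

lemma resid_hg:
 assumes "gindex m J L t y" "f:resid m a J L t y"
 shows "hg m a f"
proof -
 obtain c E where f: "!!j. j:J ==> hg m a (c j)" "!!S. hg m a (%z. E z S)"
  "eventually (%z. f z = (\<Sum>j\<in>J. c j z * row L t y j z) + dv J (%j i. z (t j i)) L (E z) {}) (nb m a)"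
  using residE[OF assms(2)] by blast
 have "hg m a (%z. (\<Sum>j\<in>J. c j z * row L t y j z) + dv J (%j i. z (t j i)) L (E z) {})"
  by (intro hg_add hg_sum hg_mult f(1,2) hg_row[OF assms(1)] hg_dv hg_coord)
   (use assms(1) in \<open>auto simp: gindex_def\<close>)
 then show ?thesis by (rule hg_cong[rotated]) (use f(3) in eventually_elim, simp)
qed

lemma resid_zero: "(%_. 0):resid m a J L t y"
proof (rule residI[where c = "%_ _. 0" and E = "%_ _. 0"])
 have "dv J T L (%_. 0) = (%_. 0)" for T by (induction L) simp_all
 then show "eventually (%z. 0 = (\<Sum>j\<in>J. 0 * row L t y j z) + dv J (%j i. z (t j i)) L (%_. 0) {}) (nb m a)"
  by simp
qed (auto intro: hg_const)

text \<open>Clears the coefficients outside \<open>mis m\<close>, which a germ does not determine,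
  so that equal germs give equal coefficient functions.\<close>

definition mc :: "nat => ser => ser" where
 "mc m c = (%mu. if mu:mis m then c mu else 0)"

lemma mc_idem: "mc m (mc m c) = mc m c" by (simp add: mc_def fun_eq_iff)

lemma hs_mc: "hs m a f c ==> hs m a f (mc m c)"
proof -
 assume h: "hs m a f c"
 have "ev m (mc m c) = ev m c" unfolding ev_def by (intro ext infsum_cong) (simp add: mc_def)
 moreover have "ps m s (mc m c) \<longleftrightarrow> ps m s c" for s
  unfolding ps_def by (intro summable_on_cong) (simp add: mc_def)
 ultimately show ?thesis using h by (simp add: hs_def)
qed

lemma mc_Xs: "k < m ==> mc m (Xs k c) = Xs k (mc m c)"
 by (auto simp: mc_def Xs_def mis_def fun_eq_iff)

lemma hs_zero: "hs m a (%_. 0) (%_. 0)"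
 unfolding hs_def ps_def ev_def by (auto intro!: exI[of _ 1] always_eventually)

lemma hs_sum:
 assumes "!!j. j:A ==> hs m a (f j) (c j)"
 shows "hs m a (%z. \<Sum>j\<in>A. k j * f j z) (%mu. \<Sum>j\<in>A. k j * c j mu)"
 using assms
proof (induction A rule: infinite_finite_induct)
 case (insert j A)
 have "hs m a (%z. k j * f j z + 1 * (\<Sum>j\<in>A. k j * f j z)) (%mu. k j * c j mu + 1 * (\<Sum>j\<in>A. k j * c j mu))"
  using insert by (intro hs_lin) auto
 then show ?case using insert by simp
qed (simp_all add: hs_zero)

lemma hs_unique:
 assumes "hs m a f c" "hs m a f d" "a:cvec m" "mu:mis m"
 shows "c mu = d mu"
proof -
 have "hs m a (%z. 1 * f z + (-1) * f z) (%mu. 1 * c mu + (-1) * d mu)" by (rule hs_lin[OF assms(1,2)])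
 then have h: "hs m a (%z. 0) (%mu. c mu - d mu)" by simp
 obtain s where s0: "s > 0" "ps m s (%mu. c mu - d mu)" using h unfolding hs_def by blast
 have "eventually (%z. 0 = ev m (%mu. c mu - d mu) z) (nb m zc)" using h unfolding hs_def by blast
 then have "eventually (%z. ev m (%mu. c mu - d mu) z = 0) (nb m zc)" by eventually_elim (rule sym)
 note s = s0 this
 from ps_unique[OF s(2,1,3) assms(4)] show ?thesis by simp
qed

lemma hs_cong:
 assumes "hs m a f c" "a:cvec m" "eventually (%z. f z = g z) (nb m a)"
 shows "hs m a g c"
proof -
 have "eventually (%z. f (%i. z i + a i) = g (%i. z i + a i)) (nb m zc)"
  using assms(3) unfolding nb_shift[OF assms(2)] .
 then have "eventually (%z. g (%i. z i + a i) = ev m c z) (nb m zc)"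
  using assms(1)[unfolded hs_def, THEN conjunct2] by eventually_elim simp
 then show ?thesis using assms(1) by (simp add: hs_def)
qed

lemma hs_Xs:
 assumes "hs m a f c" "k < m" "a k = 0"
 shows "hs m a (%z. z k * f z) (Xs k c)"
proof -
 obtain s where s: "s > 0" "ps m s c" using assms by (auto simp: hs_def)
 define Jk where "Jk mu = mu(k := mu k + (1::nat))" for mu
 have inj: "inj_on Jk A" for A
 proof (rule inj_onI)
  fix x y :: "nat => nat" assume J: "Jk x = Jk y"
  have "x i = y i" for i using fun_cong[OF J, of i] by (cases "i = k") (auto simp: Jk_def)
  then show "x = y" by blast
 qed
 have Jmis: "Jk ` mis m = {mu:mis m. mu k ~= 0}"
 proof (intro equalityI subsetI)
  fix mu :: "nat => nat" assume "mu:{mu:mis m. mu k ~= 0}"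
  then have "mu = Jk (mu(k := mu k - 1))" "mu(k := mu k - 1):mis m" by (auto simp: Jk_def mis_def)
  then show "mu:Jk ` mis m" by blast
 qed (use assms(2) in \<open>auto simp: Jk_def mis_def\<close>)
 have tJ: "tdeg m (Jk mu) = Suc (tdeg m mu)" for mu
 proof -
  have "tdeg m (Jk mu) = (\<Sum>i<m. mu i + (if i = k then 1 else 0))" unfolding tdeg_def Jk_def by (intro sum.cong) auto
  then show ?thesis using assms(2) by (simp add: sum.distrib tdeg_def)
 qed
 have mJ: "mon m z (Jk mu) = z k * mon m z mu" for z mu
 proof -
  have "mon m z (Jk mu) = (\<Prod>i<m. z i ^ mu i * (if i = k then z k else 1))" unfolding mon_def Jk_def by (intro prod.cong) auto
  then show ?thesis using assms(2) by (simp add: prod.distrib mon_def mult.commute)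
 qed
 have XJ: "Xs k c (Jk mu) = c mu" for mu by (simp add: Xs_def Jk_def)
 have X0: "Xs k c mu = 0" if "mu k = 0" for mu using that by (simp add: Xs_def)
 have "(%mu. (norm (c mu) * s ^ tdeg m mu) * s) summable_on mis m"
  using s(2) unfolding ps_def by (rule summable_on_cmult_left)
 then have "((%mu. norm (Xs k c mu) * s ^ tdeg m mu) \<circ> Jk) summable_on mis m"
  by (simp add: o_def XJ tJ mult_ac)
 then have "(%mu. norm (Xs k c mu) * s ^ tdeg m mu) summable_on {mu:mis m. mu k ~= 0}"
  unfolding Jmis[symmetric] by (simp add: summable_on_reindex[OF inj])
 then have ps: "ps m s (Xs k c)" unfolding ps_def
  by (subst summable_on_cong_neutral[where T = "{mu:mis m. mu k ~= 0}" and g = "%mu. norm (Xs k c mu) * s ^ tdeg m mu"])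
   (auto simp: X0)
 have ev: "ev m (Xs k c) z = z k * ev m c z" if "ALL i<m. norm (z i) <= s" for z
 proof -
  have "((%mu. z k * (c mu * mon m z mu)) has_sum (z k * ev m c z)) (mis m)"
   by (intro has_sum_cmult_right ps_has_sum[OF s(2)]) (use that in auto)
  then have "(((%mu. Xs k c mu * mon m z mu) \<circ> Jk) has_sum (z k * ev m c z)) (mis m)"
   by (simp add: o_def XJ mJ mult_ac)
  then have "((%mu. Xs k c mu * mon m z mu) has_sum (z k * ev m c z)) {mu:mis m. mu k ~= 0}"
   unfolding Jmis[symmetric] by (simp add: has_sum_reindex[OF inj])
  then have "((%mu. Xs k c mu * mon m z mu) has_sum (z k * ev m c z)) (mis m)"
   by (subst has_sum_cong_neutral[where T = "{mu:mis m. mu k ~= 0}" and g = "%mu. Xs k c mu * mon m z mu"])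
    (auto simp: X0)
  then show ?thesis unfolding ev_def[of m "Xs k c"] by (rule infsumI)
 qed
 have "eventually (%z. (z k + a k) * f (%i. z i + a i) = ev m (Xs k c) z) (nb m zc)"
  using assms(1)[unfolded hs_def, THEN conjunct2] eventually_small[OF s(1)]
  by eventually_elim (simp add: ev assms(3))
 then show ?thesis unfolding hs_def using ps s(1) by auto
qed

lemma hs_ct:
 assumes "!!S. hs m a (f S) (om S)" "!!j. j:J ==> k j < m" "!!j. j:J ==> a (k j) = 0"
 shows "hs m a (%z. cv J (%j. z (k j)) (%S. f S z) S) (ct J (%j. Xs (k j)) om S)"
 unfolding cv_def ct_def by (rule hs_sum) (use assms in \<open>auto intro!: hs_Xs\<close>)

lemma wt_Suc_less: "mu k ~= 0 ==> wt m (mu(k := mu k - 1)) <= wt m mu"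
 by (rule wt_mono) simp

text \<open>Congruence modulo terms of weight above N. Multiplying by a variable does not lower the
  weight, so contractions respect it.\<close>

definition agree :: "nat => nat => ser => ser => bool" where
 "agree m N c d \<longleftrightarrow> (ALL mu:mis m. wt m mu <= N --> c mu = d mu)"

lemma agree_Xs:
 assumes "agree m N c d"
 shows "agree m N (Xs k c) (Xs k d)"
 unfolding agree_def
proof (intro ballI impI)
 fix mu assume mu: "mu:mis m" "wt m mu <= N"
 show "Xs k c mu = Xs k d mu"
 proof (cases "mu k = 0")
  case False
  have "mu(k := mu k - 1):mis m" using mu(1) by (auto simp: mis_def)
  moreover have "wt m (mu(k := mu k - 1)) <= N" using wt_Suc_less[of mu k m] False mu(2) by linarith
  ultimately show ?thesis using assms by (simp add: agree_def Xs_def)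
 qed (simp add: Xs_def)
qed

lemma agree_ct:
 "(!!S. agree m N (om S) (et S)) ==> agree m N (ct J (%j. Xs (k j)) om S) (ct J (%j. Xs (k j)) et S)"
 using agree_Xs[of m N "om S" "et S" for S] unfolding ct_def agree_def by (intro ballI impI sum.cong refl arg_cong2[where f = "(*)"]) blast

context gvars
begin

lemma hs_D:
 assumes "!!S. hs m a (f S) (om S)" "!!j. j:J ==> t j i < m" "!!j. j:J ==> a (t j i) = 0"
 shows "hs m a (%z. cv J (%j. z (t j i)) (%S. f S z) S) (D i om S)"
 unfolding D_def by (rule hs_ct) (use assms in auto)

lemma hs_dl:
 assumes "!!S. hs m a (f S) (om S)" "!!j i. j:J ==> i:set L ==> t j i < m & a (t j i) = 0"
 shows "hs m a (%z. dv J (%j i. z (t j i)) L (%S. f S z) S) (dl L om S)"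
 using assms(2)
proof (induction L arbitrary: S)
 case Nil
 then show ?case using assms(1) by simp
next
 case (Cons i L)
 then show ?case by (simp only: dv_simps dl_simps) (rule hs_D, auto)
qed

lemma hs_dY:
 assumes "!!S. hs m a (f S) (om S)" "distinct L"
  "!!j i. j:J ==> i:set L ==> t j i < m & a (t j i) = 0" "!!i. i:set L ==> y i < m & a (y i) = 0"
 shows "hs m a (%z. \<Sum>i\<in>set L. z (y i) * cv J (%j. z (t j i)) (%S. f S z) S) (dY L om S)"
 using assms(2-)
proof (induction L)
 case Nil
 then show ?case by (simp add: hs_zero)
next
 case (Cons i L)
 have "hs m a (%z. z (y i) * cv J (%j. z (t j i)) (%S. f S z) S) (Xs (y i) (D i om S))"
  by (intro hs_Xs hs_D) (use assms(1) Cons.prems in auto)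
 then have "hs m a (%z. 1 * (\<Sum>i\<in>set L. z (y i) * cv J (%j. z (t j i)) (%S. f S z) S) + 1 * (z (y i) * cv J (%j. z (t j i)) (%S. f S z) S))
   (%mu. 1 * dY L om S mu + 1 * Xs (y i) (D i om S) mu)"
  using Cons by (intro hs_lin) auto
 then show ?case using Cons.prems(1) by (simp add: lc_def Y_def add.commute)
qed

lemma agree_dl: "(!!S. agree m N (om S) (et S)) ==> agree m N (dl L om S) (dl L et S)"
proof (induction L arbitrary: S)
 case (Cons i L)
 then show ?case by (simp only: dl_simps D_def) (rule agree_ct, auto)
qed simp

lemma agree_dY: "(!!S. agree m N (om S) (et S)) ==> agree m N (dY L om S) (dY L et S)"
proof (induction L)
 case (Cons i L)
 have "agree m N (Xs (y i) (D i om S)) (Xs (y i) (D i et S))"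
  unfolding D_def by (intro agree_Xs agree_ct Cons.prems)
 then show ?case using Cons by (simp add: lc_def Y_def agree_def)
qed (simp add: agree_def)

lemma mc_lin: "mc m (%mu. a * c mu + b * d mu) = (%mu. a * mc m c mu + b * mc m d mu)"
 by (auto simp: mc_def)

lemma mc_D:
 assumes "!!j. j:J ==> t j i < m" "!!S. mc m (om S) = om S"
 shows "mc m (D i om S) = D i om S"
proof -
 have "lin (mc m)" by (auto simp: lin_def mc_def)
 then have "D i (%S. mc m (om S)) = (%S. mc m (D i om S))"
  unfolding D_def by (rule ct_map) (use assms(1) mc_Xs in auto)
 then show ?thesis using assms(2) by (metis (no_types, lifting) ext)
qed

lemma mc_dY:
 assumes "!!j i. j:J ==> i:set L ==> t j i < m" "!!i. i:set L ==> y i < m" "!!S. mc m (om S) = om S"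
 shows "mc m (dY L om S) = dY L om S"
 using assms(1,2)
proof (induction L)
 case Nil
 then show ?case by (simp add: mc_def)
next
 case (Cons i L)
 have "mc m (Xs (y i) (D i om S)) = Xs (y i) (D i om S)"
  using Cons.prems by (subst mc_Xs) (auto simp: mc_D assms(3))
 then show ?case using Cons by (simp add: lc_def Y_def mc_lin[of m 1 _ 1, simplified])
qed

end

lemma hs_finite_truncation:
 fixes c :: ser
 assumes that: "a:cvec m"
 shows "EX f. hg m a f & hs m a f (%mu. if mu:mis m & wt m mu <= N then c mu else 0)"
proof -
 define d where "d = (%mu. if mu:mis m & wt m mu <= N then c mu else 0)"
 have "(%mu. norm (d mu) * 1 ^ tdeg m mu) summable_on {mu:mis m. wt m mu <= N}"
  by (rule summable_on_finite[OF finite_wt_le])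
 then have "ps m 1 d" unfolding ps_def
  by (subst summable_on_cong_neutral[where T = "{mu:mis m. wt m mu <= N}" and g = "%mu. norm (d mu) * 1 ^ tdeg m mu"])
   (auto simp: d_def)
 have h: "hs m a (%z. ev m d (%i. z i - a i)) d" by (rule hs_ev[of 1]) (simp, rule \<open>ps m 1 d\<close>)
 then show ?thesis unfolding d_def[symmetric] using hs_hg[OF h that] by blast
qed

lemma row_dY: 
 assumes "finite J"
 shows "(\<Sum>i\<in>set L. z (y i) * cv J (%j. z (t j i)) (%S. f S) {}) = (\<Sum>j\<in>J. f {j} * row L t y j z)"
 unfolding cv_def row_def sum_distrib_left by (subst sum.swap) (simp add: sg_def mult_ac)

text \<open>Pass to Taylor series and solve formally. The formal solution, truncated at weight N,
  consists of polynomials and defines a member of the ideal that agrees with h up to weight N; this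
  is the approximation \<open>krull_closed\<close> asks for.\<close>

theorem residual_at_0:
 assumes G: "gindex m J L t y" and a: "a:cvec m"
  and ay: "!!i. i:set L ==> a (y i) = 0" and at: "!!j i. j:J ==> i:set L ==> a (t j i) = 0"
  and h: "hg m a h" and n: "n:set L" and b: "!!j. j:J ==> hg m a (b j)"
  and eq: "eventually (%z. h z * z (y n) = (\<Sum>j\<in>J. b j z * row L t y j z)) (nb m a)"
 shows "h:resid m a J L t y"
proof -
 have J: "finite J" and L: "distinct L" and tm: "!!j i. j:J ==> i:set L ==> t j i < m"
  and ym: "!!i. i:set L ==> y i < m"
  using G by (auto simp: gindex_def)
 interpret gvars J "set L" t y
  by unfold_locales (use G in \<open>auto simp: gindex_def\<close>)
 obtain hc0 where hc0: "hs m a h hc0" using hs_ex[OF h a] by blast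
 define hc where "hc = mc m hc0"
 have hc: "hs m a h hc" unfolding hc_def by (rule hs_mc[OF hc0])
 have "ALL j:J. EX c. hs m a (b j) c" using hs_ex[OF b a] by blast
 from bchoice[OF this] obtain bc0 where bc0: "!!j. j:J ==> hs m a (b j) (bc0 j)" by blast
 \<comment> \<open>The relation in terms of forms: the coefficients b make up a form of degree 1,
   and h is one of degree 0.\<close>
 define bS where "bS S = (if EX j:J. S = {j} then b (the_elem S) else (%_. 0))" for S
 define bF where "bF S = (if EX j:J. S = {j} then mc m (bc0 (the_elem S)) else (%_. 0))" for S
 define hF :: "(nat => nat) form" where "hF S = (if S = {} then hc else (%_. 0))" for S
 have bF: "hs m a (bS S) (bF S)" for S
  unfolding bS_def bF_def using bc0 by (auto intro!: hs_mc hs_zero)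
 have fb: "fdeg 1 bF" unfolding fdeg_def
 proof (intro allI impI)
  fix S assume "~ (S <= J & card S = 1)"
  then have "~ (EX j:J. S = {j})" by auto
  then show "bF S = (%_. 0)" unfolding bF_def by (rule if_not_P)
 qed
 have bFm: "mc m (bF S) = bF S" for S
  unfolding bF_def by (auto simp: mc_idem) (auto simp: mc_def)
 have "Y n hF = dY L bF"
 proof (intro ext)
  fix S mu
  show "Y n hF S mu = dY L bF S mu"
  proof (cases "S = {}")
   case False
   have "fdeg 0 (dY L bF)" by (rule fdeg_dY) (use fb in simp)
   moreover have "~ (S <= J & card S = 0)" using False J finite_subset[of S J] by auto
   ultimately have "dY L bF S = (%_. 0)" by (simp add: fdeg_def)
   moreover have "Y n hF S = (%_. 0)" using False by (simp add: Y_def hF_def lin_0[OF lin_Xs])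
   ultimately show ?thesis by simp
  next
   case True
   have m1: "mc m (Y n hF {}) = Y n hF {}"
    unfolding Y_def hF_def hc_def using mc_Xs[OF ym[OF n]] by (simp add: mc_idem)
   have m2: "mc m (dY L bF {}) = dY L bF {}" by (rule mc_dY) (use tm ym bFm in auto)
   show ?thesis
   proof (cases "mu:mis m")
    case False
    then show ?thesis using True fun_cong[OF m1, of mu] fun_cong[OF m2, of mu] by (simp add: mc_def)
   next
    case mu: True
    have 1: "hs m a (%z. z (y n) * h z) (Y n hF {})"
     unfolding Y_def hF_def using hs_Xs[OF hc ym[OF n] ay[OF n]] by simp
    have 2: "hs m a (%z. \<Sum>i\<in>set L. z (y i) * cv J (%j. z (t j i)) (%S. bS S z) {}) (dY L bF {})"
     by (rule hs_dY) (use bF L tm ym at ay in auto)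
    have bSj: "bS {j} = b j" if "j:J" for j using that by (auto simp: bS_def)
    have "eventually (%z. (\<Sum>i\<in>set L. z (y i) * cv J (%j. z (t j i)) (%S. bS S z) {}) = z (y n) * h z) (nb m a)"
     using eq by eventually_elim (simp add: row_dY[OF J] bSj mult.commute)
    from hs_cong[OF 2 a this] have "hs m a (%z. z (y n) * h z) (dY L bF {})" .
    from hs_unique[OF 1 this a mu] show ?thesis using True by simp
   qed
  qed
 qed
 from generic_residual_formal[OF L order.refl n fb this]
 obtain c E where cE: "hF = lc 1 (dY L c) 1 (dl L E)" by blast
 show ?thesis
 proof (rule krull_closed[OF a, where Id = "resid m a J L t y"])
  show "(%z. f z + g z):resid m a J L t y" if "f:resid m a J L t y" "g:resid m a J L t y" for f g
   using resid_lin[OF that hg_const[of _ _ 1] hg_const[of _ _ 1]] by simp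
  show "(%z. q z * f z):resid m a J L t y" if "hg m a q" "f:resid m a J L t y" for q f
   using resid_lin[OF that(2,2,1) hg_const[of _ _ 0]] by simp
  fix N
  define tr where "tr c = (%mu. if mu:mis m & wt m mu <= N then c mu else 0)" for c :: ser
  have "EX f. hg m a f & hs m a f (tr c)" for c unfolding tr_def by (rule hs_finite_truncation[OF a])
  then have "ALL c. EX f. hg m a f & hs m a f (tr c)" by blast
  from choice[OF this] obtain fn where fn: "!!c. hg m a (fn c)" "!!c. hs m a (fn c) (tr c)" by blast
  define i where "i z = (\<Sum>j\<in>J. fn (c {j}) z * row L t y j z) + dv J (%j i. z (t j i)) L (%S. fn (E S) z) {}" for z
  have iI: "i:resid m a J L t y"
   by (rule residI[where c = "%j. fn (c {j})" and E = "%z S. fn (E S) z"]) (auto simp: fn i_def)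
  have h1: "hs m a (%z. \<Sum>i\<in>set L. z (y i) * cv J (%j. z (t j i)) (%S. fn (c S) z) {}) (dY L (%S. tr (c S)) {})"
   by (rule hs_dY) (use fn L tm ym at ay in auto)
  have h2: "hs m a (%z. dv J (%j i. z (t j i)) L (%S. fn (E S) z) {}) (dl L (%S. tr (E S)) {})"
   by (rule hs_dl) (use fn tm at in auto)
  define ic where "ic = (%mu. 1 * dY L (%S. tr (c S)) {} mu + 1 * dl L (%S. tr (E S)) {} mu)"
  have ic: "hs m a i ic"
   using hs_lin[OF h1 h2, of 1 1] unfolding ic_def i_def row_dY[OF J] by simp
  have hi: "hs m a (%z. h z - i z) (%mu. hc mu - ic mu)"
   using hs_lin[OF hc ic, of 1 "-1"] by simp
  have ag: "agree m N (c S) (tr (c S))" for c :: "(nat => nat) form" and S by (simp add: agree_def tr_def)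
  have "hc mu - ic mu = 0" if "mu:mis m" "wt m mu <= N" for mu
  proof -
   have "hc mu = dY L c {} mu + dl L E {} mu"
    using fun_cong[OF fun_cong[OF cE], of "{}" mu] by (simp add: hF_def lc_def)
   then show ?thesis unfolding ic_def
    using agree_dY[of m N c "%S. tr (c S)" L "{}"] agree_dl[of m N E "%S. tr (E S)" L "{}"] ag that
    by (simp add: agree_def)
  qed
  then show "EX i:resid m a J L t y. EX c. hs m a (%z. h z - i z) c & (ALL mu:mis m. wt m mu <= N --> c mu = 0)"
   using iI hi by blast
 next
  show "hg m a f" if "f:resid m a J L t y" for f using resid_hg[OF G that] .
  show "g:resid m a J L t y" if "f:resid m a J L t y" "eventually (%z. f z = g z) (nb m a)" for f g
   using resid_cong[OF that] .
 qed (use resid_zero h in auto)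
qed

lemma dv_cong:
 assumes "!!j i. j:J ==> i:set L ==> T j i = T' j i"
 shows "dv J T L om = dv J T' L om"
 using assms
proof (induction L)
 case (Cons i L)
 then have "dv J T L om = dv J T' L om" by simp
 then show ?case using Cons.prems unfolding dv_simps cv_def by (intro ext sum.cong) auto
qed simp

lemma dv_scale: "dv J T L (%S. a * om S) = (%S. a * dv J T L om S)"
 using dv_lin[of J T L a om 0 om] by simp

lemma hg_eps: "(!!S. hg m a (%z. om z S)) ==> hg m a (%z. eps j (om z) S)"
 unfolding eps_def by (cases "j:S") (auto intro: hg_mult hg_const)

lemma hg_if_const: "(P ==> hg m a f) ==> (~ P ==> hg m a g) ==> hg m a (%z. if P then f z else g z)"
 by (cases P) auto

text \<open>Induction on the number of columns. If all matrix entries vanish at a,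
  \<open>residual_at_0\<close> applies. Otherwise some entry is a unit at a, and elimination gives
  coordinates in which row j0 is a coordinate y0 and the other rows are, modulo y0, those of a
  matrix with one row and one column fewer. The induction hypothesis describes h on y0 = 0, and the
  difference is a multiple of y0, that is, of row j0.\<close>

theorem generic_residual:
 assumes "gindex m J L t y" "a:cvec m" "!!i. i:set L ==> a (y i) = 0" "hg m a h"
  and "!!i. i:set L ==> EX b. (ALL j:J. hg m a (b j)) &
    eventually (%z. h z * z (y i) = (\<Sum>j\<in>J. b j z * row L t y j z)) (nb m a)"
 shows "h:resid m a J L t y"
 using assms
proof (induction "length L" arbitrary: J L a h)
 case 0
 then have L: "L = []" by simp
 \<comment> \<open>Without columns the only maximal minor is 1, and every germ belongs to the
   ideal.\<close>
 show ?case unfolding L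
  by (rule residI[where c = "%_ _. 0" and E = "%z _. h z"]) (simp_all add: hg_const 0)
next
 case (Suc N)
 note G = Suc.prems(1) and a = Suc.prems(2) and ay = Suc.prems(3) and h = Suc.prems(4) and hb = Suc.prems(5)
 have J: "finite J" and L: "distinct L" and tm: "!!j i. j:J ==> i:set L ==> t j i < m"
  and ym: "!!i. i:set L ==> y i < m"
  and tinj: "!!j i j' i'. j:J ==> i:set L ==> j':J ==> i':set L ==> t j i = t j' i' ==> j = j' & i = i'"
  and yinj: "inj_on y (set L)" and ty: "!!j i k. j:J ==> i:set L ==> k:set L ==> t j i ~= y k"
  using G unfolding gindex_def by blast+
 have Lne: "L ~= []" using Suc.hyps by auto
 show ?case
 proof (cases "ALL j:J. ALL i:set L. a (t j i) = 0")
  case True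
  have n: "hd L:set L" using Lne by simp
  from hb[OF n] obtain b where b: "!!j. j:J ==> hg m a (b j)"
   "eventually (%z. h z * z (y (hd L)) = (\<Sum>j\<in>J. b j z * row L t y j z)) (nb m a)" by blast
  show ?thesis by (rule residual_at_0[OF G a ay _ h n b]) (use True in auto)
 next
  case False
  then obtain j0 i0 where j0: "j0:J" and i0: "i0:set L" and p0: "a (t j0 i0) ~= 0" by blast
  define J' where "J' = J - {j0}"
  define L' where "L' = remove1 i0 L"
  have sL': "set L' = set L - {i0}" using L by (simp add: L'_def set_remove1_eq)
  have L': "length L' = N" "distinct L'" using Suc.hyps(2) i0 L by (auto simp: L'_def length_remove1)
  have G': "gindex m J' L' t y"
   using G unfolding gindex_def sL' J'_def by (auto simp: L'(2) intro: inj_on_subset)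
  define y0 where "y0 = y i0"
  have y0m: "y0 < m" using ym i0 by (simp add: y0_def)
  define p where "p z = z (t j0 i0)" for z :: "nat => complex"
  \<comment> \<open>Pivot column times pivot row over the pivot, placed at the coordinates of the
    remaining entries: the correction of Gaussian elimination.\<close>
  define X where "X z k = (\<Sum>j\<in>J'. \<Sum>i\<in>set L'. if k = t j i then z (t j i0) * z (t j0 i) / p z else 0)"
   for z :: "nat => complex" and k
  \<comment> \<open>\<open>ta\<close> goes to the eliminated matrix and makes row j0 the coordinate
    y0, and \<open>si\<close> is its inverse where the pivot is nonzero. The entries of row j0 and
    column i0 are kept and become parameters.\<close>
  define si where "si z = (%k. if k = y0 then (z y0 - (\<Sum>i\<in>set L'. z (t j0 i) * z (y i))) / p z else z k + X z k)"
   for z :: "nat => complex"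
  define ta where "ta z = (%k. if k = y0 then row L t y j0 z else z k - X z k)" for z :: "nat => complex"
  have X1: "X z (t j i) = z (t j i0) * z (t j0 i) / p z" if "j:J'" "i:set L'" for z j i
  proof -
   have *: "(if t j i = t j' i' then z (t j' i0) * z (t j0 i') / p z else 0) =
     (if i' = i then (if j' = j then z (t j i0) * z (t j0 i) / p z else 0) else 0)" if "j':J'" "i':set L'" for j' i'
   proof -
    have "j:J" "j':J" "i:set L" "i':set L" using that \<open>j:J'\<close> \<open>i:set L'\<close> by (simp_all add: J'_def sL')
    from tinj[OF this(1,3,2,4)] show ?thesis by (cases "j' = j"; cases "i' = i") auto
   qed
   have "X z (t j i) = (\<Sum>j'\<in>J'. \<Sum>i'\<in>set L'. if i' = i then (if j' = j then z (t j i0) * z (t j0 i) / p z else 0) else 0)"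
    unfolding X_def by (intro sum.cong refl *)
   also have "\<dots> = (\<Sum>j'\<in>J'. if j' = j then z (t j i0) * z (t j0 i) / p z else 0)"
    using that by (intro sum.cong refl) simp
   finally show ?thesis using that J by (simp add: J'_def)
  qed
  have X0: "X z k = 0" if "!!j i. j:J' ==> i:set L' ==> k ~= t j i" for z k
   unfolding X_def by (rule sum.neutral, rule ballI, rule sum.neutral, rule ballI) (use that in simp)
  have X0a: "X z (t j0 i) = 0" if "i:set L" for z i
  proof (rule X0)
   fix j' i' assume "j':J'" "i':set L'"
   then show "t j0 i ~= t j' i'" using tinj[OF j0 that, of j' i'] by (auto simp: J'_def sL')
  qed
  have X0b: "X z (t j i0) = 0" if "j:J" for z j
  proof (rule X0)
   fix j' i' assume "j':J'" "i':set L'"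
   then show "t j i0 ~= t j' i'" using tinj[OF that i0, of j' i'] by (auto simp: J'_def sL')
  qed
  have X0c: "X z (y i) = 0" if "i:set L" for z i
  proof (rule X0)
   fix j' i' assume "j':J'" "i':set L'"
   then show "y i ~= t j' i'" using ty[of j' i' i] that by (auto simp: J'_def sL')
  qed
  have ne: "t j i ~= y0" if "j:J" "i:set L" for j i using ty that i0 by (auto simp: y0_def)
  have yne: "y i ~= y0" if "i:set L'" for i
   using that inj_onD[OF yinj, of i i0] i0 by (auto simp: y0_def sL')
  have sit: "si z (t j i) = z (t j i) + z (t j i0) * z (t j0 i) / p z" if "j:J'" "i:set L'" for z j i
   using that ne[of j i] by (simp add: si_def X1 J'_def sL')
  have sit0: "si z (t j0 i) = z (t j0 i)" if "i:set L" for z i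
   using that ne[OF j0 that] by (simp add: si_def X0a)
  have sit1: "si z (t j i0) = z (t j i0)" if "j:J" for z j
   using that ne[OF that i0] by (simp add: si_def X0b)
  have siy: "si z (y i) = z (y i)" if "i:set L'" for z i
   using yne[OF that] that by (simp add: si_def X0c sL')
  have siy0: "si z y0 = (z y0 - (\<Sum>i\<in>set L'. z (t j0 i) * z (y i))) / p z" for z
   by (simp add: si_def)
  have tat: "ta z (t j i) = z (t j i) - z (t j i0) * z (t j0 i) / p z" if "j:J'" "i:set L'" for z j i
   using that ne[of j i] by (simp add: ta_def X1 J'_def sL')
  have tat0: "ta z (t j0 i) = z (t j0 i)" if "i:set L" for z i
   using that ne[OF j0 that] by (simp add: ta_def X0a)
  have tat1: "ta z (t j i0) = z (t j i0)" if "j:J" for z j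
   using that ne[OF that i0] by (simp add: ta_def X0b)
  have tay: "ta z (y i) = z (y i)" if "i:set L'" for z i
   using yne[OF that] that by (simp add: ta_def X0c sL')
  have tay0: "ta z y0 = row L t y j0 z" for z by (simp add: ta_def)
  have pta: "p (ta z) = p z" for z using tat0[OF i0] by (simp add: p_def)
  have split: "(\<Sum>i\<in>set L. f i) = f i0 + (\<Sum>i\<in>set L'. f i)" for f :: "nat => complex"
   unfolding sL' by (rule sum.remove) (use i0 in auto)
  have row_split: "row L t y j z = z (t j i0) * z y0 + (\<Sum>i\<in>set L'. z (t j i) * z (y i))" for j z
   unfolding row_def split y0_def ..
  have Xta: "X (ta z) k = X z k" for z k
   unfolding X_def pta by (intro sum.cong refl if_cong) (auto simp: tat0 tat1 J'_def sL')
  have sita: "si (ta z) = z" if "p z ~= 0" for z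
  proof
   fix k show "si (ta z) k = z k"
   proof (cases "k = y0")
    case True
    have "(\<Sum>i\<in>set L'. ta z (t j0 i) * ta z (y i)) = (\<Sum>i\<in>set L'. z (t j0 i) * z (y i))"
     by (intro sum.cong refl) (auto simp: tat0 tay sL')
    then show ?thesis using that unfolding True siy0 pta tay0 row_split by (simp add: p_def)
   next
    case False
    then have "si (ta z) k = ta z k + X (ta z) k" by (simp add: si_def)
    then show ?thesis using False unfolding Xta by (simp add: ta_def)
   qed
  qed
  have row_j0: "row L t y j0 (si z) = z y0" if "p z ~= 0" for z
  proof -
   have "(\<Sum>i\<in>set L'. si z (t j0 i) * si z (y i)) = (\<Sum>i\<in>set L'. z (t j0 i) * z (y i))"
    by (intro sum.cong refl) (auto simp: sit0 siy sL')
   then show ?thesis using that unfolding row_split sit0[OF i0] siy0 by (simp add: p_def)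
  qed
  have row_si: "row L t y j (si z) = row L' t y j z + z (t j i0) / p z * z y0" if "j:J'" "p z ~= 0" for j z
  proof -
   have jJ: "j:J" using that by (simp add: J'_def)
   have "(\<Sum>i\<in>set L'. si z (t j i) * si z (y i)) =
     (\<Sum>i\<in>set L'. z (t j i) * z (y i) + z (t j i0) / p z * (z (t j0 i) * z (y i)))"
    using that by (intro sum.cong refl) (simp add: sit siy algebra_simps)
   also have "\<dots> = row L' t y j z + z (t j i0) / p z * (\<Sum>i\<in>set L'. z (t j0 i) * z (y i))"
    by (simp add: row_def sum.distrib sum_distrib_left)
   finally show ?thesis unfolding row_split sit1[OF jJ] siy0 using that(2) by (simp add: field_simps)
  qed
  have row_ta: "row L' t y j (ta z) = row L t y j z - z (t j i0) / p z * row L t y j0 z" if "j:J'" "p z ~= 0" for j z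
  proof -
   have "row L' t y j (ta z) = (\<Sum>i\<in>set L'. z (t j i) * z (y i) - z (t j i0) / p z * (z (t j0 i) * z (y i)))"
    unfolding row_def using that by (intro sum.cong refl) (simp add: tat tay algebra_simps)
   also have "\<dots> = (\<Sum>i\<in>set L'. z (t j i) * z (y i)) - z (t j i0) / p z * (\<Sum>i\<in>set L'. z (t j0 i) * z (y i))"
    by (simp add: sum_subtractf sum_distrib_left)
   finally show ?thesis unfolding row_split using that(2) by (simp add: field_simps p_def)
  qed
  define a' where "a' = ta a"
  have p0': "p a ~= 0" using p0 by (simp add: p_def)
  have pa': "p a' ~= 0" using p0' by (simp add: a'_def pta)
  have Xm: "X z k = 0" if "k >= m" for z k
   by (rule X0) (use that tm in \<open>fastforce simp: J'_def sL'\<close>)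
  have tacv: "ta z:cvec m" if "z:cvec m" for z
   using that y0m by (auto simp: ta_def cvec_def Xm)
  have sicv: "si z:cvec m" if "z:cvec m" for z
   using that y0m by (auto simp: si_def cvec_def Xm)
  have a'c: "a':cvec m" unfolding a'_def by (rule tacv[OF a])
  have a'y: "a' (y i) = 0" if "i:set L'" for i
   using that ay by (simp add: a'_def tay sL')
  have a'y0: "a' y0 = 0" unfolding a'_def tay0 row_def by (rule sum.neutral) (use ay in auto)
  have hgp: "hg m c p" for c unfolding p_def by (rule hg_coord[OF tm[OF j0 i0]])
  have hgX: "hg m c (%z. X z k)" if "p c ~= 0" "c:cvec m" for c k
   unfolding X_def by (intro hg_sum hg_if_const hg_divide hg_mult hg_coord hg_const hgp that)
    (use tm j0 i0 in \<open>auto simp: J'_def sL'\<close>)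
  have hgta: "hg m a (%z. ta z k)" if "k < m" for k
   unfolding ta_def by (intro hg_if_const hg_diff hg_coord hgX hg_row[OF G j0] p0' a that)
  have hgsi: "hg m a' (%z. si z k)" if "k < m" for k
   unfolding si_def by (intro hg_if_const hg_add hg_diff hg_divide hg_sum hg_mult hg_coord hgX hgp pa' a'c that)
    (use tm ym j0 y0m in \<open>auto simp: sL'\<close>)
  have evta: "eventually (%z. ta z:cvec m) (nb m a)"
   using eventually_nb_cvec by eventually_elim (rule tacv)
  have evsi: "eventually (%z. si z:cvec m) (nb m a')"
   using eventually_nb_cvec by eventually_elim (rule sicv)
  have sa: "si a' = a" unfolding a'_def by (rule sita[OF p0'])
  have compsi: "hg m a' (%z. f (si z))" if "hg m a f" for f
   by (rule hg_compose[where G = si and k = m]) (use that hgsi evsi a'c in \<open>auto simp: sa\<close>)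
  have compta: "hg m a (%z. f (ta z))" if "hg m a' f" for f
   by (rule hg_compose[where G = ta and k = m]) (use that hgta evta a in \<open>auto simp: a'_def\<close>)
  define Z where "Z z = z(y0 := 0)" for z :: "nat => complex"
  have Za: "Z a' = a'" using a'y0 by (auto simp: Z_def)
  have hgZ: "hg m a' (%z. Z z k)" if "k < m" for k
   unfolding Z_def by (cases "k = y0") (auto intro: hg_const hg_coord that)
  have evZ: "eventually (%z. Z z:cvec m) (nb m a')"
   using eventually_nb_cvec by eventually_elim (use y0m in \<open>auto simp: Z_def cvec_def\<close>)
  have compZ: "hg m a' (%z. f (Z z))" if "hg m a' f" for f
   by (rule hg_compose[where G = Z and k = m]) (use that hgZ evZ a'c in \<open>auto simp: Za\<close>)
  have evp: "eventually (%z. p z ~= 0) (nb m c)" if "p c ~= 0" "c:cvec m" for c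
   using hg_tendsto[OF hgp that(2)] that(1) by (rule tendsto_imp_eventually_ne)
  \<comment> \<open>On y0 = 0 row j0 vanishes, so the relations for h turn into relations among the
    rows of the smaller matrix.\<close>
  define h0 where "h0 z = h (si (Z z))" for z
  have h0: "hg m a' h0" unfolding h0_def by (rule compZ[OF compsi[OF h]])
  have rowZ: "row L' t y j (Z z) = row L' t y j z" if "j:J'" for j z
   unfolding row_def Z_def using ne yne that by (intro sum.cong refl) (auto simp: J'_def sL')
  have IH: "h0:resid m a' J' L' t y"
  proof (rule Suc.hyps(1)[OF L'(1)[symmetric] G' a'c a'y h0])
   fix i assume i: "i:set L'"
   then have iL: "i:set L" by (simp add: sL')
   from hb[OF iL] obtain b where b: "!!j. j:J ==> hg m a (b j)"
    "eventually (%z. h z * z (y i) = (\<Sum>j\<in>J. b j z * row L t y j z)) (nb m a)" by blast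
   have e1: "eventually (%z. h (si z) * si z (y i) = (\<Sum>j\<in>J. b j (si z) * row L t y j (si z))) (nb m a')"
    by (rule hg_compose_eventually[where G = si and k = m]) (use b(2) hgsi evsi a'c in \<open>auto simp: sa\<close>)
   have e2: "eventually (%z. h (si (Z z)) * si (Z z) (y i) = (\<Sum>j\<in>J. b j (si (Z z)) * row L t y j (si (Z z)))) (nb m a')"
    by (rule hg_compose_eventually[where G = Z and k = m]) (use e1 hgZ evZ a'c in \<open>auto simp: Za\<close>)
   have "eventually (%z. h0 z * z (y i) = (\<Sum>j\<in>J'. b j (si (Z z)) * row L' t y j z)) (nb m a')"
    using e2 evp[OF pa' a'c]
   proof eventually_elim
    case (elim z)
    have pZ: "p (Z z) ~= 0" using elim(2) ne[OF j0 i0] by (simp add: p_def Z_def)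
    have Z0: "Z z y0 = 0" by (simp add: Z_def)
    have "si (Z z) (y i) = z (y i)" using yne[OF i] by (simp add: siy[OF i] Z_def)
    then have "h0 z * z (y i) = (\<Sum>j\<in>J. b j (si (Z z)) * row L t y j (si (Z z)))"
     using elim(1) by (simp add: h0_def)
    also have "\<dots> = b j0 (si (Z z)) * row L t y j0 (si (Z z)) + (\<Sum>j\<in>J'. b j (si (Z z)) * row L t y j (si (Z z)))"
     unfolding J'_def by (rule sum.remove[OF J j0])
    also have "\<dots> = (\<Sum>j\<in>J'. b j (si (Z z)) * row L' t y j z)"
     unfolding row_j0[OF pZ] Z0 by (simp add: row_si pZ Z0 rowZ)
    finally show ?case .
   qed
   moreover have "hg m a' (%z. b j (si (Z z)))" if "j:J'" for j
    by (rule compZ[OF compsi[OF b(1)]]) (use that in \<open>simp add: J'_def\<close>)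
   ultimately show "EX b. (ALL j:J'. hg m a' (b j)) &
    eventually (%z. h0 z * z (y i) = (\<Sum>j\<in>J'. b j z * row L' t y j z)) (nb m a')"
    by (intro exI[of _ "%j z. b j (si (Z z))"]) auto
  qed
  obtain c E where c: "!!j. j:J' ==> hg m a' (c j)" and E: "!!S. hg m a' (%z. E z S)"
   and h0e: "eventually (%z. h0 z = (\<Sum>j\<in>J'. c j z * row L' t y j z) + dv J' (%j i. z (t j i)) L' (E z) {}) (nb m a')"
   using residE[OF IH] by blast
  obtain q where q: "hg m a' q" and qe: "eventually (%z. h (si z) - h (si (z(y0 := a' y0))) = (z y0 - a' y0) * q z) (nb m a')"
   using hg_hadamard[OF compsi[OF h] a'c y0m] by blast
  have ee: "eventually (%z. h (si z) = z y0 * q z + ((\<Sum>j\<in>J'. c j z * row L' t y j z) + dv J' (%j i. z (t j i)) L' (E z) {})) (nb m a')"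
   using h0e qe by eventually_elim (simp add: a'y0 h0_def Z_def algebra_simps)
  have eta: "eventually (%z. h (si (ta z)) = ta z y0 * q (ta z) + ((\<Sum>j\<in>J'. c j (ta z) * row L' t y j (ta z)) +
    dv J' (%j i. ta z (t j i)) L' (E (ta z)) {})) (nb m a)"
   by (rule hg_compose_eventually[where G = ta and k = m]) (use ee hgta evta a in \<open>auto simp: a'_def\<close>)
  obtain s where s: "!!T om. dv J T L om = (%S. s * dv J T (i0 # L') om S)" "s * s = 1"
   using dv_remove1[OF J i0] unfolding L'_def by fastforce
  \<comment> \<open>Compensates the sign of moving column i0 to the front and the factor produced by
    \<open>dv_pivot\<close>; s is its own inverse.\<close>
  define e where "e z = s * (-1) ^ length L' / p z" for z
  define E1 where "E1 z = (%S. e z * eps j0 (E (ta z)) S)" for z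
  \<comment> \<open>A row of the smaller matrix is a row of the given one minus a multiple of row
    j0. These multiples, together with the quotient q, make up the coefficient of row j0.\<close>
  define c1 where "c1 j z = (if j = j0 then q (ta z) - (\<Sum>j\<in>J'. c j (ta z) * (z (t j i0) / p z)) else c j (ta z))" for j z
  show ?thesis
  proof (rule residI[where c = c1 and E = E1])
   fix j assume j: "j:J"
   show "hg m a (c1 j)" unfolding c1_def
    by (intro hg_if_const hg_diff hg_sum hg_mult hg_divide compta q c hg_coord hgp p0' a)
     (use j tm i0 in \<open>auto simp: J'_def\<close>)
  next
   fix S show "hg m a (%z. E1 z S)" unfolding E1_def e_def
    by (intro hg_mult hg_divide hg_const hgp p0' a hg_eps compta E)
  next
   show "eventually (%z. h z = (\<Sum>j\<in>J. c1 j z * row L t y j z) + dv J (%j i. z (t j i)) L (E1 z) {}) (nb m a)"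
    using eta evp[OF p0' a]
   proof eventually_elim
    case (elim z)
    have i0L': "i0 \<notin> set L'" by (simp add: sL')
    have d1: "dv J (%j i. z (t j i)) L (E1 z) {} = dv J' (%j i. ta z (t j i)) L' (E (ta z)) {}"
    proof -
     have "dv J' (%j i. ta z (t j i)) L' om = dv J' (%j i. z (t j i) - z (t j i0) * z (t j0 i) / z (t j0 i0)) L' om" for om
      by (rule dv_cong) (simp add: tat p_def)
     then have "dv J (%j i. z (t j i)) (i0 # L') (eps j0 om) {} =
       (-1) ^ length L' * p z * dv J' (%j i. ta z (t j i)) L' om {}" for om
      using dv_pivot[OF J j0, of "%j i. z (t j i)" i0 L' om] elim(2) i0L' by (simp add: p_def J'_def)
     then have "dv J (%j i. z (t j i)) L (E1 z) {} = s * (e z * ((-1) ^ length L' * p z * dv J' (%j i. ta z (t j i)) L' (E (ta z)) {}))"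
      unfolding s(1) E1_def dv_scale by simp
     also have "\<dots> = (s * s) * ((-1) ^ length L' * (-1) ^ length L') * dv J' (%j i. ta z (t j i)) L' (E (ta z)) {}"
      using elim(2) by (simp add: e_def)
     finally show ?thesis by (simp add: s(2) flip: power_mult_distrib)
    qed
    have "(\<Sum>j\<in>J. c1 j z * row L t y j z) = c1 j0 z * row L t y j0 z + (\<Sum>j\<in>J'. c1 j z * row L t y j z)"
     unfolding J'_def by (rule sum.remove[OF J j0])
    also have "(\<Sum>j\<in>J'. c1 j z * row L t y j z) = (\<Sum>j\<in>J'. c j (ta z) * row L t y j z)"
     by (intro sum.cong refl) (auto simp: c1_def J'_def)
    also have "c1 j0 z * row L t y j0 z = q (ta z) * row L t y j0 z - (\<Sum>j\<in>J'. c j (ta z) * (z (t j i0) / p z * row L t y j0 z))"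
     by (simp add: c1_def algebra_simps sum_distrib_left)
    finally have "(\<Sum>j\<in>J. c1 j z * row L t y j z) = q (ta z) * row L t y j0 z +
      (\<Sum>j\<in>J'. c j (ta z) * (row L t y j z - z (t j i0) / p z * row L t y j0 z))"
     by (simp add: right_diff_distrib sum_subtractf)
    then show ?case using elim unfolding d1 sita[OF elim(2)] tay0 by (simp add: row_ta)
   qed
  qed
 qed
qed

section \<open>Division by differences of coordinates\<close>

lemma hadamard_step:
 assumes g: "hg m a g" and a: "a:cvec m" and k: "k < m" "l < m" "k ~= l" "a k = a l"
 shows "EX q. hg m a q & eventually (%z. g z - g (z(k := z l)) = q z * (z k - z l)) (nb m a)"
proof -
 \<comment> \<open>A shear turns the hyperplane \<open>z k = z l\<close> into a coordinate
   hyperplane, where \<open>hg_hadamard\<close> applies.\<close>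
 define P where "P z = z(k := z k + z l)" for z :: "nat => complex"
 define M where "M z = z(k := z k - z l)" for z :: "nat => complex"
 have PM: "P (M z) = z" for z using k by (auto simp: P_def M_def)
 have hgP: "hg m c (%z. P z i)" if "i < m" for i c
  unfolding P_def by (cases "i = k") (use that k in \<open>auto intro!: hg_add hg_coord\<close>)
 have hgM: "hg m c (%z. M z i)" if "i < m" for i c
  unfolding M_def by (cases "i = k") (use that k in \<open>auto intro!: hg_diff hg_coord\<close>)
 have cP: "P z:cvec m" "M z:cvec m" if "z:cvec m" for z
  using that k by (auto simp: P_def M_def cvec_def)
 have eP: "eventually (%z. P z:cvec m) (nb m c)" for c
  using eventually_nb_cvec by eventually_elim (rule cP)
 have eM: "eventually (%z. M z:cvec m) (nb m c)" for c
  using eventually_nb_cvec by eventually_elim (rule cP)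
 have gP: "hg m (M a) (%z. g (P z))"
  by (rule hg_compose[where G = P and k = m]) (use g hgP eP cP a in \<open>auto simp: PM\<close>)
 have Mk: "M a k = 0" using k by (simp add: M_def)
 obtain q where q: "hg m (M a) q" "eventually (%z. g (P z) - g (P (z(k := M a k))) = (z k - M a k) * q z) (nb m (M a))"
  using hg_hadamard[OF gP cP(2)[OF a] k(1)] by blast
 have "hg m a (%z. q (M z))"
  by (rule hg_compose[where G = M and k = m]) (use q hgM eM a in auto)
 moreover have "eventually (%z. g (P (M z)) - g (P ((M z)(k := M a k))) = (M z k - M a k) * q (M z)) (nb m a)"
  by (rule hg_compose_eventually[where G = M and k = m and a = a, OF q(2) hgM eM a])
 then have "eventually (%z. g z - g (z(k := z l)) = q (M z) * (z k - z l)) (nb m a)"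
 proof eventually_elim
  case (elim z)
  have "P ((M z)(k := 0)) = z(k := z l)" using k by (auto simp: P_def M_def)
  then show ?case using elim unfolding PM Mk by (simp add: M_def mult.commute)
 qed
 ultimately show ?thesis by blast
qed

text \<open>The coordinates k i are replaced by l i one at a time, each replacement costing a
  multiple of the corresponding difference. The map c records the renaming made so far; it fixes the
  base point because a has equal entries at k i and l i. After all replacements g vanishes.\<close>

lemma hadamard_diff:
 fixes N :: nat
 assumes g: "hg m a g" and a: "a:cvec m"
  and kl: "!!i. i < N ==> k i < m & l i < m & a (k i) = a (l i)"
  and ne: "!!i j. i < N ==> j < N ==> k i ~= l j" and inj: "inj_on k {..<N}"
  and z: "eventually (%z. (ALL i<N. z (k i) = z (l i)) --> g z = 0) (nb m a)"
 shows "EX q. (ALL i<N. hg m a (q i)) & eventually (%z. g z = (\<Sum>i<N. q i z * (z (k i) - z (l i)))) (nb m a)"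
proof -
 have hgc: "hg m a (%z. f (z \<circ> c))" and evc: "eventually P (nb m a) ==> eventually (%z. P (z \<circ> c)) (nb m a)"
  if "hg m a f" "a \<circ> c = a" "!!j. j < m ==> c j < m" "!!j. j >= m ==> c j = j" for f c P
 proof -
  have 1: "hg m a (%z. (z \<circ> c) i)" if "i < m" for i
   using \<open>!!j. j < m ==> c j < m\<close>[OF that] by (auto intro: hg_coord)
  have 2: "eventually (%z. z \<circ> c:cvec m) (nb m a)"
   using eventually_nb_cvec by eventually_elim (use that(4) in \<open>auto simp: cvec_def\<close>)
  show "hg m a (%z. f (z \<circ> c))"
   by (rule hg_compose[where G = "%z. z \<circ> c" and k = m, OF _ 1 2 a]) (use that in auto)
  show "eventually P (nb m a) ==> eventually (%z. P (z \<circ> c)) (nb m a)"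
   by (rule hg_compose_eventually[where G = "%z. z \<circ> c" and k = m, OF _ 1 2 a]) (use that in auto)
 qed
 have "EX c q. (ALL i<M. c (k i) = l i) & (ALL j. j \<notin> k ` {..<M} --> c j = j) & (ALL i<M. hg m a (q i)) &
   eventually (%z. g z - g (z \<circ> c) = (\<Sum>i<M. q i z * (z (k i) - z (l i)))) (nb m a)" if "M <= N" for M
  using that
 proof (induction M)
  case 0
  show ?case by (intro exI[of _ id] exI) auto
 next
  case (Suc M)
  from Suc.IH[OF Suc_leD[OF Suc.prems]] obtain c q where c: "!!i. i < M ==> c (k i) = l i" "!!j. j \<notin> k ` {..<M} ==> c j = j"
   and q: "!!i. i < M ==> hg m a (q i)" "eventually (%z. g z - g (z \<circ> c) = (\<Sum>i<M. q i z * (z (k i) - z (l i)))) (nb m a)"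
   by blast
  have M: "M < N" using Suc.prems by simp
  have ac: "a \<circ> c = a"
  proof
   fix j show "(a \<circ> c) j = a j"
   proof (cases "j:k ` {..<M}")
    case True
    then obtain i where "i < M" "j = k i" by auto
    then show ?thesis using c(1)[of i] kl[of i] M by simp
   qed (simp add: c(2))
  qed
  have cm: "c j < m" if "j < m" for j
  proof (cases "j:k ` {..<M}")
   case True
   then obtain i where "i < M" "j = k i" by auto
   then show ?thesis using c(1)[of i] kl[of i] M by simp
  qed (simp add: c(2) that)
  have cM: "c j = j" if "j >= m" for j
  proof (rule c(2), rule notI)
   assume "j:k ` {..<M}"
   then obtain i where "i < M" "j = k i" by auto
   then show False using kl[of i] M that by simp
  qed
  have gc: "hg m a (%z. g (z \<circ> c))" by (rule hgc[OF g ac cm cM])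
  obtain q' where q': "hg m a q'" "eventually (%z. g (z \<circ> c) - g (z(k M := z (l M)) \<circ> c) = q' z * (z (k M) - z (l M))) (nb m a)"
   using hadamard_step[OF gc a, of "k M" "l M"] kl[OF M] ne[OF M M] by blast
  define c' where "c' j = (if c j = k M then l M else c j)" for j
  have zc': "z(k M := z (l M)) \<circ> c = z \<circ> c'" for z :: "nat => complex" by (auto simp: c'_def)
  have kM: "k M \<notin> k ` {..<M}" using inj_onD[OF inj, of M] M by force
  have "c' (k i) = l i" if "i < Suc M" for i
  proof (cases "i = M")
   case True
   then show ?thesis using c(2)[OF kM] by (simp add: c'_def)
  next
   case False
   then have i: "i < M" using that by simp
   then show ?thesis using c(1)[OF i] ne[OF M, of i] M by (auto simp: c'_def)
  qed
  moreover have "c' j = j" if "j \<notin> k ` {..<Suc M}" for j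
  proof -
   have "j \<notin> k ` {..<M}" "j ~= k M" using that by auto
   then show ?thesis using c(2)[of j] by (simp add: c'_def)
  qed
  moreover have "eventually (%z. g z - g (z \<circ> c') = (\<Sum>i<Suc M. (if i = M then q' else q i) z * (z (k i) - z (l i)))) (nb m a)"
   using q(2) q'(2) unfolding zc'
  proof eventually_elim
   case (elim z)
   have "g z - g (z \<circ> c') = (g z - g (z \<circ> c)) + (g (z \<circ> c) - g (z \<circ> c'))" by simp
   then show ?case unfolding elim by simp
  qed
  moreover have "hg m a (if i = M then q' else q i)" if "i < Suc M" for i using that q(1) q'(1) by auto
  ultimately show ?case by (intro exI[of _ c'] exI[of _ "%i. if i = M then q' else q i"]) blast
 qed
 from this[OF order.refl] obtain c q where c: "!!i. i < N ==> c (k i) = l i" "!!j. j \<notin> k ` {..<N} ==> c j = j"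
   and q: "!!i. i < N ==> hg m a (q i)" "eventually (%z. g z - g (z \<circ> c) = (\<Sum>i<N. q i z * (z (k i) - z (l i)))) (nb m a)"
  by blast
 have cl: "c (l i) = l i" if "i < N" for i by (rule c(2)) (use ne that in \<open>metis imageE lessThan_iff\<close>)
 have ac: "a \<circ> c = a"
 proof
  fix j show "(a \<circ> c) j = a j"
  proof (cases "j:k ` {..<N}")
   case True
   then obtain i where "i < N" "j = k i" by auto
   then show ?thesis using c(1)[of i] kl[of i] by simp
  qed (simp add: c(2))
 qed
 have cm: "c j < m" if "j < m" for j
 proof (cases "j:k ` {..<N}")
  case True
  then obtain i where "i < N" "j = k i" by auto
  then show ?thesis using c(1)[of i] kl[of i] by simp
 qed (simp add: c(2) that)
 have cM: "c j = j" if "j >= m" for j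
 proof (rule c(2), rule notI)
  assume "j:k ` {..<N}"
  then obtain i where "i < N" "j = k i" by auto
  then show False using kl[of i] that by simp
 qed
 have "eventually (%z. (ALL i<N. (z \<circ> c) (k i) = (z \<circ> c) (l i)) --> g (z \<circ> c) = 0) (nb m a)"
  by (rule evc[OF g ac cm cM z])
 then have "eventually (%z. g (z \<circ> c) = 0) (nb m a)"
  by eventually_elim (simp add: c(1) cl)
 then have "eventually (%z. g z = (\<Sum>i<N. q i z * (z (k i) - z (l i)))) (nb m a)"
  using q(2) by eventually_elim simp
 then show ?thesis using q(1) by blast
qed

section \<open>Pairs of points as points of a product space\<close>

definition fstv :: "nat => cseq => nat => complex" where
 "fstv n z = (%i. if i < n then z i else 0)"

definition sndv :: "nat => cseq => nat => complex" where
 "sndv n z = (%i. z (n + i))"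

lemma fstv_cvec [simp]: "fstv n z:cvec n"
 by (simp add: fstv_def cvec_def)

lemma sndv_cvec: "z:cvec (n + k) ==> sndv n z:cvec k"
 by (simp add: sndv_def cvec_def)

lemma cconcat_cvec: "v:cvec k ==> cconcat n u v:cvec (n + k)"
 by (auto simp: cconcat_def cvec_def)

lemma fstv_cconcat [simp]: "u:cvec n ==> fstv n (cconcat n u v) = u"
 by (auto simp: fstv_def cconcat_def cvec_def fun_eq_iff)

lemma sndv_cconcat [simp]: "sndv n (cconcat n u v) = v"
 by (simp add: sndv_def cconcat_def)

lemma cconcat_fstv_sndv [simp]: "cconcat n (fstv n z) (sndv n z) = z"
 by (auto simp: fstv_def sndv_def cconcat_def fun_eq_iff)

lemma cconcat_inject: "u:cvec n ==> u':cvec n ==> cconcat n u v = cconcat n u' v' \<longleftrightarrow> u = u' & v = v'"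
 by (metis fstv_cconcat sndv_cconcat)

lemma hg_fstv: "i < n ==> hg (n + k) c (%z. fstv n z i)"
 unfolding fstv_def by (auto intro: hg_coord)

lemma hg_sndv: "i < k ==> hg (n + k) c (%z. sndv n z i)"
 unfolding sndv_def by (auto intro: hg_coord)

lemma eventually_nb_prod:
 assumes c: "c:cvec (n + k)"
 shows "eventually Q (nb (n + k) c) \<longleftrightarrow>
  (EX P1 P2. eventually P1 (nb n (fstv n c)) & eventually P2 (nb k (sndv n c)) & (ALL u v. P1 u --> P2 v --> Q (cconcat n u v)))"
proof
 assume "eventually Q (nb (n + k) c)"
 then obtain r where r: "r > 0" "ALL z:pd (n + k) c r. Q z" unfolding eventually_nb[OF c] by blast
 have "Q (cconcat n u v)" if "u:pd n (fstv n c) r" "v:pd k (sndv n c) r" for u v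
 proof -
  have "cconcat n u v i = (if i < n then u i else v (i - n))" for i by (simp add: cconcat_def)
  moreover have "norm (v (i - n) - c i) < r" if "~ i < n" "i < n + k" for i
  proof -
   have "ALL j<k. norm (v j - c (n + j)) < r"
    using \<open>v:pd k (sndv n c) r\<close> unfolding pd_def sndv_def by auto
   from this[rule_format, of "i - n"] show ?thesis using that by simp
  qed
  ultimately have "cconcat n u v:pd (n + k) c r"
   using that cconcat_cvec[of v k n u] by (auto simp: pd_def fstv_def)
  then show ?thesis using r by blast
 qed
 moreover have "eventually (%u. u:pd n (fstv n c) r) (nb n (fstv n c))"
  using r by (intro eventually_nb_openin openin_pd pd_center) auto
 moreover have "eventually (%u. u:pd k (sndv n c) r) (nb k (sndv n c))"
  using r c by (intro eventually_nb_openin openin_pd pd_center sndv_cvec) auto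
 ultimately show "EX P1 P2. eventually P1 (nb n (fstv n c)) & eventually P2 (nb k (sndv n c)) & (ALL u v. P1 u --> P2 v --> Q (cconcat n u v))"
  by blast
next
 assume "EX P1 P2. eventually P1 (nb n (fstv n c)) & eventually P2 (nb k (sndv n c)) & (ALL u v. P1 u --> P2 v --> Q (cconcat n u v))"
 then obtain P1 P2 where P: "eventually P1 (nb n (fstv n c))" "eventually P2 (nb k (sndv n c))"
  "!!u v. P1 u ==> P2 v ==> Q (cconcat n u v)" by (elim exE conjE) simp
 have "eventually (%z. P1 (fstv n z)) (nb (n + k) c)"
  by (rule hg_compose_eventually[where G = "fstv n" and k = n, OF P(1) hg_fstv _ c]) auto
 moreover have "eventually (%z. P2 (sndv n z)) (nb (n + k) c)"
  by (rule hg_compose_eventually[where G = "sndv n" and k = k, OF P(2) hg_sndv _ c])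
   (use eventually_nb_cvec[of "n + k" c] in \<open>auto elim!: eventually_mono intro: sndv_cvec\<close>)
 ultimately show "eventually Q (nb (n + k) c)"
 proof eventually_elim
  case (elim z)
  from P(3)[OF elim] show ?case by simp
 qed
qed

lemma eventually_nhdsin_prod:
 assumes "x:topspace A" "y:topspace B"
 shows "eventually P (nhdsin (prod_topology A B) (x, y)) \<longleftrightarrow>
  (EX P1 P2. eventually P1 (nhdsin A x) & eventually P2 (nhdsin B y) & (ALL u v. P1 u --> P2 v --> P (u, v)))"
  (is "?L \<longleftrightarrow> ?R")
proof
 assume ?L
 moreover have "(x, y):topspace (prod_topology A B)" using assms by simp
 ultimately obtain S where S: "openin (prod_topology A B) S" "(x, y):S" "ALL z:S. P z"
  unfolding eventually_nhdsin by blast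
 from S(1)[unfolded openin_prod_topology_alt, rule_format, OF S(2)]
 obtain U V where UV: "openin A U" "openin B V" "x:U" "y:V" "U \<times> V <= S" by blast
 have "eventually (%u. u:U) (nhdsin A x)" "eventually (%v. v:V) (nhdsin B y)"
  unfolding eventually_nhdsin using UV(1-4) by blast+
 moreover have "P (u, v)" if "u:U" "v:V" for u v using UV(5) S(3) that by blast
 ultimately show ?R by (intro exI[of _ "%u. u:U"] exI[of _ "%v. v:V"]) simp
next
 assume ?R
 then obtain P1 P2 where P: "eventually P1 (nhdsin A x)" "eventually P2 (nhdsin B y)"
  "!!u v. P1 u ==> P2 v ==> P (u, v)" by (elim exE conjE) simp
 obtain U where U: "openin A U" "x:U" "ALL u:U. P1 u" using P(1) assms(1) unfolding eventually_nhdsin by blast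
 obtain V where V: "openin B V" "y:V" "ALL v:V. P2 v" using P(2) assms(2) unfolding eventually_nhdsin by blast
 have "openin (prod_topology A B) (U \<times> V)" using U(1) V(1) by (simp add: openin_prod_Times_iff)
 moreover have "ALL z:U \<times> V. P z" using P(3) U(3) V(3) by (simp add: split_paired_all)
 ultimately show ?L unfolding eventually_nhdsin using U(2) V(2) by (intro disjI2 exI[of _ "U \<times> V"]) simp
qed

lemma eventually_nhdsin_openin: "openin T S ==> x:S ==> eventually (%z. z:S) (nhdsin T x)"
 unfolding eventually_nhdsin by blast

lemma openin_iff_nhdsin: "openin T S \<longleftrightarrow> S <= topspace T & (ALL x:S. eventually (%z. z:S) (nhdsin T x))"
proof
 assume "openin T S"
 then show "S <= topspace T & (ALL x:S. eventually (%z. z:S) (nhdsin T x))"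
  by (intro conjI ballI openin_subset eventually_nhdsin_openin)
next
 assume S: "S <= topspace T & (ALL x:S. eventually (%z. z:S) (nhdsin T x))"
 have "EX U. openin T U & x:U & U <= S" if x: "x:S" for x
 proof -
  have "eventually (%z. z:S) (nhdsin T x)" "x:topspace T" using S x by auto
  then show ?thesis unfolding eventually_nhdsin by auto
 qed
 then show "openin T S" by (subst openin_subopen) auto
qed

lemma nhdsin_nb: "a:cvec m ==> nhdsin (top_of_set (cvec m)) a = nb m a"
 unfolding filter_eq_iff
proof
 fix P assume a: "a:cvec m"
 show "eventually P (nhdsin (top_of_set (cvec m)) a) \<longleftrightarrow> eventually P (nb m a)"
 proof
  assume "eventually P (nhdsin (top_of_set (cvec m)) a)"
  then obtain S where S: "openin (top_of_set (cvec m)) S" "a:S" "ALL z:S. P z"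
   using a unfolding eventually_nhdsin by auto
  show "eventually P (nb m a)" by (rule eventually_mono[OF eventually_nb_openin[OF S(1,2)]]) (use S(3) in simp)
 next
  assume "eventually P (nb m a)"
  then obtain T where T: "open T" "a:T" "ALL z:T \<inter> cvec m. P z" unfolding eventually_nb_open by blast
  have "openin (top_of_set (cvec m)) (cvec m \<inter> T)" by (rule openin_open_Int[OF T(1)])
  then show "eventually P (nhdsin (top_of_set (cvec m)) a)"
   unfolding eventually_nhdsin using T a by (intro disjI2 exI[of _ "cvec m \<inter> T"]) auto
 qed
qed

lemma openin_cvec_iff: "openin (top_of_set (cvec m)) S \<longleftrightarrow> S <= cvec m & (ALL a:S. eventually (%z. z:S) (nb m a))"
 unfolding openin_iff_nhdsin using nhdsin_nb by (auto simp: subset_iff)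

section \<open>Manifolds, functions and maps through neighbourhood filters\<close>

definition chart :: "'a charted => 'a set => ('a => nat => complex) => bool" where
 "chart M U phi \<longleftrightarrow> opn M U & inj_on phi U & phi ` U <= cvec (mdim M) &
  (ALL x:U. filtermap phi (nhd M x) = nb (mdim M) (phi x))"

text \<open>The local content of \<open>complex_manifold\<close>, expressed by filters and germs at
  each point. In this form it passes to products by splitting filters and coordinates.\<close>

definition cm :: "'a charted => bool" where
 "cm M \<longleftrightarrow> (\<Union>(U, phi)\<in>matlas M. U) = pts M &
  (ALL (U, phi):matlas M. chart M U phi) &
  (ALL (U, phi):matlas M. ALL (V, psi):matlas M. ALL x:U \<inter> V. ALL i<mdim M.
    hg (mdim M) (phi x) (%u. psi (inv_into U phi u) i))"

lemma chartD:
 assumes "chart M U phi"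
 shows "opn M U" "inj_on phi U" "x:U ==> phi x:cvec (mdim M)"
  "x:U ==> filtermap phi (nhd M x) = nb (mdim M) (phi x)" "x:U ==> x:pts M"
  "x:U ==> eventually (%z. z:U) (nhd M x)"
proof -
 show o: "opn M U" "inj_on phi U" using assms unfolding chart_def by auto
 show "x:U ==> phi x:cvec (mdim M)" using assms unfolding chart_def by auto
 show "x:U ==> filtermap phi (nhd M x) = nb (mdim M) (phi x)" using assms unfolding chart_def by auto
 show "x:U ==> x:pts M" using openin_subset[OF o(1)] by auto
 show "x:U ==> eventually (%z. z:U) (nhd M x)" by (rule eventually_nhdsin_openin[OF o(1)])
qed

lemma chart_eventually:
 assumes "chart M U phi" "x:U"
 shows "eventually P (nb (mdim M) (phi x)) \<longleftrightarrow> eventually (%z. P (phi z)) (nhd M x)"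
 unfolding chartD(4)[OF assms, symmetric] eventually_filtermap ..

lemma chart_eventually_inv:
 assumes "chart M U phi" "x:U"
 shows "eventually P (nhd M x) \<longleftrightarrow> eventually (%u. P (inv_into U phi u)) (nb (mdim M) (phi x))"
 unfolding chart_eventually[OF assms]
 by (rule eventually_cong[OF chartD(6)[OF assms]]) (simp add: inv_into_f_f[OF chartD(2)[OF assms(1)]])

lemma chart_image_open:
 assumes "chart M U phi" "opn M T" "T <= U"
 shows "openin (top_of_set (cvec (mdim M))) (phi ` T)"
 unfolding openin_cvec_iff
proof (intro conjI ballI)
 show "phi ` T <= cvec (mdim M)" using assms(3) chartD(3)[OF assms(1)] by auto
 fix a assume "a:phi ` T"
 then obtain x where x: "x:T" "a = phi x" by blast
 have "eventually (%z. phi z:phi ` T) (nhd M x)"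
  using eventually_nhdsin_openin[OF assms(2) x(1)] by eventually_elim blast
 then show "eventually (%z. z:phi ` T) (nb (mdim M) a)"
  unfolding x(2) by (subst chart_eventually[OF assms(1)]) (use x assms in auto)
qed

lemma cmD:
 assumes "cm M"
 shows "(U, phi):matlas M ==> chart M U phi"
  and "x:pts M ==> EX U phi. (U, phi):matlas M & x:U"
  and "(U, phi):matlas M ==> (V, psi):matlas M ==> x:U ==> x:V ==> i < mdim M ==>
   hg (mdim M) (phi x) (%u. psi (inv_into U phi u) i)"
proof -
 show "chart M U phi" if "(U, phi):matlas M"
  using assms that unfolding cm_def by blast
 show "EX U phi. (U, phi):matlas M & x:U" if "x:pts M"
 proof -
  have "x:(\<Union>(U, phi)\<in>matlas M. U)" using assms that unfolding cm_def by simp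
  then show ?thesis by auto
 qed
 assume c: "(U, phi):matlas M" "(V, psi):matlas M" "x:U" "x:V" "i < mdim M"
 have "ALL (U, phi):matlas M. ALL (V, psi):matlas M. ALL x:U \<inter> V. ALL i<mdim M.
    hg (mdim M) (phi x) (%u. psi (inv_into U phi u) i)"
  using assms unfolding cm_def by (elim conjE)
 from bspec[OF this c(1)] have "ALL (V, psi):matlas M. ALL x:U \<inter> V. ALL i<mdim M.
    hg (mdim M) (phi x) (%u. psi (inv_into U phi u) i)" by simp
 from bspec[OF this c(2)] have "ALL x:U \<inter> V. ALL i<mdim M. hg (mdim M) (phi x) (%u. psi (inv_into U phi u) i)" by simp
 then show "hg (mdim M) (phi x) (%u. psi (inv_into U phi u) i)" using c by simp
qed

lemma complex_manifold_cm:
 assumes "complex_manifold M"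
 shows "cm M"
proof -
 have ch: "chart M U phi" if "(U, phi):matlas M" for U phi
 proof -
  have U: "opn M U" and o: "openin (top_of_set (cvec (mdim M))) (phi ` U)"
   and h: "homeomorphic_map (subtopology (mtop M) U) (top_of_set (phi ` U)) phi"
   using assms that unfolding complex_manifold_def by blast+
  have UM: "topspace (subtopology (mtop M) U) = U" using openin_subset[OF U] by auto
  have inj: "inj_on phi U" using homeomorphic_imp_injective_map[OF h] unfolding UM .
  have sub: "phi ` U <= cvec (mdim M)" by (rule openin_imp_subset[OF o])
  have op: "openin (top_of_set (cvec (mdim M))) (phi ` T) \<longleftrightarrow> opn M T" if "T <= U" for T
  proof -
   have "openin (top_of_set (phi ` U)) (phi ` T) \<longleftrightarrow> openin (subtopology (mtop M) U) T"
    by (rule homeomorphic_map_openness[OF h]) (simp only: UM that)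
   moreover have "openin (top_of_set (phi ` U)) (phi ` T) \<longleftrightarrow> openin (top_of_set (cvec (mdim M))) (phi ` T)"
    using openin_trans[OF _ o] openin_subset_trans[OF _ image_mono[OF that] sub] by blast
   moreover have "openin (subtopology (mtop M) U) T \<longleftrightarrow> opn M T"
    using openin_open_subtopology[OF U] that by blast
   ultimately show ?thesis by simp
  qed
  have "eventually Q (filtermap phi (nhd M x)) \<longleftrightarrow> eventually Q (nb (mdim M) (phi x))" if x: "x:U" for x Q
  proof
   assume "eventually Q (filtermap phi (nhd M x))"
   then obtain T where T: "opn M T" "x:T" "ALL z:T. Q (phi z)"
    using openin_subset[OF U] x by (auto simp: eventually_filtermap eventually_nhdsin)
   have "openin (top_of_set (cvec (mdim M))) (phi ` (T \<inter> U))" using op[of "T \<inter> U"] T U by auto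
   from eventually_nb_openin[OF this, of "phi x"] show "eventually Q (nb (mdim M) (phi x))"
    using T x by (auto elim: eventually_mono)
  next
   assume "eventually Q (nb (mdim M) (phi x))"
   moreover have "phi x:cvec (mdim M)" using sub x by blast
   ultimately have "eventually Q (nhdsin (top_of_set (cvec (mdim M))) (phi x))" by (simp add: nhdsin_nb)
   then obtain S where S: "openin (top_of_set (cvec (mdim M))) S" "phi x:S" "ALL z:S. Q z"
    using \<open>phi x:cvec (mdim M)\<close> by (auto simp: eventually_nhdsin)
   have "phi ` (U \<inter> phi -` S) = phi ` U \<inter> S" by auto
   then have "opn M (U \<inter> phi -` S)" using op[of "U \<inter> phi -` S"] S(1) o by auto
   then show "eventually Q (filtermap phi (nhd M x))"
    using S x unfolding eventually_filtermap eventually_nhdsin by (intro disjI2 exI[of _ "U \<inter> phi -` S"]) auto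
  qed
  then show ?thesis using U inj sub by (simp add: chart_def filter_eq_iff)
 qed
 have "hg (mdim M) (phi x) (%u. psi (inv_into U phi u) i)"
  if c: "(U, phi):matlas M" "(V, psi):matlas M" "x:U \<inter> V" "i < mdim M" for U phi V psi x i
 proof -
  have "opn M (U \<inter> V)" using chartD(1)[OF ch[OF c(1)]] chartD(1)[OF ch[OF c(2)]] by blast
  from chart_image_open[OF ch[OF c(1)] this] 
  have "openin (top_of_set (cvec (mdim M))) (phi ` (U \<inter> V))" by simp
  moreover have "holo_on (mdim M) (phi ` (U \<inter> V)) (%u. psi (inv_into U phi u) i)"
   using assms c unfolding complex_manifold_def by blast
  ultimately show ?thesis using c(3) by (simp add: holo_on_iff_hg)
 qed
 moreover have "(\<Union>(U, phi)\<in>matlas M. U) = pts M"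
  using assms by (simp add: complex_manifold_def)
 ultimately show ?thesis using ch unfolding cm_def by blast
qed

lemma cspace_simps [simp]: "mtop (cspace n) = top_of_set (cvec n)" "mdim (cspace n) = n" "matlas (cspace n) = {(cvec n, id)}"
 by (simp_all add: cspace_def)

lemma inv_into_cvec_id: "u:cvec n ==> inv_into (cvec n) id u = u"
 using inv_into_f_f[OF inj_on_id, of u "cvec n"] by simp

lemma cm_cspace: "cm (cspace n)"
proof -
 have "chart (cspace n) (cvec n) id" by (simp add: chart_def filtermap_ident[unfolded id_def[symmetric]] id_def nhdsin_nb)
 moreover have "hg n x (%u. inv_into (cvec n) id u i)" if "x:cvec n" "i < n" for x i
  by (rule hg_cong[OF _ hg_coord[OF that(2)]])
   (use eventually_nb_cvec in eventually_elim, simp add: inv_into_cvec_id)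
 ultimately show ?thesis by (simp add: cm_def)
qed

lemma prod_mfd_simps [simp]: "mtop (M \<times>\<^sub>M\<^sub>f N) = prod_topology (mtop M) (mtop N)"
 "mdim (M \<times>\<^sub>M\<^sub>f N) = mdim M + mdim N"
 "matlas (M \<times>\<^sub>M\<^sub>f N) = {(U \<times> V, %(x, y). cconcat (mdim M) (phi x) (psi y)) | U phi V psi.
         (U, phi):matlas M & (V, psi):matlas N}"
 by (simp_all add: prod_mfd_def)

definition pchart :: "nat => ('a => nat => complex) => ('b => nat => complex) => 'a \<times> 'b => nat => complex" where
 "pchart n phi psi = (%(x, y). cconcat n (phi x) (psi y))"

lemma pchart_simp [simp]: "pchart n phi psi (x, y) = cconcat n (phi x) (psi y)"
 by (simp add: pchart_def)

lemma chart_prod: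
 assumes A: "chart M U phi" and B: "chart N V psi"
 shows "chart (M \<times>\<^sub>M\<^sub>f N) (U \<times> V) (pchart (mdim M) phi psi)"
  and "u:phi ` U ==> v:psi ` V ==>
   inv_into (U \<times> V) (pchart (mdim M) phi psi) (cconcat (mdim M) u v) = (inv_into U phi u, inv_into V psi v)"
proof -
 have inj: "inj_on (pchart (mdim M) phi psi) (U \<times> V)"
  using chartD(2)[OF A] chartD(2)[OF B] chartD(3)[OF A]
  by (auto simp: inj_on_def cconcat_inject)
 have "eventually Q (filtermap (pchart (mdim M) phi psi) (nhdsin (prod_topology (mtop M) (mtop N)) (x, y))) \<longleftrightarrow>
    eventually Q (nb (mdim M + mdim N) (cconcat (mdim M) (phi x) (psi y)))" if "x:U" "y:V" for x y Q
 proof -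
  have "eventually Q (filtermap (pchart (mdim M) phi psi) (nhdsin (prod_topology (mtop M) (mtop N)) (x, y))) \<longleftrightarrow>
   (EX P1 P2. eventually P1 (nhd M x) & eventually P2 (nhd N y) &
    (ALL u v. P1 u --> P2 v --> Q (cconcat (mdim M) (phi u) (psi v))))"
   using that chartD(5)[OF A] chartD(5)[OF B] by (simp add: eventually_filtermap eventually_nhdsin_prod)
  also have "\<dots> \<longleftrightarrow> (EX P1 P2. eventually P1 (nb (mdim M) (phi x)) & eventually P2 (nb (mdim N) (psi y)) &
    (ALL u v. P1 u --> P2 v --> Q (cconcat (mdim M) u v)))" (is "?L \<longleftrightarrow> ?R")
  proof
   assume ?L
   then obtain P1 P2 where P: "eventually P1 (nhd M x)" "eventually P2 (nhd N y)"
    "!!u v. P1 u ==> P2 v ==> Q (cconcat (mdim M) (phi u) (psi v))" by (elim exE conjE) simp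
   have "eventually (%u. EX z. u = phi z & P1 z) (nb (mdim M) (phi x))"
    unfolding chart_eventually[OF A that(1)] using P(1) by eventually_elim blast
   moreover have "eventually (%u. EX z. u = psi z & P2 z) (nb (mdim N) (psi y))"
    unfolding chart_eventually[OF B that(2)] using P(2) by eventually_elim blast
   ultimately show ?R
    by (intro exI[of _ "%u. EX z. u = phi z & P1 z"] exI[of _ "%u. EX z. u = psi z & P2 z"] conjI)
     (simp_all add: P(3), use P(3) in fast)
  next
   assume ?R
   then obtain P1 P2 where P: "eventually P1 (nb (mdim M) (phi x))" "eventually P2 (nb (mdim N) (psi y))"
    "!!u v. P1 u ==> P2 v ==> Q (cconcat (mdim M) u v)" by (elim exE conjE) simp
   show ?L
    using P(1,2)[unfolded chart_eventually[OF A that(1)] chart_eventually[OF B that(2)]] P(3)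
    by (intro exI[of _ "%z. P1 (phi z)"] exI[of _ "%z. P2 (psi z)"]) simp
  qed
  also have "\<dots> \<longleftrightarrow> eventually Q (nb (mdim M + mdim N) (cconcat (mdim M) (phi x) (psi y)))"
   using chartD(3)[OF A that(1)] chartD(3)[OF B that(2)]
   by (subst eventually_nb_prod) (simp_all add: cconcat_cvec)
  finally show ?thesis .
 qed
 then have "filtermap (pchart (mdim M) phi psi) (nhdsin (prod_topology (mtop M) (mtop N)) z) =
   nb (mdim M + mdim N) (pchart (mdim M) phi psi z)" if "z:U \<times> V" for z
  using that by (cases z) (simp add: filter_eq_iff)
 then show "chart (M \<times>\<^sub>M\<^sub>f N) (U \<times> V) (pchart (mdim M) phi psi)"
  unfolding chart_def using inj chartD(1)[OF A] chartD(1)[OF B] chartD(3)[OF B]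
  by (auto simp: openin_prod_Times_iff intro!: cconcat_cvec)
 assume "u:phi ` U" "v:psi ` V"
 then obtain x y where "x:U" "u = phi x" "y:V" "v = psi y" by blast
 then show "inv_into (U \<times> V) (pchart (mdim M) phi psi) (cconcat (mdim M) u v) = (inv_into U phi u, inv_into V psi v)"
  using inv_into_f_f[OF inj, of "(x, y)"] inv_into_f_f[OF chartD(2)[OF A]] inv_into_f_f[OF chartD(2)[OF B]] by simp
qed

lemma hg_fstv_comp: "hg n (fstv n c) f ==> c:cvec (n + k) ==> hg (n + k) c (%z. f (fstv n z))"
 by (rule hg_compose[where G = "fstv n" and k = n]) (auto intro: hg_fstv)

lemma hg_sndv_comp: "hg k (sndv n c) f ==> c:cvec (n + k) ==> hg (n + k) c (%z. f (sndv n z))"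
 by (rule hg_compose[where G = "sndv n" and k = k])
  (use eventually_nb_cvec[of "n + k" c] in \<open>auto elim!: eventually_mono intro: sndv_cvec hg_sndv\<close>)

lemma chart_prod_inv_eventually:
 assumes A: "chart M U phi" and B: "chart N V psi" and x: "x:U" "y:V"
 shows "eventually (%z. inv_into (U \<times> V) (pchart (mdim M) phi psi) z =
  (inv_into U phi (fstv (mdim M) z), inv_into V psi (sndv (mdim M) z))) (nb (mdim M + mdim N) (cconcat (mdim M) (phi x) (psi y)))"
proof -
 have "openin (top_of_set (cvec (mdim M))) (phi ` U)" "openin (top_of_set (cvec (mdim N))) (psi ` V)"
  by (rule chart_image_open[OF A chartD(1)[OF A] order.refl], rule chart_image_open[OF B chartD(1)[OF B] order.refl])
 then have "eventually (%u. u:phi ` U) (nb (mdim M) (phi x))" "eventually (%u. u:psi ` V) (nb (mdim N) (psi y))"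
  using x by (auto intro: eventually_nb_openin)
 then show ?thesis
  unfolding eventually_nb_prod[OF cconcat_cvec[OF chartD(3)[OF B x(2)]]]
  by (intro exI[of _ "%u. u:phi ` U"] exI[of _ "%v. v:psi ` V"] conjI allI impI,
    unfold chart_prod(2)[OF A B] fstv_cconcat[OF chartD(3)[OF A x(1)]] sndv_cconcat)
   (use chartD(3)[OF A] in \<open>auto simp: chart_prod(2)[OF A B]\<close>)
qed

lemma cm_prod:
 assumes M: "cm M" and N: "cm N"
 shows "cm (M \<times>\<^sub>M\<^sub>f N)"
proof -
 have at: "matlas (M \<times>\<^sub>M\<^sub>f N) = {(U \<times> V, pchart (mdim M) phi psi) | U phi V psi. (U, phi):matlas M & (V, psi):matlas N}"
  by (simp add: pchart_def)
 have 1: "(\<Union>(U, phi)\<in>matlas (M \<times>\<^sub>M\<^sub>f N). U) = pts (M \<times>\<^sub>M\<^sub>f N)" (is "?A = ?B")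
 proof (intro equalityI subsetI)
  fix z assume "z:?A"
  then obtain U phi V psi where "(U, phi):matlas M" "(V, psi):matlas N" "z:U \<times> V" unfolding at by blast
  then show "z:?B" using chartD(5)[OF cmD(1)[OF M]] chartD(5)[OF cmD(1)[OF N]] by auto
 next
  fix z assume "z:?B"
  then obtain x y where z: "z = (x, y)" "x:pts M" "y:pts N" by auto
  from cmD(2)[OF M z(2)] cmD(2)[OF N z(3)] show "z:?A" unfolding at z(1) by blast
 qed
 have 2: "chart (M \<times>\<^sub>M\<^sub>f N) U phi" if "(U, phi):matlas (M \<times>\<^sub>M\<^sub>f N)" for U phi
  using that chart_prod(1)[OF cmD(1)[OF M] cmD(1)[OF N]] unfolding at by blast
 have 3: "hg (mdim M + mdim N) (cconcat (mdim M) (phi x) (psi y))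
   (%z. pchart (mdim M) phi' psi' (inv_into (U \<times> V) (pchart (mdim M) phi psi) z) i)"
  if c: "(U, phi):matlas M" "(V, psi):matlas N" "(U', phi'):matlas M" "(V', psi'):matlas N"
   "x:U" "x:U'" "y:V" "y:V'" "i < mdim M + mdim N" for U phi V psi U' phi' V' psi' x y i
 proof -
  let ?c = "cconcat (mdim M) (phi x) (psi y)"
  have A: "chart M U phi" and B: "chart N V psi" using cmD(1) M N c by blast+
  have cc: "?c:cvec (mdim M + mdim N)" using chartD(3)[OF B c(7)] by (rule cconcat_cvec)
  have "hg (mdim M + mdim N) ?c (%z. cconcat (mdim M) (phi' (inv_into U phi (fstv (mdim M) z))) (psi' (inv_into V psi (sndv (mdim M) z))) i)"
  proof (cases "i < mdim M")
   case True
   have "hg (mdim M + mdim N) ?c (%z. phi' (inv_into U phi (fstv (mdim M) z)) i)"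
    by (rule hg_fstv_comp[OF _ cc]) (use cmD(3)[OF M c(1,3,5,6) True] chartD(3)[OF A c(5)] in simp)
   then show ?thesis using True by (simp add: cconcat_def)
  next
   case False
   then have i: "i - mdim M < mdim N" using c by simp
   have "hg (mdim M + mdim N) ?c (%z. psi' (inv_into V psi (sndv (mdim M) z)) (i - mdim M))"
    by (rule hg_sndv_comp[OF _ cc]) (use cmD(3)[OF N c(2,4,7,8) i] in simp)
   then show ?thesis using False by (simp add: cconcat_def)
  qed
  then show ?thesis
   by (rule hg_cong[rotated]) (use chart_prod_inv_eventually[OF A B c(5,7)] in \<open>auto elim!: eventually_mono\<close>)
 qed
 show ?thesis unfolding cm_def
 proof (intro conjI 1)
  show "ALL (U, phi):matlas (M \<times>\<^sub>M\<^sub>f N). chart (M \<times>\<^sub>M\<^sub>f N) U phi" using 2 by blast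
  show "ALL (U, phi):matlas (M \<times>\<^sub>M\<^sub>f N). ALL (V, psi):matlas (M \<times>\<^sub>M\<^sub>f N). ALL x:U \<inter> V. ALL i<mdim (M \<times>\<^sub>M\<^sub>f N).
    hg (mdim (M \<times>\<^sub>M\<^sub>f N)) (phi x) (%u. psi (inv_into U phi u) i)"
   unfolding at using 3 by (simp only: prod_mfd_simps) fastforce
 qed
qed

definition hol_at :: "'a charted => ('a => complex) => 'a => bool" where
 "hol_at M h x \<longleftrightarrow> (EX U phi. (U, phi):matlas M & x:U & hg (mdim M) (phi x) (%u. h (inv_into U phi u)))"

text \<open>Independence of the chart: the change of charts is a germ of a holomorphic map, and
  \<open>hg\<close> is stable under composition.\<close>

lemma hol_atD:
 assumes M: "cm M" and h: "hol_at M h x" and V: "(V, psi):matlas M" "x:V"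
 shows "hg (mdim M) (psi x) (%u. h (inv_into V psi u))"
proof -
 obtain U phi where U: "(U, phi):matlas M" "x:U" and hg: "hg (mdim M) (phi x) (%u. h (inv_into U phi u))"
  using h unfolding hol_at_def by blast
 note cU = cmD(1)[OF M U(1)] and cV = cmD(1)[OF M V(1)]
 define G where "G u = phi (inv_into V psi u)" for u
 have G0: "G (psi x) = phi x" using inv_into_f_f[OF chartD(2)[OF cV] V(2)] by (simp add: G_def)
 have ev: "eventually (%u. inv_into V psi u:U) (nb (mdim M) (psi x))"
  using chartD(6)[OF cU U(2)] unfolding chart_eventually_inv[OF cV V(2)] .
 have "hg (mdim M) (psi x) (%u. h (inv_into U phi (G u)))"
 proof (rule hg_compose[where G = G and k = "mdim M"])
  show "hg (mdim M) (G (psi x)) (%u. h (inv_into U phi u))" using hg G0 by simp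
  show "hg (mdim M) (psi x) (%z. G z i)" if "i < mdim M" for i
   unfolding G_def by (rule cmD(3)[OF M V(1) U(1) V(2) U(2) that])
  show "eventually (%z. G z:cvec (mdim M)) (nb (mdim M) (psi x))"
   using ev by eventually_elim (simp add: G_def chartD(3)[OF cU])
  show "psi x:cvec (mdim M)" by (rule chartD(3)[OF cV V(2)])
 qed
 then show ?thesis
  by (rule hg_cong[rotated]) (use ev in \<open>eventually_elim, simp add: G_def inv_into_f_f[OF chartD(2)[OF cU]]\<close>)
qed

lemma hol_at_topspace: "cm M ==> hol_at M h x ==> x:pts M"
 unfolding hol_at_def by (elim exE conjE) (rule chartD(5)[OF cmD(1)])

lemma hol_at_cong:
 assumes M: "cm M" and "hol_at M f x" "eventually (%z. f z = g z) (nhd M x)"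
 shows "hol_at M g x"
proof -
 obtain U phi where U: "(U, phi):matlas M" "x:U" and hg: "hg (mdim M) (phi x) (%u. f (inv_into U phi u))"
  using assms(2) unfolding hol_at_def by blast
 have "hg (mdim M) (phi x) (%u. g (inv_into U phi u))"
  by (rule hg_cong[OF iffD1[OF chart_eventually_inv[OF cmD(1)[OF M U(1)] U(2)] assms(3)] hg])
 then show ?thesis using U unfolding hol_at_def by blast
qed

lemma hol_at_const: "cm M ==> x:pts M ==> hol_at M (%_. k) x"
 unfolding hol_at_def using cmD(2)[of M x] by (auto intro: hg_const)

lemma hol_at_add:
 assumes "cm M" "hol_at M f x" "hol_at M g x" shows "hol_at M (%z. f z + g z) x"
proof -
 obtain U phi where U: "(U, phi):matlas M" "x:U" using assms(2) unfolding hol_at_def by blast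
 from hg_add[OF hol_atD[OF assms(1,2) U] hol_atD[OF assms(1,3) U]] show ?thesis
  using U unfolding hol_at_def by blast
qed

lemma hol_at_mult:
 assumes "cm M" "hol_at M f x" "hol_at M g x" shows "hol_at M (%z. f z * g z) x"
proof -
 obtain U phi where U: "(U, phi):matlas M" "x:U" using assms(2) unfolding hol_at_def by blast
 from hg_mult[OF hol_atD[OF assms(1,2) U] hol_atD[OF assms(1,3) U]] show ?thesis
  using U unfolding hol_at_def by blast
qed

lemma hol_at_diff:
 assumes "cm M" "hol_at M f x" "hol_at M g x" shows "hol_at M (%z. f z - g z) x"
 using hol_at_add[OF assms(1,2) hol_at_mult[OF assms(1) hol_at_const[OF assms(1) hol_at_topspace[OF assms(1,3)], of "-1"] assms(3)]]
 by simp

lemma hol_at_sum: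
 assumes "cm M" "x:pts M" "!!i. i:I ==> hol_at M (f i) x"
 shows "hol_at M (%z. \<Sum>i\<in>I. f i z) x"
 using assms(3)
 by (induction I rule: infinite_finite_induct) (auto intro: hol_at_const hol_at_add assms(1,2))

lemma hol_at_eventually:
 assumes M: "cm M" and h: "hol_at M h x"
 shows "eventually (%z. hol_at M h z) (nhd M x)"
proof -
 obtain U phi where U: "(U, phi):matlas M" "x:U" and hg: "hg (mdim M) (phi x) (%u. h (inv_into U phi u))"
  using h unfolding hol_at_def by blast
 note cU = cmD(1)[OF M U(1)]
 have "eventually (%z. hg (mdim M) (phi z) (%u. h (inv_into U phi u))) (nhd M x)"
  using hg_eventually[OF hg] unfolding chart_eventually[OF cU U(2)] .
 then show ?thesis using chartD(6)[OF cU U(2)]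
  by eventually_elim (use U in \<open>auto simp: hol_at_def\<close>)
qed

lemma hol_at_cspace: "hol_at (cspace n) h a \<longleftrightarrow> a:cvec n & hg n a h"
proof -
 have "hg n a (%u. h (inv_into (cvec n) id u)) \<longleftrightarrow> hg n a h"
  by (rule iffI; erule hg_cong[rotated]; use eventually_nb_cvec in eventually_elim, simp add: inv_into_cvec_id)
 then show ?thesis by (auto simp: hol_at_def)
qed

lemma holo_fun_iff:
 assumes M: "cm M" and W: "opn M W"
 shows "holo_fun M W h \<longleftrightarrow> (ALL x:W. hol_at M h x)"
proof -
 have op: "openin (top_of_set (cvec (mdim M))) (phi ` (U \<inter> W))" if "(U, phi):matlas M" for U phi
  using chart_image_open[OF cmD(1)[OF M that], of "U \<inter> W"] chartD(1)[OF cmD(1)[OF M that]] W by blast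
 show ?thesis
 proof
  assume h: "holo_fun M W h"
  show "ALL x:W. hol_at M h x"
  proof
   fix x assume x: "x:W"
   then obtain U phi where U: "(U, phi):matlas M" "x:U" using cmD(2)[OF M] openin_subset[OF W] by blast
   have "holo_on (mdim M) (phi ` (U \<inter> W)) (%u. h (inv_into U phi u))" using h U unfolding holo_fun_def by blast
   then show "hol_at M h x" unfolding holo_on_iff_hg[OF op[OF U(1)]] hol_at_def using U x by blast
  qed
 next
  assume h: "ALL x:W. hol_at M h x"
  then show "holo_fun M W h" unfolding holo_fun_def
   by (intro ballI, clarify, subst holo_on_iff_hg[OF op]) (auto intro: hol_atD[OF M])
 qed
qed

text \<open>Holomorphy of a map is tested by pulling back all germs of holomorphic functions.
  Compositions are then immediate and mention no chart, and \<open>map_atI\<close> reduces the test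
  to the coordinates of one chart.\<close>

definition map_at :: "'a charted => 'b charted => ('a => 'b) => 'a => bool" where
 "map_at M N F x \<longleftrightarrow> x:pts M & F x:pts N &
  filterlim F (nhd N (F x)) (nhd M x) &
  (ALL g. hol_at N g (F x) --> hol_at M (%z. g (F z)) x)"

lemma map_atD:
 assumes "map_at M N F x"
 shows "x:pts M" "F x:pts N"
  "filterlim F (nhd N (F x)) (nhd M x)" "hol_at N g (F x) ==> hol_at M (%z. g (F z)) x"
  "eventually P (nhd N (F x)) ==> eventually (%z. P (F z)) (nhd M x)"
 using assms unfolding map_at_def filterlim_iff by blast+

lemma map_at_comp:
 assumes F: "map_at M N F x" and G: "map_at N P G (F x)"
 shows "map_at M P (%z. G (F z)) x"
 unfolding map_at_def
 using map_atD[OF F] map_atD[OF G] filterlim_compose[OF map_atD(3)[OF G] map_atD(3)[OF F]] by blast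

lemma map_at_cong:
 assumes M: "cm M" and F: "map_at M N F x" and e: "eventually (%z. F z = G z) (nhd M x)"
 shows "map_at M N G x"
proof -
 have x: "x:pts M" by (rule map_atD(1)[OF F])
 have eq: "G x = F x" using e x by (auto simp: eventually_nhdsin)
 have "filterlim G (nhd N (F x)) (nhd M x)"
  using filterlim_cong[OF refl refl e] map_atD(3)[OF F] by blast
 moreover have "hol_at M (%z. g (G z)) x" if "hol_at N g (F x)" for g
  by (rule hol_at_cong[OF M map_atD(4)[OF F that]]) (use e in \<open>auto elim!: eventually_mono\<close>)
 ultimately show ?thesis unfolding map_at_def eq using map_atD(1,2)[OF F] by blast
qed

lemma hol_at_chart_coord:
 assumes M: "cm M" and U: "(U, phi):matlas M" "x:U" and i: "i < mdim M"
 shows "hol_at M (%z. phi z i) x"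
 unfolding hol_at_def using cmD(3)[OF M U(1) U(1) U(2) U(2) i] U by blast

lemma map_atI:
 assumes M: "cm M" and N: "cm N" and V: "(V, psi):matlas N" "F x:V" and x: "x:pts M"
  and c: "filterlim F (nhd N (F x)) (nhd M x)"
  and h: "!!j. j < mdim N ==> hol_at M (%z. psi (F z) j) x"
 shows "map_at M N F x"
 unfolding map_at_def
proof (intro conjI allI impI x c)
 note cV = cmD(1)[OF N V(1)]
 show "F x:pts N" by (rule chartD(5)[OF cV V(2)])
 fix g assume g: "hol_at N g (F x)"
 obtain U phi where U: "(U, phi):matlas M" "x:U" using cmD(2)[OF M x] by blast
 note cU = cmD(1)[OF M U(1)]
 define G where "G u = psi (F (inv_into U phi u))" for u
 have G0: "G (phi x) = psi (F x)" using inv_into_f_f[OF chartD(2)[OF cU] U(2)] by (simp add: G_def)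
 have "eventually (%z. F z:V) (nhd M x)"
  using c chartD(6)[OF cV V(2)] unfolding filterlim_iff by blast
 then have ev: "eventually (%u. F (inv_into U phi u):V) (nb (mdim M) (phi x))"
  unfolding chart_eventually_inv[OF cU U(2)] .
 have "hg (mdim M) (phi x) (%u. g (inv_into V psi (G u)))"
 proof (rule hg_compose[where G = G and k = "mdim N"])
  show "hg (mdim N) (G (phi x)) (%u. g (inv_into V psi u))" unfolding G0 by (rule hol_atD[OF N g V])
  show "hg (mdim M) (phi x) (%z. G z i)" if "i < mdim N" for i
   unfolding G_def by (rule hol_atD[OF M h[OF that] U])
  show "eventually (%z. G z:cvec (mdim N)) (nb (mdim M) (phi x))"
   using ev by eventually_elim (simp add: G_def chartD(3)[OF cV])
  show "phi x:cvec (mdim M)" by (rule chartD(3)[OF cU U(2)])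
 qed
 then have "hg (mdim M) (phi x) (%u. g (F (inv_into U phi u)))"
  by (rule hg_cong[rotated]) (use ev in \<open>eventually_elim, simp add: G_def inv_into_f_f[OF chartD(2)[OF cV]]\<close>)
 then show "hol_at M (%z. g (F z)) x" using U unfolding hol_at_def by blast
qed

lemma holo_map_iff:
 assumes M: "cm M" and N: "cm N" and W: "opn M W"
 shows "holo_map M N W F \<longleftrightarrow> (ALL x:W. map_at M N F x)"
proof -
 have WM: "W <= pts M" by (rule openin_subset[OF W])
 have op: "opn M (W \<inter> F -` S)"
  if c: "continuous_map (subtopology (mtop M) W) (mtop N) F" and S: "opn N S" for S
 proof -
  have "openin (subtopology (mtop M) W) {x:topspace (subtopology (mtop M) W). F x:S}"
   using c S by (auto simp: continuous_map_def)
  moreover have "{x:topspace (subtopology (mtop M) W). F x:S} = W \<inter> F -` S" using WM by auto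
  ultimately show ?thesis using openin_open_subtopology[OF W] by auto
 qed
 show ?thesis
 proof
  assume F: "holo_map M N W F"
  then have c: "continuous_map (subtopology (mtop M) W) (mtop N) F" by (simp add: holo_map_def)
  show "ALL x:W. map_at M N F x"
  proof
   fix x assume x: "x:W"
   have FN: "F x:pts N" using c x WM by (auto simp: continuous_map_def Pi_iff)
   obtain U phi where U: "(U, phi):matlas M" "x:U" using cmD(2)[OF M] x WM by blast
   obtain V psi where V: "(V, psi):matlas N" "F x:V" using cmD(2)[OF N FN] by blast
   note cU = cmD(1)[OF M U(1)] and cV = cmD(1)[OF N V(1)]
   show "map_at M N F x"
   proof (rule map_atI[where F = F and x = x, OF M N V(1,2)])
    show "x:pts M" using x WM by blast
    show "filterlim F (nhd N (F x)) (nhd M x)" unfolding filterlim_iff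
    proof (intro allI impI)
     fix P assume "eventually P (nhd N (F x))"
     then obtain S where S: "opn N S" "F x:S" "ALL y:S. P y" using FN by (auto simp: eventually_nhdsin)
     show "eventually (%z. P (F z)) (nhd M x)"
      using eventually_nhdsin_openin[OF op[OF c S(1)], of x] S x by (auto elim!: eventually_mono)
    qed
    fix j assume j: "j < mdim N"
    have oT: "opn M (U \<inter> W \<inter> F -` V)"
     using openin_Int[OF chartD(1)[OF cU] op[OF c chartD(1)[OF cV]]] by (simp add: Int_assoc)
    have "holo_on (mdim M) (phi ` (U \<inter> W \<inter> F -` V)) (%u. psi (F (inv_into U phi u)) j)"
     using F U(1) V(1) j unfolding holo_map_def by blast
    then have "hg (mdim M) (phi x) (%u. psi (F (inv_into U phi u)) j)"
     using holo_on_iff_hg[OF chart_image_open[OF cU oT]] x U V by blast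
    then show "hol_at M (%z. psi (F z) j) x" unfolding hol_at_def using U by blast
   qed
  qed
 next
  assume F: "ALL x:W. map_at M N F x"
  have op2: "opn M (W \<inter> F -` S)" if S: "opn N S" for S
   unfolding openin_iff_nhdsin[of "mtop M" "W \<inter> F -` S"]
  proof (intro conjI ballI)
   fix x assume x: "x:W \<inter> F -` S"
   have "eventually (%z. F z:S) (nhd M x)"
    by (rule map_atD(5)[of M N]) (use F x eventually_nhdsin_openin[OF S] in auto)
   then show "eventually (%z. z:W \<inter> F -` S) (nhd M x)"
    using eventually_nhdsin_openin[OF W, of x] x by (auto elim: eventually_elim2)
  qed (use WM in auto)
  have c: "continuous_map (subtopology (mtop M) W) (mtop N) F" unfolding continuous_map_def
  proof (intro conjI allI impI)
   show "F:topspace (subtopology (mtop M) W) \<rightarrow> pts N" using F map_atD(2)[of M N F] by (auto simp: Pi_iff)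
   fix S assume "opn N S"
   moreover have "{x:topspace (subtopology (mtop M) W). F x:S} = W \<inter> F -` S" using WM by auto
   ultimately show "openin (subtopology (mtop M) W) {x:topspace (subtopology (mtop M) W). F x:S}"
    using openin_open_subtopology[OF W] op2 by auto
  qed
  have "holo_on (mdim M) (phi ` (U \<inter> W \<inter> F -` V)) (%u. psi (F (inv_into U phi u)) j)"
   if U: "(U, phi):matlas M" and V: "(V, psi):matlas N" and j: "j < mdim N" for U phi V psi j
  proof -
   note cU = cmD(1)[OF M U(1)] and cV = cmD(1)[OF N V(1)]
   have oT: "opn M (U \<inter> W \<inter> F -` V)"
    using openin_Int[OF chartD(1)[OF cU] op2[OF chartD(1)[OF cV]]] by (simp add: Int_assoc)
   have "hg (mdim M) (phi x) (%u. psi (F (inv_into U phi u)) j)" if x: "x:U \<inter> W \<inter> F -` V" for x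
   proof (rule hol_atD[OF M _ U])
    show "hol_at M (%z. psi (F z) j) x"
     by (rule map_atD(4)[of M N F x "%y. psi y j"]) (use F x hol_at_chart_coord[OF N V _ j] in auto)
   qed (use x in auto)
   then show ?thesis using holo_on_iff_hg[OF chart_image_open[OF cU oT]] by blast
  qed
  then show "holo_map M N W F" using c unfolding holo_map_def by blast
 qed
qed

lemma prod_atlasI: "(U, phi):matlas M ==> (V, psi):matlas N ==>
  (U \<times> V, pchart (mdim M) phi psi):matlas (M \<times>\<^sub>M\<^sub>f N)"
 by (auto simp: pchart_def)

lemma map_at_fst:
 assumes M: "cm M" and N: "cm N" and x: "x:pts M" "y:pts N"
 shows "map_at (M \<times>\<^sub>M\<^sub>f N) M fst (x, y)"
 unfolding map_at_def
proof (intro conjI allI impI)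
 show "filterlim fst (nhd M (fst (x, y))) (nhd (M \<times>\<^sub>M\<^sub>f N) (x, y))"
  unfolding filterlim_iff prod_mfd_simps eventually_nhdsin_prod[OF x] fst_conv
 proof (intro allI impI)
  fix P assume "eventually P (nhd M x)"
  then show "EX P1 P2. eventually P1 (nhd M x) & eventually P2 (nhd N y) & (ALL u v. P1 u --> P2 v --> P u)"
   by (intro exI[of _ P] exI[of _ "%_. True"]) simp
 qed
 fix g assume g: "hol_at M g (fst (x, y))"
 obtain U phi where U: "(U, phi):matlas M" "x:U" using cmD(2)[OF M x(1)] by auto
 obtain V psi where V: "(V, psi):matlas N" "y:V" using cmD(2)[OF N x(2)] by auto
 note cU = cmD(1)[OF M U(1)] and cV = cmD(1)[OF N V(1)]
 let ?c = "cconcat (mdim M) (phi x) (psi y)"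
 have "hg (mdim M + mdim N) ?c (%z. g (inv_into U phi (fstv (mdim M) z)))"
  by (rule hg_fstv_comp[OF _ cconcat_cvec[OF chartD(3)[OF cV V(2)]]])
   (use hol_atD[OF M _ U] g chartD(3)[OF cU U(2)] in simp)
 then have "hg (mdim M + mdim N) ?c (%z. g (fst (inv_into (U \<times> V) (pchart (mdim M) phi psi) z)))"
  by (rule hg_cong[rotated]) (use chart_prod_inv_eventually[OF cU cV U(2) V(2)] in \<open>eventually_elim, simp\<close>)
 then show "hol_at (M \<times>\<^sub>M\<^sub>f N) (%z. g (fst z)) (x, y)"
  unfolding hol_at_def
  by (intro exI[of _ "U \<times> V"] exI[of _ "pchart (mdim M) phi psi"] conjI prod_atlasI U V) (use U V in auto)
qed (use x in auto)

lemma map_at_snd: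
 assumes M: "cm M" and N: "cm N" and x: "x:pts M" "y:pts N"
 shows "map_at (M \<times>\<^sub>M\<^sub>f N) N snd (x, y)"
 unfolding map_at_def
proof (intro conjI allI impI)
 show "filterlim snd (nhd N (snd (x, y))) (nhd (M \<times>\<^sub>M\<^sub>f N) (x, y))"
  unfolding filterlim_iff prod_mfd_simps eventually_nhdsin_prod[OF x] snd_conv
 proof (intro allI impI)
  fix P assume "eventually P (nhd N y)"
  then show "EX P1 P2. eventually P1 (nhd M x) & eventually P2 (nhd N y) & (ALL u v. P1 u --> P2 v --> P v)"
   by (intro exI[of _ "%_. True"] exI[of _ P]) simp
 qed
 fix g assume g: "hol_at N g (snd (x, y))"
 obtain U phi where U: "(U, phi):matlas M" "x:U" using cmD(2)[OF M x(1)] by auto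
 obtain V psi where V: "(V, psi):matlas N" "y:V" using cmD(2)[OF N x(2)] by auto
 note cU = cmD(1)[OF M U(1)] and cV = cmD(1)[OF N V(1)]
 let ?c = "cconcat (mdim M) (phi x) (psi y)"
 have "hg (mdim M + mdim N) ?c (%z. g (inv_into V psi (sndv (mdim M) z)))"
  by (rule hg_sndv_comp[OF _ cconcat_cvec[OF chartD(3)[OF cV V(2)]]])
   (use hol_atD[OF N _ V] g in simp)
 then have "hg (mdim M + mdim N) ?c (%z. g (snd (inv_into (U \<times> V) (pchart (mdim M) phi psi) z)))"
  by (rule hg_cong[rotated]) (use chart_prod_inv_eventually[OF cU cV U(2) V(2)] in \<open>eventually_elim, simp\<close>)
 then show "hol_at (M \<times>\<^sub>M\<^sub>f N) (%z. g (snd z)) (x, y)"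
  unfolding hol_at_def
  by (intro exI[of _ "U \<times> V"] exI[of _ "pchart (mdim M) phi psi"] conjI prod_atlasI U V) (use U V in auto)
qed (use x in auto)

lemma map_at_pair:
 assumes M: "cm M" and A: "cm A" and B: "cm B" and F: "map_at M A F x" and G: "map_at M B G x"
 shows "map_at M (A \<times>\<^sub>M\<^sub>f B) (%z. (F z, G z)) x"
proof -
 obtain U phi where U: "(U, phi):matlas A" "F x:U" using cmD(2)[OF A map_atD(2)[OF F]] by auto
 obtain V psi where V: "(V, psi):matlas B" "G x:V" using cmD(2)[OF B map_atD(2)[OF G]] by auto
 show ?thesis
 proof (rule map_atI[where F = "%z. (F z, G z)" and x = x, OF M cm_prod[OF A B] prod_atlasI[OF U(1) V(1)]])
  show "(F x, G x):U \<times> V" using U V by simp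
  show "x:pts M" by (rule map_atD(1)[OF F])
  show "filterlim (%z. (F z, G z)) (nhd (A \<times>\<^sub>M\<^sub>f B) (F x, G x)) (nhd M x)"
   unfolding filterlim_iff prod_mfd_simps eventually_nhdsin_prod[OF map_atD(2)[OF F] map_atD(2)[OF G]]
  proof (intro allI impI, elim exE conjE)
   fix P P1 P2
   assume P: "eventually P1 (nhd A (F x))" "eventually P2 (nhd B (G x))"
    "ALL u v. P1 u --> P2 v --> P (u, v)"
   show "eventually (%z. P (F z, G z)) (nhd M x)"
    using map_atD(5)[OF F P(1)] map_atD(5)[OF G P(2)] by eventually_elim (use P(3) in simp)
  qed
  fix j assume j: "j < mdim (A \<times>\<^sub>M\<^sub>f B)"
  show "hol_at M (%z. pchart (mdim A) phi psi (F z, G z) j) x"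
  proof (cases "j < mdim A")
   case True
   then show ?thesis using map_atD(4)[OF F hol_at_chart_coord[OF A U True]] by (simp add: cconcat_def)
  next
   case False
   then have "j - mdim A < mdim B" using j by simp
   from map_atD(4)[OF G hol_at_chart_coord[OF B V this]] False show ?thesis by (simp add: cconcat_def)
  qed
 qed
qed

lemma hol_at_tendsto:
 assumes M: "cm M" and h: "hol_at M h x"
 shows "(h \<longlongrightarrow> h x) (nhd M x)"
proof -
 obtain U phi where U: "(U, phi):matlas M" "x:U" and hg: "hg (mdim M) (phi x) (%u. h (inv_into U phi u))"
  using h unfolding hol_at_def by auto
 note cU = cmD(1)[OF M U(1)]
 have "((%u. h (inv_into U phi u)) \<longlongrightarrow> h x) (nb (mdim M) (phi x))"
  using hg_tendsto[OF hg chartD(3)[OF cU U(2)]] by (simp add: inv_into_f_f[OF chartD(2)[OF cU] U(2)])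
 then show ?thesis unfolding filterlim_iff chart_eventually_inv[OF cU U(2)] .
qed

lemma map_at_cspace:
 assumes M: "cm M" and x: "x:pts M" and c: "eventually (%z. F z:cvec n) (nhd M x)"
  and h: "!!i. i < n ==> hol_at M (%z. F z i) x"
 shows "map_at M (cspace n) F x"
proof -
 have Fx: "F x:cvec n" using c x by (auto simp: eventually_nhdsin)
 show ?thesis
 proof (rule map_atI[where F = F and x = x and V = "cvec n" and psi = id, OF M cm_cspace])
  show "filterlim F (nhd (cspace n) (F x)) (nhd M x)"
   unfolding cspace_simps nhdsin_nb[OF Fx] by (rule filterlim_nb[OF hol_at_tendsto[OF M h] Fx c])
 qed (use Fx x h in auto)
qed

text \<open>A chart that is biholomorphic onto its image but need not belong to the atlas. The local
  coordinates in the definition of the sheaf of minors are of this kind, and so are translates of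
  charts.\<close>

definition gchart :: "'a charted => 'a set => ('a => nat => complex) => bool" where
 "gchart M U phi \<longleftrightarrow> chart M U phi &
  (ALL x:U. map_at M (cspace (mdim M)) phi x & map_at (cspace (mdim M)) M (inv_into U phi) (phi x))"

lemma gchartD:
 assumes "gchart M U phi"
 shows "chart M U phi" "x:U ==> map_at M (cspace (mdim M)) phi x"
  "x:U ==> map_at (cspace (mdim M)) M (inv_into U phi) (phi x)"
  "x:U ==> inv_into U phi (phi x) = x"
 using assms unfolding gchart_def chart_def by (auto simp: inv_into_f_f)

lemma gchartI:
 assumes U: "opn M U" and inj: "inj_on phi U" and op: "openin (top_of_set (cvec (mdim M))) (phi ` U)"
  and F: "!!x. x:U ==> map_at M (cspace (mdim M)) phi x"
  and G: "!!x. x:U ==> map_at (cspace (mdim M)) M (inv_into U phi) (phi x)"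
 shows "gchart M U phi"
proof -
 have sub: "phi ` U <= cvec (mdim M)" by (rule openin_imp_subset[OF op])
 have "eventually Q (filtermap phi (nhd M x)) \<longleftrightarrow> eventually Q (nb (mdim M) (phi x))" if x: "x:U" for x Q
 proof -
  have xc: "phi x:cvec (mdim M)" using sub x by auto
  have ix: "inv_into U phi (phi x) = x" by (rule inv_into_f_f[OF inj x])
  show ?thesis unfolding eventually_filtermap
  proof
   assume "eventually (%z. Q (phi z)) (nhd M x)"
   then have "eventually (%u. Q (phi (inv_into U phi u))) (nb (mdim M) (phi x))"
    using map_atD(5)[OF G[OF x], of "%z. Q (phi z)"] by (simp add: ix nhdsin_nb[OF xc])
   then show "eventually Q (nb (mdim M) (phi x))"
    using eventually_nb_openin[OF op imageI[OF x]] by eventually_elim (simp add: f_inv_into_f)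
  next
   assume "eventually Q (nb (mdim M) (phi x))"
   then show "eventually (%z. Q (phi z)) (nhd M x)"
    using map_atD(5)[OF F[OF x], of Q] by (simp add: nhdsin_nb[OF xc])
  qed
 qed
 then have "chart M U phi" unfolding chart_def using U inj sub by (simp add: filter_eq_iff)
 then show ?thesis unfolding gchart_def using F G by simp
qed

lemma gchart_atlas:
 assumes M: "cm M" and U: "(U, phi):matlas M"
 shows "gchart M U phi"
proof -
 note cU = cmD(1)[OF M U]
 have "map_at M (cspace (mdim M)) phi x" if x: "x:U" for x
 proof (rule map_at_cspace[OF M chartD(5)[OF cU x]])
  show "eventually (%z. phi z:cvec (mdim M)) (nhd M x)"
   using chartD(6)[OF cU x] by eventually_elim (rule chartD(3)[OF cU])
 qed (rule hol_at_chart_coord[OF M U x])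
 moreover have "map_at (cspace (mdim M)) M (inv_into U phi) (phi x)" if x: "x:U" for x
 proof -
  have ix: "inv_into U phi (phi x) = x" by (rule inv_into_f_f[OF chartD(2)[OF cU] x])
  have xc: "phi x:cvec (mdim M)" by (rule chartD(3)[OF cU x])
  show ?thesis unfolding map_at_def ix cspace_simps nhdsin_nb[OF xc]
  proof (intro conjI allI impI)
   show "filterlim (inv_into U phi) (nhd M x) (nb (mdim M) (phi x))"
    unfolding filterlim_iff chart_eventually_inv[OF cU x] by simp
   show "hol_at (cspace (mdim M)) (%z. g (inv_into U phi z)) (phi x)" if "hol_at M g x" for g
    unfolding hol_at_cspace using hol_atD[OF M that U x] xc by simp
  qed (use xc chartD(5)[OF cU x] in auto)
 qed
 ultimately show ?thesis unfolding gchart_def using cU by simp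
qed

lemma map_at_shift: "a:cvec n ==> c:cvec n ==> map_at (cspace n) (cspace n) (%u i. u i + c i) a"
proof (rule map_at_cspace[OF cm_cspace])
 assume a: "a:cvec n" and c: "c:cvec n"
 show "a:pts (cspace n)" using a by simp
 show "eventually (%z. (%i. z i + c i):cvec n) (nhd (cspace n) a)"
  unfolding cspace_simps nhdsin_nb[OF a] using eventually_nb_cvec
  by eventually_elim (use c in \<open>simp add: cvec_def\<close>)
qed (auto simp: hol_at_cspace intro!: hg_add hg_coord hg_const)

lemma gchart_translate:
 assumes M: "cm M" and g: "gchart M U phi" and c: "c:cvec (mdim M)"
 shows "gchart M U (%z i. phi z i + c i)"
proof -
 let ?n = "mdim M"
 note cU = gchartD(1)[OF g]
 have nc: "(%i. - c i):cvec ?n" using c by (simp add: cvec_def)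
 have eq: "phi z = phi z'" if "(%i. phi z i + c i) = (%i. phi z' i + c i)" for z z'
  using that by (simp add: fun_eq_iff)
 have inj: "inj_on (%z i. phi z i + c i) U"
  by (rule inj_onI) (use inj_onD[OF chartD(2)[OF cU]] eq in \<open>simp only:\<close>)
 have mem: "u:(%z i. phi z i + c i) ` U \<longleftrightarrow> (%i. u i + - c i):phi ` U" for u
 proof
  assume "(%i. u i + - c i):phi ` U"
  then obtain z where z: "z:U" "(%i. u i + - c i) = phi z" by auto
  have "u = (%i. phi z i + c i)" unfolding z(2)[symmetric] by simp
  then show "u:(%z i. phi z i + c i) ` U" using z(1) by auto
 qed auto
 have inv: "inv_into U (%z i. phi z i + c i) u = inv_into U phi (%i. u i + - c i)"
  if u: "u:(%z i. phi z i + c i) ` U" for u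
 proof -
  obtain z where z: "z:U" "u = (%i. phi z i + c i)" using u by auto
  show ?thesis using inv_into_f_f[OF inj z(1)] gchartD(4)[OF g z(1)] unfolding z(2) by simp
 qed
 have op: "openin (top_of_set (cvec ?n)) ((%z i. phi z i + c i) ` U)"
  unfolding openin_cvec_iff
 proof (intro conjI ballI)
  show "(%z i. phi z i + c i) ` U <= cvec ?n" using chartD(3)[OF cU] c by (auto simp: cvec_def)
  fix a assume a: "a:(%z i. phi z i + c i) ` U"
  then have ac: "a:cvec ?n" using chartD(3)[OF cU] c by (auto simp: cvec_def)
  have a': "(%i. a i + - c i):phi ` U" using a mem by simp
  have "eventually (%u. u:phi ` U) (nhd (cspace ?n) (%i. a i + - c i))"
   by (rule eventually_nhdsin_openin[OF _ a']) (use chart_image_open[OF cU chartD(1)[OF cU]] in simp)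
  from map_atD(5)[where F = "%u i. u i + - c i" and x = a, OF map_at_shift[OF ac nc] this]
  show "eventually (%z. z:(%z i. phi z i + c i) ` U) (nb ?n a)"
   unfolding mem by (simp add: nhdsin_nb[OF ac])
 qed
 show ?thesis
 proof (rule gchartI[OF chartD(1)[OF cU] inj op])
  fix x assume x: "x:U"
  have xc: "phi x:cvec ?n" by (rule chartD(3)[OF cU x])
  show "map_at M (cspace ?n) (%z i. phi z i + c i) x"
   by (rule map_at_comp[OF gchartD(2)[OF g x] map_at_shift[OF xc c]])
  define a where "a = (%i. phi x i + c i)"
  have ac: "a:cvec ?n" using xc c by (simp add: a_def cvec_def)
  have am: "(%i. a i + - c i) = phi x" by (simp add: a_def)
  have 1: "map_at (cspace ?n) M (%u. inv_into U phi (%i. u i + - c i)) a"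
   by (rule map_at_comp[OF map_at_shift[OF ac nc]]) (simp only: am gchartD(3)[OF g x])
  have "a:(%z i. phi z i + c i) ` U" using x by (auto simp: a_def)
  from eventually_nb_openin[OF op this]
  have "eventually (%u. inv_into U phi (%i. u i + - c i) = inv_into U (%z i. phi z i + c i) u) (nhd (cspace ?n) a)"
   unfolding cspace_simps nhdsin_nb[OF ac] by eventually_elim (simp only: inv)
  from map_at_cong[OF cm_cspace 1 this]
  show "map_at (cspace ?n) M (inv_into U (%z i. phi z i + c i)) (%i. phi x i + c i)"
   unfolding a_def .
 qed
qed

lemma centred_chart_exists:
 assumes M: "cm M" and x: "x:pts M"
 shows "EX U phi. gchart M U phi & x:U & phi x = (%_. 0)"
proof -
 obtain U phi where U: "(U, phi):matlas M" "x:U" using cmD(2)[OF M x] by auto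
 have "(%i. - phi x i):cvec (mdim M)" using chartD(3)[OF cmD(1)[OF M U(1)] U(2)] by (simp add: cvec_def)
 from gchart_translate[OF M gchart_atlas[OF M U(1)] this] U(2) show ?thesis
  by (intro exI[of _ U] exI[of _ "%z i. phi z i + - phi x i"]) simp
qed

lemma gchart_hol_at:
 assumes M: "cm M" and g: "gchart M U phi" and x: "x:U"
 shows "hol_at M h x \<longleftrightarrow> hg (mdim M) (phi x) (%u. h (inv_into U phi u))"
proof
 assume "hol_at M h x"
 then show "hg (mdim M) (phi x) (%u. h (inv_into U phi u))"
  using map_atD(4)[OF gchartD(3)[OF g x], of h] by (simp add: gchartD(4)[OF g x] hol_at_cspace)
next
 assume "hg (mdim M) (phi x) (%u. h (inv_into U phi u))"
 then have "hol_at (cspace (mdim M)) (%u. h (inv_into U phi u)) (phi x)"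
  using chartD(3)[OF gchartD(1)[OF g] x] by (simp add: hol_at_cspace)
 from map_atD(4)[OF gchartD(2)[OF g x] this] have "hol_at M (%z. h (inv_into U phi (phi z))) x" .
 then show "hol_at M h x"
  by (rule hol_at_cong[OF M])
   (use chartD(6)[OF gchartD(1)[OF g] x] in \<open>eventually_elim, simp add: gchartD(4)[OF g]\<close>)
qed

lemma gchart_coord:
 assumes "gchart M U phi" "x:U" "i < mdim M"
 shows "hol_at M (%z. phi z i) x"
 using map_atD(4)[OF gchartD(2)[OF assms(1,2)], of "%u. u i"] chartD(3)[OF gchartD(1)[OF assms(1)] assms(2)] assms(3)
 by (simp add: hol_at_cspace hg_coord)

lemma gchart_cspace: "gchart (cspace n) (cvec n) id"
 using gchart_atlas[OF cm_cspace, of "cvec n" id n] by simp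

lemma gchart_prod:
 assumes M: "cm M" and N: "cm N" and A: "gchart M U phi" and B: "gchart N V psi"
 shows "gchart (M \<times>\<^sub>M\<^sub>f N) (U \<times> V) (pchart (mdim M) phi psi)"
proof -
 note cA = gchartD(1)[OF A] and cB = gchartD(1)[OF B]
 note ch = chart_prod(1)[OF cA cB]
 show ?thesis unfolding gchart_def
 proof (intro conjI ballI ch)
  fix z assume "z:U \<times> V"
  then obtain x y where z: "z = (x, y)" and x: "x:U" and y: "y:V" by auto
  note xt = chartD(5)[OF cA x] and yt = chartD(5)[OF cB y]
  have cc: "cconcat (mdim M) (phi x) (psi y):cvec (mdim M + mdim N)"
   by (rule cconcat_cvec[OF chartD(3)[OF cB y]])
  note f1 = map_at_comp[OF map_at_fst[OF M N xt yt], unfolded fst_conv]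
  note f2 = map_at_comp[OF map_at_snd[OF M N xt yt], unfolded snd_conv]
  show "map_at (M \<times>\<^sub>M\<^sub>f N) (cspace (mdim (M \<times>\<^sub>M\<^sub>f N))) (pchart (mdim M) phi psi) z"
   unfolding prod_mfd_simps(2)
  proof (rule map_at_cspace[OF cm_prod[OF M N]])
   show "z:pts (M \<times>\<^sub>M\<^sub>f N)" using z xt yt by simp
   have "eventually (%w. w:U \<times> V) (nhd (M \<times>\<^sub>M\<^sub>f N) z)"
    by (rule chartD(6)[OF ch]) (use z x y in simp)
   then show "eventually (%z. pchart (mdim M) phi psi z:cvec (mdim M + mdim N)) (nhd (M \<times>\<^sub>M\<^sub>f N) z)"
    by eventually_elim (use chartD(3)[OF cB] in \<open>auto intro!: cconcat_cvec\<close>)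
   fix i assume i: "i < mdim M + mdim N"
   show "hol_at (M \<times>\<^sub>M\<^sub>f N) (%z. pchart (mdim M) phi psi z i) z"
   proof (cases "i < mdim M")
    case True
    then show ?thesis unfolding z
     using map_atD(4)[OF map_at_fst[OF M N xt yt], of "%x. phi x i"] gchart_coord[OF A x True]
     by (simp add: pchart_def cconcat_def case_prod_unfold)
   next
    case False
    then have "i - mdim M < mdim N" using i by simp
    with False show ?thesis unfolding z
     using map_atD(4)[OF map_at_snd[OF M N xt yt], of "%y. psi y (i - mdim M)"] gchart_coord[OF B y]
     by (simp add: pchart_def cconcat_def case_prod_unfold)
   qed
  qed
  let ?c = "cconcat (mdim M) (phi x) (psi y)"
  have cx: "fstv (mdim M) ?c = phi x" using chartD(3)[OF cA x] by simp
  have p1: "map_at (cspace (mdim M + mdim N)) (cspace (mdim M)) (fstv (mdim M)) ?c"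
   by (rule map_at_cspace[OF cm_cspace]) (use cc in \<open>auto simp: hol_at_cspace intro: hg_fstv\<close>)
  have p2: "map_at (cspace (mdim M + mdim N)) (cspace (mdim N)) (sndv (mdim M)) ?c"
   by (rule map_at_cspace[OF cm_cspace])
    (use cc eventually_nb_cvec[of "mdim M + mdim N" ?c] in
     \<open>auto simp: hol_at_cspace nhdsin_nb intro: hg_sndv sndv_cvec elim!: eventually_mono\<close>)
  have q1: "map_at (cspace (mdim M + mdim N)) M (%z. inv_into U phi (fstv (mdim M) z)) ?c"
   by (rule map_at_comp[OF p1]) (unfold cx, rule gchartD(3)[OF A x])
  have q2: "map_at (cspace (mdim M + mdim N)) N (%z. inv_into V psi (sndv (mdim M) z)) ?c"
   by (rule map_at_comp[OF p2]) (unfold sndv_cconcat, rule gchartD(3)[OF B y])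
  have "eventually (%z. (inv_into U phi (fstv (mdim M) z), inv_into V psi (sndv (mdim M) z)) =
    inv_into (U \<times> V) (pchart (mdim M) phi psi) z) (nhd (cspace (mdim M + mdim N)) ?c)"
   using chart_prod_inv_eventually[OF cA cB x y] unfolding cspace_simps nhdsin_nb[OF cc]
   by eventually_elim simp
  from map_at_cong[OF cm_cspace map_at_pair[OF cm_cspace M N q1 q2] this]
  show "map_at (cspace (mdim (M \<times>\<^sub>M\<^sub>f N))) (M \<times>\<^sub>M\<^sub>f N) (inv_into (U \<times> V) (pchart (mdim M) phi psi)) (pchart (mdim M) phi psi z)"
   by (simp add: z)
 qed
qed

lemma gchart_prod_hol_at:
 assumes M: "cm M" and N: "cm N" and A: "gchart M U phi" and B: "gchart N V psi" and x: "x:U" "y:V"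
 shows "hol_at (M \<times>\<^sub>M\<^sub>f N) h (x, y) \<longleftrightarrow> hg (mdim M + mdim N) (cconcat (mdim M) (phi x) (psi y))
  (%z. h (inv_into U phi (fstv (mdim M) z), inv_into V psi (sndv (mdim M) z)))"
proof -
 note e = chart_prod_inv_eventually[OF gchartD(1)[OF A] gchartD(1)[OF B] x]
 have "hol_at (M \<times>\<^sub>M\<^sub>f N) h (x, y) \<longleftrightarrow> hg (mdim M + mdim N) (cconcat (mdim M) (phi x) (psi y))
  (%z. h (inv_into (U \<times> V) (pchart (mdim M) phi psi) z))"
  using gchart_hol_at[OF cm_prod[OF M N] gchart_prod[OF M N A B], of "(x, y)"] x by simp
 also have "\<dots> \<longleftrightarrow> hg (mdim M + mdim N) (cconcat (mdim M) (phi x) (psi y))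
  (%z. h (inv_into U phi (fstv (mdim M) z), inv_into V psi (sndv (mdim M) z)))"
  by (rule iffI; erule hg_cong[rotated]; use e in eventually_elim, simp)
 finally show ?thesis .
qed

lemma gchart_prod_eventually:
 assumes A: "gchart M U phi" and B: "gchart N V psi" and x: "x:U" "y:V"
 shows "eventually P (nhd (M \<times>\<^sub>M\<^sub>f N) (x, y)) \<longleftrightarrow>
  eventually (%z. P (inv_into U phi (fstv (mdim M) z), inv_into V psi (sndv (mdim M) z)))
   (nb (mdim M + mdim N) (cconcat (mdim M) (phi x) (psi y)))"
proof -
 note e = chart_prod_inv_eventually[OF gchartD(1)[OF A] gchartD(1)[OF B] x]
 have "eventually P (nhd (M \<times>\<^sub>M\<^sub>f N) (x, y)) \<longleftrightarrow>
  eventually (%z. P (inv_into (U \<times> V) (pchart (mdim M) phi psi) z))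
   (nb (mdim M + mdim N) (cconcat (mdim M) (phi x) (psi y)))"
  using chart_eventually_inv[OF chart_prod(1)[OF gchartD(1)[OF A] gchartD(1)[OF B]], of "(x, y)" P] x by simp
 also have "\<dots> \<longleftrightarrow> eventually (%z. P (inv_into U phi (fstv (mdim M) z), inv_into V psi (sndv (mdim M) z)))
   (nb (mdim M + mdim N) (cconcat (mdim M) (phi x) (psi y)))"
  by (rule eventually_cong[OF e]) simp
 finally show ?thesis .
qed

lemma local_coords_iff:
 assumes M: "cm M"
 shows "local_coords M x U phi \<longleftrightarrow> x:U & phi x = (%_. 0) & gchart M U phi"
proof -
 have "biholo M (cspace (mdim M)) U (phi ` U) phi \<longleftrightarrow> gchart M U phi"
 proof
  assume b: "biholo M (cspace (mdim M)) U (phi ` U) phi"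
  then have o: "opn M U" "opn (cspace (mdim M)) (phi ` U)" and i: "inj_on phi U"
   and h: "holo_map M (cspace (mdim M)) U phi" "holo_map (cspace (mdim M)) M (phi ` U) (inv_into U phi)"
   unfolding biholo_def bij_betw_def by auto
  show "gchart M U phi"
   by (rule gchartI[OF o(1) i])
    (use o(2) h(1)[unfolded holo_map_iff[OF M cm_cspace o(1)]] h(2)[unfolded holo_map_iff[OF cm_cspace M o(2)]] in auto)
 next
  assume g: "gchart M U phi"
  note c = gchartD(1)[OF g]
  have o: "opn (cspace (mdim M)) (phi ` U)" using chart_image_open[OF c chartD(1)[OF c]] by simp
  show "biholo M (cspace (mdim M)) U (phi ` U) phi"
   unfolding biholo_def bij_betw_def holo_map_iff[OF M cm_cspace chartD(1)[OF c]] holo_map_iff[OF cm_cspace M o]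
   using o chartD(1,2)[OF c] gchartD(2,3)[OF g] by auto
 qed
 then show ?thesis unfolding local_coords_def by auto
qed

section \<open>Ideals in rings of holomorphic functions\<close>

lemma holo_ring_carrier:
 assumes "cm M" "opn M V"
 shows "h:hfn M V \<longleftrightarrow> h:extensional V & (ALL x:V. hol_at M h x)"
 by (simp add: holo_ring_def holo_fun_iff[OF assms])

lemma restrict_carrier:
 assumes M: "cm M" and V: "opn M V" and h: "!!x. x:V ==> hol_at M h x"
 shows "restrict h V:hfn M V"
 unfolding holo_ring_carrier[OF M V]
proof (intro conjI ballI)
 fix x assume x: "x:V"
 show "hol_at M (restrict h V) x"
  by (rule hol_at_cong[OF M h[OF x]]) (use eventually_nhdsin_openin[OF V x] in eventually_elim, simp)
qed simp

lemma carrier_hol_at: "cm M ==> opn M V ==> h:hfn M V ==> x:V ==> hol_at M h x"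
 by (simp add: holo_ring_carrier)

lemma carrier_restrict: "h:hfn M V ==> restrict h V = h"
 by (simp add: holo_ring_def extensional_restrict)

lemma holo_ring_ops [simp]:
 "g \<otimes>\<^bsub>holo_ring M V\<^esub> h = (\<lambda>z\<in>V. g z * h z)" "g \<oplus>\<^bsub>holo_ring M V\<^esub> h = (\<lambda>z\<in>V. g z + h z)"
 "\<one>\<^bsub>holo_ring M V\<^esub> = (\<lambda>z\<in>V. 1)" "\<zero>\<^bsub>holo_ring M V\<^esub> = (\<lambda>z\<in>V. 0)"
 by (simp_all add: holo_ring_def)

lemma holo_cring:
 assumes M: "cm M" and V: "opn M V"
 shows "cring (holo_ring M V)"
proof (rule cringI)
 note rc = restrict_carrier[OF M V] and ch = carrier_hol_at[OF M V]
 have Vt: "x:pts M" if "x:V" for x using openin_subset[OF V] that by auto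
 note cl = rc[OF hol_at_add[OF M ch ch]] rc[OF hol_at_mult[OF M ch ch]] rc[OF hol_at_const[OF M Vt]]
 show "abelian_group (holo_ring M V)"
 proof (rule abelian_groupI)
  fix x assume x: "x:hfn M V"
  have "(\<lambda>z\<in>V. (-1) * x z):hfn M V"
   by (rule rc, rule hol_at_mult[OF M hol_at_const[OF M Vt] ch[OF x]])
  then show "EX y:hfn M V. y \<oplus>\<^bsub>holo_ring M V\<^esub> x = \<zero>\<^bsub>holo_ring M V\<^esub>"
   by (rule bexI[rotated]) (auto simp: fun_eq_iff)
  have "\<zero>\<^bsub>holo_ring M V\<^esub> \<oplus>\<^bsub>holo_ring M V\<^esub> x = restrict x V" by (auto simp: fun_eq_iff restrict_def)
  then show "\<zero>\<^bsub>holo_ring M V\<^esub> \<oplus>\<^bsub>holo_ring M V\<^esub> x = x" by (simp only: carrier_restrict[OF x])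
 qed (auto simp: fun_eq_iff algebra_simps intro: cl)
 show "comm_monoid (holo_ring M V)"
 proof (rule comm_monoidI)
  fix x assume x: "x:hfn M V"
  have "\<one>\<^bsub>holo_ring M V\<^esub> \<otimes>\<^bsub>holo_ring M V\<^esub> x = restrict x V" by (auto simp: fun_eq_iff restrict_def)
  then show "\<one>\<^bsub>holo_ring M V\<^esub> \<otimes>\<^bsub>holo_ring M V\<^esub> x = x" by (simp only: carrier_restrict[OF x])
 qed (auto simp: fun_eq_iff algebra_simps intro: cl)
qed (auto simp: fun_eq_iff algebra_simps)

text \<open>The functions satisfying P form an ideal that contains S. Statements about germs of
  members of a generated ideal are thereby reduced to the generators.\<close>

lemma Idl_induct:
 assumes M: "cm M" and V: "opn M V" and S: "S <= hfn M V"
  and h: "h:hid M V S"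
  and gen: "!!g. g:S ==> P g" and zero: "P (\<lambda>z\<in>V. 0)"
  and add: "!!g g'. g:hfn M V ==> g':hfn M V ==> P g ==> P g' ==> P (\<lambda>z\<in>V. g z + g' z)"
  and mult: "!!c g. c:hfn M V ==> g:hfn M V ==> P g ==> P (\<lambda>z\<in>V. c z * g z)"
 shows "P h"
proof -
 interpret cring "holo_ring M V" by (rule holo_cring[OF M V])
 let ?R = "holo_ring M V"
 let ?I = "{g:carrier ?R. P g}"
 have m: "x \<otimes>\<^bsub>?R\<^esub> a:?I" if "a:?I" "x:carrier ?R" for a x
  using mult[of x a] that m_closed[of x a] by simp
 have "ideal ?I ?R"
 proof (rule idealI)
  show "ring ?R" by (rule ring_axioms)
  show "subgroup ?I (add_monoid ?R)"
  proof
   show "?I <= carrier (add_monoid ?R)" by auto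
   show "x \<otimes>\<^bsub>add_monoid ?R\<^esub> y:?I" if "x:?I" "y:?I" for x y
    using add[of x y] that a_closed[of x y] by simp
   show "\<one>\<^bsub>add_monoid ?R\<^esub>:?I" using zero zero_closed by simp
   show "inv\<^bsub>add_monoid ?R\<^esub> x:?I" if x: "x:?I" for x
   proof -
    have "\<ominus>\<^bsub>?R\<^esub> x = (\<ominus>\<^bsub>?R\<^esub> \<one>\<^bsub>?R\<^esub>) \<otimes>\<^bsub>?R\<^esub> x"
     using x l_minus[OF one_closed, of x] l_one[of x] by (simp del: holo_ring_ops)
    moreover have "(\<ominus>\<^bsub>?R\<^esub> \<one>\<^bsub>?R\<^esub>) \<otimes>\<^bsub>?R\<^esub> x:?I" by (rule m[OF x a_inv_closed[OF one_closed]])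
    ultimately have "\<ominus>\<^bsub>?R\<^esub> x:?I" by (simp only:)
    then show ?thesis unfolding a_inv_def .
   qed
  qed
  show "x \<otimes>\<^bsub>?R\<^esub> a:?I" if "a:?I" "x:carrier ?R" for a x by (rule m[OF that])
  show "a \<otimes>\<^bsub>?R\<^esub> x:?I" if "a:?I" "x:carrier ?R" for a x
  proof -
   have "a \<otimes>\<^bsub>?R\<^esub> x = x \<otimes>\<^bsub>?R\<^esub> a" by (rule m_comm) (use that in auto)
   then show ?thesis using m[OF that] by (simp only:)
  qed
 qed
 moreover have "S <= ?I" using S gen by auto
 ultimately have "Idl\<^bsub>?R\<^esub> S <= ?I" by (rule genideal_minimal)
 then show ?thesis using h by auto
qed

lemma Idl_ideal:
 assumes M: "cm M" and V: "opn M V" and S: "S <= hfn M V"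
 shows "g:S ==> g:hid M V S"
  and "(\<lambda>z\<in>V. 0):hid M V S"
  and "g:hid M V S ==> g':hid M V S ==> (\<lambda>z\<in>V. g z + g' z):hid M V S"
  and "g:hid M V S ==> c:hfn M V ==> (\<lambda>z\<in>V. c z * g z):hid M V S"
proof -
 interpret cring "holo_ring M V" by (rule holo_cring[OF M V])
 interpret I: ideal "hid M V S" "holo_ring M V" by (rule genideal_ideal[OF S])
 show "g:S ==> g:hid M V S" using genideal_self[OF S] by auto
 show "(\<lambda>z\<in>V. 0):hid M V S" using I.zero_closed by simp
 show "g:hid M V S ==> g':hid M V S ==> (\<lambda>z\<in>V. g z + g' z):hid M V S"
  using I.a_closed[of g g'] by simp
 show "g:hid M V S ==> c:hfn M V ==> (\<lambda>z\<in>V. c z * g z):hid M V S"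
  using I.I_l_closed[of g c] by simp
qed

lemma Idl_sum:
 assumes M: "cm M" and V: "opn M V" and S: "S <= hfn M V"
  and c: "!!k x. k:K ==> x:V ==> hol_at M (c k) x" and g: "!!k. k:K ==> restrict (g k) V:S"
 shows "(\<lambda>z\<in>V. \<Sum>k\<in>K. c k z * g k z):hid M V S"
 using c g
proof (induction K rule: infinite_finite_induct)
 case (insert k K)
 have "(\<lambda>z\<in>V. restrict (c k) V z * restrict (g k) V z):hid M V S"
  by (rule Idl_ideal(4)[OF M V S Idl_ideal(1)[OF M V S] restrict_carrier[OF M V]]) (use insert.prems in auto)
 moreover have "(\<lambda>z\<in>V. \<Sum>k\<in>K. c k z * g k z):hid M V S"
  by (rule insert.IH) (use insert.prems in auto)
 ultimately have "(\<lambda>z\<in>V. (\<lambda>z\<in>V. restrict (c k) V z * restrict (g k) V z) z + (\<lambda>z\<in>V. \<Sum>k\<in>K. c k z * g k z) z):hid M V S"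
  by (rule Idl_ideal(3)[OF M V S])
 moreover have "(\<lambda>z\<in>V. (\<lambda>z\<in>V. restrict (c k) V z * restrict (g k) V z) z + (\<lambda>z\<in>V. \<Sum>k\<in>K. c k z * g k z) z) =
   (\<lambda>z\<in>V. \<Sum>k\<in>insert k K. c k z * g k z)" using insert.hyps by (auto simp: fun_eq_iff)
 ultimately show ?case by (simp only:)
qed (use Idl_ideal(2)[OF M V S] in simp_all)

section \<open>Germs of maps and the unfolding argument in coordinates\<close>

definition gm :: "nat => cseq => nat => (cseq => nat => complex) => bool" where
 "gm m a k F \<longleftrightarrow> a:cvec m & (ALL i<k. hg m a (%z. F z i)) & eventually (%z. F z:cvec k) (nb m a)"

lemma gmI: "a:cvec m ==> (!!i. i < k ==> hg m a (%z. F z i)) ==> (!!z. z:cvec m ==> F z:cvec k) ==> gm m a k F"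
 unfolding gm_def using eventually_mono[OF eventually_nb_cvec[of m a], of "%z. F z:cvec k"] by simp

lemma gmD: "gm m a k F ==> i < k ==> hg m a (%z. F z i)"
 by (simp add: gm_def)

lemma gm_hg: "gm m a k F ==> hg k b h ==> F a = b ==> hg m a (%z. h (F z))"
 by (rule hg_compose[where G = F and k = k]) (simp_all add: gm_def)

lemma gm_ev: "gm m a k F ==> eventually P (nb k b) ==> F a = b ==> eventually (%z. P (F z)) (nb m a)"
 by (rule hg_compose_eventually[where G = F and k = k and P = P and a = a]) (simp_all add: gm_def)

lemma gm_comp: "gm m a k F ==> gm k b l G ==> F a = b ==> gm m a l (%z. G (F z))"
proof -
 assume F: "gm m a k F" and G: "gm k b l G" and e: "F a = b"
 have "hg m a (%z. G (F z) i)" if "i < l" for i by (rule gm_hg[OF F gmD[OF G that] e])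
 moreover have "eventually (%z. G (F z):cvec l) (nb m a)"
  by (rule gm_ev[OF F _ e]) (use G in \<open>simp add: gm_def\<close>)
 ultimately show ?thesis using F by (simp add: gm_def)
qed

lemma gm_cconcat: "gm m a r F ==> gm m a k G ==> gm m a (r + k) (%z. cconcat r (F z) (G z))"
 unfolding gm_def cconcat_def
 by (auto intro!: hg_if_const elim!: eventually_mono simp: cvec_def)

lemma gm_fstv: "a:cvec (r + k) ==> gm (r + k) a r (fstv r)"
 by (rule gmI) (auto intro: hg_fstv)

lemma gm_sndv: "a:cvec (r + k) ==> gm (r + k) a k (sndv r)"
 by (rule gmI) (auto intro: hg_sndv sndv_cvec)

lemma zc_simps [simp]: "cconcat n zc zc = zc" "fstv n zc = zc" "sndv n zc = zc"
 by (auto simp: cconcat_def fstv_def sndv_def)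

text \<open>Coordinates are (s, x, x'), with s a parameter: f(s, x) - f(s, x') vanishes on x = x',
  hence lies in the ideal of the differences of coordinates.\<close>

lemma param_hadamard:
 assumes f: "hg (r + p) zc f"
 shows "EX q. (ALL l<p. hg (r + (p + p)) zc (q l)) &
  eventually (%w. f (cconcat r (fstv r w) (fstv p (sndv r w))) - f (cconcat r (fstv r w) (sndv p (sndv r w))) =
   (\<Sum>l<p. q l w * (w (r + l) - w (r + p + l)))) (nb (r + (p + p)) zc)"
proof (rule hadamard_diff)
 let ?m = "r + (p + p)"
 have 1: "gm ?m zc r (fstv r)" by (rule gm_fstv) simp
 have 2: "gm ?m zc (p + p) (sndv r)" by (rule gm_sndv) simp
 have 3: "gm (p + p) zc p (fstv p)" by (rule gm_fstv) simp
 have 4: "gm (p + p) zc p (sndv p)" by (rule gm_sndv) simp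
 note g1 = gm_cconcat[OF 1 gm_comp[OF 2 3]] and g2 = gm_cconcat[OF 1 gm_comp[OF 2 4]]
 show "hg ?m zc (%w. f (cconcat r (fstv r w) (fstv p (sndv r w))) - f (cconcat r (fstv r w) (sndv p (sndv r w))))"
  by (intro hg_diff gm_hg[OF g1 f] gm_hg[OF g2 f]) simp_all
 show "eventually (%w. (ALL l<p. w (r + l) = w (r + p + l)) -->
   f (cconcat r (fstv r w) (fstv p (sndv r w))) - f (cconcat r (fstv r w) (sndv p (sndv r w))) = 0) (nb ?m zc)"
  using eventually_nb_cvec
 proof (eventually_elim, intro impI)
  fix w assume w: "w:cvec ?m" "ALL l<p. w (r + l) = w (r + p + l)"
  have "fstv p (sndv r w) = sndv p (sndv r w)"
  proof
   fix l show "fstv p (sndv r w) l = sndv p (sndv r w) l"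
    using w by (cases "l < p") (auto simp: fstv_def sndv_def cvec_def add.assoc)
  qed
  then show "f (cconcat r (fstv r w) (fstv p (sndv r w))) - f (cconcat r (fstv r w) (sndv p (sndv r w))) = 0" by simp
 qed
qed (auto intro: inj_onI)

text \<open>A map preserving the parameter sends the ideal of the differences of two points into
  that of the differences of their images. Both the target part of a trivialization and the inverse
  of its source part are used in this way.\<close>

lemma param_hadamard_map:
 assumes f: "hg (r + p) zc f" and S: "gm m a r S" "S a = zc" and X: "gm m a p X" "X a = zc" and Y: "gm m a p Y" "Y a = zc"
 shows "EX q. (ALL l<p. hg m a (q l)) & eventually (%z. f (cconcat r (S z) (X z)) - f (cconcat r (S z) (Y z)) =
   (\<Sum>l<p. q l z * (X z l - Y z l))) (nb m a)"
proof -
 obtain q where q0: "ALL l<p. hg (r + (p + p)) zc (q l)" and q1: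
  "eventually (%w. f (cconcat r (fstv r w) (fstv p (sndv r w))) - f (cconcat r (fstv r w) (sndv p (sndv r w))) =
   (\<Sum>l<p. q l w * (w (r + l) - w (r + p + l)))) (nb (r + (p + p)) zc)"
  using param_hadamard[OF f] by blast
 note q = q0[rule_format] q1
 let ?G = "%z. cconcat r (S z) (cconcat p (X z) (Y z))"
 have G: "gm m a (r + (p + p)) ?G" by (rule gm_cconcat[OF S(1) gm_cconcat[OF X(1) Y(1)]])
 have G0: "?G a = zc" by (simp add: S X Y)
 have "eventually (%z. f (cconcat r (S z) (X z)) - f (cconcat r (S z) (Y z)) =
   (\<Sum>l<p. q l (?G z) * (X z l - Y z l))) (nb m a)"
  using gm_ev[OF G q(2) G0] S(1)[unfolded gm_def, THEN conjunct2, THEN conjunct2]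
   X(1)[unfolded gm_def, THEN conjunct2, THEN conjunct2]
 proof eventually_elim
  case (elim z)
  have 1: "fstv r (?G z) = S z" "sndv r (?G z) = cconcat p (X z) (Y z)" "fstv p (cconcat p (X z) (Y z)) = X z"
   using elim by simp_all
  have "(\<Sum>l<p. q l (?G z) * (?G z (r + l) - ?G z (r + p + l))) = (\<Sum>l<p. q l (?G z) * (X z l - Y z l))"
   by (intro sum.cong refl) (simp add: cconcat_def)
  then show ?case using elim(1) unfolding 1 sndv_cconcat by simp
 qed
 moreover have "hg m a (%z. q l (?G z))" if "l < p" for l by (rule gm_hg[OF G q(1)[OF that] G0])
 ultimately show ?thesis by (intro exI[of _ "%l z. q l (?G z)"]) simp
qed

text \<open>The parameters s of the unfolding g(u) + s u are traded for the entries T = s + alpha(u,u') of a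
 generic matrix; the germ obtained by moving hh along the trivialization satisfies the hypothesis of
 generic_residual in the coordinates T, u - u', u', and T = alpha gives back hh.\<close>

theorem core:
 fixes n p r :: nat
 defines "r \<equiv> p * n"
 defines "Fs \<equiv> %g z j. if j < p then g j (sndv r z) + (\<Sum>i<n. z (j * n + i) * z (r + i)) else (0::complex)"
 assumes hh: "hg (n + n) zc hh" and g: "!!j. j < p ==> hg n zc (g j)" and g0: "!!j. j < p ==> g j zc = 0"
  and al: "!!j i. j < p ==> i < n ==> hg (n + n) zc (al j i)"
  and alg: "eventually (%z. ALL j<p. g j (fstv n z) - g j (sndv n z) = (\<Sum>i<n. al j i z * (z i - z (n + i)))) (nb (n + n) zc)"
  and H2: "!!i. i < n ==> EX c. (ALL j<p. hg (n + n) zc (c j)) &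
   eventually (%z. hh z * (z i - z (n + i)) = (\<Sum>j<p. c j z * (g j (fstv n z) - g j (sndv n z)))) (nb (n + n) zc)"
  and Ph: "gm (r + n) zc n Phi" and Ph': "!!i. i < n ==> hg (r + n) zc (Phi' i)"
  and inv: "eventually (%z. ALL i<n. Phi' i (cconcat r (fstv r z) (Phi z)) = z (r + i)) (nb (r + n) zc)"
  and Ph0: "eventually (%u. Phi (cconcat r zc u) = u) (nb n zc)"
  and Ps: "!!j. j < p ==> hg (r + p) zc (Psi j)"
  and conj: "eventually (%z. ALL j<p. Psi j (cconcat r (fstv r z) (Fs g z)) = g j (Phi z)) (nb (r + n) zc)"
 shows "EX c E. (ALL j<p. hg (n + n) zc (c j)) & (ALL S. hg (n + n) zc (%z. E z S)) &
  eventually (%z. hh z = (\<Sum>j<p. c j z * (g j (fstv n z) - g j (sndv n z))) +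
   dv {..<p} (%j i. al j i z) [0..<n] (E z) {}) (nb (n + n) zc)"
proof -
 define m where "m = r + (n + n)"
 have dm: "(j * n + i) div n = j" "(j * n + i) mod n = i" if "i < n" for j i :: nat using that by auto
 have jr: "j * n + i < r" if "j < p" "i < n" for j i
 proof -
  have "j * n + i < Suc j * n" using that by simp
  also have "\<dots> <= p * n" using that by (intro mult_right_mono) auto
  finally show ?thesis by (simp add: r_def)
 qed
 have kdiv: "k div n < p" "k mod n < n" if "k < r" for k
 proof -
  show "k div n < p" using that unfolding r_def by (rule less_mult_imp_div_less)
  have "n > 0" using that unfolding r_def by (cases n) auto
  then show "k mod n < n" by simp
 qed
 \<comment> \<open>The m = r + 2 n coordinates are the entries of T row by row, then v = u - u',
   then u'; the points u and u' and the parameter s are recovered from them.\<close>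
 define u' where "u' z = (%i. if i < n then z (r + n + i) else 0)" for z :: "nat => complex"
 define u where "u z = (%i. if i < n then z (r + i) + z (r + n + i) else 0)" for z :: "nat => complex"
 define UU where "UU z = cconcat n (u z) (u' z)" for z
 define s where "s z = (%k. if k < r then z k - al (k div n) (k mod n) (UU z) else 0)" for z :: "nat => complex"
 \<comment> \<open>The point s = 0, u = u' = 0 in the new coordinates. Its matrix part is the
   Jacobian matrix of g at 0 and need not vanish, so \<open>generic_residual\<close> is required at
   an arbitrary matrix.\<close>
 define a where "a = (%k. if k < r then al (k div n) (k mod n) zc else 0)"
 have a: "a:cvec m" by (simp add: a_def cvec_def m_def)
 have ua: "u a = zc" "u' a = zc" by (auto simp: u_def u'_def a_def)
 have UUa: "UU a = zc" by (simp add: UU_def ua)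
 have sa: "s a = zc" unfolding s_def UUa by (auto simp: a_def)
 have uc: "u z:cvec n" "u' z:cvec n" and sc: "s z:cvec r" for z by (auto simp: u_def u'_def s_def cvec_def)
 have gu: "gm m a n u" by (rule gmI[OF a _ uc(1)]) (auto simp: u_def m_def intro!: hg_add hg_coord)
 have gu': "gm m a n u'" by (rule gmI[OF a _ uc(2)]) (auto simp: u'_def m_def intro!: hg_coord)
 have gUU: "gm m a (n + n) UU" unfolding UU_def by (rule gm_cconcat[OF gu gu'])
 have gs: "gm m a r s"
 proof (rule gmI[OF a _ sc])
  fix k assume k: "k < r"
  have "hg m a (%z. z k - al (k div n) (k mod n) (UU z))"
   by (intro hg_diff hg_coord gm_hg[OF gUU al[OF kdiv[OF k]] UUa]) (use k in \<open>simp add: m_def\<close>)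
  then show "hg m a (%z. s z k)" using k by (simp add: s_def)
 qed
 define A where "A z = cconcat r (s z) (u z)" for z
 define B where "B z = cconcat r (s z) (u' z)" for z
 have gA: "gm m a (r + n) A" unfolding A_def by (rule gm_cconcat[OF gs gu])
 have gB: "gm m a (r + n) B" unfolding B_def by (rule gm_cconcat[OF gs gu'])
 have Aa: "A a = zc" "B a = zc" by (simp_all add: A_def B_def sa ua)
 have fA: "fstv r (A z) = s z" "sndv r (A z) = u z" "fstv r (B z) = s z" "sndv r (B z) = u' z" for z
  using sc by (simp_all add: A_def B_def)
 have Ar: "A z (r + i) = u z i" "B z (r + i) = u' z i" for z i by (simp_all add: A_def B_def cconcat_def)
 have As: "A z k = s z k" "B z k = s z k" if "k < r" for z k using that by (simp_all add: A_def B_def cconcat_def)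
 define P where "P z = Phi (A z)" for z
 define Q where "Q z = Phi (B z)" for z
 have gP: "gm m a n P" unfolding P_def by (rule gm_comp[OF gA Ph Aa(1)])
 have gQ: "gm m a n Q" unfolding Q_def by (rule gm_comp[OF gB Ph Aa(2)])
 have Phz: "Phi zc = zc" using eventually_nb_self[OF Ph0] by (simp add: cvec_def)
 have Pa: "P a = zc" "Q a = zc" by (simp_all add: P_def Q_def Aa Phz)
 have Pc: "eventually (%z. P z:cvec n) (nb m a)" using gP by (simp add: gm_def)
 \<comment> \<open>hh at the two points moved by the trivialization with the common parameter s: the
   extension of hh to the parameter space.\<close>
 define ht where "ht z = hh (cconcat n (P z) (Q z))" for z
 note gPQ = gm_cconcat[OF gP gQ]
 have PQa: "cconcat n (P a) (Q a) = zc" by (simp add: Pa)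
 have ght: "hg m a ht" unfolding ht_def by (rule gm_hg[OF gPQ hh PQa])
 define L where "L = [0..<n]"
 define t where "t j i = j * n + i" for j i :: nat
 define y where "y i = r + i" for i :: nat
 have setL: "set L = {..<n}" by (auto simp: L_def)
 have row: "row L t y j z = (\<Sum>i<n. z (j * n + i) * z (r + i))" for j z
  by (simp add: row_def setL t_def y_def)
 have G: "gindex m {..<p} L t y" unfolding gindex_def setL
 proof (intro conjI ballI impI)
  fix j i j' i' assume "i:{..<n}" "i':{..<n}" "t j i = t j' i'"
  then show "j = j'" "i = i'" using dm unfolding t_def by (metis lessThan_iff)+
 next
  fix j i assume "j:{..<p}" "i:{..<n}"
  then show "t j i < m" using jr[of j i] by (simp add: t_def m_def)
 next
  fix j i k assume "j:{..<p}" "i:{..<n}" "k:{..<n}"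
  then show "t j i ~= y k" using jr[of j i] by (simp add: t_def y_def)
 qed (auto simp: L_def y_def m_def inj_on_def)
 \<comment> \<open>The unfolding g(u) + s u has difference (\<alpha> + s) v = T v at u and u', which
   consists of the generic rows.\<close>
 have Fdiff: "eventually (%z. ALL j<p. Fs g (A z) j - Fs g (B z) j = row L t y j z) (nb m a)"
  using gm_ev[OF gUU alg UUa]
 proof (eventually_elim, intro allI impI)
  fix z j assume e: "ALL j<p. g j (fstv n (UU z)) - g j (sndv n (UU z)) = (\<Sum>i<n. al j i (UU z) * (UU z i - UU z (n + i)))"
   and j: "j < p"
  have e': "g j (u z) - g j (u' z) = (\<Sum>i<n. al j i (UU z) * z (r + i))"
  proof -
   have "(\<Sum>i<n. al j i (UU z) * (UU z i - UU z (n + i))) = (\<Sum>i<n. al j i (UU z) * z (r + i))"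
    by (intro sum.cong refl) (simp add: UU_def cconcat_def u_def u'_def)
   then show ?thesis using e[rule_format, OF j] uc[of z] by (simp add: UU_def)
  qed
  have sz: "s z (j * n + i) = z (j * n + i) - al j i (UU z)" if "i < n" for i
   using jr[OF j that] dm[OF that] by (simp add: s_def)
  have "Fs g (A z) j - Fs g (B z) j = (g j (u z) - g j (u' z)) + (\<Sum>i<n. s z (j * n + i) * z (r + i))"
  proof -
   have "(\<Sum>i<n. A z (j * n + i) * A z (r + i)) = (\<Sum>i<n. s z (j * n + i) * u' z i) + (\<Sum>i<n. s z (j * n + i) * z (r + i))"
    unfolding sum.distrib[symmetric]
   proof (intro sum.cong refl)
    fix i assume "i:{..<n}"
    then have i: "i < n" by simp
    then show "A z (j * n + i) * A z (r + i) = s z (j * n + i) * u' z i + s z (j * n + i) * z (r + i)"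
     unfolding As(1)[OF jr[OF j i]] Ar by (simp add: u_def u'_def distrib_left)
   qed
   moreover have "(\<Sum>i<n. B z (j * n + i) * B z (r + i)) = (\<Sum>i<n. s z (j * n + i) * u' z i)"
    by (intro sum.cong refl) (use jr[OF j] in \<open>simp add: As Ar\<close>)
   ultimately show ?thesis using j by (simp add: Fs_def fA)
  qed
  also have "\<dots> = (\<Sum>i<n. z (j * n + i) * z (r + i))"
   unfolding e' sum.distrib[symmetric] by (intro sum.cong refl) (simp add: sz left_diff_distrib)
  finally show "Fs g (A z) j - Fs g (B z) j = row L t y j z" by (simp only: row)
 qed
 have gFs: "gm (r + n) zc p (Fs g)"
 proof (rule gmI)
  fix j assume j: "j < p"
  have "hg (r + n) zc (%z. g j (sndv r z) + (\<Sum>i<n. z (j * n + i) * z (r + i)))"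
   by (intro hg_add hg_sum hg_mult hg_coord gm_hg[OF gm_sndv g[OF j]]) (use jr[OF j] in \<open>auto simp: cvec_def trans_less_add1\<close>)
  then show "hg (r + n) zc (%z. Fs g z j)" using j by (simp add: Fs_def)
 qed (auto simp: Fs_def cvec_def)
 have Fs0: "Fs g zc = zc" using g0 by (auto simp: Fs_def fun_eq_iff)
 have gFA: "gm m a p (%z. Fs g (A z))" "gm m a p (%z. Fs g (B z))"
  by (rule gm_comp[OF gA gFs Aa(1)], rule gm_comp[OF gB gFs Aa(2)])
 have "EX q. (ALL l<p. hg m a (q l)) & eventually (%z. Psi j (cconcat r (s z) (Fs g (A z))) - Psi j (cconcat r (s z) (Fs g (B z))) =
   (\<Sum>l<p. q l z * (Fs g (A z) l - Fs g (B z) l))) (nb m a)" if "j < p" for j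
  by (rule param_hadamard_map[OF Ps[OF that] gs sa gFA(1) _ gFA(2)]) (simp_all add: Aa Fs0)
 then have "ALL j. EX q. j < p --> ((ALL l<p. hg m a (q l)) & eventually (%z. Psi j (cconcat r (s z) (Fs g (A z))) - Psi j (cconcat r (s z) (Fs g (B z))) =
   (\<Sum>l<p. q l z * (Fs g (A z) l - Fs g (B z) l))) (nb m a))" by simp
 from choice[OF this] obtain q where q0: "ALL j. j < p --> (ALL l<p. hg m a (q j l)) & eventually (%z. Psi j (cconcat r (s z) (Fs g (A z))) - Psi j (cconcat r (s z) (Fs g (B z))) =
   (\<Sum>l<p. q j l z * (Fs g (A z) l - Fs g (B z) l))) (nb m a)" by blast
 note q = q0[rule_format, THEN conjunct1, rule_format] q0[rule_format, THEN conjunct2]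
 \<comment> \<open>The trivialization identifies g at the moved points with \<open>Psi\<close> of
   the unfolding at the original ones; by the Hadamard quotients of \<open>Psi\<close> the
   differences of g fall into the ideal of the rows.\<close>
 have gdiff: "eventually (%z. g j (P z) - g j (Q z) = (\<Sum>l<p. q j l z * row L t y l z)) (nb m a)" if j: "j < p" for j
  using q(2)[OF j] Fdiff gm_ev[OF gA conj Aa(1)] gm_ev[OF gB conj Aa(2)]
  by eventually_elim (use j in \<open>simp add: fA P_def Q_def\<close>)
 \<comment> \<open>Three inclusions combine: v lies in the ideal of P - Q because
   \<open>Phi'\<close> inverts the motion; ht times P - Q lies in the ideal of g(P) - g(Q) by the
   hypothesis on hh; and g(P) - g(Q) lies in the ideal of the rows.\<close>
 have ex: "EX b. (ALL j:{..<p}. hg m a (b j)) &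
   eventually (%z. ht z * z (y i) = (\<Sum>j\<in>{..<p}. b j z * row L t y j z)) (nb m a)" if i: "i:set L" for i
 proof -
  have i: "i < n" using that by (simp add: setL)
  obtain e where e0: "ALL k<n. hg m a (e k)" and ee: "eventually (%z. Phi' i (cconcat r (s z) (P z)) - Phi' i (cconcat r (s z) (Q z)) =
   (\<Sum>k<n. e k z * (P z k - Q z k))) (nb m a)"
   using param_hadamard_map[OF Ph'[OF i] gs sa gP Pa(1) gQ Pa(2)] by blast
  note e = e0[rule_format]
  have "ALL k. EX c. k < n --> ((ALL j<p. hg (n + n) zc (c j)) &
   eventually (%z. hh z * (z k - z (n + k)) = (\<Sum>j<p. c j z * (g j (fstv n z) - g j (sndv n z)))) (nb (n + n) zc))"
   using H2 by simp
  from choice[OF this] obtain c where c0: "ALL k. k < n --> (ALL j<p. hg (n + n) zc (c k j)) & eventually (%z. hh z * (z k - z (n + k)) = (\<Sum>j<p. c k j z * (g j (fstv n z) - g j (sndv n z)))) (nb (n + n) zc)"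
   by blast
  note c = c0[rule_format, THEN conjunct1, rule_format] c0[rule_format, THEN conjunct2]
  define c' where "c' k j z = c k j (cconcat n (P z) (Q z))" for k j z
  have c': "hg m a (c' k j)" if "k < n" "j < p" for k j
   unfolding c'_def by (rule gm_hg[OF gPQ c(1)[OF that] PQa])
  have 1: "eventually (%z. ALL k:{..<n}. ht z * (P z k - Q z k) = (\<Sum>j<p. c' k j z * (g j (P z) - g j (Q z)))) (nb m a)"
  proof (rule eventually_ball_finite, simp, rule ballI)
   fix k assume "k:{..<n}"
   then have k: "k < n" by simp
   show "eventually (%z. ht z * (P z k - Q z k) = (\<Sum>j<p. c' k j z * (g j (P z) - g j (Q z)))) (nb m a)"
    using gm_ev[OF gPQ c(2)[OF k] PQa] Pc
   proof eventually_elim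
    case (elim z)
    have "cconcat n (P z) (Q z) k = P z k" "cconcat n (P z) (Q z) (n + k) = Q z k" using k by (simp_all add: cconcat_def)
    then show ?case using elim by (simp add: ht_def c'_def)
   qed
  qed
  have 2: "eventually (%z. ALL j:{..<p}. g j (P z) - g j (Q z) = (\<Sum>l<p. q j l z * row L t y l z)) (nb m a)"
   by (rule eventually_ball_finite) (use gdiff in auto)
  have 3: "eventually (%z. z (y i) = (\<Sum>k<n. e k z * (P z k - Q z k))) (nb m a)"
   using ee gm_ev[OF gA inv Aa(1)] gm_ev[OF gB inv Aa(2)]
  proof eventually_elim
   case (elim z)
   have "Phi' i (cconcat r (s z) (P z)) = u z i" "Phi' i (cconcat r (s z) (Q z)) = u' z i"
    using elim(2,3) i by (simp_all add: fA P_def Q_def Ar)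
   then show ?case using elim(1) i by (simp add: u_def u'_def y_def)
  qed
  define b where "b l z = (\<Sum>k<n. \<Sum>j<p. e k z * c' k j z * q j l z)" for l z
  have "eventually (%z. ht z * z (y i) = (\<Sum>l<p. b l z * row L t y l z)) (nb m a)"
   using 1 2 3
  proof eventually_elim
   case (elim z)
   have "ht z * z (y i) = (\<Sum>k<n. e k z * (ht z * (P z k - Q z k)))"
    unfolding elim(3) sum_distrib_left by (intro sum.cong refl) (simp add: mult_ac)
   also have "\<dots> = (\<Sum>k<n. \<Sum>j<p. \<Sum>l<p. e k z * c' k j z * q j l z * row L t y l z)"
    using elim(1,2) by (intro sum.cong refl) (simp add: sum_distrib_left mult_ac)
   also have "\<dots> = (\<Sum>k<n. \<Sum>l<p. \<Sum>j<p. e k z * c' k j z * q j l z * row L t y l z)"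
    by (intro sum.cong refl sum.swap)
   also have "\<dots> = (\<Sum>l<p. \<Sum>k<n. \<Sum>j<p. e k z * c' k j z * q j l z * row L t y l z)"
    by (rule sum.swap)
   finally show ?case by (simp add: b_def sum_distrib_right)
  qed
  moreover have "hg m a (b l)" if "l < p" for l
   unfolding b_def by (intro hg_sum hg_mult e c' q) (use that in auto)
  ultimately show ?thesis by (intro exI[of _ b]) simp
 qed
 have ht: "ht:resid m a {..<p} L t y"
  by (rule generic_residual[OF G a _ ght ex]) (simp_all add: y_def a_def)
 obtain c E where c: "!!j. j:{..<p} ==> hg m a (c j)" and E: "!!S. hg m a (%z. E z S)"
  and ev: "eventually (%z. ht z = (\<Sum>j\<in>{..<p}. c j z * row L t y j z) + dv {..<p} (%j i. z (t j i)) L (E z) {}) (nb m a)"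
  using residE[OF ht] by blast
 \<comment> \<open>The section T = \<alpha>(w), that is s = 0. Over it \<open>Phi\<close> is the
   identity, ht becomes hh, and the rows become the differences of g.\<close>
 define K where "K w = (%k. if k < r then al (k div n) (k mod n) w else if k < r + n then w (k - r) - w (n + (k - r))
   else if k < m then w (k - r) else 0)" for w
 have zc2: "zc:cvec (n + n)" by (simp add: cvec_def)
 have gK: "gm (n + n) zc m K"
 proof (rule gmI[OF zc2])
  fix k assume k: "k < m"
  show "hg (n + n) zc (%z. K z k)" unfolding K_def
   by (intro hg_if_const hg_diff hg_coord hg_const) (use k al kdiv in \<open>auto simp: m_def\<close>)
 qed (auto simp: K_def cvec_def m_def)
 have Ka: "K zc = a" by (auto simp: K_def a_def fun_eq_iff)
 have Kt: "K w (t j i) = al j i w" if "j < p" "i < n" for w j i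
  using jr[OF that] dm[OF that(2)] by (simp add: K_def t_def)
 have Ky: "K w (y i) = w i - w (n + i)" if "i < n" for w i using that by (simp add: K_def y_def)
 have Kw: "K w (r + n + i) = w (n + i)" if "i < n" for w i using that by (simp add: K_def m_def)
 have uK: "u (K w) = fstv n w" for w
  using Ky[of _ w] Kw[of _ w] by (auto simp: u_def fstv_def y_def)
 have u'K: "u' (K w) = sndv n w" if "w:cvec (n + n)" for w
  using Kw[of _ w] that by (auto simp: u'_def sndv_def cvec_def)
 have sK: "s (K w) = zc" if "w:cvec (n + n)" for w
 proof -
  have "UU (K w) = w" by (simp add: UU_def uK u'K[OF that])
  then show ?thesis by (auto simp: s_def K_def)
 qed
 have PK: "eventually (%w. Phi (cconcat r zc (fstv n w)) = fstv n w) (nb (n + n) zc)"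
  by (rule gm_ev[OF gm_fstv[OF zc2] Ph0]) simp
 have QK: "eventually (%w. Phi (cconcat r zc (sndv n w)) = sndv n w) (nb (n + n) zc)"
  by (rule gm_ev[OF gm_sndv[OF zc2] Ph0]) simp
 have fin: "eventually (%w. hh w = (\<Sum>j<p. c j (K w) * (g j (fstv n w) - g j (sndv n w))) +
   dv {..<p} (%j i. al j i w) [0..<n] (E (K w)) {}) (nb (n + n) zc)"
  using gm_ev[OF gK ev Ka] PK QK eventually_nb_cvec alg
 proof eventually_elim
  case (elim w)
  have "ht (K w) = hh w"
   unfolding ht_def P_def Q_def A_def B_def uK u'K[OF elim(4)] sK[OF elim(4)] elim(2,3) by simp
  moreover have "row L t y j (K w) = g j (fstv n w) - g j (sndv n w)" if "j < p" for j
   using elim(5) that by (simp add: row_def setL Kt Ky)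
  moreover have "dv {..<p} (%j i. K w (t j i)) L (E (K w)) = dv {..<p} (%j i. al j i w) L (E (K w))"
   by (rule dv_cong) (simp add: Kt setL)
  ultimately show ?case using elim(1) unfolding L_def[symmetric] by simp
 qed
 have "hg (n + n) zc (%w. c j (K w))" if "j < p" for j by (rule gm_hg[OF gK c Ka]) (simp add: that)
 moreover have "hg (n + n) zc (%w. E (K w) S)" for S by (rule gm_hg[OF gK E Ka])
 ultimately show ?thesis
  using fin by (intro exI[of _ "%j w. c j (K w)"] exI[of _ "%w. E (K w)"]) simp
qed

section \<open>Iterated contractions as combinations of minors\<close>

definition msub :: "(nat => nat => complex) => nat list => nat set => complex mat" where
 "msub T L Q = mat (length L) (length L) (%(a, b). T (pick Q a) (L ! b))"

text \<open>\<open>pick\<close> enumerates a set increasingly; deleting its k-th element shifts the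
  later ones by one place, just as \<open>mat_delete\<close> shifts rows.\<close>

lemma pick_remove:
 assumes Q: "finite Q" and k: "k < card Q" and a: "Suc a < card Q"
 shows "pick (Q - {pick Q k}) a = pick Q (if a < k then a else Suc a)"
proof -
 define c where "c = (if a < k then a else Suc a)"
 have c: "c < card Q" using a by (simp add: c_def)
 have inQ: "pick Q c:Q" "pick Q k:Q" using pick_in_set_le c k by auto
 have "card {b:Q - {pick Q k}. b < pick Q c} = a"
 proof (cases "a < k")
  case True
  then have "pick Q c < pick Q k" using pick_mono_le[OF k, of c] by (simp add: c_def)
  then have "{b:Q - {pick Q k}. b < pick Q c} = {b:Q. b < pick Q c}" by auto
  then show ?thesis using card_pick_le[OF c] True by (simp add: c_def)
 next
  case False
  then have "pick Q k < pick Q c" using pick_mono_le[OF c, of k] by (simp add: c_def)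
  then have "{b:Q. b < pick Q c} = insert (pick Q k) {b:Q - {pick Q k}. b < pick Q c}" using inQ by auto
  moreover have "finite {b:Q - {pick Q k}. b < pick Q c}" using Q by simp
  ultimately have "card {b:Q. b < pick Q c} = Suc (card {b:Q - {pick Q k}. b < pick Q c})" by simp
  then show ?thesis using card_pick_le[OF c] False by (simp add: c_def)
 qed
 moreover have "pick Q c:Q - {pick Q k}"
 proof -
  have "pick Q c ~= pick Q k"
   using pick_mono_le[OF c, of k] pick_mono_le[OF k, of c] by (cases "a < k") (auto simp: c_def)
  then show ?thesis using inQ by simp
 qed
 ultimately show ?thesis using pick_card_in_set[of "pick Q c" "Q - {pick Q k}"] by (simp add: c_def)
qed

lemma mat_delete_msub:
 assumes "finite Q" "card Q = Suc (length L)" "k < card Q"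
 shows "mat_delete (msub T (i # L) Q) k 0 = msub T L (Q - {pick Q k})"
 by (rule eq_matI) (use assms in \<open>auto simp: mat_delete_def msub_def pick_remove\<close>)

lemma det_msub_expand:
 assumes Q: "finite Q" "card Q = Suc (length L)"
 shows "Determinant.det (msub T (i # L) Q) =
  (\<Sum>j\<in>Q. T j i * ((-1) ^ card {a:Q. a < j} * Determinant.det (msub T L (Q - {j}))))"
proof -
 have A: "msub T (i # L) Q:carrier_mat (Suc (length L)) (Suc (length L))" by (simp add: msub_def)
 have "Determinant.det (msub T (i # L) Q) =
   (\<Sum>k<Suc (length L). msub T (i # L) Q $$ (k, 0) * cofactor (msub T (i # L) Q) k 0)"
  by (rule laplace_expansion_column[OF A]) simp
 also have "\<dots> = (\<Sum>k<card Q. T (pick Q k) i * ((-1) ^ k * Determinant.det (msub T L (Q - {pick Q k}))))"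
  unfolding Q(2)
  by (intro sum.cong refl) (use Q in \<open>simp add: cofactor_def mat_delete_msub, simp add: msub_def\<close>)
 also have "\<dots> = (\<Sum>j\<in>Q. T j i * ((-1) ^ card {a:Q. a < j} * Determinant.det (msub T L (Q - {j}))))"
 proof (rule sum.reindex_bij_witness[of _ "%j. card {a:Q. a < j}" "pick Q"])
  fix k assume "k:{..<card Q}"
  then have k: "k < card Q" by simp
  then show "card {a:Q. a < pick Q k} = k" "pick Q k:Q" by (simp_all add: card_pick_le pick_in_set_le)
  show "T (pick Q k) i * ((-1) ^ card {a:Q. a < pick Q k} * Determinant.det (msub T L (Q - {pick Q k}))) =
    T (pick Q k) i * ((-1) ^ k * Determinant.det (msub T L (Q - {pick Q k})))"
   by (simp add: card_pick_le[OF k])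
 next
  fix j assume j: "j:Q"
  show "pick Q (card {a:Q. a < j}) = j" by (rule pick_card_in_set[OF j])
  have "{a:Q. a < j} \<subset> Q" using j by auto
  then show "card {a:Q. a < j}:{..<card Q}" using psubset_card_mono[OF Q(1)] by simp
 qed
 finally show ?thesis .
qed

lemma sg_split: "S <= R ==> sg j R = sg j S * (-1) ^ card {a:R - S. a < j}"
proof -
 assume "S <= R"
 then have "{k:R. k < j} = {k:S. k < j} \<union> {a:R - S. a < j}" by auto
 then have "card {k:R. k < j} = card {k:S. k < j} + card {a:R - S. a < j}"
  by (simp add: card_Un_disjoint disjoint_iff)
 then show ?thesis by (simp add: sg_def power_add)
qed

text \<open>Each contraction is a Laplace expansion along its column. A general S is needed for the
  induction over the columns, since contracting with the first one evaluates the others at S with an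
  element added.\<close>

lemma dv_det:
 assumes J: "finite J" and S: "S <= J"
 shows "dv J T L E S = (\<Sum>R\<in>Pow J. if S <= R & card R = card S + length L
  then E R * (\<Prod>t\<in>R - S. sg t R) * Determinant.det (msub T L (R - S)) else 0)"
 using S
proof (induction L arbitrary: S)
 case Nil
 have fin: "finite R" if "R <= J" for R using finite_subset[OF that J] .
 have eq: "S <= R & card R = card S \<longleftrightarrow> R = S" if "R:Pow J" for R
  using card_subset_eq[of R S] fin[of R] that by auto
 have d: "Determinant.det (msub T [] {}) = 1" by (rule det_dim_zero) (simp add: msub_def)
 have "(\<Sum>R\<in>Pow J. if S <= R & card R = card S + length []
  then E R * (\<Prod>t\<in>R - S. sg t R) * Determinant.det (msub T [] (R - S)) else 0) = (\<Sum>R\<in>Pow J. if R = S then E S else 0)"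
  by (intro sum.cong refl) (use eq d in simp)
 also have "\<dots> = E S" using J Nil by simp
 finally show ?case by simp
next
 case (Cons i L)
 define F where "F j R = sg j S * T j i * (E R * (\<Prod>t\<in>R - insert j S. sg t R) * Determinant.det (msub T L (R - insert j S)))" for j R
 have finS: "finite S" using finite_subset[OF Cons.prems J] .
 have "dv J T (i # L) E S = (\<Sum>j\<in>J - S. sg j S * (T j i * dv J T L E (insert j S)))"
  by (simp add: cv_def)
 also have "\<dots> = (\<Sum>j\<in>J - S. \<Sum>R\<in>Pow J. if insert j S <= R & card R = card (insert j S) + length L then F j R else 0)"
 proof (intro sum.cong refl)
  fix j assume j: "j:J - S"
  then have "insert j S <= J" using Cons.prems by auto
  from Cons.IH[OF this] show "sg j S * (T j i * dv J T L E (insert j S)) =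
    (\<Sum>R\<in>Pow J. if insert j S <= R & card R = card (insert j S) + length L then F j R else 0)"
   by (simp add: sum_distrib_left F_def mult.assoc if_distrib[of "%x. _ * x"] cong: if_cong)
 qed
 also have "\<dots> = (\<Sum>R\<in>Pow J. \<Sum>j\<in>J - S. if insert j S <= R & card R = card (insert j S) + length L then F j R else 0)"
  by (rule sum.swap)
 also have "\<dots> = (\<Sum>R\<in>Pow J. if S <= R & card R = card S + length (i # L)
  then E R * (\<Prod>t\<in>R - S. sg t R) * Determinant.det (msub T (i # L) (R - S)) else 0)"
 proof (intro sum.cong refl)
  fix R assume "R:Pow J"
  then have RJ: "R <= J" and finR: "finite R" using finite_subset[OF _ J] by auto
  show "(\<Sum>j\<in>J - S. if insert j S <= R & card R = card (insert j S) + length L then F j R else 0) =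
   (if S <= R & card R = card S + length (i # L)
    then E R * (\<Prod>t\<in>R - S. sg t R) * Determinant.det (msub T (i # L) (R - S)) else 0)"
  proof (cases "S <= R & card R = card S + length (i # L)")
   case False
   have "(if insert j S <= R & card R = card (insert j S) + length L then F j R else 0) = 0" if "j:J - S" for j
    using that False finS by auto
   then show ?thesis using False by (simp only: sum.neutral_const if_False cong: sum.cong)
  next
   case True
   define Q where "Q = R - S"
   have Q: "finite Q" "card Q = Suc (length L)"
    using True finR finS by (auto simp: Q_def card_Diff_subset)
   have "(\<Sum>j\<in>J - S. if insert j S <= R & card R = card (insert j S) + length L then F j R else 0) =
     (\<Sum>j\<in>J - S. if j:R then F j R else 0)"
    by (intro sum.cong refl) (use True finS in auto)
   also have "\<dots> = (\<Sum>j\<in>{j:J - S. j:R}. F j R)" by (rule sum.inter_filter[symmetric]) (use J in simp)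
   also have "{j:J - S. j:R} = Q" using RJ by (auto simp: Q_def)
   also have "(\<Sum>j\<in>Q. F j R) = (\<Sum>j\<in>Q. E R * (\<Prod>t\<in>Q. sg t R) * (T j i * ((-1) ^ card {a:Q. a < j} * Determinant.det (msub T L (Q - {j})))))"
   proof (intro sum.cong refl)
    fix j assume j: "j:Q"
    have RQ: "R - insert j S = Q - {j}" by (auto simp: Q_def)
    have pr: "(\<Prod>t\<in>Q. sg t R) = sg j R * (\<Prod>t\<in>Q - {j}. sg t R)" using prod.remove[OF Q(1) j] .
    have sq: "(- 1) ^ k * (- 1) ^ k = (1::complex)" for k :: nat by (simp flip: power_mult_distrib)
    \<comment> \<open>The sign of j relative to R is its sign relative to S times the alternating
      sign of Laplace expansion inside R - S.\<close>
    have s1: "sg j R * (-1) ^ card {a:Q. a < j} = sg j S"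
     using sg_split[of S R j] True sq[of "card {a:Q. a < j}"] by (simp add: Q_def[symmetric] mult.assoc)
    have "E R * (\<Prod>t\<in>Q. sg t R) * (T j i * ((-1) ^ card {a:Q. a < j} * Determinant.det (msub T L (Q - {j})))) =
     (sg j R * (-1) ^ card {a:Q. a < j}) * T j i * (E R * (\<Prod>t\<in>Q - {j}. sg t R) * Determinant.det (msub T L (Q - {j})))"
     unfolding pr by (simp add: mult_ac)
    then show "F j R = E R * (\<Prod>t\<in>Q. sg t R) * (T j i * ((-1) ^ card {a:Q. a < j} * Determinant.det (msub T L (Q - {j}))))"
     unfolding s1 F_def RQ by (rule sym)
   qed
   also have "\<dots> = E R * (\<Prod>t\<in>Q. sg t R) * Determinant.det (msub T (i # L) Q)"
    unfolding det_msub_expand[OF Q] sum_distrib_left ..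
   finally show ?thesis using True by (simp add: Q_def)
  qed
 qed
 finally show ?case .
qed

lemma submatrix_rows:
 assumes A: "A:carrier_mat p n" and R: "R <= {..<p}" "card R = n"
 shows "submatrix A R UNIV = mat n n (%(a, b). A $$ (pick R a, b))"
proof -
 have "{i. i < p & i:R} = R" using R by auto
 moreover have "{j. j < n} = {..<n}" by auto
 ultimately show ?thesis using A R by (auto simp: submatrix_def pick_UNIV)
qed

lemma hg_det:
 assumes "!!z. B z:carrier_mat k k" "!!i j. i < k ==> j < k ==> hg m a (%z. B z $$ (i, j))"
 shows "hg m a (%z. Determinant.det (B z))"
 unfolding det_def'[OF assms(1)]
proof (intro hg_sum hg_mult hg_const hg_prod)
 fix p i assume "p:{p. p permutes {0..<k}}" "i:{0..<k}"
 then have "p i < k" "i < k" using permutes_in_image[of p "{0..<k}" i] by auto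
 then show "hg m a (%z. B z $$ (i, p i))" by (intro assms)
qed

lemma hg_adj_mat:
 assumes "!!z. B z:carrier_mat k k" "!!i j. i < k ==> j < k ==> hg m a (%z. B z $$ (i, j))" "i < k" "j < k"
 shows "hg m a (%z. adj_mat (B z) $$ (i, j))"
proof -
 have d: "dim_row (B z) = k" "dim_col (B z) = k" for z using assms(1)[of z] by auto
 have "hg m a (%z. Determinant.det (mat_delete (B z) j i))"
 proof (rule hg_det)
  show "mat_delete (B z) j i:carrier_mat (k - 1) (k - 1)" for z using mat_delete_carrier[OF assms(1)] .
  show "hg m a (%z. mat_delete (B z) j i $$ (i', j'))" if "i' < k - 1" "j' < k - 1" for i' j'
   using that by (auto simp: mat_delete_def d intro!: assms(2))
 qed
 then show ?thesis using assms(3,4) by (simp add: adj_mat_def d cofactor_def hg_mult hg_const)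
qed

lemma cramer:
 assumes A: "(A :: complex mat):carrier_mat k k" and i: "i < k"
 shows "Determinant.det A * v i = (\<Sum>l<k. adj_mat A $$ (i, l) * (\<Sum>q<k. A $$ (l, q) * v q))"
proof -
 have e: "(\<Sum>l<k. adj_mat A $$ (i, l) * A $$ (l, q)) = (if i = q then Determinant.det A else 0)" if q: "q < k" for q
 proof -
  have "(adj_mat A * A) $$ (i, q) = (\<Sum>l<k. adj_mat A $$ (i, l) * A $$ (l, q))"
   using A adj_mat(1)[OF A] i q by (simp add: scalar_prod_def lessThan_atLeast0)
  then show ?thesis unfolding adj_mat(3)[OF A] using i q by (cases "i = q") auto
 qed
 have "(\<Sum>l<k. adj_mat A $$ (i, l) * (\<Sum>q<k. A $$ (l, q) * v q)) = (\<Sum>q<k. (\<Sum>l<k. adj_mat A $$ (i, l) * A $$ (l, q)) * v q)"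
  unfolding sum_distrib_left sum_distrib_right by (subst sum.swap) (simp add: mult.assoc)
 also have "\<dots> = (\<Sum>q<k. if i = q then Determinant.det A * v q else 0)"
  by (intro sum.cong refl) (simp add: e)
 finally show ?thesis using i by simp
qed

section \<open>Finitely generated ideals of germs\<close>

definition gi :: "nat => cseq => nat => (nat => cseq => complex) => (cseq => complex) set" where
 "gi m a p F = {h. EX c. (ALL j<p. hg m a (c j)) & eventually (%z. h z = (\<Sum>j<p. c j z * F j z)) (nb m a)}"

lemma giI: "(!!j. j < p ==> hg m a (c j)) ==> eventually (%z. h z = (\<Sum>j<p. c j z * F j z)) (nb m a) ==> h:gi m a p F"
 unfolding gi_def by auto

lemma giE:
 assumes "h:gi m a p F"
 obtains c where "ALL j<p. hg m a (c j)" "eventually (%z. h z = (\<Sum>j<p. c j z * F j z)) (nb m a)"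
 using assms unfolding gi_def by blast

lemma gi_cong:
 assumes "h:gi m a p F" "eventually (%z. h z = k z) (nb m a)"
 shows "k:gi m a p F"
proof -
 obtain c where c: "ALL j<p. hg m a (c j)" "eventually (%z. h z = (\<Sum>j<p. c j z * F j z)) (nb m a)"
  using giE[OF assms(1)] by blast
 show ?thesis by (rule giI[of p m a c]) (use c(1) in simp, use c(2) assms(2) in eventually_elim, simp)
qed

lemma gi_zero: "(%_. 0):gi m a p F"
 by (rule giI[of p m a "%_ _. 0"]) (simp_all add: hg_const)

lemma gi_gen:
 assumes "j < p"
 shows "F j:gi m a p F"
proof (rule giI[of p m a "%k _. if k = j then 1 else 0"])
 have "(\<Sum>k<p. (if k = j then 1 else 0) * F k z) = F j z" for z
  using assms by (simp add: if_distrib[of "%x. x * _"] cong: if_cong)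
 then show "eventually (%z. F j z = (\<Sum>k<p. (if k = j then 1 else 0) * F k z)) (nb m a)" by simp
qed (rule hg_const)

lemma gi_add:
 assumes "h:gi m a p F" "k:gi m a p F"
 shows "(%z. h z + k z):gi m a p F"
proof -
 obtain c where c: "ALL j<p. hg m a (c j)" "eventually (%z. h z = (\<Sum>j<p. c j z * F j z)) (nb m a)"
  using giE[OF assms(1)] by blast
 obtain d where d: "ALL j<p. hg m a (d j)" "eventually (%z. k z = (\<Sum>j<p. d j z * F j z)) (nb m a)"
  using giE[OF assms(2)] by blast
 show ?thesis
  by (rule giI[of p m a "%j z. c j z + d j z"]) (use c(1) d(1) in \<open>simp add: hg_add\<close>,
   use c(2) d(2) in eventually_elim, simp add: sum.distrib distrib_right)
qed

lemma gi_mult: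
 assumes "h:gi m a p F" "hg m a q"
 shows "(%z. q z * h z):gi m a p F"
proof -
 obtain c where c: "ALL j<p. hg m a (c j)" "eventually (%z. h z = (\<Sum>j<p. c j z * F j z)) (nb m a)"
  using giE[OF assms(1)] by blast
 show ?thesis
  by (rule giI[of p m a "%j z. q z * c j z"]) (use c(1) assms(2) in \<open>simp add: hg_mult\<close>,
   use c(2) in eventually_elim, simp add: sum_distrib_left mult.assoc)
qed

lemma gi_sum: "(!!k. k:K ==> f k:gi m a p F) ==> (%z. \<Sum>k\<in>K. f k z):gi m a p F"
 by (induction K rule: infinite_finite_induct) (auto intro: gi_zero gi_add)

section \<open>The ideal of minors on coordinate space\<close>

abbreviation cc2 :: "nat => ((nat => complex) \<times> cseq) charted" where
 "cc2 n \<equiv> cspace n \<times>\<^sub>M\<^sub>f cspace n"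

lemma cm_cc2: "cm (cc2 n)"
 by (rule cm_prod[OF cm_cspace cm_cspace])

lemma cc2_inv: "eventually (%z. inv_into (cvec n) id (fstv n z) = fstv n z & inv_into (cvec n) id (sndv n z) = sndv n z) (nb (n + n) c)"
 using eventually_nb_cvec by eventually_elim (simp add: inv_into_cvec_id sndv_cvec)

lemma hol_cc2:
 assumes "a:cvec n" "b:cvec n"
 shows "hol_at (cc2 n) h (a, b) \<longleftrightarrow> hg (n + n) (cconcat n a b) (%z. h (fstv n z, sndv n z))"
proof -
 have "hol_at (cc2 n) h (a, b) \<longleftrightarrow> hg (n + n) (cconcat n a b) (%z. h (inv_into (cvec n) id (fstv n z), inv_into (cvec n) id (sndv n z)))"
  using gchart_prod_hol_at[OF cm_cspace cm_cspace gchart_cspace gchart_cspace assms, of h] by simp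
 also have "\<dots> \<longleftrightarrow> hg (n + n) (cconcat n a b) (%z. h (fstv n z, sndv n z))"
  by (rule iffI; erule hg_cong[rotated]; use cc2_inv in eventually_elim, simp)
 finally show ?thesis .
qed

lemma eventually_cc2:
 assumes "a:cvec n" "b:cvec n"
 shows "eventually P (nhd (cc2 n) (a, b)) \<longleftrightarrow> eventually (%z. P (fstv n z, sndv n z)) (nb (n + n) (cconcat n a b))"
proof -
 have "eventually P (nhd (cc2 n) (a, b)) \<longleftrightarrow>
  eventually (%z. P (inv_into (cvec n) id (fstv n z), inv_into (cvec n) id (sndv n z))) (nb (n + n) (cconcat n a b))"
  using gchart_prod_eventually[OF gchart_cspace gchart_cspace assms, of P] by simp
 also have "\<dots> \<longleftrightarrow> eventually (%z. P (fstv n z, sndv n z)) (nb (n + n) (cconcat n a b))"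
  by (rule eventually_cong[OF cc2_inv]) simp
 finally show ?thesis .
qed

lemma zc_cvec [simp]: "zc:cvec n"
 by (simp add: cvec_def)

lemma difference_matrixD:
 assumes "difference_matrix n p g D al"
 shows "opn (cc2 n) D" "(zc, zc):D" "z:D ==> al z:carrier_mat p n"
  "z:D ==> j < p ==> i < n ==> hol_at (cc2 n) (%z. al z $$ (j, i)) z"
  "(x, x'):D ==> j < p ==> g x j - g x' j = (\<Sum>i<n. al (x, x') $$ (j, i) * (x i - x' i))"
proof -
 show o: "opn (cc2 n) D" and z0: "(zc, zc):D" and c: "!!z. z:D ==> al z:carrier_mat p n"
  using assms unfolding difference_matrix_def by auto
 show "z:D ==> j < p ==> i < n ==> hol_at (cc2 n) (%z. al z $$ (j, i)) z"
  using assms unfolding difference_matrix_def holo_fun_iff[OF cm_cc2 o] by auto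
 assume xx: "(x, x'):D" and j: "j < p"
 have "Matrix.vec p (%j. g x j - g x' j) = al (x, x') *\<^sub>v Matrix.vec n (%i. x i - x' i)"
  using assms xx unfolding difference_matrix_def by auto
 then have "Matrix.vec p (%j. g x j - g x' j) $ j = (al (x, x') *\<^sub>v Matrix.vec n (%i. x i - x' i)) $ j" by simp
 then show "g x j - g x' j = (\<Sum>i<n. al (x, x') $$ (j, i) * (x i - x' i))"
  using c[OF xx] j by (simp add: scalar_prod_def lessThan_atLeast0)
qed

lemma minor_hol_at:
 assumes "difference_matrix n p g D al" "R <= {..<p}" "card R = n" "w:D"
 shows "hol_at (cc2 n) (%z. Determinant.det (submatrix (al z) R UNIV)) w"
proof -
 note dm = difference_matrixD[OF assms(1)]
 obtain a b where w: "w = (a, b)" by (cases w)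
 have "w:pts (cc2 n)" using openin_subset[OF dm(1)] assms(4) by blast
 then have ab: "a:cvec n" "b:cvec n" by (simp_all add: w)
 have pk: "pick R k < p" if "k < n" for k using pick_in_set_le[of k R] that assms(2,3) by auto
 have "hg (n + n) (cconcat n a b) (%z. Determinant.det (mat n n (%(k, l). al (fstv n z, sndv n z) $$ (pick R k, l))))"
 proof (rule hg_det)
  fix k l assume "k < n" "l < n"
  then show "hg (n + n) (cconcat n a b) (%z. mat n n (%(k, l). al (fstv n z, sndv n z) $$ (pick R k, l)) $$ (k, l))"
   using dm(4)[OF assms(4) pk[OF \<open>k < n\<close>] \<open>l < n\<close>] unfolding w hol_cc2[OF ab] by simp
 qed simp
 then have "hol_at (cc2 n) (%z. Determinant.det (mat n n (%(k, l). al z $$ (pick R k, l)))) w"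
  unfolding w hol_cc2[OF ab] .
 then show ?thesis
  by (rule hol_at_cong[OF cm_cc2])
   (use eventually_nhdsin_openin[OF dm(1) assms(4)] in \<open>eventually_elim, simp add: submatrix_rows[OF dm(3) assms(2,3)]\<close>)
qed

lemma coord_hol_at_cc2:
 assumes "w:pts (cc2 n)" "i < n"
 shows "hol_at (cc2 n) (%z. fst z i - snd z i) w"
proof -
 obtain a b where w: "w = (a, b)" by (cases w)
 have ab: "a:cvec n" "b:cvec n" using assms by (simp_all add: w)
 show ?thesis unfolding w hol_cc2[OF ab] by (intro hg_diff) (use assms in \<open>simp_all add: hg_fstv hg_sndv\<close>)
qed

abbreviation I2_gens where
 "I2_gens n p g D al \<equiv> {(\<lambda>(x, x')\<in>D. g x j - g x' j) | j. j < p} \<union>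
  {(\<lambda>z\<in>D. Determinant.det (submatrix (al z) R UNIV)) | R. R <= {..<p} & card R = n}"

lemma I2_gens_carrier:
 assumes d: "difference_matrix n p g D al"
 shows "I2_gens n p g D al <= hfn (cc2 n) D"
proof -
 note dm = difference_matrixD[OF d]
 have "restrict (%(x, x'). g x j - g x' j) D:hfn (cc2 n) D" if j: "j < p" for j
 proof (rule restrict_carrier[OF cm_cc2 dm(1)])
  fix w assume w: "w:D"
  then have wt: "w:pts (cc2 n)" using openin_subset[OF dm(1)] by blast
  have "hol_at (cc2 n) (%z. \<Sum>i<n. al z $$ (j, i) * (fst z i - snd z i)) w"
   by (intro hol_at_sum hol_at_mult cm_cc2 wt dm(4)[OF w j] coord_hol_at_cc2) auto
  then show "hol_at (cc2 n) (%(x, x'). g x j - g x' j) w"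
   by (rule hol_at_cong[OF cm_cc2])
    (use eventually_nhdsin_openin[OF dm(1) w] in \<open>eventually_elim, use dm(5)[OF _ j] in auto\<close>)
 qed
 moreover have "restrict (%z. Determinant.det (submatrix (al z) R UNIV)) D:hfn (cc2 n) D"
  if "R <= {..<p}" "card R = n" for R
  by (rule restrict_carrier[OF cm_cc2 dm(1)]) (rule minor_hol_at[OF d that])
 ultimately show ?thesis by auto
qed

text \<open>For the minors this is Cramer's rule.\<close>

lemma I2_germ_imp:
 assumes h: "h:I2_germ n p g" and i: "i < n"
 shows "(%z. h (fstv n z, sndv n z) * (z i - z (n + i))) \<in>
  gi (n + n) zc p (%j z. g (fstv n z) j - g (sndv n z) j)"
proof -
 obtain D al where d: "difference_matrix n p g D al"
  and hI: "restrict h D:hid (cc2 n) D (I2_gens n p g D al)"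
  using h unfolding I2_germ_def by blast
 note dm = difference_matrixD[OF d]
 let ?F = "%j z. g (fstv n z) j - g (sndv n z) j"
 let ?G = "gi (n + n) zc p ?F"
 have inD: "eventually (%z. (fstv n z, sndv n z):D) (nb (n + n) zc)"
  using eventually_nhdsin_openin[OF dm(1,2)] unfolding eventually_cc2[OF zc_cvec zc_cvec] by simp
 have df: "eventually (%z. z i - z (n + i) = fstv n z i - sndv n z i) (nb (n + n) zc)"
  using i by (simp add: fstv_def sndv_def)
 have hi: "hg (n + n) zc (%z. z i - z (n + i))" using i by (intro hg_diff hg_coord) auto
 have alh: "hg (n + n) zc (%z. al (fstv n z, sndv n z) $$ (j, l))" if "j < p" "l < n" for j l
  using dm(4)[OF dm(2) that] unfolding hol_cc2[OF zc_cvec zc_cvec] by simp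
 have "(%z. restrict h D (fstv n z, sndv n z) * (z i - z (n + i))):?G"
 proof (rule Idl_induct[OF cm_cc2 dm(1) I2_gens_carrier[OF d] hI,
   where P = "%k. (%z. k (fstv n z, sndv n z) * (z i - z (n + i))):?G"])
  fix k assume "k:I2_gens n p g D al"
  then consider j where "j < p" "k = (\<lambda>(x, x')\<in>D. g x j - g x' j)"
   | R where "R <= {..<p}" "card R = n" "k = (\<lambda>z\<in>D. Determinant.det (submatrix (al z) R UNIV))" by auto
  then show "(%z. k (fstv n z, sndv n z) * (z i - z (n + i))):?G"
  proof cases
   case 1
   have "(%z. (z i - z (n + i)) * ?F j z):?G" by (rule gi_mult[OF gi_gen[OF 1(1)] hi])
   then show ?thesis by (rule gi_cong) (use inD in \<open>eventually_elim, simp add: 1(2)\<close>)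
  next
   case 2
   have pk: "pick R l < p" if "l < n" for l using pick_in_set_le[of l R] that 2 by auto
   define B where "B z = mat n n (%(k, l). al (fstv n z, sndv n z) $$ (pick R k, l))" for z
   have Bc: "B z:carrier_mat n n" for z by (simp add: B_def)
   have "hg (n + n) zc (%z. adj_mat (B z) $$ (i, l))" if "l < n" for l
    by (rule hg_adj_mat[OF Bc _ i that]) (simp add: B_def alh pk)
   then have "(%z. \<Sum>l<n. adj_mat (B z) $$ (i, l) * ?F (pick R l) z):?G"
    by (intro gi_sum gi_mult gi_gen pk) auto
   then show ?thesis
   proof (rule gi_cong)
    show "eventually (%z. (\<Sum>l<n. adj_mat (B z) $$ (i, l) * ?F (pick R l) z) =
      k (fstv n z, sndv n z) * (z i - z (n + i))) (nb (n + n) zc)"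
     using inD df
    proof eventually_elim
     case (elim z)
     have "?F (pick R l) z = (\<Sum>q<n. B z $$ (l, q) * (fstv n z q - sndv n z q))" if "l < n" for l
      using dm(5)[OF elim(1) pk[OF that]] that by (simp add: B_def)
     then have "(\<Sum>l<n. adj_mat (B z) $$ (i, l) * ?F (pick R l) z) = Determinant.det (B z) * (fstv n z i - sndv n z i)"
      using cramer[OF Bc i, of z "%q. fstv n z q - sndv n z q"] by simp
     then show ?case using elim by (simp add: 2(3) B_def submatrix_rows[OF dm(3)[OF elim(1)] 2(1,2)])
    qed
   qed
  qed
 next
  show "(%z. (\<lambda>z\<in>D. 0) (fstv n z, sndv n z) * (z i - z (n + i))):?G"
   by (rule gi_cong[OF gi_zero]) (use inD in \<open>eventually_elim, simp\<close>)
 next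
  fix k k' assume "(%z. k (fstv n z, sndv n z) * (z i - z (n + i))):?G"
   "(%z. k' (fstv n z, sndv n z) * (z i - z (n + i))):?G"
  from gi_add[OF this] show "(%z. (\<lambda>z\<in>D. k z + k' z) (fstv n z, sndv n z) * (z i - z (n + i))):?G"
   by (rule gi_cong) (use inD in \<open>eventually_elim, simp add: distrib_right\<close>)
 next
  fix c k assume c: "c:hfn (cc2 n) D" and k: "(%z. k (fstv n z, sndv n z) * (z i - z (n + i))):?G"
  have "hg (n + n) zc (%z. c (fstv n z, sndv n z))"
   using carrier_hol_at[OF cm_cc2 dm(1) c dm(2)] unfolding hol_cc2[OF zc_cvec zc_cvec] by simp
  from gi_mult[OF k this] show "(%z. (\<lambda>z\<in>D. c z * k z) (fstv n z, sndv n z) * (z i - z (n + i))):?G"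
   by (rule gi_cong) (use inD in \<open>eventually_elim, simp add: mult.assoc\<close>)
 qed
 then show ?thesis by (rule gi_cong) (use inD in \<open>eventually_elim, simp\<close>)
qed

text \<open>The coefficient germs must be realised on one common neighbourhood D, on which the germs
  al form a difference matrix. Only finitely many are involved, as E enters through subsets of the p
  rows; \<open>dv_det\<close> then displays the contraction as a combination of the minors.\<close>

lemma I2_germI:
 assumes al: "!!j i. j < p ==> i < n ==> hg (n + n) zc (al j i)"
  and alg: "eventually (%z. ALL j<p. g (fstv n z) j - g (sndv n z) j = (\<Sum>i<n. al j i z * (z i - z (n + i)))) (nb (n + n) zc)"
  and c: "!!j. j < p ==> hg (n + n) zc (c j)" and E: "!!S. hg (n + n) zc (%z. E z S)"
  and h: "eventually (%z. h (fstv n z, sndv n z) = (\<Sum>j<p. c j z * (g (fstv n z) j - g (sndv n z) j)) +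
   dv {..<p} (%j i. al j i z) [0..<n] (E z) {}) (nb (n + n) zc)"
 shows "h:I2_germ n p g"
proof -
 define cc where "cc w = cconcat n (fst w) (snd w)" for w :: "(nat => complex) \<times> cseq"
 have ccz: "cc (fstv n z, sndv n z) = z" for z by (simp add: cc_def)
 let ?N = "nhd (cc2 n) (zc, zc)"
 have lift: "hol_at (cc2 n) (%w. q (cc w)) (zc, zc)" if "hg (n + n) zc q" for q
  unfolding hol_cc2[OF zc_cvec zc_cvec] ccz using that by simp
 have e1: "eventually (%w. ALL j:{..<p}. ALL i:{..<n}. hol_at (cc2 n) (%w. al j i (cc w)) w) ?N"
  by (intro eventually_ball_finite ballI hol_at_eventually[OF cm_cc2] lift al) auto
 have e2: "eventually (%w. ALL j:{..<p}. hol_at (cc2 n) (%w. c j (cc w)) w) ?N"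
  by (intro eventually_ball_finite ballI hol_at_eventually[OF cm_cc2] lift c) auto
 have e3: "eventually (%w. ALL R:Pow {..<p}. hol_at (cc2 n) (%w. E (cc w) R) w) ?N"
  by (intro eventually_ball_finite ballI hol_at_eventually[OF cm_cc2] lift E) auto
 have e4: "eventually (%w. ALL j<p. g (fst w) j - g (snd w) j = (\<Sum>i<n. al j i (cc w) * (fst w i - snd w i))) ?N"
  unfolding eventually_cc2[OF zc_cvec zc_cvec] ccz zc_simps
  using alg by eventually_elim (simp add: fstv_def sndv_def)
 have e5: "eventually (%w. h w = (\<Sum>j<p. c j (cc w) * (g (fst w) j - g (snd w) j)) +
   dv {..<p} (%j i. al j i (cc w)) [0..<n] (E (cc w)) {}) ?N"
  unfolding eventually_cc2[OF zc_cvec zc_cvec] ccz zc_simps using h by simp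
 have "eventually (%w. (ALL j:{..<p}. ALL i:{..<n}. hol_at (cc2 n) (%w. al j i (cc w)) w) &
   (ALL j:{..<p}. hol_at (cc2 n) (%w. c j (cc w)) w) & (ALL R:Pow {..<p}. hol_at (cc2 n) (%w. E (cc w) R) w) &
   (ALL j<p. g (fst w) j - g (snd w) j = (\<Sum>i<n. al j i (cc w) * (fst w i - snd w i))) &
   h w = (\<Sum>j<p. c j (cc w) * (g (fst w) j - g (snd w) j)) + dv {..<p} (%j i. al j i (cc w)) [0..<n] (E (cc w)) {}) ?N"
  (is "eventually ?P ?N")
  using e1 e2 e3 e4 e5 by eventually_elim simp
 moreover have "(zc, zc):pts (cc2 n)" by simp
 ultimately obtain D where D: "opn (cc2 n) D" "(zc, zc):D" and P: "ALL w:D. ?P w"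
  unfolding eventually_nhdsin by blast
 define A where "A w = mat p n (%(j, i). al j i (cc w))" for w
 have Ac: "A w:carrier_mat p n" for w by (simp add: A_def)
 have d: "difference_matrix n p g D A" unfolding difference_matrix_def
 proof (intro conjI ballI allI impI)
  show "opn (cc2 n) D" "(zc, zc):D" by (rule D)+
  show "A z:carrier_mat p n" for z by (rule Ac)
  show "holo_fun (cc2 n) D (%z. A z $$ (j, i))" if "j < p" "i < n" for j i
   unfolding holo_fun_iff[OF cm_cc2 D(1)] using P that by (simp add: A_def)
  show "case z of (x, x') => Matrix.vec p (%j. g x j - g x' j) = A (x, x') *\<^sub>v Matrix.vec n (%i. x i - x' i)" if "z:D" for z
  proof (cases z)
   case (Pair x x')
   have e: "ALL j<p. g x j - g x' j = (\<Sum>i<n. al j i (cc z) * (x i - x' i))" using P that Pair by auto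
   show ?thesis unfolding Pair prod.case
    by (rule eq_vecI) (use e in \<open>simp_all add: A_def scalar_prod_def lessThan_atLeast0 Pair\<close>)
  qed
 qed
 note S = I2_gens_carrier[OF d]
 have 1: "(\<lambda>w\<in>D. \<Sum>j<p. c j (cc w) * (%(x, x'). g x j - g x' j) w):hid (cc2 n) D (I2_gens n p g D A)"
  by (rule Idl_sum[OF cm_cc2 D(1) S]) (use P in auto)
 define K where "K = {R. R <= {..<p} & card R = n}"
 have topE: "hol_at (cc2 n) (%w. E (cc w) R * (\<Prod>t\<in>R. sg t R)) w" if "R:K" "w:D" for R w
  by (intro hol_at_mult[OF cm_cc2] hol_at_const[OF cm_cc2])
   (use P that openin_subset[OF D(1)] in \<open>auto simp: K_def\<close>)
 have 2: "(\<lambda>w\<in>D. \<Sum>R\<in>K. (E (cc w) R * (\<Prod>t\<in>R. sg t R)) * Determinant.det (submatrix (A w) R UNIV))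
  :hid (cc2 n) D (I2_gens n p g D A)"
  by (rule Idl_sum[OF cm_cc2 D(1) S topE]) (auto simp: K_def)
 have "restrict h D = (\<lambda>w\<in>D. (\<lambda>w\<in>D. \<Sum>j<p. c j (cc w) * (%(x, x'). g x j - g x' j) w) w +
   (\<lambda>w\<in>D. \<Sum>R\<in>K. (E (cc w) R * (\<Prod>t\<in>R. sg t R)) * Determinant.det (submatrix (A w) R UNIV)) w)"
 proof (rule restrict_ext)
  fix w assume w: "w:D"
  have "dv {..<p} (%j i. al j i (cc w)) [0..<n] (E (cc w)) {} =
    (\<Sum>R\<in>Pow {..<p}. if card R = n then E (cc w) R * (\<Prod>t\<in>R. sg t R) * Determinant.det (msub (%j i. al j i (cc w)) [0..<n] R) else 0)"
   by (simp add: dv_det cong: if_cong)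
  also have "\<dots> = (\<Sum>R\<in>K. E (cc w) R * (\<Prod>t\<in>R. sg t R) * Determinant.det (msub (%j i. al j i (cc w)) [0..<n] R))"
   by (simp add: K_def sum.inter_filter[symmetric] Pow_def)
  also have "\<dots> = (\<Sum>R\<in>K. (E (cc w) R * (\<Prod>t\<in>R. sg t R)) * Determinant.det (submatrix (A w) R UNIV))"
  proof (intro sum.cong refl)
   fix R assume "R:K"
   then have R: "R <= {..<p}" "card R = n" by (auto simp: K_def)
   have pk: "pick R k < p" if "k < n" for k using pick_in_set_le[of k R] that R by auto
   have "msub (%j i. al j i (cc w)) [0..<n] R = submatrix (A w) R UNIV"
    unfolding submatrix_rows[OF Ac R] by (rule eq_matI) (auto simp: msub_def A_def pk)
   then show "E (cc w) R * (\<Prod>t\<in>R. sg t R) * Determinant.det (msub (%j i. al j i (cc w)) [0..<n] R) =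
    (E (cc w) R * (\<Prod>t\<in>R. sg t R)) * Determinant.det (submatrix (A w) R UNIV)" by simp
  qed
  finally show "h w = (\<lambda>w\<in>D. \<Sum>j<p. c j (cc w) * (%(x, x'). g x j - g x' j) w) w +
   (\<lambda>w\<in>D. \<Sum>R\<in>K. (E (cc w) R * (\<Prod>t\<in>R. sg t R)) * Determinant.det (submatrix (A w) R UNIV)) w"
   using bspec[OF P w] w by (simp add: case_prod_unfold)
 qed
 then have "restrict h D:hid (cc2 n) D (I2_gens n p g D A)"
  using Idl_ideal(3)[OF cm_cc2 D(1) S 1 2] by (simp only:)
 then show ?thesis using d unfolding I2_germ_def by blast
qed

section \<open>The double ideal in local coordinates\<close>

definition dgens :: "'a charted => 'b charted => ('a => 'b) => ('a \<times> 'a) set => ('a \<times> 'a => complex) set" where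
 "dgens X Y f V = {restrict (g \<circ> map_prod f f) V | g Q. opn (sq Y) Q & map_prod f f ` V <= Q & g:diagonal_ideal Y Q}"

lemma double_ideal_iff:
 "h:double_ideal X Y f W \<longleftrightarrow> h:hfn (sq X) W &
  (ALL z:W. EX V. opn (sq X) V & z:V & V <= W & restrict h V:hid (sq X) V (dgens X Y f V))"
 by (simp add: double_ideal_def pullback_ideal_def generated_sheaf_def dgens_def)

locale hol_map =
 fixes X :: "'a charted" and Y :: "'b charted" and f :: "'a => 'b"
 assumes X: "cm X" and Y: "cm Y" and f: "!!z. z:pts X ==> map_at X Y f z"
begin

lemma XX: "cm (sq X)" and YY: "cm (sq Y)"
 by (rule cm_prod[OF X X], rule cm_prod[OF Y Y])

lemma map_at_map_prod:
 assumes "w:pts (sq X)"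
 shows "map_at (sq X) (sq Y) (map_prod f f) w"
proof -
 obtain a b where w: "w = (a, b)" by (cases w)
 have ab: "a:pts X" "b:pts X" using assms by (simp_all add: w)
 have 1: "map_at (sq X) Y (%z. f (fst z)) (a, b)"
  by (rule map_at_comp[OF map_at_fst[OF X X ab]]) (use f[OF ab(1)] in simp)
 have 2: "map_at (sq X) Y (%z. f (snd z)) (a, b)"
  by (rule map_at_comp[OF map_at_snd[OF X X ab]]) (use f[OF ab(2)] in simp)
 have "map_prod f f = (%z. (f (fst z), f (snd z)))" by (simp add: fun_eq_iff)
 then show ?thesis using map_at_pair[OF XX Y Y 1 2] by (simp add: w)
qed

lemma dgens_carrier:
 assumes V: "opn (sq X) V"
 shows "dgens X Y f V <= hfn (sq X) V"
proof
 fix k assume "k:dgens X Y f V"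
 then obtain g Q where k: "k = restrict (g \<circ> map_prod f f) V" and Q: "opn (sq Y) Q" "map_prod f f ` V <= Q"
  and g: "g:hfn (sq Y) Q" unfolding dgens_def diagonal_ideal_def by blast
 show "k:hfn (sq X) V" unfolding k
 proof (rule restrict_carrier[OF XX V])
  fix w assume w: "w:V"
  then have wt: "w:pts (sq X)" using openin_subset[OF V] by blast
  have "map_prod f f w:Q" using Q(2) w by blast
  from map_atD(4)[OF map_at_map_prod[OF wt] carrier_hol_at[OF YY Q(1) g this]]
  show "hol_at (sq X) (g \<circ> map_prod f f) w" by (simp add: o_def)
 qed
qed

text \<open>A pulled-back generator stays one on a smaller set, with the same open set Q of the
  target; the ideal operations commute with restriction.\<close>

lemma restrict_Idl:
 assumes V1: "opn (sq X) V1" and V2: "opn (sq X) V2" "V2 <= V1"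
  and h: "h:hid (sq X) V1 (dgens X Y f V1)"
 shows "restrict h V2:hid (sq X) V2 (dgens X Y f V2)"
proof (rule Idl_induct[OF XX V1 dgens_carrier[OF V1] h, where P = "%k. restrict k V2:hid (sq X) V2 (dgens X Y f V2)"])
 note I = Idl_ideal[OF XX V2(1) dgens_carrier[OF V2(1)]]
 have rr: "restrict (restrict k V1) V2 = restrict k V2" for k :: "'a \<times> 'a => complex"
  using V2(2) by (auto simp: fun_eq_iff restrict_def)
 fix k assume "k:dgens X Y f V1"
 then obtain g Q where k: "k = restrict (g \<circ> map_prod f f) V1" and Q: "opn (sq Y) Q" "map_prod f f ` V1 <= Q"
  and g: "g:diagonal_ideal Y Q" unfolding dgens_def by blast
 have "map_prod f f ` V2 <= Q" using Q(2) V2(2) by blast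
 then have "restrict (g \<circ> map_prod f f) V2:dgens X Y f V2" using Q(1) g unfolding dgens_def by blast
 then show "restrict k V2:hid (sq X) V2 (dgens X Y f V2)" unfolding k rr by (rule I(1))
next
 note I = Idl_ideal[OF XX V2(1) dgens_carrier[OF V2(1)]]
 have "restrict (\<lambda>z\<in>V1. 0) V2 = (\<lambda>z\<in>V2. 0::complex)" using V2(2) by (auto simp: fun_eq_iff restrict_def)
 then show "restrict (\<lambda>z\<in>V1. 0) V2:hid (sq X) V2 (dgens X Y f V2)" using I(2) by (simp only:)
next
 note I = Idl_ideal[OF XX V2(1) dgens_carrier[OF V2(1)]]
 fix k k' assume "restrict k V2:hid (sq X) V2 (dgens X Y f V2)"
  "restrict k' V2:hid (sq X) V2 (dgens X Y f V2)"
 from I(3)[OF this] show "restrict (\<lambda>z\<in>V1. k z + k' z) V2:hid (sq X) V2 (dgens X Y f V2)"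
 proof (rule back_subst[where P = "%u. u:_"])
  show "(\<lambda>z\<in>V2. restrict k V2 z + restrict k' V2 z) = restrict (\<lambda>z\<in>V1. k z + k' z) V2"
   using V2(2) by (auto simp: fun_eq_iff restrict_def)
 qed
next
 note I = Idl_ideal[OF XX V2(1) dgens_carrier[OF V2(1)]]
 fix c k assume c: "c:hfn (sq X) V1" and k: "restrict k V2:hid (sq X) V2 (dgens X Y f V2)"
 have "restrict c V2:hfn (sq X) V2"
  by (rule restrict_carrier[OF XX V2(1) carrier_hol_at[OF XX V1 c]]) (use V2(2) in blast)
 from I(4)[OF k this] show "restrict (\<lambda>z\<in>V1. c z * k z) V2:hid (sq X) V2 (dgens X Y f V2)"
 proof (rule back_subst[where P = "%u. u:_"])
  show "(\<lambda>z\<in>V2. restrict c V2 z * restrict k V2 z) = restrict (\<lambda>z\<in>V1. c z * k z) V2"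
   using V2(2) by (auto simp: fun_eq_iff restrict_def)
 qed
qed

end

locale hol_map_at = hol_map +
 fixes U :: "'a set" and phi :: "'a => nat => complex" and V :: "'b set" and psi :: "'b => nat => complex" and x :: 'a
 assumes U: "gchart X U phi" and V: "gchart Y V psi" and x: "x:U" "phi x = zc" and y: "f x:V" "psi (f x) = zc"
begin

abbreviation n where "n \<equiv> mdim X"
abbreviation p where "p \<equiv> mdim Y"

text \<open>gh is f in the centred charts. Near (x, x) the square of X is parametrized by
  \<open>P\<close> with coordinates \<open>Q\<close>, and the germs \<open>F j\<close> generate the
  stalk of the double ideal.\<close>

definition gh where "gh = psi \<circ> f \<circ> inv_into U phi"
definition P where "P z = (inv_into U phi (fstv n z), inv_into U phi (sndv n z))"
definition F where "F j z = gh (fstv n z) j - gh (sndv n z) j"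
definition Q where "Q w = cconcat n (phi (fst w)) (phi (snd w))"

lemma xt: "x:pts X"
 by (rule chartD(5)[OF gchartD(1)[OF U] x(1)])

lemma invx: "inv_into U phi zc = x"
 using gchartD(4)[OF U x(1)] by (simp add: x(2))

lemma ev_U: "eventually (%u. u:phi ` U) (nb n zc)"
 using eventually_nb_openin[OF chart_image_open[OF gchartD(1)[OF U] chartD(1)[OF gchartD(1)[OF U]] order.refl] imageI[OF x(1)]]
 by (simp add: x(2))

lemma ev_fV: "eventually (%u. f (inv_into U phi u):V) (nb n zc)"
 using map_atD(5)[OF f[OF xt] chartD(6)[OF gchartD(1)[OF V] y(1)]]
 unfolding chart_eventually_inv[OF gchartD(1)[OF U] x(1)] x(2) .

lemma gm_gh: "gm n zc p gh"
 unfolding gm_def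
proof (intro conjI allI impI)
 fix j assume j: "j < p"
 have "hol_at X (%z. psi (f z) j) x" by (rule map_atD(4)[OF f[OF xt] gchart_coord[OF V y(1) j]])
 then show "hg n zc (%u. gh u j)" unfolding gchart_hol_at[OF X U x(1)] x(2) by (simp add: gh_def)
next
 show "eventually (%u. gh u:cvec p) (nb n zc)"
  using ev_fV by eventually_elim (simp add: gh_def chartD(3)[OF gchartD(1)[OF V]])
qed simp

lemma gh0: "gh zc = zc"
 by (simp add: gh_def invx y)

lemma hol_P: "hol_at (sq X) h (x, x) \<longleftrightarrow> hg (n + n) zc (%z. h (P z))"
 using gchart_prod_hol_at[OF X X U U x(1) x(1), of h] by (simp add: x(2) P_def)

lemma ev_P: "eventually R (nhd (sq X) (x, x)) \<longleftrightarrow> eventually (%z. R (P z)) (nb (n + n) zc)"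
 using gchart_prod_eventually[OF U U x(1) x(1), of R] by (simp add: x(2) P_def)

lemma ev_fst_snd:
 assumes "eventually R (nb n zc)"
 shows "eventually (%z. R (fstv n z) & R (sndv n z)) (nb (n + n) zc)"
 using gm_ev[OF gm_fstv[OF zc_cvec] assms] gm_ev[OF gm_sndv[OF zc_cvec] assms] by (simp add: eventually_conj)

lemma QP: "eventually (%z. Q (P z) = z) (nb (n + n) zc)"
 using ev_fst_snd[OF ev_U] by eventually_elim (simp add: Q_def P_def f_inv_into_f)

text \<open>A function vanishing on the diagonal of Y is a combination of coordinate differences by
  Hadamard's lemma; pulled back by f these are the F j.\<close>

lemma Idl_imp_gi:
 assumes V': "opn (sq X) V'" "(x, x):V'"
  and h: "h:hid (sq X) V' (dgens X Y f V')"
 shows "(%z. h (P z)):gi (n + n) zc p F"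
proof -
 have inV: "eventually (%z. P z:V') (nb (n + n) zc)"
  using eventually_nhdsin_openin[OF V'] unfolding ev_P .
 show ?thesis
 proof (rule Idl_induct[OF XX V'(1) dgens_carrier[OF V'(1)] h, where P = "%k. (%z. k (P z)):gi (n + n) zc p F"])
  fix k assume "k:dgens X Y f V'"
  then obtain g Q where k: "k = restrict (g \<circ> map_prod f f) V'" and Q: "opn (sq Y) Q" "map_prod f f ` V' <= Q"
   and g: "g:hfn (sq Y) Q" and g0: "ALL z. (z, z):Q --> g (z, z) = 0"
   unfolding dgens_def diagonal_ideal_def by blast
  define gg where "gg w = g (inv_into V psi (fstv p w), inv_into V psi (sndv p w))" for w
  have yQ: "(f x, f x):Q" using Q(2) V'(2) by force
  have hgg: "hg (p + p) zc gg"
   using carrier_hol_at[OF YY Q(1) g yQ] gchart_prod_hol_at[OF Y Y V V y(1) y(1), of g] by (simp add: y(2) gg_def[abs_def])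
  have inQ: "eventually (%w. (inv_into V psi (fstv p w), inv_into V psi (sndv p w)):Q) (nb (p + p) zc)"
   using eventually_nhdsin_openin[OF Q(1) yQ] gchart_prod_eventually[OF V V y(1) y(1), of "%w. w:Q"] by (simp add: y(2))
  have "EX q. (ALL i<p. hg (p + p) zc (q i)) & eventually (%w. gg w = (\<Sum>i<p. q i w * (w i - w (p + i)))) (nb (p + p) zc)"
  proof (rule hadamard_diff[OF hgg zc_cvec])
   show "eventually (%w. (ALL i<p. w i = w (p + i)) --> gg w = 0) (nb (p + p) zc)"
    using inQ eventually_nb_cvec
   proof (eventually_elim, intro impI)
    fix w assume w: "(inv_into V psi (fstv p w), inv_into V psi (sndv p w)):Q" "w:cvec (p + p)" "ALL i<p. w i = w (p + i)"
    have "fstv p w = sndv p w"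
    proof
     fix i show "fstv p w i = sndv p w i" using w(2,3) by (cases "i < p") (auto simp: fstv_def sndv_def cvec_def)
    qed
    then show "gg w = 0" using w(1) g0 by (simp add: gg_def)
   qed
  qed (auto intro: inj_onI)
  then obtain q where q: "ALL i<p. hg (p + p) zc (q i)" "eventually (%w. gg w = (\<Sum>i<p. q i w * (w i - w (p + i)))) (nb (p + p) zc)"
   by blast
  define G where "G z = cconcat p (gh (fstv n z)) (gh (sndv n z))" for z
  have gG: "gm (n + n) zc (p + p) G" unfolding G_def
   by (rule gm_cconcat[OF gm_comp[OF gm_fstv[OF zc_cvec] gm_gh] gm_comp[OF gm_sndv[OF zc_cvec] gm_gh]]) simp_all
  have G0: "G zc = zc" by (simp add: G_def gh0)
  show "(%z. k (P z)):gi (n + n) zc p F"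
  proof (rule giI[of p _ _ "%i z. q i (G z)"])
   show "hg (n + n) zc (%z. q i (G z))" if "i < p" for i by (rule gm_hg[OF gG _ G0]) (use q(1) that in simp)
   show "eventually (%z. k (P z) = (\<Sum>i<p. q i (G z) * F i z)) (nb (n + n) zc)"
    using gm_ev[OF gG q(2) G0] inV ev_fst_snd[OF ev_fV]
   proof eventually_elim
    case (elim z)
    have c: "gh (fstv n z):cvec p" using elim(3) by (simp add: gh_def chartD(3)[OF gchartD(1)[OF V]])
    have "gg (G z) = g (map_prod f f (P z))"
     using elim(3) c gchartD(4)[OF V] by (simp add: gg_def G_def P_def gh_def)
    moreover have "(\<Sum>i<p. q i (G z) * (G z i - G z (p + i))) = (\<Sum>i<p. q i (G z) * F i z)"
     by (intro sum.cong refl) (simp add: G_def cconcat_def F_def)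
    ultimately show ?case using elim(1,2) by (simp add: k)
   qed
  qed
 next
  show "(%z. (\<lambda>z\<in>V'. 0) (P z)):gi (n + n) zc p F"
   by (rule gi_cong[OF gi_zero]) (use inV in \<open>eventually_elim, simp\<close>)
 next
  fix k k' assume "(%z. k (P z)):gi (n + n) zc p F" "(%z. k' (P z)):gi (n + n) zc p F"
  from gi_add[OF this] show "(%z. (\<lambda>z\<in>V'. k z + k' z) (P z)):gi (n + n) zc p F"
   by (rule gi_cong) (use inV in \<open>eventually_elim, simp\<close>)
 next
  fix c k assume c: "c:hfn (sq X) V'" and k: "(%z. k (P z)):gi (n + n) zc p F"
  have "hg (n + n) zc (%z. c (P z))" using carrier_hol_at[OF XX V'(1) c V'(2)] unfolding hol_P .
  from gi_mult[OF k this] show "(%z. (\<lambda>z\<in>V'. c z * k z) (P z)):gi (n + n) zc p F"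
   by (rule gi_cong) (use inV in \<open>eventually_elim, simp\<close>)
 qed
qed

text \<open>The coordinate differences on V times V are sections of the ideal of the diagonal of Y,
  and the finitely many coefficients are holomorphic on a common neighbourhood S.\<close>

lemma gi_imp_Idl:
 assumes W: "opn (sq X) W" "(x, x):W" and h: "(%z. h (P z)):gi (n + n) zc p F"
 shows "EX V'. opn (sq X) V' & (x, x):V' & V' <= W &
  restrict h V':hid (sq X) V' (dgens X Y f V')"
proof -
 obtain c where c: "ALL j<p. hg (n + n) zc (c j)" and e: "eventually (%z. h (P z) = (\<Sum>j<p. c j z * F j z)) (nb (n + n) zc)"
  using giE[OF h] by blast
 define g where "g j = (%w. psi (fst w) j - psi (snd w) j)" for j
 let ?N = "nhd (sq X) (x, x)"
 have "hol_at (sq X) (%w. c j (Q w)) (x, x)" if "j < p" for j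
  unfolding hol_P by (rule hg_cong[of "c j"]) (use QP c that in \<open>auto elim!: eventually_mono\<close>)
 then have e1: "eventually (%w. ALL j:{..<p}. hol_at (sq X) (%w. c j (Q w)) w) ?N"
  by (intro eventually_ball_finite ballI hol_at_eventually[OF XX]) auto
 have e2: "eventually (%w. h w = (\<Sum>j<p. c j (Q w) * g j (map_prod f f w))) ?N"
  unfolding ev_P using e QP
 proof eventually_elim
  case (elim z)
  have "F j z = g j (map_prod f f (P z))" for j by (simp add: F_def g_def P_def gh_def)
  then show ?case using elim by simp
 qed
 have e3: "eventually (%w. map_prod f f w:V \<times> V) ?N"
  unfolding ev_P using ev_fst_snd[OF ev_fV] by eventually_elim (simp add: P_def)
 have "eventually (%w. (ALL j:{..<p}. hol_at (sq X) (%w. c j (Q w)) w) &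
   h w = (\<Sum>j<p. c j (Q w) * g j (map_prod f f w)) & map_prod f f w:V \<times> V & w:W) ?N"
  using e1 e2 e3 eventually_nhdsin_openin[OF W] by eventually_elim simp
 moreover have "(x, x):pts (sq X)" using xt by simp
 ultimately obtain S where S: "opn (sq X) S" "(x, x):S" and
  R: "ALL w:S. (ALL j:{..<p}. hol_at (sq X) (%w. c j (Q w)) w) &
   h w = (\<Sum>j<p. c j (Q w) * g j (map_prod f f w)) & map_prod f f w:V \<times> V & w:W"
  unfolding eventually_nhdsin by blast
 have VV: "opn (sq Y) (V \<times> V)"
  using chartD(1)[OF gchartD(1)[OF V]] by (simp add: openin_prod_Times_iff)
 have gd: "restrict (g j) (V \<times> V):diagonal_ideal Y (V \<times> V)" if j: "j < p" for j
 proof -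
  have "restrict (g j) (V \<times> V):carrier (holo_ring (sq Y) (V \<times> V))"
  proof (rule restrict_carrier[OF YY VV])
   fix w assume "w:V \<times> V"
   then obtain a b where w: "w = (a, b)" "a:V" "b:V" by blast
   note t = chartD(5)[OF gchartD(1)[OF V] w(2)] chartD(5)[OF gchartD(1)[OF V] w(3)]
   show "hol_at (sq Y) (g j) w" unfolding g_def w(1)
    by (rule hol_at_diff[OF YY map_atD(4)[OF map_at_fst[OF Y Y t]] map_atD(4)[OF map_at_snd[OF Y Y t]]])
     (use gchart_coord[OF V w(2) j] gchart_coord[OF V w(3) j] in simp_all)
  qed
  then show ?thesis by (auto simp: diagonal_ideal_def g_def)
 qed
 have "(\<lambda>w\<in>S. \<Sum>j\<in>{..<p}. c j (Q w) * (g j \<circ> map_prod f f) w):hid (sq X) S (dgens X Y f S)"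
 proof (rule Idl_sum[OF XX S(1) dgens_carrier[OF S(1)]])
  fix j assume "j:{..<p}"
  then have j: "j < p" by simp
  show "hol_at (sq X) (%w. c j (Q w)) w" if "w:S" for w using R that j by simp
  have im: "map_prod f f ` S <= V \<times> V"
  proof (rule image_subsetI)
   fix w assume "w:S"
   from bspec[OF R this] show "map_prod f f w:V \<times> V" by (elim conjE)
  qed
  have "restrict (g j \<circ> map_prod f f) S = restrict (restrict (g j) (V \<times> V) \<circ> map_prod f f) S"
  proof (rule restrict_ext)
   fix w assume "w:S"
   then have "map_prod f f w:V \<times> V" using im by blast
   then show "(g j \<circ> map_prod f f) w = (restrict (g j) (V \<times> V) \<circ> map_prod f f) w" by (simp only: o_apply restrict_apply')
  qed
  then show "restrict (g j \<circ> map_prod f f) S:dgens X Y f S" unfolding dgens_def using VV im gd[OF j] by blast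
 qed
 moreover have "restrict h S = (\<lambda>w\<in>S. \<Sum>j\<in>{..<p}. c j (Q w) * (g j \<circ> map_prod f f) w)"
  by (rule restrict_ext) (use R in simp)
 ultimately have "restrict h S:hid (sq X) S (dgens X Y f S)" by (simp only:)
 then show ?thesis using S R by blast
qed

lemma diagonal_hadamard:
 assumes "hg (n + n) zc k" "eventually (%z. fstv n z = sndv n z --> k z = 0) (nb (n + n) zc)"
 shows "EX q. (ALL i<n. hg (n + n) zc (q i)) & eventually (%z. k z = (\<Sum>i<n. q i z * (z i - z (n + i)))) (nb (n + n) zc)"
proof (rule hadamard_diff[OF assms(1) zc_cvec])
 show "eventually (%z. (ALL i<n. z i = z (n + i)) --> k z = 0) (nb (n + n) zc)"
  using assms(2) eventually_nb_cvec
 proof (eventually_elim, intro impI)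
  fix w assume w: "fstv n w = sndv n w --> k w = 0" "w:cvec (n + n)" "ALL i<n. w i = w (n + i)"
  have "fstv n w = sndv n w"
  proof
   fix i show "fstv n w i = sndv n w i" using w(2,3) by (cases "i < n") (auto simp: fstv_def sndv_def cvec_def)
  qed
  then show "k w = 0" using w(1) by simp
 qed
qed (auto intro: inj_onI)

text \<open>A section of the ideal of the diagonal is a combination of the coordinate differences of
  X, and multiplying h by each of these is covered by \<open>I2_germ_imp\<close>.\<close>

lemma I2_diagonal:
 assumes h: "h \<circ> map_prod (inv_into U phi) (inv_into U phi):I2_germ n p gh"
  and V': "opn (sq X) V'" "(x, x):V'" and g: "g:diagonal_ideal X V'"
 shows "EX S. opn (sq X) S & (x, x):S & S <= V' &
  restrict (\<lambda>z\<in>V'. h z * g z) S:hid (sq X) S (dgens X Y f S)"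
proof (rule gi_imp_Idl[OF V'])
 have gc: "g:hfn (sq X) V'" and g0: "ALL z. (z, z):V' --> g (z, z) = 0"
  using g by (auto simp: diagonal_ideal_def)
 have inV: "eventually (%z. P z:V') (nb (n + n) zc)"
  using eventually_nhdsin_openin[OF V'] unfolding ev_P .
 have "hg (n + n) zc (%z. g (P z))" using carrier_hol_at[OF XX V'(1) gc V'(2)] unfolding hol_P .
 moreover have "eventually (%z. fstv n z = sndv n z --> g (P z) = 0) (nb (n + n) zc)"
  using inV by eventually_elim (intro impI, use g0 in \<open>simp add: P_def\<close>)
 ultimately obtain q where q: "ALL i<n. hg (n + n) zc (q i)" and
  qe: "eventually (%z. g (P z) = (\<Sum>i<n. q i z * (z i - z (n + i)))) (nb (n + n) zc)"
  using diagonal_hadamard by blast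
 have "(%z. h (P z) * (z i - z (n + i))):gi (n + n) zc p F" if "i < n" for i
  using I2_germ_imp[OF h that] unfolding F_def by (simp add: P_def)
 then have "(%z. q i z * (h (P z) * (z i - z (n + i)))):gi (n + n) zc p F" if "i < n" for i
  by (rule gi_mult) (use q that in auto)
 then have "(%z. \<Sum>i<n. q i z * (h (P z) * (z i - z (n + i)))):gi (n + n) zc p F"
  by (intro gi_sum) auto
 then show "(%z. (\<lambda>z\<in>V'. h z * g z) (P z)):gi (n + n) zc p F"
  by (rule gi_cong) (use inV qe in \<open>eventually_elim, simp add: sum_distrib_left mult_ac\<close>)
qed

end

section \<open>Stability\<close>

locale stable_at = hol_map_at +
 assumes Haus: "Hausdorff_space (mtop X)"
  and fin: "finite {z:pts X. f z = f x}"
  and stab: "stable_multigerm X Y f {z:pts X. f z = f x} (f x)"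
begin

abbreviation r where "r \<equiv> p * n"

text \<open>A trivialization in coordinates, reduced to its nontrivial components: Phi for the
  source, Phi' for the inverse of the source map, Psi for the target.\<close>

definition trivializing where
 "trivializing Phi Phi' Psi \<longleftrightarrow> gm (r + n) zc n Phi & (ALL i<n. hg (r + n) zc (Phi' i)) &
  eventually (%z. ALL i<n. Phi' i (cconcat r (fstv r z) (Phi z)) = z (r + i)) (nb (r + n) zc) &
  eventually (%u. Phi (cconcat r zc u) = u) (nb n zc) &
  (ALL j<p. hg (r + p) zc (Psi j)) &
  eventually (%z. ALL j<p. Psi j (cconcat r (fstv r z)
   (%j. if j < p then gh (sndv r z) j + (\<Sum>i<n. z (j * n + i) * z (r + i)) else 0)) = gh (Phi z) j) (nb (r + n) zc)"

text \<open>The term s u makes sense only in the chart at x. Since X is Hausdorff and the fibre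
  finite, x and the rest of the fibre have disjoint neighbourhoods; on the first the unfolding is
  written in charts, and on the second it is constantly f. The two pieces need not match, because
  the domain W is the disjoint union of their domains.\<close>

lemma trivialization: "EX Phi Phi' Psi. trivializing Phi Phi' Psi"
proof -
 let ?T = "pts X"
 let ?S = "{z:?T. f z = f x}"
 let ?CX = "cspace r \<times>\<^sub>M\<^sub>f X" and ?CY = "cspace r \<times>\<^sub>M\<^sub>f Y"
 have CX: "cm ?CX" and CY: "cm ?CY" by (rule cm_prod[OF cm_cspace X], rule cm_prod[OF cm_cspace Y])
 have "compactin (mtop X) {x}" "compactin (mtop X) (?S - {x})" "disjnt {x} (?S - {x})"
  using xt fin by (auto intro!: finite_imp_compactin)
 from Hausdorff_space_compact_separation[OF Haus this]
 obtain U0 O' where UO: "opn X U0" "opn X O'" "{x} <= U0" "?S - {x} <= O'" and dis: "disjnt U0 O'"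
  by blast
 have U0: "opn X U0" "x:U0" and O': "opn X O'" "?S - {x} <= O'" using UO by auto
 have "eventually (%z. f z:V & z:U & z:U0) (nhd X x)"
  using map_atD(5)[OF f[OF xt] chartD(6)[OF gchartD(1)[OF V] y(1)]] chartD(6)[OF gchartD(1)[OF U] x(1)]
   eventually_nhdsin_openin[OF U0] by eventually_elim simp
 then obtain U1 where U1: "opn X U1" "x:U1" "!!z. z:U1 ==> f z:V" "!!z. z:U1 ==> z:U" "!!z. z:U1 ==> z:U0"
  using xt unfolding eventually_nhdsin by auto
 have U1O: "z \<notin> U1" if "z:O'" for z using dis U1(5)[of z] that by (auto simp: disjnt_iff)
 define b where "b w = (%j. if j < p then psi (f (snd w)) j + (\<Sum>i<n. fst w (j * n + i) * phi (snd w) i) else 0)"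
  for w :: "(nat => complex) \<times> 'a"
 have bc: "b w:cvec p" for w by (simp add: b_def cvec_def)
 have jr: "j * n + i < r" if "j < p" "i < n" for j i
 proof -
  have "j * n + i < Suc j * n" using that by simp
  also have "\<dots> <= p * n" using that by (intro mult_right_mono) auto
  finally show ?thesis .
 qed
 have fstm: "map_at ?CX (cspace r) fst (s, z)" and sndm: "map_at ?CX X snd (s, z)" if "s:cvec r" "z:?T" for s z
  using map_at_fst[OF cm_cspace X, of s r z] map_at_snd[OF cm_cspace X, of s r z] that by simp_all
 have bm: "map_at ?CX (cspace p) b (s, z)" if s: "s:cvec r" and z: "z:U1" for s z
 proof (rule map_at_cspace[OF CX])
  have zt: "z:?T" using openin_subset[OF U1(1)] z by blast
  show szt: "(s, z):pts ?CX" using s zt by simp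
  show "eventually (%w. b w:cvec p) (nhd ?CX (s, z))" by (simp add: bc)
  fix j assume j: "j < p"
  have 1: "hol_at ?CX (%w. psi (f (snd w)) j) (s, z)"
   by (rule map_atD(4)[OF sndm[OF s zt], of "%z. psi (f z) j"])
    (use map_atD(4)[OF f[OF zt] gchart_coord[OF V U1(3)[OF z] j]] in simp)
  have 2: "hol_at ?CX (%w. fst w k) (s, z)" if "k < r" for k
   by (rule map_atD(4)[OF fstm[OF s zt], of "%u. u k"]) (use s that in \<open>simp add: hol_at_cspace hg_coord\<close>)
  have 3: "hol_at ?CX (%w. phi (snd w) i) (s, z)" if "i < n" for i
   by (rule map_atD(4)[OF sndm[OF s zt], of "%z. phi z i"]) (use gchart_coord[OF U U1(4)[OF z] that] in simp)
  have "hol_at ?CX (%w. psi (f (snd w)) j + (\<Sum>i<n. fst w (j * n + i) * phi (snd w) i)) (s, z)"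
   by (intro hol_at_add hol_at_sum hol_at_mult CX szt 1 2 3) (use jr[OF j] in auto)
  then show "hol_at ?CX (%w. b w j) (s, z)" using j by (simp add: b_def)
 qed
 have opV: "opn (cspace p) (psi ` V)"
  using chart_image_open[OF gchartD(1)[OF V] chartD(1)[OF gchartD(1)[OF V]]] by simp
 \<comment> \<open>Near x the pair of parameter and point is restricted so that the deformed value b
   stays in the image of the chart of Y.\<close>
 define W where "W = {w. fst w:cvec r & snd w:U1 & b w:psi ` V} \<union> cvec r \<times> O'"
 define Fm where "Fm w = (fst w, if snd w:U1 then inv_into V psi (b w) else f (snd w))" for w
 have evU1: "eventually (%w. w:pts ?CX & snd w:U1) (nhd ?CX (s, z))"
  if s: "s:cvec r" and z: "z:U1" for s z
 proof -
  have zt: "z:?T" using openin_subset[OF U1(1)] z by blast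
  have "eventually (%w. snd w:U1) (nhd ?CX (s, z))"
   by (rule map_atD(5)[OF sndm[OF s zt]]) (use eventually_nhdsin_openin[OF U1(1) z] in simp)
  moreover have "eventually (%w. w:pts ?CX) (nhd ?CX (s, z))"
   by (rule eventually_nhdsin_openin[OF openin_topspace]) (use s zt in simp)
  ultimately show ?thesis by eventually_elim simp
 qed
 have evW: "eventually (%w. w:W & snd w:U1 & b w:psi ` V) (nhd ?CX (s, z))"
  if s: "s:cvec r" and z: "z:U1" and bV: "b (s, z):psi ` V" for s z
  using map_atD(5)[OF bm[OF s z] eventually_nhdsin_openin[OF opV bV]] evU1[OF s z]
  by eventually_elim (auto simp: W_def)
 have openO: "opn ?CX (cvec r \<times> O')" using O'(1) by (simp add: openin_prod_Times_iff)
 have Wt: "W <= pts ?CX"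
  using openin_subset[OF U1(1)] openin_subset[OF O'(1)] by (auto simp: W_def)
 have W: "opn ?CX W" unfolding openin_iff_nhdsin
 proof (intro conjI Wt ballI)
  fix w assume w: "w:W"
  show "eventually (%z. z:W) (nhd ?CX w)"
  proof (cases "w:cvec r \<times> O'")
   case True
   show ?thesis using eventually_nhdsin_openin[OF openO True] by eventually_elim (simp add: W_def)
  next
   case False
   then have "fst w:cvec r" "snd w:U1" "b (fst w, snd w):psi ` V" using w by (auto simp: W_def)
   from evW[OF this] have "eventually (%z. z:W & snd z:U1 & b z:psi ` V) (nhd ?CX w)" by simp
   then show ?thesis by eventually_elim simp
  qed
 qed
 have Wb: "b w:psi ` V" if "w:W" "snd w:U1" for w using that U1O by (auto simp: W_def)
 have Fmm: "map_at ?CX ?CY Fm w" if w: "w:W" for w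
 proof (cases "snd w:U1")
  case True
  obtain s z where sz: "w = (s, z)" by (cases w)
  have s: "s:cvec r" and z: "z:U1" and bV: "b (s, z):psi ` V"
   using True w Wb[OF w True] by (auto simp: W_def sz)
  have zt: "z:?T" using openin_subset[OF U1(1)] z by blast
  obtain v where v: "v:V" "b (s, z) = psi v" using bV by auto
  have 1: "map_at ?CX Y (%w. inv_into V psi (b w)) (s, z)"
   by (rule map_at_comp[OF bm[OF s z]]) (use gchartD(3)[OF V v(1)] v(2) in simp)
  have "eventually (%w. (fst w, inv_into V psi (b w)) = Fm w) (nhd ?CX (s, z))"
   using evU1[OF s z] by eventually_elim (simp add: Fm_def)
  from map_at_cong[OF CX map_at_pair[OF CX cm_cspace Y fstm[OF s zt] 1] this] show ?thesis by (simp add: sz)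
 next
  case False
  obtain s z where sz: "w = (s, z)" by (cases w)
  have s: "s:cvec r" and z: "z:O'" using False w by (auto simp: W_def sz)
  have zt: "z:?T" using openin_subset[OF O'(1)] z by blast
  have 1: "map_at ?CX Y (%w. f (snd w)) (s, z)"
   by (rule map_at_comp[OF sndm[OF s zt]]) (use f[OF zt] in simp)
  have "eventually (%w. (fst w, f (snd w)) = Fm w) (nhd ?CX (s, z))"
   using eventually_nhdsin_openin[OF openO, of "(s, z)"] s z by (auto elim!: eventually_mono simp: Fm_def U1O)
  from map_at_cong[OF CX map_at_pair[OF CX cm_cspace Y fstm[OF s zt] 1] this] show ?thesis by (simp add: sz)
 qed
 have b0: "b (zc, z) = psi (f z)" if "f z:V" for z
  using chartD(3)[OF gchartD(1)[OF V] that] by (auto simp: b_def cvec_def)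
 have unf: "unfolding_of X Y f ?S r W Fm" unfolding unfolding_of_def
 proof (intro conjI W)
  show "{%_. 0} \<times> ?S <= W"
  proof
   fix w :: "(nat => complex) \<times> 'a" assume "w:{%_. 0} \<times> ?S"
   then obtain z where w: "w = (zc, z)" and z: "z:?S" by blast
   show "w:W"
   proof (cases "z = x")
    case True
    then show ?thesis using U1(2) b0[OF y(1)] y(1) by (auto simp: W_def w)
   next
    case False
    then have "z:O'" using O'(2) z by blast
    then show ?thesis by (simp add: W_def w)
   qed
  qed
  show "holo_map ?CX ?CY W Fm" unfolding holo_map_iff[OF CX CY W] using Fmm by blast
  show "ALL (s, z):W. fst (Fm (s, z)) = s" by (auto simp: Fm_def)
  show "ALL z. (%_. 0, z):W --> Fm (%_. 0, z) = (%_. 0, f z)"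
   using U1(3) gchartD(4)[OF V] by (auto simp: Fm_def b0)
 qed
 from stab[unfolded stable_multigerm_def, rule_format, OF unf]
 obtain W0 W0' Phi Q Q' Psi where W0: "W0 <= W" and FQ: "Fm ` W0 <= Q"
  and uPh: "unfolding_of X X id ?S r W0 Phi" and bPh: "biholo ?CX ?CX W0 W0' Phi"
  and uPs: "unfolding_of Y Y id {f x} r Q Psi" and bPs: "biholo ?CY ?CY Q Q' Psi"
  and eq: "ALL z:W0'. Psi (Fm (inv_into W0 Phi z)) = map_prod id f z"
  unfolding trivial_unfolding_def by (elim exE conjE) (rule that; assumption)
 have oW0: "opn ?CX W0" and oW0': "opn ?CX W0'" and bij: "bij_betw Phi W0 W0'"
  and mPh: "!!w. w:W0 ==> map_at ?CX ?CX Phi w" and mPhi: "!!w. w:W0' ==> map_at ?CX ?CX (inv_into W0 Phi) w"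
 proof -
  show o: "opn ?CX W0" "opn ?CX W0'" "bij_betw Phi W0 W0'" using bPh unfolding biholo_def by auto
  have "holo_map ?CX ?CX W0 Phi" "holo_map ?CX ?CX W0' (inv_into W0 Phi)" using bPh unfolding biholo_def by auto
  then show "!!w. w:W0 ==> map_at ?CX ?CX Phi w" "!!w. w:W0' ==> map_at ?CX ?CX (inv_into W0 Phi) w"
   unfolding holo_map_iff[OF CX CX o(1)] holo_map_iff[OF CX CX o(2)] by auto
 qed
 have Phf: "fst (Phi w) = fst w" if "w:W0" for w using uPh that unfolding unfolding_of_def by (cases w) auto
 have Ph00: "Phi (zc, z) = (zc, z)" if "(zc, z):W0" for z using uPh that unfolding unfolding_of_def by auto
 have x0W: "(zc, x):W0" using uPh xt unfolding unfolding_of_def by auto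
 have Phi: "inv_into W0 Phi (Phi w) = w" if "w:W0" for w
  using bij that by (simp add: bij_betw_def inv_into_f_f)
 have PhW: "Phi w:W0'" if "w:W0" for w using bij that by (auto simp: bij_betw_def)
 have oQ: "opn ?CY Q" and mPs: "!!w. w:Q ==> map_at ?CY ?CY Psi w" and y0Q: "(zc, f x):Q"
  and Ps0: "Psi (zc, f x) = (zc, f x)"
 proof -
  show oQ: "opn ?CY Q" and yQ: "(zc, f x):Q" using uPs unfolding unfolding_of_def by auto
  show "!!w. w:Q ==> map_at ?CY ?CY Psi w" using uPs unfolding unfolding_of_def holo_map_iff[OF CY CY oQ] by auto
  show "Psi (zc, f x) = (zc, f x)" using uPs yQ unfolding unfolding_of_def by auto
 qed
 \<comment> \<open>Triviality composed with \<open>Phi\<close>, so that the inverse of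
   \<open>Phi\<close> drops out of the equation.\<close>
 have FPs: "Psi (Fm w) = (fst (Phi w), f (snd (Phi w)))" if "w:W0" for w
  using eq[rule_format, OF PhW[OF that]] unfolding Phi[OF that] by (simp add: map_prod_def case_prod_unfold)
 define B where "B z = (fstv r z, inv_into U phi (sndv r z))" for z
 have holB: "hol_at ?CX h (zc, x) \<longleftrightarrow> hg (r + n) zc (%z. h (B z))" for h
 proof -
  have "hol_at ?CX h (zc, x) \<longleftrightarrow> hg (r + n) zc (%z. h (inv_into (cvec r) id (fstv r z), inv_into U phi (sndv r z)))"
   using gchart_prod_hol_at[OF cm_cspace X gchart_cspace U zc_cvec x(1), of r h] by (simp add: x(2))
  then show ?thesis by (simp add: B_def inv_into_cvec_id)
 qed
 have evB: "eventually R (nhd ?CX (zc, x)) \<longleftrightarrow> eventually (%z. R (B z)) (nb (r + n) zc)" for R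
 proof -
  have "eventually R (nhd ?CX (zc, x)) \<longleftrightarrow>
    eventually (%z. R (inv_into (cvec r) id (fstv r z), inv_into U phi (sndv r z))) (nb (r + n) zc)"
   using gchart_prod_eventually[OF gchart_cspace U zc_cvec x(1), of R] by (simp add: x(2))
  then show ?thesis by (simp add: B_def inv_into_cvec_id)
 qed
 have holY: "hol_at ?CY h (zc, f x) \<longleftrightarrow> hg (r + p) zc (%z. h (fstv r z, inv_into V psi (sndv r z)))" for h
 proof -
  have "hol_at ?CY h (zc, f x) \<longleftrightarrow> hg (r + p) zc (%z. h (inv_into (cvec r) id (fstv r z), inv_into V psi (sndv r z)))"
   using gchart_prod_hol_at[OF cm_cspace Y gchart_cspace V zc_cvec y(1), of r h] by (simp add: y(2))
  then show ?thesis by (simp add: inv_into_cvec_id)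
 qed
 have sPh: "map_at ?CX X (%w. snd (Phi w)) (zc, x)"
  by (rule map_at_comp[OF mPh[OF x0W]]) (use sndm[of zc x] xt in \<open>simp add: Ph00[OF x0W]\<close>)
 have sPhi: "map_at ?CX X (%w. snd (inv_into W0 Phi w)) (zc, x)"
  by (rule map_at_comp[OF mPhi])
   (use PhW[OF x0W] Phi[OF x0W] sndm[of zc x] xt in \<open>simp_all add: Ph00[OF x0W]\<close>)
 have sPs: "map_at ?CY Y (%w. snd (Psi w)) (zc, f x)"
  by (rule map_at_comp[OF mPs[OF y0Q]])
   (use map_at_snd[OF cm_cspace Y, of zc r "f x"] chartD(5)[OF gchartD(1)[OF V] y(1)] in \<open>simp add: Ps0\<close>)
 have PhU: "eventually (%w. snd (Phi w):U) (nhd ?CX (zc, x))"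
  by (rule map_atD(5)[OF sPh]) (use chartD(6)[OF gchartD(1)[OF U] x(1)] in \<open>simp add: Ph00[OF x0W]\<close>)
 have inW0: "eventually (%w. w:W0) (nhd ?CX (zc, x))" by (rule eventually_nhdsin_openin[OF oW0 x0W])
 define Ph where "Ph z = phi (snd (Phi (B z)))" for z
 define Ph' where "Ph' i z = phi (snd (inv_into W0 Phi (B z))) i" for i z
 define Ps where "Ps j z = psi (snd (Psi (fstv r z, inv_into V psi (sndv r z)))) j" for j z
 have evsU: "eventually (%z. sndv r z:phi ` U) (nb (r + n) zc)"
  by (rule gm_ev[OF gm_sndv[OF zc_cvec] ev_U]) simp
 have "gm (r + n) zc n Ph" unfolding gm_def
 proof (intro conjI allI impI zc_cvec)
  fix i assume i: "i < n"
  have "hol_at ?CX (%w. phi (snd (Phi w)) i) (zc, x)"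
   by (rule map_atD(4)[OF sPh, of "%z. phi z i"]) (use gchart_coord[OF U x(1) i] in \<open>simp add: Ph00[OF x0W]\<close>)
  then show "hg (r + n) zc (%z. Ph z i)" unfolding holB by (simp add: Ph_def)
 next
  show "eventually (%z. Ph z:cvec n) (nb (r + n) zc)"
   using PhU[unfolded evB] by eventually_elim (simp add: Ph_def chartD(3)[OF gchartD(1)[OF U]])
 qed
 moreover have "hg (r + n) zc (Ph' i)" if i: "i < n" for i
 proof -
  have "hol_at ?CX (%w. phi (snd (inv_into W0 Phi w)) i) (zc, x)"
   by (rule map_atD(4)[OF sPhi, of "%z. phi z i"])
    (use gchart_coord[OF U x(1) i] Phi[OF x0W] in \<open>simp add: Ph00[OF x0W]\<close>)
  then show ?thesis unfolding holB by (simp add: Ph'_def[abs_def])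
 qed
 moreover have "eventually (%z. ALL i<n. Ph' i (cconcat r (fstv r z) (Ph z)) = z (r + i)) (nb (r + n) zc)"
  using PhU[unfolded evB] inW0[unfolded evB] evsU
 proof eventually_elim
  case (elim z)
  have "B (cconcat r (fstv r z) (Ph z)) = (fst (Phi (B z)), snd (Phi (B z)))"
   using elim(1) gchartD(4)[OF U elim(1)] Phf[OF elim(2)] by (simp add: B_def Ph_def)
  then have "inv_into W0 Phi (B (cconcat r (fstv r z) (Ph z))) = B z" using Phi[OF elim(2)] by simp
  moreover have "phi (snd (B z)) = sndv r z" using elim(3) by (simp add: B_def f_inv_into_f)
  ultimately show ?case by (simp add: Ph'_def sndv_def)
 qed
 moreover have "eventually (%u. Ph (cconcat r zc u) = u) (nb n zc)"
 proof -
  have g: "gm n zc (r + n) (%u. cconcat r zc u)"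
   by (rule gm_cconcat) (auto simp: gm_def eventually_nb_cvec intro: hg_const hg_coord)
  have "eventually (%u. B (cconcat r zc u):W0) (nb n zc)"
   by (rule gm_ev[OF g inW0[unfolded evB]]) simp
  then show ?thesis using ev_U
   by eventually_elim (simp add: Ph_def B_def Ph00 f_inv_into_f)
 qed
 moreover have "hg (r + p) zc (Ps j)" if j: "j < p" for j
 proof -
  have "hol_at ?CY (%w. psi (snd (Psi w)) j) (zc, f x)"
   by (rule map_atD(4)[OF sPs, of "%z. psi z j"]) (use gchart_coord[OF V y(1) j] in \<open>simp add: Ps0\<close>)
  then show ?thesis unfolding holY by (simp add: Ps_def[abs_def])
 qed
 moreover have "eventually (%z. ALL j<p. Ps j (cconcat r (fstv r z)
   (%j. if j < p then gh (sndv r z) j + (\<Sum>i<n. z (j * n + i) * z (r + i)) else 0)) = gh (Ph z) j) (nb (r + n) zc)"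
  using PhU[unfolded evB] inW0[unfolded evB] evsU evU1[OF zc_cvec U1(2), unfolded evB]
 proof eventually_elim
  case (elim z)
  have pz: "phi (inv_into U phi (sndv r z)) = sndv r z" using elim(3) by (simp add: f_inv_into_f)
  have bz: "(%j. if j < p then gh (sndv r z) j + (\<Sum>i<n. z (j * n + i) * z (r + i)) else 0) = b (B z)"
  proof
   fix j
   have "(\<Sum>i<n. z (j * n + i) * z (r + i)) = (\<Sum>i<n. fst (B z) (j * n + i) * phi (snd (B z)) i)" if "j < p"
    by (intro sum.cong refl) (use jr[OF that] in \<open>simp add: B_def pz, simp add: fstv_def sndv_def\<close>)
   then show "(if j < p then gh (sndv r z) j + (\<Sum>i<n. z (j * n + i) * z (r + i)) else 0) = b (B z) j"
    by (simp add: b_def gh_def B_def)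
  qed
  have "Fm (B z) = (fstv r z, inv_into V psi (b (B z)))" using elim(4) by (simp add: Fm_def B_def)
  then have "snd (Psi (fstv r z, inv_into V psi (b (B z)))) = f (snd (Phi (B z)))" using FPs[OF elim(2)] by simp
  then show ?case unfolding bz using gchartD(4)[OF U elim(1)] by (simp add: Ps_def gh_def Ph_def)
 qed
 ultimately show ?thesis unfolding trivializing_def by (intro exI[of _ Ph] exI[of _ Ph'] exI[of _ Ps]) simp
qed

text \<open>Testing h on the coordinate differences brings it into the setting of
  \<open>core\<close>, whose conclusion is the description of the minors ideal used by
  \<open>I2_germI\<close>.\<close>

lemma quotient_in_I2:
 assumes W: "opn (sq X) W" "(x, x):W" and h: "h:H2_sheaf X Y f W"
 shows "h \<circ> map_prod (inv_into U phi) (inv_into U phi):I2_germ n p gh"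
proof -
 have hc: "h:hfn (sq X) W"
  and hq: "!!V g. opn (sq X) V ==> V <= W ==> g:diagonal_ideal X V ==> (\<lambda>z\<in>V. h z * g z):double_ideal X Y f V"
  using h unfolding H2_sheaf_def ideal_quotient_def by auto
 define hh where "hh z = h (P z)" for z
 have hhh: "hg (n + n) zc hh" using carrier_hol_at[OF XX W(1) hc W(2)] unfolding hol_P hh_def[abs_def] .
 have UU: "opn (sq X) (U \<times> U)"
  using chartD(1)[OF gchartD(1)[OF U]] by (simp add: openin_prod_Times_iff)
 define V1 where "V1 = W \<inter> U \<times> U"
 have V1: "opn (sq X) V1" "(x, x):V1" "V1 <= W" "V1 <= U \<times> U"
  using openin_Int[OF W(1) UU] W(2) x(1) by (auto simp: V1_def)
 \<comment> \<open>Over V1 both points lie in the chart, so each coordinate difference is a section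
   of the ideal of the diagonal on which the quotient may be tested.\<close>
 have H2: "(%z. hh z * (z i - z (n + i))):gi (n + n) zc p F" if i: "i < n" for i
 proof -
  define g where "g = (\<lambda>w\<in>V1. phi (fst w) i - phi (snd w) i)"
  have "g:hfn (sq X) V1" unfolding g_def
  proof (rule restrict_carrier[OF XX V1(1)])
   fix w assume "w:V1"
   then obtain a b where w: "w = (a, b)" "a:U" "b:U" using V1(4) by blast
   note t = chartD(5)[OF gchartD(1)[OF U] w(2)] chartD(5)[OF gchartD(1)[OF U] w(3)]
   show "hol_at (sq X) (%w. phi (fst w) i - phi (snd w) i) w" unfolding w(1)
    by (rule hol_at_diff[OF XX map_atD(4)[OF map_at_fst[OF X X t], of "%z. phi z i"] map_atD(4)[OF map_at_snd[OF X X t], of "%z. phi z i"]])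
     (use gchart_coord[OF U w(2) i] gchart_coord[OF U w(3) i] in simp_all)
  qed
  then have "g:diagonal_ideal X V1" by (auto simp: diagonal_ideal_def g_def)
  from hq[OF V1(1,3) this] have "(\<lambda>z\<in>V1. h z * g z):double_ideal X Y f V1" .
  then obtain S where S: "opn (sq X) S" "(x, x):S" "S <= V1"
   and I: "restrict (\<lambda>z\<in>V1. h z * g z) S:hid (sq X) S (dgens X Y f S)"
   using V1(2) unfolding double_ideal_iff by blast
  have inS: "eventually (%z. P z:S) (nb (n + n) zc)"
   using eventually_nhdsin_openin[OF S(1,2)] unfolding ev_P .
  show ?thesis
  proof (rule gi_cong[OF Idl_imp_gi[OF S(1,2) I]])
   show "eventually (%z. restrict (\<lambda>z\<in>V1. h z * g z) S (P z) = hh z * (z i - z (n + i))) (nb (n + n) zc)"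
    using inS QP
   proof eventually_elim
    case (elim z)
    have "P z:V1" using elim(1) S(3) by blast
    moreover have "phi (fst (P z)) i = z i" "phi (snd (P z)) i = z (n + i)"
     using fun_cong[OF elim(2), of i] fun_cong[OF elim(2), of "n + i"] i by (simp_all add: Q_def cconcat_def)
    ultimately show ?case using elim(1) by (simp add: g_def hh_def)
   qed
  qed
 qed
 have gF: "hg (n + n) zc (F j)" if "j < p" for j
  unfolding F_def[abs_def]
  by (intro hg_diff gm_hg[OF gm_fstv[OF zc_cvec] gmD[OF gm_gh that]] gm_hg[OF gm_sndv[OF zc_cvec] gmD[OF gm_gh that]]) simp_all
 \<comment> \<open>The matrix \<alpha> is obtained from Hadamard's lemma: each F j vanishes on the
   diagonal.\<close>
 have "EX q. (ALL i<n. hg (n + n) zc (q i)) & eventually (%z. F j z = (\<Sum>i<n. q i z * (z i - z (n + i)))) (nb (n + n) zc)" if "j < p" for j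
  by (rule diagonal_hadamard[OF gF[OF that]]) (simp add: F_def)
 then have "ALL j. EX q. j < p --> ((ALL i<n. hg (n + n) zc (q i)) & eventually (%z. F j z = (\<Sum>i<n. q i z * (z i - z (n + i)))) (nb (n + n) zc))" by simp
 from choice[OF this] obtain al where al0: "ALL j. j < p --> (ALL i<n. hg (n + n) zc (al j i)) & eventually (%z. F j z = (\<Sum>i<n. al j i z * (z i - z (n + i)))) (nb (n + n) zc)"
  by blast
 note al = al0[rule_format, THEN conjunct1, rule_format]
 have "eventually (%z. ALL j:{..<p}. F j z = (\<Sum>i<n. al j i z * (z i - z (n + i)))) (nb (n + n) zc)"
  by (rule eventually_ball_finite) (use al0 in auto)
 then have alg: "eventually (%z. ALL j<p. gh (fstv n z) j - gh (sndv n z) j = (\<Sum>i<n. al j i z * (z i - z (n + i)))) (nb (n + n) zc)"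
  by eventually_elim (simp add: F_def)
 obtain Phi Phi' Psi where tr: "trivializing Phi Phi' Psi"
  using trivialization by blast
 have t: "gm (r + n) zc n Phi" "ALL i<n. hg (r + n) zc (Phi' i)" "ALL j<p. hg (r + p) zc (Psi j)"
  using tr by (simp_all add: trivializing_def)
 note te = tr[unfolded trivializing_def, THEN conjunct2, THEN conjunct2]
 have "EX c E. (ALL j<p. hg (n + n) zc (c j)) & (ALL S. hg (n + n) zc (%z. E z S)) &
  eventually (%z. hh z = (\<Sum>j<p. c j z * (gh (fstv n z) j - gh (sndv n z) j)) +
   dv {..<p} (%j i. al j i z) [0..<n] (E z) {}) (nb (n + n) zc)"
 proof (rule core[where g = "%j u. gh u j" and Phi = Phi and Phi' = Phi' and Psi = Psi, OF hhh gmD[OF gm_gh] _ al alg _ t(1) _ te[THEN conjunct1] te[THEN conjunct2, THEN conjunct1] _ te[THEN conjunct2, THEN conjunct2, THEN conjunct2]])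
  show "gh zc j = 0" for j by (simp add: gh0)
  fix i assume "i < n"
  from H2[OF this] show "EX c. (ALL j<p. hg (n + n) zc (c j)) &
   eventually (%z. hh z * (z i - z (n + i)) = (\<Sum>j<p. c j z * (gh (fstv n z) j - gh (sndv n z) j))) (nb (n + n) zc)"
   unfolding gi_def F_def by blast
 qed (use t(2,3) in auto)
 then obtain c E where c: "ALL j<p. hg (n + n) zc (c j)" and E: "ALL S. hg (n + n) zc (%z. E z S)"
  and e: "eventually (%z. hh z = (\<Sum>j<p. c j z * (gh (fstv n z) j - gh (sndv n z) j)) +
   dv {..<p} (%j i. al j i z) [0..<n] (E z) {}) (nb (n + n) zc)" by blast
 show ?thesis
 proof (rule I2_germI[OF al alg])
  show "hg (n + n) zc (c j)" if "j < p" for j using c that by simp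
  show "hg (n + n) zc (%z. E z S)" for S using E by simp
  show "eventually (%z. (h \<circ> map_prod (inv_into U phi) (inv_into U phi)) (fstv n z, sndv n z) =
   (\<Sum>j<p. c j z * (gh (fstv n z) j - gh (sndv n z) j)) + dv {..<p} (%j i. al j i z) [0..<n] (E z) {}) (nb (n + n) zc)"
   using e by eventually_elim (simp add: hh_def P_def)
 qed
qed

end

section \<open>Comparison of the two sheaves point by point\<close>

theorem corollary6p9:
  fixes X :: "'a charted" and Y :: "'b charted" and f :: "'a \<Rightarrow> 'b"
  assumes "complex_manifold X" and "complex_manifold Y"
    and "holo_map X Y (topspace (mtop X)) f"
    and "finite_map X Y f"
    and "stable_map X Y f"
  shows "\<forall>W. openin (mtop (X \<times>\<^sub>M\<^sub>f X)) W \<longrightarrow> I2_sheaf X Y f W = H2_sheaf X Y f W"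
proof (intro allI impI)
 fix W assume W: "opn (sq X) W"
 have X: "cm X" and Y: "cm Y" using assms(1,2) by (simp_all add: complex_manifold_cm)
 have f: "map_at X Y f z" if "z:pts X" for z
  using assms(3) that unfolding holo_map_iff[OF X Y openin_topspace] by blast
 interpret hol_map X Y f by unfold_locales (rule X, rule Y, rule f)
 have Haus: "Hausdorff_space (mtop X)" using assms(1) by (simp add: complex_manifold_def)
 have Wt: "a:pts X & b:pts X" if "(a, b):W" for a b
  using openin_subset[OF W] that by auto
 show "I2_sheaf X Y f W = H2_sheaf X Y f W"
 proof
  \<comment> \<open>Arbitrary centred charts serve here, since membership in the sheaf of minors
    asks for some pair of local coordinates at each diagonal point.\<close>
  show "H2_sheaf X Y f W <= I2_sheaf X Y f W"
  proof
   fix h assume h: "h:H2_sheaf X Y f W"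
   then have hc: "h:hfn (sq X) W"
    and hq: "!!V g. opn (sq X) V ==> V <= W ==> g:diagonal_ideal X V ==> (\<lambda>z\<in>V. h z * g z):double_ideal X Y f V"
    unfolding H2_sheaf_def ideal_quotient_def by auto
   have off: "EX V. opn (sq X) V & (a, b):V & V <= W & restrict h V:double_ideal X Y f V"
    if ab: "(a, b):W" "a ~= b" for a b
   proof -
    from Haus obtain A B where AB: "opn X A" "opn X B" "a:A" "b:B" "disjnt A B"
     unfolding Hausdorff_space_def using Wt[OF ab(1)] ab(2) by blast
    define V where "V = W \<inter> A \<times> B"
    have V: "opn (sq X) V" "(a, b):V" "V <= W"
     using openin_Int[OF W, of "A \<times> B"] AB ab(1) by (auto simp: V_def openin_prod_Times_iff)
    have nd: "(z, z) \<notin> V" for z using AB(5) by (auto simp: V_def disjnt_iff)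
    have "(\<lambda>z\<in>V. 1):hfn (sq X) V"
     by (rule restrict_carrier[OF XX V(1)], rule hol_at_const[OF XX]) (use openin_subset[OF V(1)] in blast)
    then have "(\<lambda>z\<in>V. 1):diagonal_ideal X V" using nd by (simp add: diagonal_ideal_def)
    from hq[OF V(1,3) this] have "(\<lambda>z\<in>V. h z * (\<lambda>z\<in>V. 1) z):double_ideal X Y f V" .
    moreover have "(\<lambda>z\<in>V. h z * (\<lambda>z\<in>V. 1) z) = restrict h V" by (rule restrict_ext) simp
    ultimately show ?thesis using V by (intro exI[of _ V]) simp
   qed
   have diag: "EX U phi V psi. local_coords X x U phi & local_coords Y (f x) V psi &
     h \<circ> map_prod (inv_into U phi) (inv_into U phi):I2_germ (mdim X) (mdim Y) (psi \<circ> f \<circ> inv_into U phi)"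
    if xW: "(x, x):W" for x
   proof -
    have x: "x:pts X" using Wt[OF xW] by simp
    note fx = map_atD(2)[OF f[OF x]]
    obtain U phi where gU: "gchart X U phi" "x:U" "phi x = (%_. 0)" using centred_chart_exists[OF X x] by blast
    obtain V psi where gV: "gchart Y V psi" "f x:V" "psi (f x) = (%_. 0)" using centred_chart_exists[OF Y fx] by blast
    interpret stable_at X Y f U phi V psi x
    proof unfold_locales
     show "finite {z:pts X. f z = f x}" using assms(4) fx unfolding finite_map_def by blast
     show "stable_multigerm X Y f {z:pts X. f z = f x} (f x)"
      using assms(5) x unfolding stable_map_def by blast
    qed (use gU gV Haus in auto)
    have "local_coords X x U phi" "local_coords Y (f x) V psi"
     using gU gV by (simp_all add: local_coords_iff[OF X] local_coords_iff[OF Y])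
    moreover have "h \<circ> map_prod (inv_into U phi) (inv_into U phi):I2_germ (mdim X) (mdim Y) (psi \<circ> f \<circ> inv_into U phi)"
     using quotient_in_I2[OF W xW h] unfolding gh_def .
    ultimately show ?thesis by blast
   qed
   show "h:I2_sheaf X Y f W" unfolding I2_sheaf_def using hc off diag by auto
  qed
  \<comment> \<open>Here the charts are those that membership supplies. Away from the diagonal, h
    already lies in the double ideal locally, and multiplication by g keeps it there.\<close>
  show "I2_sheaf X Y f W <= H2_sheaf X Y f W"
  proof
   fix h assume h: "h:I2_sheaf X Y f W"
   have hc: "h:hfn (sq X) W"
    and off: "!!a b. (a, b):W ==> a ~= b ==>
     EX V. opn (sq X) V & (a, b):V & V <= W & restrict h V:double_ideal X Y f V"
    and diag: "!!x. (x, x):W ==> EX U phi V psi. local_coords X x U phi & local_coords Y (f x) V psi &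
       h \<circ> map_prod (inv_into U phi) (inv_into U phi):I2_germ (mdim X) (mdim Y) (psi \<circ> f \<circ> inv_into U phi)"
    using h unfolding I2_sheaf_def by auto
   have "(\<lambda>z\<in>V. h z * g z):double_ideal X Y f V"
    if Vo: "opn (sq X) V" "V <= W" and g: "g:diagonal_ideal X V" for V g
    unfolding double_ideal_iff
   proof (intro conjI ballI)
    have gc: "g:hfn (sq X) V" using g by (simp add: diagonal_ideal_def)
    show "(\<lambda>z\<in>V. h z * g z):hfn (sq X) V"
     by (rule restrict_carrier[OF XX Vo(1)], rule hol_at_mult[OF XX carrier_hol_at[OF XX W hc] carrier_hol_at[OF XX Vo(1) gc]])
      (use Vo(2) in auto)
    fix w assume w: "w:V"
    obtain a b where ab: "w = (a, b)" by (cases w)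
    have abW: "(a, b):W" using w Vo(2) ab by auto
    show "EX S. opn (sq X) S & w:S & S <= V &
     restrict (\<lambda>z\<in>V. h z * g z) S:hid (sq X) S (dgens X Y f S)"
    proof (cases "a = b")
     case True
     from diag[of a] abW True obtain U phi V' psi where c: "local_coords X a U phi" "local_coords Y (f a) V' psi"
      and hI: "h \<circ> map_prod (inv_into U phi) (inv_into U phi):I2_germ (mdim X) (mdim Y) (psi \<circ> f \<circ> inv_into U phi)" by blast
     interpret hol_map_at X Y f U phi V' psi a
      by unfold_locales (use c in \<open>simp_all add: local_coords_iff[OF X] local_coords_iff[OF Y]\<close>)
     show ?thesis using I2_diagonal[OF hI[folded gh_def] Vo(1) _ g] w unfolding ab True by blast
    next
     case False
     from off[OF abW False] obtain V1 where V1: "opn (sq X) V1" "(a, b):V1" "V1 <= W"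
      and hd: "restrict h V1:double_ideal X Y f V1" by blast
     from hd V1(2) obtain V2 where V2: "opn (sq X) V2" "(a, b):V2" "V2 <= V1"
      and hI: "restrict (restrict h V1) V2:hid (sq X) V2 (dgens X Y f V2)"
      unfolding double_ideal_iff by blast
     define S where "S = V2 \<inter> V"
     have S: "opn (sq X) S" "w:S" "S <= V2" "S <= V"
      using V2 Vo w ab by (auto simp: S_def)
     have gS: "restrict g S:hfn (sq X) S"
      by (rule restrict_carrier[OF XX S(1) carrier_hol_at[OF XX Vo(1) gc]]) (use S(4) in blast)
     from Idl_ideal(4)[OF XX S(1) dgens_carrier[OF S(1)] restrict_Idl[OF V2(1) S(1,3) hI] gS]
     have "(\<lambda>z\<in>S. restrict g S z * restrict (restrict (restrict h V1) V2) S z):hid (sq X) S (dgens X Y f S)" .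
     moreover have "(\<lambda>z\<in>S. restrict g S z * restrict (restrict (restrict h V1) V2) S z) = restrict (\<lambda>z\<in>V. h z * g z) S"
      by (rule restrict_ext) (use S(3,4) V2(3) in \<open>auto simp: mult.commute\<close>)
     ultimately show ?thesis using S by (intro exI[of _ S]) simp
    qed
   qed
   then show "h:H2_sheaf X Y f W" unfolding H2_sheaf_def ideal_quotient_def using hc by auto
  qed
 qed
qed

end
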